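(* The closure of a (Lusztig) stratum is in general not a union of strata, not even for spherical strata: there exist a connected reductive algebraic group $G$ over an algebraically closed field of zero or good characteristic and a stratum $X$ of $G$, all of whose conjugacy classes are spherical, such that the Zariski closure $\overline{X}$ is not a union of strata of $G$.
   Context: A conjugacy class of $G$ is spherical if a Borel subgroup of $G$ has a dense orbit on it. Strata: let $T$ be a maximal torus of $G$, $\Phi$ the root system, $W$ the Weyl group. For $x\in G$, $G^{x\circ}$ is the identity component of its centralizer. For $s\in G$ semisimple, conjugate $s$ into $T$ and let $W_s$ be the Weyl group of $G^{s\circ}$, viewed as the subgroup of $W$ generated by the reflections $s_\alpha$ with $\alpha\in\Phi$, $\alpha(s)=1$ (well defined up to $W$-conjugacy). For a connected reductive group $H$ and a unipotent element $y\in H$, $\rho^H_y$ denotes the Springer representation (an irreducible representation of the Weyl group of $H$) attached to the class of $y$ and the trivial local system, normalized so that $y=1$ gives the sign representation and regular unipotent $y$ the trivial representation. For reflection subgroups $W_1\le W_2$ of $W$, ${\bf j}_{W_1}^{W_2}$ is truncated ($j$-)induction: if $E$ is an irreducible representation of $W_1$ and there is $e\ge0$ such that $E$ occurs with multiplicity one in the $e$-th symmetric power of the reflection representation $V$ and does not occur in lower symmetric powers, then ${\bf j}_{W_1}^{W_2}E$ is the (irreducible) $W_2$-submodule of $S^e(V)$ generated by the $E$-isotypic component. Lusztig's map $\phi_G\colon G\to{\rm Irr}(W)$ is $\phi_G(su)={\bf j}_{W_s}^{W}\rho_u^{G^{s\circ}}$ for $g=su$ the Jordan decomposition. A stratum of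 $G$ is a non-empty fiber of $\phi_G$. Equivalently (theorem of Lusztig), the strata are the sets $\underline{G}_C$, for $C$ a conjugacy class in $W$: with $B\supset T$ a Borel subgroup and $w$ any element of minimal length in $C$, $\underline{G}_C$ is the union of the conjugacy classes of minimal dimension among those meeting $BwB$. *)

theory Defs
  imports "HOL-Analysis.Analysis" "HOL-Algebra.Solvable_Groups" "HOL-Algebra.Product_Groups" "HOL-Algebra.Group_Action"
    "HOL-Algebra.Algebraic_Closure"
begin

section \<open>Affine varieties\<close>

text \<open>
  The base field is a HOL-Algebra record \<open>K\<close>, so that it can be quantified over. A point of
  affine space is a function on \<open>nat\<close>, extensional outside \<open>{..<N}\<close>. \<open>poly_funs K S\<close> is the
  \<open>K\<close>-algebra of functions generated by the coordinate functions in \<open>S\<close>; its restriction to an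
  affine variety \<open>V\<close> with coordinate functions \<open>S\<close> is the coordinate ring of \<open>V\<close>.
\<close>

type_synonym 'a point = "nat \<Rightarrow> 'a"

definition affine_space :: "('a, 'r) ring_scheme \<Rightarrow> nat \<Rightarrow> 'a point set" where
  "affine_space K N = {..<N} \<rightarrow>\<^sub>E carrier K"

inductive_set poly_funs :: "('a, 'r) ring_scheme \<Rightarrow> ('p \<Rightarrow> 'a) set \<Rightarrow> ('p \<Rightarrow> 'a) set"
  for K :: "('a, 'r) ring_scheme" and S :: "('p \<Rightarrow> 'a) set"
where
  const: "c \<in> carrier K \<Longrightarrow> (\<lambda>_. c) \<in> poly_funs K S"
| coord: "s \<in> S \<Longrightarrow> s \<in> poly_funs K S"
| add: "f \<in> poly_funs K S \<Longrightarrow> g \<in> poly_funs K S \<Longrightarrow> (\<lambda>x. f x \<oplus>\<^bsub>K\<^esub> g x) \<in> poly_funs K S"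
| mult: "f \<in> poly_funs K S \<Longrightarrow> g \<in> poly_funs K S \<Longrightarrow> (\<lambda>x. f x \<otimes>\<^bsub>K\<^esub> g x) \<in> poly_funs K S"

definition coords :: "nat \<Rightarrow> ('a point \<Rightarrow> 'a) set" where
  "coords N = {\<lambda>x. x i | i. i < N}"

definition pair_coords :: "nat \<Rightarrow> ('a point \<times> 'a point \<Rightarrow> 'a) set" where
  "pair_coords N = {\<lambda>z. fst z i | i. i < N} \<union> {\<lambda>z. snd z i | i. i < N}"

definition regular_map ::
  "('a, 'r) ring_scheme \<Rightarrow> ('p \<Rightarrow> 'a) set \<Rightarrow> 'p set \<Rightarrow> ('q \<Rightarrow> 'a) set \<Rightarrow> ('p \<Rightarrow> 'q) \<Rightarrow> bool" where
  "regular_map K S V S' f \<longleftrightarrow> (\<forall>s\<in>S'. \<exists>p\<in>poly_funs K S. \<forall>x\<in>V. s (f x) = p x)"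

text \<open>The Zariski topology is generated by the principal open sets.\<close>

definition zariski :: "('a, 'r) ring_scheme \<Rightarrow> nat \<Rightarrow> 'a point topology" where
  "zariski K N = topology_generated_by
     {{x \<in> affine_space K N. f x \<noteq> \<zero>\<^bsub>K\<^esub>} | f. f \<in> poly_funs K (coords N)}"

definition zero_locus :: "('a, 'r) ring_scheme \<Rightarrow> nat \<Rightarrow> ('a point \<Rightarrow> 'a) set \<Rightarrow> 'a point set" where
  "zero_locus K N F = {x \<in> affine_space K N. \<forall>f\<in>F. f x = \<zero>\<^bsub>K\<^esub>}"

lemma poly_funs_coords_closed:
  assumes "ring K" "f \<in> poly_funs K (coords N)" "x \<in> affine_space K N"
  shows "f x \<in> carrier K"
  using assms(2)
proof induction
  case (coord s)
  then show ?case using assms(3) by (auto simp: coords_def affine_space_def PiE_iff)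
qed (use assms(1) in \<open>auto simp: ring.ring_simprules\<close>)

lemma closedin_zariski_iff:
  assumes "domain K"
  shows "closedin (zariski K N) V \<longleftrightarrow> (\<exists>F\<subseteq>poly_funs K (coords N). V = zero_locus K N F)"
proof -
  interpret domain K by fact
  define P where "P = poly_funs K (coords N)"
  define A where "A = affine_space K N"
  define Z where "Z = zero_locus K N"
  define S where "S = {{x \<in> A. f x \<noteq> \<zero>\<^bsub>K\<^esub>} | f. f \<in> P}"
  have car: "f x \<in> carrier K" if "f \<in> P" "x \<in> A" for f x
    using poly_funs_coords_closed[OF ring_axioms] that by (auto simp: P_def A_def)
  have zar: "zariski K N = topology_generated_by S"
    by (simp add: zariski_def S_def P_def A_def)
  have ZA: "Z F \<subseteq> A" for F by (auto simp: Z_def zero_locus_def A_def)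
  have one: "(\<lambda>_. \<one>\<^bsub>K\<^esub>) \<in> P" by (simp add: P_def poly_funs.const)
  have op_iff: "openin (zariski K N) U \<longleftrightarrow> generate_topology_on S U" for U
    by (simp add: zar openin_topology_generated_by_iff)
  have AS: "\<Union>S = A"
    using one by (auto simp: S_def intro!: exI[of _ "{x \<in> A. \<one>\<^bsub>K\<^esub> \<noteq> \<zero>\<^bsub>K\<^esub>}"])
  have ts: "topspace (zariski K N) = A"
    unfolding zar using AS by (simp add: topology_generated_by_topspace)
  have gen: "U \<subseteq> A \<and> (\<exists>F\<subseteq>P. A - U = Z F)" if "generate_topology_on S U" for U
    using that
  proof induction
    case Empty
    have "A - {} = Z {}" by (auto simp: Z_def zero_locus_def A_def)
    then show ?case by blast
  next
    case (Int U V)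
    then obtain F G where FG: "F \<subseteq> P" "A - U = Z F" "G \<subseteq> P" "A - V = Z G" by blast
    define H where "H = {\<lambda>x. f x \<otimes>\<^bsub>K\<^esub> g x | f g. f \<in> F \<and> g \<in> G}"
    have "H \<subseteq> P" using FG by (auto simp: H_def P_def intro: poly_funs.mult)
    moreover have "Z F \<union> Z G = Z H"
    proof
      show "Z F \<union> Z G \<subseteq> Z H"
        using FG car by (auto simp: Z_def zero_locus_def H_def A_def) (metis A_def l_null r_null subsetD)+
      show "Z H \<subseteq> Z F \<union> Z G"
      proof
        fix x assume x: "x \<in> Z H"
        then have xA: "x \<in> A" using ZA by blast
        show "x \<in> Z F \<union> Z G"
        proof (rule ccontr)
          assume "x \<notin> Z F \<union> Z G"
          then obtain f g where fg: "f \<in> F" "f x \<noteq> \<zero>\<^bsub>K\<^esub>" "g \<in> G" "g x \<noteq> \<zero>\<^bsub>K\<^esub>"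
            using xA by (auto simp: Z_def zero_locus_def A_def)
          then have "f x \<otimes>\<^bsub>K\<^esub> g x = \<zero>\<^bsub>K\<^esub>"
            using x by (auto simp: Z_def zero_locus_def H_def)
          then show False using fg FG car[OF _ xA] integral by blast
        qed
      qed
    qed
    ultimately show ?case using FG Int by (metis Diff_Int inf.coboundedI1)
  next
    case (UN \<U>)
    then have "\<forall>U\<in>\<U>. \<exists>F. F \<subseteq> P \<and> A - U = Z F" by blast
    then obtain F where F: "\<And>U. U \<in> \<U> \<Longrightarrow> F U \<subseteq> P \<and> A - U = Z (F U)" by metis
    have "A - \<Union>\<U> = Z (\<Union>U\<in>\<U>. F U)"
    proof -
      have "A - \<Union>\<U> = {x \<in> A. \<forall>U\<in>\<U>. x \<in> A - U}" by auto
      also have "\<dots> = {x \<in> A. \<forall>U\<in>\<U>. x \<in> Z (F U)}" using F by auto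
      also have "\<dots> = Z (\<Union>U\<in>\<U>. F U)" by (auto simp: Z_def zero_locus_def A_def)
      finally show ?thesis .
    qed
    then show ?case using F UN by (metis UN_least Union_least)
  next
    case (Basis U)
    then obtain f where "f \<in> P" "U = {x \<in> A. f x \<noteq> \<zero>\<^bsub>K\<^esub>}" by (auto simp: S_def)
    then show ?case
      by (intro conjI exI[of _ "{f}"]) (auto simp: Z_def zero_locus_def A_def)
  qed
  have conv: "openin (zariski K N) (A - Z F)" if "F \<subseteq> P" for F
  proof -
    have "A - Z F = \<Union>((\<lambda>f. {x \<in> A. f x \<noteq> \<zero>\<^bsub>K\<^esub>}) ` F)"
      by (auto simp: Z_def zero_locus_def A_def)
    moreover have "openin (zariski K N) {x \<in> A. f x \<noteq> \<zero>\<^bsub>K\<^esub>}" if "f \<in> F" for f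
      unfolding op_iff using that \<open>F \<subseteq> P\<close>
      by (intro generate_topology_on.Basis) (auto simp: S_def)
    ultimately show ?thesis by auto
  qed
  show ?thesis
    unfolding closedin_def ts op_iff P_def[symmetric] Z_def[symmetric]
    using gen conv ZA unfolding op_iff by (metis Diff_Diff_Int inf.absorb_iff2)
qed

text \<open>
  Dimension as transcendence degree: the largest number of algebraically independent elements of
  the coordinate ring of (the closure of) \<open>V\<close>. Over an infinite field, a polynomial in \<open>d\<close>
  variables is zero iff its function on \<open>K\<^sup>d\<close> is zero.
\<close>

definition alg_independent ::
  "('a, 'r) ring_scheme \<Rightarrow> nat \<Rightarrow> 'a point set \<Rightarrow> nat \<Rightarrow> (nat \<Rightarrow> 'a point \<Rightarrow> 'a) \<Rightarrow> bool" where
  "alg_independent K N V d f \<longleftrightarrow>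
     (\<forall>i<d. f i \<in> poly_funs K (coords N)) \<and>
     (\<forall>P\<in>poly_funs K (coords d).
        (\<forall>x\<in>V. P (\<lambda>i\<in>{..<d}. f i x) = \<zero>\<^bsub>K\<^esub>) \<longrightarrow> (\<forall>y\<in>affine_space K d. P y = \<zero>\<^bsub>K\<^esub>))"

definition var_dim :: "('a, 'r) ring_scheme \<Rightarrow> nat \<Rightarrow> 'a point set \<Rightarrow> enat" where
  "var_dim K N V = Sup {enat d | d. \<exists>f. alg_independent K N V d f}"


section \<open>Linear algebraic groups\<close>

definition affine_alg_group :: "('a, 'r) ring_scheme \<Rightarrow> nat \<Rightarrow> 'a point monoid \<Rightarrow> bool" where
  "affine_alg_group K N G \<longleftrightarrow>
     group G \<and> closedin (zariski K N) (carrier G) \<and>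
     regular_map K (pair_coords N) (carrier G \<times> carrier G) (coords N) (\<lambda>z. fst z \<otimes>\<^bsub>G\<^esub> snd z) \<and>
     regular_map K (coords N) (carrier G) (coords N) (\<lambda>x. inv\<^bsub>G\<^esub> x)"

definition closed_subgroup ::
  "('a, 'r) ring_scheme \<Rightarrow> nat \<Rightarrow> 'a point monoid \<Rightarrow> 'a point set \<Rightarrow> bool" where
  "closed_subgroup K N G H \<longleftrightarrow> subgroup H G \<and> closedin (zariski K N) H"

text \<open>
  \<open>g\<close> is unipotent iff right translation by \<open>g\<close> is locally unipotent on the coordinate ring of \<open>G\<close>.
\<close>

definition unipotent ::
  "('a, 'r) ring_scheme \<Rightarrow> nat \<Rightarrow> 'a point monoid \<Rightarrow> 'a point \<Rightarrow> bool" where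
  "unipotent K N G g \<longleftrightarrow> g \<in> carrier G \<and>
     (\<forall>f\<in>poly_funs K (coords N). \<exists>m::nat. \<forall>x\<in>carrier G.
        ((\<lambda>h y. h (y \<otimes>\<^bsub>G\<^esub> g) \<ominus>\<^bsub>K\<^esub> h y) ^^ m) f x = \<zero>\<^bsub>K\<^esub>)"

definition connected_reductive :: "('a, 'r) ring_scheme \<Rightarrow> nat \<Rightarrow> 'a point monoid \<Rightarrow> bool" where
  "connected_reductive K N G \<longleftrightarrow>
     affine_alg_group K N G \<and> connectedin (zariski K N) (carrier G) \<and>
     (\<forall>H. closed_subgroup K N G H \<and> connectedin (zariski K N) H \<and> H \<lhd> G \<and>
          (\<forall>h\<in>H. unipotent K N G h) \<longrightarrow> H = {\<one>\<^bsub>G\<^esub>})"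

definition borel_subgroup ::
  "('a, 'r) ring_scheme \<Rightarrow> nat \<Rightarrow> 'a point monoid \<Rightarrow> 'a point set \<Rightarrow> bool" where
  "borel_subgroup K N G B \<longleftrightarrow>
     (let csc = (\<lambda>H. closed_subgroup K N G H \<and> connectedin (zariski K N) H \<and>
                     solvable (G\<lparr>carrier := H\<rparr>))
      in csc B \<and> (\<forall>H. csc H \<and> B \<subseteq> H \<longrightarrow> H = B))"

text \<open>
  The split torus of rank \<open>r\<close> is the \<open>r\<close>-fold power of the multiplicative group of \<open>K\<close>; its
  coordinate ring consists of the Laurent polynomials.
\<close>

definition split_torus :: "('a, 'r) ring_scheme \<Rightarrow> nat \<Rightarrow> 'a point monoid" where
  "split_torus K r = product_group {..<r} (\<lambda>_. units_of K)"

definition laurent_coords :: "('a, 'r) ring_scheme \<Rightarrow> nat \<Rightarrow> ('a point \<Rightarrow> 'a) set" where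
  "laurent_coords K r = {\<lambda>t. t i | i. i < r} \<union> {\<lambda>t. inv\<^bsub>K\<^esub> (t i) | i. i < r}"

definition torus ::
  "('a, 'r) ring_scheme \<Rightarrow> nat \<Rightarrow> 'a point monoid \<Rightarrow> 'a point set \<Rightarrow> bool" where
  "torus K N G T \<longleftrightarrow> closed_subgroup K N G T \<and>
     (\<exists>r. \<exists>\<psi>\<in>iso (split_torus K r) (G\<lparr>carrier := T\<rparr>).
        regular_map K (laurent_coords K r) (carrier (split_torus K r)) (coords N) \<psi> \<and>
        regular_map K (coords N) T (laurent_coords K r)
          (inv_into (carrier (split_torus K r)) \<psi>))"

definition maximal_torus ::
  "('a, 'r) ring_scheme \<Rightarrow> nat \<Rightarrow> 'a point monoid \<Rightarrow> 'a point set \<Rightarrow> bool" where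
  "maximal_torus K N G T \<longleftrightarrow>
     torus K N G T \<and> (\<forall>T'. torus K N G T' \<and> T \<subseteq> T' \<longrightarrow> T' = T)"

definition borel_pair ::
  "('a, 'r) ring_scheme \<Rightarrow> nat \<Rightarrow> 'a point monoid \<Rightarrow> 'a point set \<Rightarrow> 'a point set \<Rightarrow> bool" where
  "borel_pair K N G T B \<longleftrightarrow> maximal_torus K N G T \<and> borel_subgroup K N G B \<and> T \<subseteq> B"


section \<open>Roots and good characteristic\<close>

definition characters ::
  "('a, 'r) ring_scheme \<Rightarrow> nat \<Rightarrow> 'a point monoid \<Rightarrow> 'a point set \<Rightarrow> ('a point \<Rightarrow> 'a) set" where
  "characters K N G T =
     {\<beta> \<in> extensional T. \<beta> \<in> hom (G\<lparr>carrier := T\<rparr>) (units_of K) \<and>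
        (\<exists>p\<in>poly_funs K (coords N). \<forall>t\<in>T. \<beta> t = p t)}"

text \<open>
  \<open>u\<close> is an isomorphism of algebraic groups from the additive group of \<open>K\<close> onto a closed subgroup
  of \<open>G\<close> normalized by \<open>T\<close>, with \<open>T\<close> acting through \<open>\<alpha>\<close>. For connected reductive \<open>G\<close> and a maximal
  torus \<open>T\<close>, the nontrivial characters \<open>\<alpha>\<close> admitting such a \<open>u\<close> are the roots of \<open>(G, T)\<close>, and the
  image of \<open>u\<close> is the root subgroup of \<open>\<alpha>\<close>. Characters are written multiplicatively.
\<close>

definition root_hom ::
  "('a, 'r) ring_scheme \<Rightarrow> nat \<Rightarrow> 'a point monoid \<Rightarrow> 'a point set \<Rightarrow> ('a point \<Rightarrow> 'a) \<Rightarrow>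
   ('a \<Rightarrow> 'a point) \<Rightarrow> bool" where
  "root_hom K N G T \<alpha> u \<longleftrightarrow>
     u \<in> hom (add_monoid K) G \<and>
     closedin (zariski K N) (u ` carrier K) \<and>
     regular_map K {\<lambda>c. c} (carrier K) (coords N) u \<and>
     (\<exists>p\<in>poly_funs K (coords N). \<forall>c\<in>carrier K. p (u c) = c) \<and>
     (\<forall>t\<in>T. \<forall>c\<in>carrier K. t \<otimes>\<^bsub>G\<^esub> u c \<otimes>\<^bsub>G\<^esub> inv\<^bsub>G\<^esub> t = u (\<alpha> t \<otimes>\<^bsub>K\<^esub> c))"

definition roots ::
  "('a, 'r) ring_scheme \<Rightarrow> nat \<Rightarrow> 'a point monoid \<Rightarrow> 'a point set \<Rightarrow> ('a point \<Rightarrow> 'a) set" where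
  "roots K N G T =
     {\<alpha> \<in> characters K N G T. (\<exists>t\<in>T. \<alpha> t \<noteq> \<one>\<^bsub>K\<^esub>) \<and> (\<exists>u. root_hom K N G T \<alpha> u)}"

definition pos_roots ::
  "('a, 'r) ring_scheme \<Rightarrow> nat \<Rightarrow> 'a point monoid \<Rightarrow> 'a point set \<Rightarrow> 'a point set \<Rightarrow>
   ('a point \<Rightarrow> 'a) set" where
  "pos_roots K N G T B =
     {\<alpha> \<in> roots K N G T. \<exists>u. root_hom K N G T \<alpha> u \<and> u ` carrier K \<subseteq> B}"

definition char_mult ::
  "('a, 'r) ring_scheme \<Rightarrow> 'a point set \<Rightarrow> ('a point \<Rightarrow> 'a) \<Rightarrow> ('a point \<Rightarrow> 'a) \<Rightarrow> 'a point \<Rightarrow> 'a" where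
  "char_mult K T \<alpha> \<beta> = (\<lambda>t\<in>T. \<alpha> t \<otimes>\<^bsub>K\<^esub> \<beta> t)"

definition simple_roots ::
  "('a, 'r) ring_scheme \<Rightarrow> nat \<Rightarrow> 'a point monoid \<Rightarrow> 'a point set \<Rightarrow> 'a point set \<Rightarrow>
   ('a point \<Rightarrow> 'a) set" where
  "simple_roots K N G T B =
     {\<alpha> \<in> pos_roots K N G T B.
        \<nexists>\<beta> \<gamma>. \<beta> \<in> pos_roots K N G T B \<and> \<gamma> \<in> pos_roots K N G T B \<and> \<alpha> = char_mult K T \<beta> \<gamma>}"

text \<open>The highest roots of the irreducible components of the root system.\<close>

definition highest_roots ::
  "('a, 'r) ring_scheme \<Rightarrow> nat \<Rightarrow> 'a point monoid \<Rightarrow> 'a point set \<Rightarrow> 'a point set \<Rightarrow>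
   ('a point \<Rightarrow> 'a) set" where
  "highest_roots K N G T B =
     {\<alpha> \<in> pos_roots K N G T B.
        \<forall>\<beta>\<in>simple_roots K N G T B. char_mult K T \<alpha> \<beta> \<notin> roots K N G T}"

text \<open>
  A prime is bad if it divides a nonzero coefficient of some highest root with respect to the simple
  roots; the characteristic of \<open>K\<close> must not be a bad prime.
\<close>

definition zero_or_good_char :: "('a, 'r) ring_scheme \<Rightarrow> nat \<Rightarrow> 'a point monoid \<Rightarrow> bool" where
  "zero_or_good_char K N G \<longleftrightarrow>
     (\<forall>p::nat. Factorial_Ring.prime p \<and> [p] \<cdot>\<^bsub>K\<^esub> \<one>\<^bsub>K\<^esub> = \<zero>\<^bsub>K\<^esub> \<longrightarrow>
        (\<forall>T B. borel_pair K N G T B \<longrightarrow>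
           (\<forall>\<alpha>\<in>highest_roots K N G T B. \<forall>m :: ('a point \<Rightarrow> 'a) \<Rightarrow> nat.
              \<alpha> = (\<lambda>t\<in>T. \<Otimes>\<^bsub>K\<^esub>\<beta>\<in>simple_roots K N G T B. \<beta> t [^]\<^bsub>K\<^esub> m \<beta>) \<longrightarrow>
              (\<forall>\<beta>\<in>simple_roots K N G T B. m \<beta> \<noteq> 0 \<longrightarrow> \<not> p dvd m \<beta>))))"


section \<open>Weyl group, conjugacy classes and strata\<close>

text \<open>The elements of the Weyl group are cosets of \<open>T\<close> in its normalizer.\<close>

definition weyl_group :: "'p monoid \<Rightarrow> 'p set \<Rightarrow> 'p set monoid" where
  "weyl_group G T = (G\<lparr>carrier := normalizer G T\<rparr>) Mod T"

text \<open>The number of positive roots made negative by \<open>w\<close>.\<close>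

definition weyl_length ::
  "('a, 'r) ring_scheme \<Rightarrow> nat \<Rightarrow> 'a point monoid \<Rightarrow> 'a point set \<Rightarrow> 'a point set \<Rightarrow>
   'a point set \<Rightarrow> nat" where
  "weyl_length K N G T B w =
     card {\<alpha> \<in> pos_roots K N G T B.
             \<exists>n\<in>w. (\<lambda>t\<in>T. \<alpha> (inv\<^bsub>G\<^esub> n \<otimes>\<^bsub>G\<^esub> t \<otimes>\<^bsub>G\<^esub> n)) \<notin> pos_roots K N G T B}"

definition conj_class :: "'p monoid \<Rightarrow> 'p \<Rightarrow> 'p set" where
  "conj_class G x = {g \<otimes>\<^bsub>G\<^esub> x \<otimes>\<^bsub>G\<^esub> inv\<^bsub>G\<^esub> g | g. g \<in> carrier G}"

definition conj_classes :: "'p monoid \<Rightarrow> 'p set set" where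
  "conj_classes G = conj_class G ` carrier G"

definition spherical_class ::
  "('a, 'r) ring_scheme \<Rightarrow> nat \<Rightarrow> 'a point monoid \<Rightarrow> 'a point set \<Rightarrow> bool" where
  "spherical_class K N G C \<longleftrightarrow> C \<in> conj_classes G \<and>
     (\<exists>B. borel_subgroup K N G B \<and>
       (\<exists>x\<in>C. C \<subseteq> zariski K N closure_of {b \<otimes>\<^bsub>G\<^esub> x \<otimes>\<^bsub>G\<^esub> inv\<^bsub>G\<^esub> b | b. b \<in> B}))"

text \<open>
  \<open>stratum_of K N G B w\<close> is the union of the conjugacy classes of minimal dimension among those
  meeting the Bruhat double coset \<open>BwB\<close>. Since \<open>w\<close> is a coset of \<open>T\<close> contained in \<open>G\<close>, the double
  coset is a product of three subsets of \<open>G\<close>.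
\<close>

definition stratum_of ::
  "('a, 'r) ring_scheme \<Rightarrow> nat \<Rightarrow> 'a point monoid \<Rightarrow> 'a point set \<Rightarrow> 'a point set \<Rightarrow> 'a point set" where
  "stratum_of K N G B w =
     (let M = {C \<in> conj_classes G. C \<inter> (B <#>\<^bsub>G\<^esub> w <#>\<^bsub>G\<^esub> B) \<noteq> {}}
      in \<Union>{C \<in> M. \<forall>C'\<in>M. var_dim K N C \<le> var_dim K N C'})"

text \<open>
  Lusztig's strata, in his parametrization by the conjugacy classes \<open>C\<close> of the Weyl group. The
  stratum of \<open>C\<close> depends neither on the choice of \<open>T\<close> and \<open>B\<close> (all such pairs are conjugate) nor, by
  a theorem of Lusztig, on the choice of the element \<open>w\<close> of minimal length in \<open>C\<close>.
\<close>

definition strata :: "('a, 'r) ring_scheme \<Rightarrow> nat \<Rightarrow> 'a point monoid \<Rightarrow> 'a point set set" where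
  "strata K N G =
     {stratum_of K N G B w | T B C w.
        borel_pair K N G T B \<and> C \<in> conj_classes (weyl_group G T) \<and> w \<in> C \<and>
        (\<forall>w'\<in>C. weyl_length K N G T B w \<le> weyl_length K N G T B w')}"

end

theory Submission
  imports Defs "HOL-Computational_Algebra.Fundamental_Theorem_Algebra" "HOL-Algebra.Zassenhaus"
begin

section \<open>Polynomial functions over the complex numbers\<close>

definition CC :: "complex ring" where
  "CC = \<lparr>carrier = UNIV, mult = (*), one = 1, zero = 0, add = (+)\<rparr>"

lemma CC_simps [simp]:
  "carrier CC = UNIV" "x \<otimes>\<^bsub>CC\<^esub> y = x * y" "\<one>\<^bsub>CC\<^esub> = 1" "\<zero>\<^bsub>CC\<^esub> = 0" "x \<oplus>\<^bsub>CC\<^esub> y = x + y"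
  by (simp_all add: CC_def)

lemma Units_CC: "Units CC = - {0}"
proof -
  have "\<exists>y. y * x = 1 \<and> x * y = 1" if "x \<noteq> 0" for x :: complex
    using that by (intro exI[of _ "inverse x"]) auto
  then show ?thesis by (auto simp: Units_def)
qed

lemma field_CC: "field CC"
proof -
  have "cring CC"
    by (rule cringI; (rule abelian_groupI | rule comm_monoidI)?)
       (auto simp: algebra_simps intro: exI[of _ "- x" for x])
  then show ?thesis
    by (rule cring.cring_fieldI) (simp add: Units_CC Compl_eq_Diff_UNIV)
qed

interpretation CC: cring CC using field_CC by (simp add: field_def domain_def)

lemma uminus_CC [simp]: "\<ominus>\<^bsub>CC\<^esub> x = - x"
  by (rule CC.minus_equality) auto

lemma minus_CC [simp]: "x \<ominus>\<^bsub>CC\<^esub> y = x - y"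
  by (simp add: a_minus_def)

lemma units_CC_simps [simp]:
  "carrier (units_of CC) = - {0}" "x \<otimes>\<^bsub>units_of CC\<^esub> y = x * y" "\<one>\<^bsub>units_of CC\<^esub> = 1"
  by (simp_all add: units_of_def Units_CC)

lemma inv_CC [simp]: "x \<noteq> 0 \<Longrightarrow> inv\<^bsub>CC\<^esub> x = inverse x"
  by (rule CC.comm_inv_char) auto

lemma pow_CC [simp]: "x [^]\<^bsub>CC\<^esub> (n::nat) = x ^ n"
  by (induction n) (simp_all add: mult.commute)

lemma add_pow_CC [simp]: "[n] \<cdot>\<^bsub>CC\<^esub> x = of_nat n * x"
  by (induction n) (simp_all add: algebra_simps)

lemma eval_CC: "ring.eval CC xs x = poly (Poly (rev xs)) x"
  by (induction xs) (simp_all add: Poly_append poly_monom algebra_simps)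

lemma algebraically_closed_CC: "algebraically_closed CC"
proof (rule field.algebraically_closedI[OF field_CC])
  fix p assume p: "p \<in> carrier (poly_ring CC)" "length p - 1 > 1"
  then have "polynomial\<^bsub>CC\<^esub> (carrier CC) p"
    by (simp add: univ_poly_carrier)
  with p(2) have hd: "hd p \<noteq> 0" by (auto simp: polynomial_def)
  define q where "q = Poly (rev p)"
  have "Polynomial.coeff q (length p - 1) \<noteq> 0"
    using hd p(2) by (cases p) (auto simp: q_def nth_default_def nth_append)
  then have "Polynomial.degree q \<noteq> 0"
    using p(2) le_degree[of q "length p - 1"] by linarith
  then obtain x where "poly q x = 0"
    using fundamental_theorem_of_algebra[of q] constant_degree[of q] by auto
  then show "\<exists>x\<in>carrier CC. ring.eval CC p x = \<zero>\<^bsub>CC\<^esub>"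
    by (auto simp: eval_CC q_def)
qed

subsection \<open>Closure properties\<close>

abbreviation pf :: "('p \<Rightarrow> complex) set \<Rightarrow> ('p \<Rightarrow> complex) set" where
  "pf S \<equiv> poly_funs CC S"

lemma pf_const: "(\<lambda>_. c) \<in> pf S"
  by (rule poly_funs.const) simp

lemma pf_coord: "i < n \<Longrightarrow> (\<lambda>x. x i) \<in> pf (coords n)"
  by (rule poly_funs.coord) (auto simp: coords_def)

lemma pf_add: "f \<in> pf S \<Longrightarrow> g \<in> pf S \<Longrightarrow> (\<lambda>x. f x + g x) \<in> pf S"
  using poly_funs.add[of f CC S g] by simp

lemma pf_mult: "f \<in> pf S \<Longrightarrow> g \<in> pf S \<Longrightarrow> (\<lambda>x. f x * g x) \<in> pf S"
  using poly_funs.mult[of f CC S g] by simp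

lemma pf_uminus: "f \<in> pf S \<Longrightarrow> (\<lambda>x. - f x) \<in> pf S"
  using pf_mult[OF pf_const[of "-1"]] by simp

lemma pf_diff: "f \<in> pf S \<Longrightarrow> g \<in> pf S \<Longrightarrow> (\<lambda>x. f x - g x) \<in> pf S"
  using pf_add[of f S "\<lambda>x. - g x"] pf_uminus[of g S] by simp

lemma pf_sum: "(\<And>i. i \<in> I \<Longrightarrow> f i \<in> pf S) \<Longrightarrow> (\<lambda>x. \<Sum>i\<in>I. f i x) \<in> pf S"
  by (induction I rule: infinite_finite_induct) (auto intro: pf_add pf_const)

lemma pf_prod: "(\<And>i. i \<in> I \<Longrightarrow> f i \<in> pf S) \<Longrightarrow> (\<lambda>x. \<Prod>i\<in>I. f i x) \<in> pf S"
  by (induction I rule: infinite_finite_induct) (auto intro: pf_mult pf_const)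

lemma pf_power: "f \<in> pf S \<Longrightarrow> (\<lambda>x. f x ^ n) \<in> pf S"
  by (induction n) (auto intro: pf_mult pf_const)

lemmas pf_intros = pf_const pf_coord pf_add pf_mult pf_uminus pf_diff pf_sum pf_prod pf_power

lemma pf_compose:
  assumes "f \<in> pf S" "\<And>s. s \<in> S \<Longrightarrow> (\<lambda>x. s (\<phi> x)) \<in> pf S'"
  shows "(\<lambda>x. f (\<phi> x)) \<in> pf S'"
  using assms(1) by induction (auto intro: pf_intros assms(2))

lemma pf_coords_compose:
  assumes "f \<in> pf (coords n)" "\<And>i. i < n \<Longrightarrow> (\<lambda>x. \<phi> x i) \<in> pf S'"
  shows "(\<lambda>x. f (\<phi> x)) \<in> pf S'"
  using assms by (intro pf_compose[OF assms(1)]) (auto simp: coords_def)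

lemma pf_cong_coords:
  assumes "f \<in> pf (coords n)" "\<And>i. i < n \<Longrightarrow> x i = y i"
  shows "f x = f y"
  using assms(1) by induction (auto simp: coords_def assms(2))

text \<open>Polynomial functions of one variable.\<close>

definition upoly :: "(complex \<Rightarrow> complex) \<Rightarrow> bool" where
  "upoly g \<longleftrightarrow> (\<exists>p. \<forall>z. g z = poly p z)"

lemma upoly_const: "upoly (\<lambda>_. c)"
  unfolding upoly_def by (intro exI[of _ "[:c:]"]) simp

lemma upoly_id: "upoly (\<lambda>z. z)"
  unfolding upoly_def by (intro exI[of _ "[:0,1:]"]) simp

lemma upoly_add: "upoly f \<Longrightarrow> upoly g \<Longrightarrow> upoly (\<lambda>z. f z + g z)"
  unfolding upoly_def by (metis poly_add)

lemma upoly_mult: "upoly f \<Longrightarrow> upoly g \<Longrightarrow> upoly (\<lambda>z. f z * g z)"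
  unfolding upoly_def by (metis poly_mult)

lemma upoly_uminus: "upoly f \<Longrightarrow> upoly (\<lambda>z. - f z)"
  using upoly_mult[OF upoly_const[of "-1"]] by simp

lemma upoly_diff: "upoly f \<Longrightarrow> upoly g \<Longrightarrow> upoly (\<lambda>z. f z - g z)"
  using upoly_add[OF _ upoly_uminus] by simp

lemma upoly_sum: "(\<And>i. i \<in> I \<Longrightarrow> upoly (f i)) \<Longrightarrow> upoly (\<lambda>z. \<Sum>i\<in>I. f i z)"
  by (induction I rule: infinite_finite_induct) (auto intro: upoly_add upoly_const)

lemma upoly_power: "upoly f \<Longrightarrow> upoly (\<lambda>z. f z ^ n)"
  by (induction n) (auto intro: upoly_mult upoly_const)

lemmas upoly_intros = upoly_const upoly_id upoly_add upoly_mult upoly_uminus upoly_diff upoly_sum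
  upoly_power

lemma upoly_finite_zeros:
  assumes "upoly g" "g a \<noteq> 0"
  shows "finite {z. g z = 0}"
proof -
  obtain p where p: "\<And>z. g z = poly p z" using assms(1) by (auto simp: upoly_def)
  then have "p \<noteq> 0" using assms(2) by auto
  then show ?thesis unfolding p by (rule poly_roots_finite)
qed

lemma upoly_compose:
  assumes "f \<in> pf S" "\<And>s. s \<in> S \<Longrightarrow> upoly (\<lambda>z. s (\<phi> z))"
  shows "upoly (\<lambda>z. f (\<phi> z))"
  using assms(1) by induction (auto intro: upoly_intros assms(2))

lemma upoly_coords_compose:
  assumes "f \<in> pf (coords n)" "\<And>i. i < n \<Longrightarrow> upoly (\<lambda>z. \<phi> z i)"
  shows "upoly (\<lambda>z. f (\<phi> z))"
  using assms by (intro upoly_compose[OF assms(1)]) (auto simp: coords_def)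


section \<open>Zariski closure, irreducibility and connectedness\<close>

abbreviation \<A> :: "nat \<Rightarrow> complex point set" where
  "\<A> n \<equiv> affine_space CC n"

abbreviation zar :: "nat \<Rightarrow> complex point topology" where
  "zar n \<equiv> zariski CC n"

lemma affine_CC: "\<A> n = {..<n} \<rightarrow>\<^sub>E UNIV"
  by (simp add: affine_space_def)

lemma domain_CC: "domain CC"
  using field_CC by (simp add: field_def)

lemma closedin_zar: "closedin (zar n) V \<longleftrightarrow> (\<exists>F\<subseteq>pf (coords n). V = {x \<in> \<A> n. \<forall>f\<in>F. f x = 0})"
  by (simp add: closedin_zariski_iff[OF domain_CC] zero_locus_def)

lemma closedin_zarI:
  assumes "f \<in> pf (coords n)" shows "closedin (zar n) {x \<in> \<A> n. f x = 0}"
  unfolding closedin_zar using assms by (intro exI[of _ "{f}"]) auto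

lemma topspace_zar: "topspace (zar n) = \<A> n"
proof
  have "closedin (zar n) (\<A> n)"
    unfolding closedin_zar by (intro exI[of _ "{}"]) auto
  then show "\<A> n \<subseteq> topspace (zar n)" by (rule closedin_subset)
  have "closedin (zar n) (topspace (zar n))" by simp
  then show "topspace (zar n) \<subseteq> \<A> n" unfolding closedin_zar by auto
qed

lemma closure_zar:
  assumes "S \<subseteq> \<A> n"
  shows "zar n closure_of S = {x \<in> \<A> n. \<forall>f\<in>pf (coords n). (\<forall>s\<in>S. f s = 0) \<longrightarrow> f x = 0}"
    (is "_ = ?R")
proof
  have "closedin (zar n) ?R"
    unfolding closedin_zar
    by (intro exI[of _ "{f \<in> pf (coords n). \<forall>s\<in>S. f s = 0}"]) auto
  then show "zar n closure_of S \<subseteq> ?R"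
    using assms by (intro closure_of_minimal) auto
  show "?R \<subseteq> zar n closure_of S"
  proof
    fix x assume x: "x \<in> ?R"
    have "closedin (zar n) (zar n closure_of S)" by simp
    then obtain F where F: "F \<subseteq> pf (coords n)" "zar n closure_of S = {x \<in> \<A> n. \<forall>f\<in>F. f x = 0}"
      unfolding closedin_zar by blast
    moreover have "S \<subseteq> zar n closure_of S"
      using assms by (intro closure_of_subset) (simp add: topspace_zar)
    ultimately show "x \<in> zar n closure_of S" using x by blast
  qed
qed

definition zar_irreducible :: "nat \<Rightarrow> complex point set \<Rightarrow> bool" where
  "zar_irreducible n V \<longleftrightarrow> (\<forall>f\<in>pf (coords n). \<forall>g\<in>pf (coords n).
     (\<forall>x\<in>V. f x * g x = 0) \<longrightarrow> (\<forall>x\<in>V. f x = 0) \<or> (\<forall>x\<in>V. g x = 0))"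

lemma zar_irreducibleD:
  assumes "zar_irreducible n V" "f \<in> pf (coords n)" "g \<in> pf (coords n)" "\<forall>x\<in>V. f x * g x = 0"
  shows "(\<forall>x\<in>V. f x = 0) \<or> (\<forall>x\<in>V. g x = 0)"
  using assms unfolding zar_irreducible_def by blast

text \<open>A set any two points of which lie on a polynomial curve inside it is irreducible, since
  nonzero polynomials in one variable have finitely many zeros.\<close>

lemma zar_irreducibleI_curves:
  assumes "\<And>x y. x \<in> V \<Longrightarrow> y \<in> V \<Longrightarrow>
    \<exists>\<phi> a b. (\<forall>z. \<phi> z \<in> V) \<and> (\<forall>i<n. upoly (\<lambda>z. \<phi> z i)) \<and> \<phi> a = x \<and> \<phi> b = y"
  shows "zar_irreducible n V"
  unfolding zar_irreducible_def
proof (intro ballI impI, rule ccontr)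
  fix f g assume fg: "f \<in> pf (coords n)" "g \<in> pf (coords n)" "\<forall>x\<in>V. f x * g x = 0"
    and "\<not> ((\<forall>x\<in>V. f x = 0) \<or> (\<forall>x\<in>V. g x = 0))"
  then obtain x y where xy: "x \<in> V" "y \<in> V" "f x \<noteq> 0" "g y \<noteq> 0" by auto
  from assms[OF xy(1,2)] obtain \<phi> a b where
    \<phi>: "\<forall>z. \<phi> z \<in> V" "\<forall>i<n. upoly (\<lambda>z. \<phi> z i)" "\<phi> a = x" "\<phi> b = y" by blast
  have "finite {z. f (\<phi> z) = 0}" "finite {z. g (\<phi> z) = 0}"
    using upoly_finite_zeros[OF upoly_coords_compose[OF fg(1)], of \<phi> a]
      upoly_finite_zeros[OF upoly_coords_compose[OF fg(2)], of \<phi> b] \<phi> xy by auto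
  then have "finite ({z. f (\<phi> z) = 0} \<union> {z. g (\<phi> z) = 0})" by simp
  moreover have "{z. f (\<phi> z) = 0} \<union> {z. g (\<phi> z) = 0} = UNIV"
    using fg(3) \<phi>(1) by auto
  ultimately show False using infinite_UNIV_char_0[where 'a=complex] by simp
qed

lemma zar_irreducible_connected:
  assumes "zar_irreducible n V" "V \<subseteq> \<A> n"
  shows "connectedin (zar n) V"
  unfolding connectedin_closedin
proof (intro conjI notI)
  show "V \<subseteq> topspace (zar n)" using assms by (simp add: topspace_zar)
  assume "\<exists>E1 E2. closedin (zar n) E1 \<and> closedin (zar n) E2 \<and> V \<subseteq> E1 \<union> E2 \<and> E1 \<inter> E2 \<inter> V = {} \<and>
    E1 \<inter> V \<noteq> {} \<and> E2 \<inter> V \<noteq> {}"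
  then obtain E1 E2 where E: "closedin (zar n) E1" "closedin (zar n) E2" "V \<subseteq> E1 \<union> E2"
    "E1 \<inter> E2 \<inter> V = {}" "E1 \<inter> V \<noteq> {}" "E2 \<inter> V \<noteq> {}" by blast
  then obtain x y where xy: "x \<in> V" "x \<in> E1" "x \<notin> E2" "y \<in> V" "y \<in> E2" "y \<notin> E1" by blast
  obtain F1 F2 where F: "F1 \<subseteq> pf (coords n)" "E1 = {x \<in> \<A> n. \<forall>f\<in>F1. f x = 0}"
    "F2 \<subseteq> pf (coords n)" "E2 = {x \<in> \<A> n. \<forall>f\<in>F2. f x = 0}"
    using E(1,2) unfolding closedin_zar by auto
  obtain f where f: "f \<in> F1" "f y \<noteq> 0" using xy F assms(2) by auto
  obtain g where g: "g \<in> F2" "g x \<noteq> 0" using xy F assms(2) by auto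
  have "\<forall>v\<in>V. f v * g v = 0" using E(3) F f g by auto
  then have "(\<forall>x\<in>V. f x = 0) \<or> (\<forall>x\<in>V. g x = 0)"
    using assms(1) f g F unfolding zar_irreducible_def by blast
  then show False using f g xy by auto
qed

lemma continuous_map_zar:
  assumes "\<And>i. i < m \<Longrightarrow> (\<lambda>x. \<phi> x i) \<in> pf (coords n)" "\<And>x. x \<in> \<A> n \<Longrightarrow> \<phi> x \<in> \<A> m"
  shows "continuous_map (zar n) (zar m) \<phi>"
  unfolding continuous_map_closedin topspace_zar
proof (intro conjI ballI allI impI)
  fix C assume "closedin (zar m) C"
  then obtain F where F: "F \<subseteq> pf (coords m)" "C = {x \<in> \<A> m. \<forall>f\<in>F. f x = 0}"
    unfolding closedin_zar by blast
  have "(\<lambda>f x. f (\<phi> x)) ` F \<subseteq> pf (coords n)"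
  proof clarify
    fix f assume "f \<in> F"
    then have "f \<in> pf (coords m)" using F(1) by blast
    then show "(\<lambda>x. f (\<phi> x)) \<in> pf (coords n)"
      by (rule pf_coords_compose) (rule assms(1))
  qed
  moreover have "{x \<in> \<A> n. \<phi> x \<in> C} = {x \<in> \<A> n. \<forall>g\<in>(\<lambda>f x. f (\<phi> x)) ` F. g x = 0}"
    by (simp add: F(2) assms(2) cong: conj_cong)
  ultimately show "closedin (zar n) {x \<in> \<A> n. \<phi> x \<in> C}"
    unfolding closedin_zar by (rule_tac exI[of _ "(\<lambda>f x. f (\<phi> x)) ` F"]) (rule conjI)
qed (use assms(2) in auto)

text \<open>The form in which connectedness enters the theorem of Lie and Kolchin.\<close>

lemma connectedin_zar_finite_values:
  assumes "connectedin (zar n) H" "f \<in> pf (coords n)" "finite (f ` H)" "x \<in> H" "y \<in> H"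
  shows "f x = f y"
proof (rule ccontr)
  assume ne: "f x \<noteq> f y"
  define E1 where "E1 = {v \<in> \<A> n. f v - f x = 0}"
  define g where "g = (\<lambda>v. \<Prod>b\<in>f ` H - {f x}. f v - b)"
  define E2 where "E2 = {v \<in> \<A> n. g v = 0}"
  have sub: "H \<subseteq> \<A> n"
    using connectedin_subset_topspace[OF assms(1)] by (simp add: topspace_zar)
  have "closedin (zar n) E1" unfolding E1_def
    by (rule closedin_zarI) (intro pf_intros assms)
  moreover have "closedin (zar n) E2" unfolding E2_def g_def
    by (rule closedin_zarI) (intro pf_intros assms)
  moreover have g: "g v = 0 \<longleftrightarrow> f v \<noteq> f x" if "v \<in> H" for v
    using assms(3) that by (auto simp: g_def)
  then have "H \<subseteq> E1 \<union> E2" "E1 \<inter> E2 \<inter> H = {}" "E1 \<inter> H \<noteq> {}" "E2 \<inter> H \<noteq> {}"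
    using sub assms(4,5) ne by (auto simp: E1_def E2_def)
  ultimately show False using assms(1) unfolding connectedin_closedin by blast
qed

section \<open>Bounding dimensions\<close>

lemma var_dim_geI: "alg_independent CC N V d f \<Longrightarrow> enat d \<le> var_dim CC N V"
  unfolding var_dim_def by (rule Sup_upper) auto

subsection \<open>Lower bounds\<close>

text \<open>All but finitely many values of the first coordinate can be continued, by all but finitely
  many values of the second coordinate, and so on, to a point of \<open>S\<close>; the exceptional values of a
  coordinate may depend on the coordinates before it. Such a set is Zariski dense, but the
  condition can be checked one coordinate at a time.\<close>

fun thick :: "nat \<Rightarrow> nat \<Rightarrow> complex point set \<Rightarrow> complex point \<Rightarrow> bool" where
  "thick k 0 S y \<longleftrightarrow> y \<in> S"
| "thick k (Suc n) S y \<longleftrightarrow> finite {a. \<not> thick (Suc k) n S (y(k := a))}"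

lemma thick_nonzero:
  assumes "thick k n S y" "P \<in> pf (coords m)" "\<And>i. k + n \<le> i \<Longrightarrow> z i = y i"
    "P (\<lambda>i. if i < k then y i else z i) \<noteq> 0"
  shows "\<exists>s\<in>S. P s \<noteq> 0"
  using assms(1,3,4)
proof (induction n arbitrary: k y)
  case 0
  have "(\<lambda>i. if i < k then y i else z i) = y" using 0(2) by (intro ext) auto
  then show ?case using 0 by auto
next
  case (Suc n)
  define g where "g = (\<lambda>a. P (\<lambda>i. if i < Suc k then (y(k := a)) i else z i))"
  have "upoly g" unfolding g_def
  proof (rule upoly_coords_compose[OF assms(2)])
    fix i show "upoly (\<lambda>a. if i < Suc k then (y(k := a)) i else z i)"
      by (cases "i = k"; cases "i < k") (auto intro: upoly_const upoly_id)
  qed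
  moreover have "(\<lambda>i. if i < Suc k then (y(k := z k)) i else z i) = (\<lambda>i. if i < k then y i else z i)"
    by (auto simp: less_Suc_eq)
  then have "g (z k) \<noteq> 0" using Suc.prems(3) by (simp add: g_def)
  ultimately have "finite {a. g a = 0}" by (rule upoly_finite_zeros)
  then have "finite ({a. g a = 0} \<union> {a. \<not> thick (Suc k) n S (y(k := a))})"
    using Suc.prems(1) by simp
  then obtain a where "g a \<noteq> 0" "thick (Suc k) n S (y(k := a))"
    using infinite_UNIV_char_0[where 'a=complex] by (metis (mono_tags, lifting) UnI1 UnI2
      ex_new_if_finite mem_Collect_eq)
  then show ?case
    using Suc.prems(2) unfolding g_def by (intro Suc.IH[of "Suc k" "y(k := a)"]) (simp_all add: fun_upd_def)
qed

lemma var_dim_ge_thick: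
  assumes f: "\<And>i. i < d \<Longrightarrow> f i \<in> pf (coords N)"
    and "thick 0 d ((\<lambda>x. \<lambda>i\<in>{..<d}. f i x) ` V) (\<lambda>_. undefined)"
  shows "enat d \<le> var_dim CC N V"
proof (rule var_dim_geI[of N V d f], unfold alg_independent_def, intro conjI ballI allI impI)
  fix P y assume P: "P \<in> pf (coords d)" and
    van: "\<forall>x\<in>V. P (\<lambda>i\<in>{..<d}. f i x) = \<zero>\<^bsub>CC\<^esub>" and y: "y \<in> \<A> d"
  show "P y = \<zero>\<^bsub>CC\<^esub>"
  proof (rule ccontr)
    assume "P y \<noteq> \<zero>\<^bsub>CC\<^esub>"
    with assms(2) P y have "\<exists>s\<in>(\<lambda>x. \<lambda>i\<in>{..<d}. f i x) ` V. P s \<noteq> 0"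
      by (intro thick_nonzero[of 0 d _ "\<lambda>_. undefined" P d y]) (auto simp: affine_CC PiE_def extensional_def)
    then show False using van by auto
  qed
qed (use f in auto)


subsection \<open>Upper bounds\<close>

lemma homogeneous_system:
  fixes c :: "'e \<Rightarrow> 'a \<Rightarrow> complex"
  assumes "finite E" "finite A" "card E < card A"
  shows "\<exists>x. (\<exists>a\<in>A. x a \<noteq> 0) \<and> (\<forall>e\<in>E. (\<Sum>a\<in>A. c e a * x a) = 0)"
  using assms
proof (induction E arbitrary: A c rule: finite_induct)
  case empty
  then have "A \<noteq> {}" by auto
  then show ?case by (intro exI[of _ "\<lambda>_. 1"]) auto
next
  case (insert e E)
  show ?case
  proof (cases "\<forall>a\<in>A. c e a = 0")
    case True
    obtain x where "\<exists>a\<in>A. x a \<noteq> 0" "\<forall>e\<in>E. (\<Sum>a\<in>A. c e a * x a) = 0"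
      using insert.IH[of A c] insert.prems insert.hyps by (metis Suc_lessD card_insert_disjoint)
    with True show ?thesis by (intro exI[of _ x]) auto
  next
    case False
    then obtain b where b: "b \<in> A" "c e b \<noteq> 0" by auto
    define A' where "A' = A - {b}"
    have A': "finite A'" "A = insert b A'" "b \<notin> A'" using b insert by (auto simp: A'_def)
    then have card: "card E < card A'" using insert by auto
    obtain x where x: "\<exists>a\<in>A'. x a \<noteq> 0"
      "\<forall>d\<in>E. (\<Sum>a\<in>A'. (c d a - c d b * c e a / c e b) * x a) = 0"
      using insert.IH[OF A'(1) card, of "\<lambda>d a. c d a - c d b * c e a / c e b"] by auto
    define s where "s = - (\<Sum>a\<in>A'. c e a * x a) / c e b"
    define x' where "x' = x(b := s)"
    have sum: "(\<Sum>a\<in>A. c d a * x' a) = c d b * s + (\<Sum>a\<in>A'. c d a * x a)" for d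
    proof -
      have "(\<Sum>a\<in>A'. c d a * x' a) = (\<Sum>a\<in>A'. c d a * x a)"
        using A'(3) by (intro sum.cong) (auto simp: x'_def)
      then show ?thesis unfolding A'(2) using A'(1,3) by (simp add: x'_def)
    qed
    have "(\<Sum>a\<in>A. c d a * x' a) = 0" if "d \<in> insert e E" for d
    proof (cases "d = e")
      case True then show ?thesis unfolding sum using b by (simp add: s_def)
    next
      case False
      then have "0 = (\<Sum>a\<in>A'. c d a * x a - c d b / c e b * (c e a * x a))"
        using x(2) that by (auto simp: algebra_simps)
      also have "\<dots> = (\<Sum>a\<in>A'. c d a * x a) - c d b / c e b * (\<Sum>a\<in>A'. c e a * x a)"
        by (simp only: sum_subtractf sum_distrib_left)
      finally show ?thesis unfolding sum by (simp add: s_def)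
    qed
    moreover have "\<exists>a\<in>A. x' a \<noteq> 0" using x(1) A' by (auto simp: x'_def)
    ultimately show ?thesis by blast
  qed
qed

definition exps :: "nat \<Rightarrow> nat \<Rightarrow> (nat \<Rightarrow> nat) set" where
  "exps n M = {..<n} \<rightarrow>\<^sub>E {..M}"

definition mon :: "nat \<Rightarrow> (nat \<Rightarrow> nat) \<Rightarrow> complex point \<Rightarrow> complex" where
  "mon n \<alpha> z = (\<Prod>i<n. z i ^ \<alpha> i)"

definition bounded_poly :: "nat \<Rightarrow> nat \<Rightarrow> (complex point \<Rightarrow> complex) \<Rightarrow> bool" where
  "bounded_poly n D f \<longleftrightarrow> (\<exists>c. \<forall>z. f z = (\<Sum>\<beta>\<in>exps n D. c \<beta> * mon n \<beta> z))"

lemma finite_exps [simp]: "finite (exps n M)"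
  unfolding exps_def by (intro finite_PiE) auto

lemma card_exps: "card (exps n M) = Suc M ^ n"
  unfolding exps_def by (subst card_PiE) auto

lemma mon_in_pf: "mon n \<alpha> \<in> pf (coords n)"
  unfolding mon_def by (intro pf_intros) auto

lemma bounded_poly_mono: assumes "\<And>i. i < n \<Longrightarrow> \<beta> i \<le> D" shows "bounded_poly n D (mon n \<beta>)"
proof -
  define \<gamma> where "\<gamma> = restrict \<beta> {..<n}"
  have \<gamma>: "\<gamma> \<in> exps n D" using assms by (auto simp: \<gamma>_def exps_def)
  have "mon n \<beta> z = mon n \<gamma> z" for z by (simp add: mon_def \<gamma>_def)
  then have "mon n \<beta> z = (\<Sum>\<delta>\<in>exps n D. (if \<delta> = \<gamma> then 1 else 0) * mon n \<delta> z)" for z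
    using \<gamma> by (simp add: if_distrib[of "\<lambda>x. x * _"] cong: if_cong)
  then show ?thesis unfolding bounded_poly_def
    by (intro exI[of _ "\<lambda>\<delta>. if \<delta> = \<gamma> then 1 else 0"]) blast
qed

lemma bounded_poly_add:
  assumes "bounded_poly n D f" "bounded_poly n D g" shows "bounded_poly n D (\<lambda>z. f z + g z)"
proof -
  obtain c c' where "\<forall>z. f z = (\<Sum>\<beta>\<in>exps n D. c \<beta> * mon n \<beta> z)" "\<forall>z. g z = (\<Sum>\<beta>\<in>exps n D. c' \<beta> * mon n \<beta> z)"
    using assms unfolding bounded_poly_def by auto
  then show ?thesis unfolding bounded_poly_def
    by (intro exI[of _ "\<lambda>\<beta>. c \<beta> + c' \<beta>"]) (simp add: algebra_simps sum.distrib)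
qed

lemma bounded_poly_cmult:
  assumes "bounded_poly n D f" shows "bounded_poly n D (\<lambda>z. a * f z)"
proof -
  obtain c where "\<forall>z. f z = (\<Sum>\<beta>\<in>exps n D. c \<beta> * mon n \<beta> z)"
    using assms unfolding bounded_poly_def by auto
  then show ?thesis unfolding bounded_poly_def
    by (intro exI[of _ "\<lambda>\<beta>. a * c \<beta>"]) (simp add: sum_distrib_left mult_ac)
qed

lemma bounded_poly_0: "bounded_poly n D (\<lambda>_. 0)"
  unfolding bounded_poly_def by (intro exI[of _ "\<lambda>_. 0"]) simp

lemma bounded_poly_sum:
  "(\<And>i. i \<in> I \<Longrightarrow> bounded_poly n D (f i)) \<Longrightarrow> bounded_poly n D (\<lambda>z. \<Sum>i\<in>I. f i z)"
  by (induction I rule: infinite_finite_induct) (auto intro: bounded_poly_add bounded_poly_0)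

lemma bounded_poly_mult:
  assumes "bounded_poly n D f" "bounded_poly n D' g" shows "bounded_poly n (D + D') (\<lambda>z. f z * g z)"
proof -
  obtain c c' where f: "\<And>z. f z = (\<Sum>\<beta>\<in>exps n D. c \<beta> * mon n \<beta> z)"
    and g: "\<And>z. g z = (\<Sum>\<beta>\<in>exps n D'. c' \<beta> * mon n \<beta> z)"
    using assms unfolding bounded_poly_def by auto
  have "f z * g z = (\<Sum>\<beta>\<in>exps n D. \<Sum>\<gamma>\<in>exps n D'. (c \<beta> * c' \<gamma>) * mon n (\<lambda>i. \<beta> i + \<gamma> i) z)" for z
    unfolding f g sum_product mon_def power_add prod.distrib by (simp add: mult_ac)
  moreover have "bounded_poly n (D + D')
    (\<lambda>z. \<Sum>\<beta>\<in>exps n D. \<Sum>\<gamma>\<in>exps n D'. (c \<beta> * c' \<gamma>) * mon n (\<lambda>i. \<beta> i + \<gamma> i) z)"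
    by (intro bounded_poly_sum bounded_poly_cmult bounded_poly_mono) (fastforce simp: exps_def intro!: add_mono)
  ultimately show ?thesis by simp
qed

lemma bounded_poly_le:
  assumes "bounded_poly n D f" "D \<le> D'" shows "bounded_poly n D' f"
proof -
  obtain c where f: "\<And>z. f z = (\<Sum>\<beta>\<in>exps n D. c \<beta> * mon n \<beta> z)"
    using assms unfolding bounded_poly_def by auto
  have "bounded_poly n D' (\<lambda>z. \<Sum>\<beta>\<in>exps n D. c \<beta> * mon n \<beta> z)"
    by (intro bounded_poly_sum bounded_poly_cmult bounded_poly_mono)
      (use assms(2) in \<open>auto simp: exps_def intro: order_trans\<close>)
  then show ?thesis by (simp add: f[abs_def])
qed

lemma bounded_poly_const: "bounded_poly n 0 (\<lambda>_. a)"
  using bounded_poly_cmult[OF bounded_poly_mono[of n "\<lambda>_. 0" 0], of a] by (simp add: mon_def)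

lemma bounded_poly_coord: assumes "i < n" shows "bounded_poly n 1 (\<lambda>z. z i)"
proof -
  have "mon n (\<lambda>j. if j = i then 1 else 0) = (\<lambda>z. z i)"
    using assms by (simp add: mon_def fun_eq_iff if_distrib[of "\<lambda>k. _ ^ k"] cong: if_cong)
  then show ?thesis
    using bounded_poly_mono[of n "\<lambda>j. if j = i then 1 else 0" 1] by simp
qed

lemma bounded_poly_power: "bounded_poly n D f \<Longrightarrow> bounded_poly n (k * D) (\<lambda>z. f z ^ k)"
  by (induction k) (auto intro: bounded_poly_const bounded_poly_mult)

lemma bounded_poly_prod:
  "(\<And>i. i < m \<Longrightarrow> bounded_poly n D (f i)) \<Longrightarrow> bounded_poly n (m * D) (\<lambda>z. \<Prod>i<m. f i z)"
proof (induction m)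
  case (Suc m)
  then have "bounded_poly n (m * D + D) (\<lambda>z. (\<Prod>i<m. f i z) * f m z)"
    by (intro bounded_poly_mult) auto
  then show ?case by (simp add: add.commute)
qed (auto intro: bounded_poly_const)

lemma pf_bounded: "f \<in> pf (coords n) \<Longrightarrow> \<exists>D. bounded_poly n D f"
proof (induction rule: poly_funs.induct)
  case (add f g)
  then obtain D D' where "bounded_poly n D f" "bounded_poly n D' g" by auto
  then have "bounded_poly n (max D D') (\<lambda>z. f z + g z)"
    by (intro bounded_poly_add) (auto intro: bounded_poly_le)
  then show ?case by auto
qed (auto intro: bounded_poly_const bounded_poly_mult bounded_poly_coord simp: coords_def)

lemma mon_Suc: "mon (Suc n) (g(n := k)) (y(n := t)) = mon n g y * t ^ k"
proof -
  have "(\<Prod>i<n. (y(n := t)) i ^ (g(n := k)) i) = (\<Prod>i<n. y i ^ g i)"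
    by (intro prod.cong) auto
  then show ?thesis by (simp add: mon_def)
qed

lemma mon_independent:
  assumes "\<exists>\<alpha>\<in>exps n M. x \<alpha> \<noteq> 0"
  shows "\<exists>y\<in>\<A> n. (\<Sum>\<alpha>\<in>exps n M. x \<alpha> * mon n \<alpha> y) \<noteq> 0"
  using assms
proof (induction n arbitrary: x)
  case 0
  then show ?case by (auto simp: exps_def affine_CC mon_def)
next
  case (Suc n)
  have split: "(\<Sum>\<alpha>\<in>exps (Suc n) M. h \<alpha>) = (\<Sum>k\<le>M. \<Sum>g\<in>exps n M. h (g(n := k)))" for h :: "_ \<Rightarrow> complex"
  proof -
    have "(\<Sum>\<alpha>\<in>exps (Suc n) M. h \<alpha>) = (\<Sum>(k, g)\<in>{..M} \<times> exps n M. h (g(n := k)))"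
      unfolding exps_def lessThan_Suc PiE_insert_eq
      by (subst sum.reindex) (auto simp: case_prod_beta intro!: inj_combinator)
    then show ?thesis by (simp add: sum.cartesian_product)
  qed
  obtain k g where k: "k \<le> M" and g: "g \<in> exps n M" "x (g(n := k)) \<noteq> 0"
    using Suc.prems unfolding exps_def lessThan_Suc PiE_insert_eq by auto
  define c where "c = (\<lambda>y k. \<Sum>g\<in>exps n M. x (g(n := k)) * mon n g y)"
  obtain y where y: "y \<in> \<A> n" "c y k \<noteq> 0"
    using Suc.IH[of "\<lambda>g. x (g(n := k))"] g unfolding c_def by blast
  have eq: "(\<Sum>\<alpha>\<in>exps (Suc n) M. x \<alpha> * mon (Suc n) \<alpha> (y(n := t))) = (\<Sum>k\<le>M. c y k * t ^ k)" for t
    unfolding split mon_Suc c_def by (simp add: sum_distrib_right mult.assoc)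
  define p where "p = (\<Sum>k\<le>M. Polynomial.monom (c y k) k)"
  have "Polynomial.coeff p k \<noteq> 0"
    using y(2) k by (simp add: p_def Polynomial.coeff_sum)
  then have "p \<noteq> 0" by auto
  then obtain t where "poly p t \<noteq> 0" using poly_all_0_iff_0 by blast
  then have "(\<Sum>\<alpha>\<in>exps (Suc n) M. x \<alpha> * mon (Suc n) \<alpha> (y(n := t))) \<noteq> 0"
    unfolding eq by (simp add: p_def poly_sum poly_monom)
  moreover have "y(n := t) \<in> \<A> (Suc n)"
    using y(1) by (auto simp: affine_CC lessThan_Suc PiE_def extensional_def)
  ultimately show ?case by blast
qed

text \<open>Among the products of powers of \<open>m > n\<close> polynomials in \<open>n\<close> variables, with exponents at
  most \<open>M\<close>, a linear relation holds for large \<open>M\<close>: there are \<open>(M + 1) ^ m\<close> of them, in a space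
  of dimension \<open>O(M ^ n)\<close>.\<close>

lemma algebraic_dependence:
  assumes F: "\<And>i. i < m \<Longrightarrow> F i \<in> pf (coords n)" and "n < m"
  obtains P y where "P \<in> pf (coords m)" "y \<in> \<A> m" "P y \<noteq> 0"
    "\<And>z. P (\<lambda>i\<in>{..<m}. F i z) = 0"
proof -
  have "\<exists>D. \<forall>i<m. bounded_poly n D (F i)"
  proof -
    have "\<forall>i. \<exists>D. i < m \<longrightarrow> bounded_poly n D (F i)" using pf_bounded[OF F] by blast
    then obtain D where D: "\<And>i. i < m \<Longrightarrow> bounded_poly n (D i) (F i)" by metis
    have "bounded_poly n (Max (D ` {..<m})) (F i)" if "i < m" for i
      using that by (intro bounded_poly_le[OF D] Max_ge) auto
    then show ?thesis by blast
  qed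
  then obtain D where D: "\<And>i. i < m \<Longrightarrow> bounded_poly n D (F i)" by blast
  define c where "c = m * D"
  define M where "M = (c + 1) ^ n"
  define E where "E = exps n (m * (M * D))"
  have "bounded_poly n (m * (M * D)) (\<lambda>z. \<Prod>i<m. F i z ^ \<alpha> i)" if "\<alpha> \<in> exps m M" for \<alpha>
  proof (rule bounded_poly_prod)
    fix i assume "i < m"
    then show "bounded_poly n (M * D) (\<lambda>z. F i z ^ \<alpha> i)"
      using that by (intro bounded_poly_le[OF bounded_poly_power[OF D]]) (auto simp: exps_def)
  qed
  then have "\<forall>\<alpha>\<in>exps m M. \<exists>b. \<forall>z. (\<Prod>i<m. F i z ^ \<alpha> i) = (\<Sum>\<beta>\<in>E. b \<beta> * mon n \<beta> z)"
    unfolding bounded_poly_def E_def by blast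
  then obtain b where b: "\<And>\<alpha> z. \<alpha> \<in> exps m M \<Longrightarrow> (\<Prod>i<m. F i z ^ \<alpha> i) = (\<Sum>\<beta>\<in>E. b \<alpha> \<beta> * mon n \<beta> z)"
    by metis
  have "card E = (c * M + 1) ^ n" by (simp add: E_def card_exps c_def mult_ac)
  also have "\<dots> \<le> ((c + 1) * (M + 1)) ^ n" by (intro power_mono) auto
  also have "\<dots> = M * (M + 1) ^ n" by (simp only: power_mult_distrib M_def)
  also have "\<dots> < (M + 1) ^ Suc n" by simp
  also have "\<dots> \<le> (M + 1) ^ m" using \<open>n < m\<close> by (intro power_increasing) auto
  also have "\<dots> = card (exps m M)" by (simp add: card_exps)
  finally obtain x where x: "\<exists>\<alpha>\<in>exps m M. x \<alpha> \<noteq> 0"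
    "\<And>\<beta>. \<beta> \<in> E \<Longrightarrow> (\<Sum>\<alpha>\<in>exps m M. b \<alpha> \<beta> * x \<alpha>) = 0"
    using homogeneous_system[of E "exps m M" "\<lambda>\<beta> \<alpha>. b \<alpha> \<beta>"] by (auto simp: E_def)
  define P where "P = (\<lambda>y. \<Sum>\<alpha>\<in>exps m M. x \<alpha> * mon m \<alpha> y)"
  have "P (\<lambda>i\<in>{..<m}. F i z) = 0" for z
  proof -
    have "P (\<lambda>i\<in>{..<m}. F i z) = (\<Sum>\<alpha>\<in>exps m M. x \<alpha> * (\<Prod>i<m. F i z ^ \<alpha> i))"
      by (simp add: P_def mon_def)
    also have "\<dots> = (\<Sum>\<alpha>\<in>exps m M. \<Sum>\<beta>\<in>E. mon n \<beta> z * (b \<alpha> \<beta> * x \<alpha>))"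
      by (intro sum.cong) (auto simp: b sum_distrib_left mult_ac)
    also have "\<dots> = (\<Sum>\<beta>\<in>E. mon n \<beta> z * (\<Sum>\<alpha>\<in>exps m M. b \<alpha> \<beta> * x \<alpha>))"
      by (subst sum.swap) (simp add: sum_distrib_left)
    also have "\<dots> = 0" using x(2) by simp
    finally show ?thesis .
  qed
  moreover obtain y where "y \<in> \<A> m" "P y \<noteq> 0" using mon_independent[OF x(1)] by (auto simp: P_def)
  moreover have "P \<in> pf (coords m)" unfolding P_def by (intro pf_intros mon_in_pf)
  ultimately show ?thesis using that by blast
qed

text \<open>A chart of a nonempty open part of an irreducible set bounds its dimension.\<close>

lemma var_dim_le_chart:
  assumes V: "zar_irreducible N V" and \<psi>: "\<And>i. i < N \<Longrightarrow> (\<lambda>z. \<psi> z i) \<in> pf (coords d)"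
    and g: "g \<in> pf (coords N)" "x0 \<in> V" "g x0 \<noteq> 0"
    and cover: "\<And>x. x \<in> V \<Longrightarrow> g x \<noteq> 0 \<Longrightarrow> \<exists>z. x = \<psi> z"
  shows "var_dim CC N V \<le> enat d"
  unfolding var_dim_def
proof (rule Sup_least, clarify)
  fix m f assume f: "alg_independent CC N V m f"
  show "enat m \<le> enat d"
  proof (rule ccontr)
    assume "\<not> enat m \<le> enat d"
    then have "d < m" by simp
    have fi: "\<And>i. i < m \<Longrightarrow> f i \<in> pf (coords N)" using f by (auto simp: alg_independent_def)
    then have "\<And>i. i < m \<Longrightarrow> (\<lambda>z. f i (\<psi> z)) \<in> pf (coords d)"
      using pf_coords_compose \<psi> by blast
    then obtain P y where P: "P \<in> pf (coords m)" "y \<in> \<A> m" "P y \<noteq> 0"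
      "\<And>z. P (\<lambda>i\<in>{..<m}. f i (\<psi> z)) = 0"
      using algebraic_dependence[of m "\<lambda>i z. f i (\<psi> z)" d] \<open>d < m\<close> by metis
    define h where "h = (\<lambda>x. P (\<lambda>i\<in>{..<m}. f i x))"
    have "h \<in> pf (coords N)" unfolding h_def
      by (rule pf_coords_compose[OF P(1)]) (simp add: fi)
    moreover have "\<forall>x\<in>V. h x * g x = 0" using cover P(4) unfolding h_def by force
    ultimately have "\<forall>x\<in>V. h x = 0" using V g unfolding zar_irreducible_def by blast
    then show False using f P(1-3) unfolding alg_independent_def h_def by auto
  qed
qed


subsection \<open>Proper closed subsets\<close>

lemma pf_last_coord:
  assumes "P \<in> pf (coords (Suc d))"
  shows "\<exists>m c. (\<forall>k. c k \<in> pf (coords d)) \<and> (\<forall>k>m. c k = (\<lambda>_. 0)) \<and> (\<forall>z. P z = (\<Sum>k\<le>m. c k z * z d ^ k))"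
proof -
  define Q where "Q = (\<lambda>P. \<exists>m c. (\<forall>k. c k \<in> pf (coords d)) \<and> (\<forall>k>m. c k = (\<lambda>_. 0)) \<and>
    (\<forall>z. P z = (\<Sum>k\<le>m. c k z * z d ^ k)))"
  have Q1: "Q (\<lambda>z. c z * z d ^ k)" if "c \<in> pf (coords d)" for c k
    unfolding Q_def
    by (rule exI[of _ k], rule exI[of _ "\<lambda>l. if l = k then c else (\<lambda>_. 0)"])
      (auto simp: that pf_const if_distrib[of "\<lambda>f. f _ * _"] cong: if_cong)
  have Qadd: "Q (\<lambda>z. f z + g z)" if fg: "Q f" "Q g" for f g
  proof -
    obtain m c m' c' where 1: "\<forall>k. c k \<in> pf (coords d)" "\<forall>k>m. c k = (\<lambda>_. 0)"
      "\<forall>z. f z = (\<Sum>k\<le>m. c k z * z d ^ k)"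
      and 2: "\<forall>k. c' k \<in> pf (coords d)" "\<forall>k>m'. c' k = (\<lambda>_. 0)"
      "\<forall>z. g z = (\<Sum>k\<le>m'. c' k z * z d ^ k)"
      using fg unfolding Q_def by auto
    let ?M = "max m m'"
    have "(\<Sum>k\<le>m. c k z * z d ^ k) = (\<Sum>k\<le>?M. c k z * z d ^ k)" for z
      by (intro sum.mono_neutral_left) (auto simp: 1(2))
    moreover have "(\<Sum>k\<le>m'. c' k z * z d ^ k) = (\<Sum>k\<le>?M. c' k z * z d ^ k)" for z
      by (intro sum.mono_neutral_left) (auto simp: 2(2))
    ultimately have "\<forall>z. f z + g z = (\<Sum>k\<le>?M. (c k z + c' k z) * z d ^ k)"
      using 1(3) 2(3) by (simp add: algebra_simps sum.distrib)
    then show ?thesis unfolding Q_def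
      using 1(1,2) 2(1,2) by (intro exI[of _ ?M] exI[of _ "\<lambda>k z. c k z + c' k z"]) (auto intro: pf_add)
  qed
  have Q0: "Q (\<lambda>_. 0)" using Q1[OF pf_const[of 0]] by simp
  have Qsum: "Q (\<lambda>z. \<Sum>i\<in>I. f i z)" if "\<And>i. i \<in> I \<Longrightarrow> Q (f i)" for I :: "nat set" and f
    using that by (induction I rule: infinite_finite_induct) (auto intro: Qadd Q0)
  have Qmult: "Q (\<lambda>z. f z * g z)" if fg: "Q f" "Q g" for f g
  proof -
    obtain m c m' c' where 1: "\<forall>k. c k \<in> pf (coords d)" "\<forall>z. f z = (\<Sum>k\<le>m. c k z * z d ^ k)"
      and 2: "\<forall>k. c' k \<in> pf (coords d)" "\<forall>z. g z = (\<Sum>k\<le>m'. c' k z * z d ^ k)"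
      using fg unfolding Q_def by auto
    have "Q (\<lambda>z. \<Sum>k\<le>m. \<Sum>l\<le>m'. (c k z * c' l z) * z d ^ (k + l))"
      by (intro Qsum Q1 pf_mult) (use 1 2 in auto)
    moreover have "(\<Sum>k\<le>m. \<Sum>l\<le>m'. (c k z * c' l z) * z d ^ (k + l)) = f z * g z" for z
      unfolding 1(2)[rule_format] 2(2)[rule_format] sum_product
      by (intro sum.cong refl) (simp add: power_add mult_ac)
    ultimately show ?thesis by simp
  qed
  have "Q P" using assms
  proof induction
    case (const a) then show ?case using Q1[OF pf_const[of a], of 0] by simp
  next
    case (coord s)
    then obtain i where i: "s = (\<lambda>z. z i)" "i < Suc d" by (auto simp: coords_def)
    show ?case
    proof (cases "i = d")
      case True then show ?thesis using Q1[OF pf_const[of 1], of 1] i by simp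
    next
      case False then show ?thesis using Q1[OF pf_coord[of i d], of 0] i by simp
    qed
  qed (auto intro: Qadd Qmult)
  then show ?thesis by (simp add: Q_def)
qed

text \<open>If \<open>F\<close> vanishes on \<open>Z\<close> but not on the irreducible set \<open>V\<close>, it is independent of functions
  that are independent on \<open>Z\<close>: divide a relation by the largest possible power of \<open>F\<close> and restrict
  it to \<open>Z\<close>.\<close>

lemma var_dim_drop:
  assumes V: "zar_irreducible N V" "Z \<subseteq> V"
    and F: "F \<in> pf (coords N)" "\<And>x. x \<in> Z \<Longrightarrow> F x = 0" "x0 \<in> V" "F x0 \<noteq> 0"
    and Z: "enat d \<le> var_dim CC N Z" and "0 < d"
  shows "enat (Suc d) \<le> var_dim CC N V"
proof -
  have "\<exists>m f. d \<le> m \<and> alg_independent CC N Z m f"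
  proof -
    obtain n where n: "d = Suc n" using \<open>0 < d\<close> by (cases d) auto
    have "enat n < Sup {enat d | d. \<exists>f. alg_independent CC N Z d f}"
      using Z unfolding var_dim_def n Suc_ile_eq .
    then obtain m f where "n < m" "alg_independent CC N Z m f" unfolding less_Sup_iff by auto
    then show ?thesis unfolding n by (meson Suc_leI)
  qed
  then obtain m f where m: "d \<le> m" and f: "alg_independent CC N Z m f" by blast
  have fi: "\<And>i. i < m \<Longrightarrow> f i \<in> pf (coords N)" using f by (auto simp: alg_independent_def)
  define f' where "f' = f(m := F)"
  have "alg_independent CC N V (Suc m) f'"
    unfolding alg_independent_def
  proof (intro conjI allI impI ballI)
    fix i assume "i < Suc m" then show "f' i \<in> pf (coords N)" using fi F by (auto simp: f'_def)
  next
    fix P y assume P: "P \<in> pf (coords (Suc m))"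
      and van: "\<forall>x\<in>V. P (\<lambda>i\<in>{..<Suc m}. f' i x) = \<zero>\<^bsub>CC\<^esub>" and y: "y \<in> \<A> (Suc m)"
    obtain l c where c: "\<And>k. c k \<in> pf (coords m)" "\<And>z. P z = (\<Sum>k\<le>l. c k z * z m ^ k)"
      using pf_last_coord[OF P] by blast
    define r where "r = (\<lambda>x. \<lambda>i\<in>{..<m}. f i x)"
    have c0: "c k z = 0" if "k \<le> l" "z \<in> \<A> m" for k z
      using that
    proof (induction k arbitrary: z rule: less_induct)
      case (less k)
      define h where "h = (\<lambda>x. \<Sum>j\<in>{k..l}. c j (r x) * F x ^ (j - k))"
      have h: "h \<in> pf (coords N)" unfolding h_def r_def
        by (intro pf_intros F(1)) (rule pf_coords_compose[OF c(1)], simp add: fi)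
      have "\<forall>x\<in>V. F x ^ k * h x = 0"
      proof
        fix x assume x: "x \<in> V"
        have rA: "r x \<in> \<A> m" by (auto simp: r_def affine_CC)
        have "0 = (\<Sum>j\<le>l. c j (\<lambda>i\<in>{..<Suc m}. f' i x) * F x ^ j)"
          using van x unfolding c(2) by (simp add: f'_def)
        also have "\<dots> = (\<Sum>j\<le>l. c j (r x) * F x ^ j)"
          by (intro sum.cong refl arg_cong2[of _ _ _ _ "(*)"] pf_cong_coords[OF c(1)])
            (auto simp: r_def f'_def)
        also have "\<dots> = (\<Sum>j\<in>{k..l}. c j (r x) * F x ^ j)"
          by (intro sum.mono_neutral_right) (use less rA in auto)
        also have "\<dots> = F x ^ k * h x"
          unfolding h_def sum_distrib_left
          by (intro sum.cong) (auto simp: power_add[symmetric] mult.left_commute)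
        finally show "F x ^ k * h x = 0" by simp
      qed
      then have "(\<forall>x\<in>V. F x ^ k = 0) \<or> (\<forall>x\<in>V. h x = 0)"
        by (rule zar_irreducibleD[OF V(1) pf_power[OF F(1)] h])
      then have "\<forall>x\<in>V. h x = 0" using F(3,4) by auto
      moreover have "h x = c k (r x)" if "x \<in> Z" for x
      proof -
        have "{k..l} = insert k {Suc k..l}" using less.prems by auto
        then show ?thesis unfolding h_def using F(2)[OF that] by (simp add: power_0_left)
      qed
      ultimately have "\<forall>x\<in>Z. c k (r x) = 0" using V(2) by (metis subsetD)
      then show ?case using f c(1) less.prems(2) unfolding alg_independent_def r_def by auto
    qed
    have "c k y = 0" if "k \<le> l" for k
    proof -
      have "c k y = c k (restrict y {..<m})" by (rule pf_cong_coords[OF c(1)]) simp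
      also have "\<dots> = 0" using that by (intro c0) (auto simp: affine_CC)
      finally show ?thesis .
    qed
    then show "P y = \<zero>\<^bsub>CC\<^esub>" by (simp add: c(2))
  qed
  then have "enat (Suc m) \<le> var_dim CC N V" by (rule var_dim_geI)
  then show ?thesis using m by (meson Suc_le_mono enat_ord_simps(1) order_trans)
qed

section \<open>The symplectic group of degree six\<close>

type_synonym cvec = "complex ^ (3 + 3)"
type_synonym cmat = "complex ^ (3 + 3) ^ (3 + 3)"

lemma sum_33: "(\<Sum>i\<in>(UNIV :: (3 + 3) set). h i) = (\<Sum>i\<in>UNIV. h (Inl i)) + (\<Sum>i\<in>UNIV. h (Inr i))"
  by (simp only: UNIV_Plus_UNIV[symmetric] sum.Plus[OF finite finite]) (simp add: comp_def)

lemma forall_33: "(\<forall>i :: 3 + 3. P i) \<longleftrightarrow> (\<forall>i. P (Inl i)) \<and> (\<forall>i. P (Inr i))"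
  by (rule split_sum_all)

fun flip :: "'a + 'a \<Rightarrow> 'a + 'a" where
  "flip (Inl i) = Inr i"
| "flip (Inr i) = Inl i"

fun sg :: "'a + 'a \<Rightarrow> complex" where
  "sg (Inl i) = 1"
| "sg (Inr i) = - 1"

lemma flip_flip [simp]: "flip (flip i) = i"
  by (cases i) auto

lemma sg_flip [simp]: "sg (flip i) = - sg i"
  by (cases i) auto

lemma sg_mult [simp]: "sg i * sg i = 1" "sg i * (sg i * x) = x"
  by (cases i; simp)+

lemma sg_nz [simp]: "sg i \<noteq> 0"
  by (cases i) auto

lemma flip_inj [simp]: "flip i = flip j \<longleftrightarrow> i = j"
  by (metis flip_flip)

lemma flip_eq_iff: "flip i = j \<longleftrightarrow> i = flip j"
  by (metis flip_flip)

lemma bij_flip: "bij flip"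
  by (rule o_bij[of flip]) (auto simp: fun_eq_iff)

definition om :: "cvec \<Rightarrow> cvec \<Rightarrow> complex" where
  "om v w = (\<Sum>j\<in>UNIV. sg j * v $ j * w $ flip j)"

lemma om_eq: "om v w = (\<Sum>i\<in>UNIV. v $ Inl i * w $ Inr i) - (\<Sum>i\<in>UNIV. v $ Inr i * w $ Inl i)"
  by (simp add: om_def sum_33 sum_negf)

lemma om_add_left: "om (u + v) w = om u w + om v w"
  and om_add_right: "om w (u + v) = om w u + om w v"
  and om_diff_left: "om (u - v) w = om u w - om v w"
  and om_diff_right: "om w (u - v) = om w u - om w v"
  and om_minus_left: "om (- v) w = - om v w"
  and om_minus_right: "om w (- v) = - om w v"
  and om_scale_left: "om (c *s v) w = c * om v w"
  and om_scale_right: "om w (c *s v) = c * om w v"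
  and om_zero_left: "om 0 w = 0"
  and om_zero_right: "om w 0 = 0"
  by (simp_all add: om_def algebra_simps sum.distrib sum_subtractf sum_distrib_left sum_negf)

lemmas om_simps = om_add_left om_add_right om_diff_left om_diff_right om_minus_left om_minus_right
  om_scale_left om_scale_right om_zero_left om_zero_right

lemma om_skew: "om v w = - om w v"
  by (simp add: om_eq mult.commute)

lemma om_self [simp]: "om v v = 0"
  using om_skew[of v v] by simp

lemma om_axis_left: "om (axis j 1) w = sg j * w $ flip j"
proof -
  have "om (axis j 1) w = (\<Sum>i\<in>UNIV. if i = j then sg j * w $ flip j else 0)"
    unfolding om_def by (intro sum.cong) (auto simp: axis_def)
  then show ?thesis by simp
qed

lemma om_axis_right: "om w (axis j 1) = - sg j * w $ flip j"
  using om_skew[of w "axis j 1"] by (simp add: om_axis_left)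

lemma om_nondegenerate: assumes "v \<noteq> 0" obtains j where "om v (axis (flip j) 1) \<noteq> 0" "v $ j \<noteq> 0"
proof -
  obtain j where "v $ j \<noteq> 0" using assms by (auto simp: vec_eq_iff)
  then show ?thesis using that[of j] by (simp add: om_axis_right)
qed

lemma om_eq_zero: "(\<And>w. om v w = 0) \<Longrightarrow> v = 0"
  using om_nondegenerate by metis

definition Sp :: "cmat set" where
  "Sp = {A. \<forall>v w. om (A *v v) (A *v w) = om v w}"

definition adj :: "cmat \<Rightarrow> cmat" where
  "adj A = (\<chi> i j. sg i * sg j * A $ flip j $ flip i)"

lemma om_adj: "om (A *v v) w = om v (adj A *v w)"
proof -
  have "om (A *v v) w = (\<Sum>i\<in>UNIV. \<Sum>j\<in>UNIV. sg i * A $ i $ j * v $ j * w $ flip i)"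
    unfolding om_def matrix_vector_mult_def by (simp add: sum_distrib_left sum_distrib_right mult_ac)
  also have "\<dots> = (\<Sum>j\<in>UNIV. \<Sum>i\<in>UNIV. sg i * A $ i $ j * v $ j * w $ flip i)"
    by (rule sum.swap)
  also have "\<dots> = (\<Sum>j\<in>UNIV. sg j * v $ j * (\<Sum>i\<in>UNIV. adj A $ flip j $ flip i * w $ flip i))"
    by (intro sum.cong refl) (simp add: adj_def sum_distrib_left mult_ac)
  also have "\<dots> = (\<Sum>j\<in>UNIV. sg j * v $ j * (adj A *v w) $ flip j)"
  proof -
    have "(\<Sum>i\<in>UNIV. adj A $ k $ flip i * w $ flip i) = (\<Sum>i\<in>UNIV. adj A $ k $ i * w $ i)" for k
      by (rule sum.reindex_bij_betw[OF bij_flip])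
    then show ?thesis by (simp add: matrix_vector_mult_def)
  qed
  also have "\<dots> = om v (adj A *v w)" by (simp add: om_def)
  finally show ?thesis .
qed

lemma adj_adj [simp]: "adj (adj A) = A"
  by (simp add: adj_def vec_eq_iff)

lemma om_adj': "om w (A *v v) = om (adj A *v w) v"
  using om_adj[of "adj A" w v] by simp

lemma Sp_iff: "A \<in> Sp \<longleftrightarrow> adj A ** A = mat 1"
proof
  assume A: "A \<in> Sp"
  have "(adj A ** A) *v w - w = 0" for w
  proof (rule om_eq_zero)
    fix v
    have "om v ((adj A ** A) *v w) = om v w"
      using A om_adj[of A v "A *v w"] by (simp add: Sp_def matrix_vector_mul_assoc)
    then show "om ((adj A ** A) *v w - w) v = 0"
      using om_skew[of v] by (simp add: om_simps)
  qed
  then show "adj A ** A = mat 1" by (simp add: matrix_eq)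
next
  assume "adj A ** A = mat 1"
  then show "A \<in> Sp"
    unfolding Sp_def by (simp add: om_adj matrix_vector_mul_assoc)
qed

lemma Sp_om: "A \<in> Sp \<Longrightarrow> om (A *v v) (A *v w) = om v w"
  by (simp add: Sp_def)

lemma Sp_adj_left: "A \<in> Sp \<Longrightarrow> adj A ** A = mat 1"
  by (simp add: Sp_iff)

lemma Sp_adj_right: "A \<in> Sp \<Longrightarrow> A ** adj A = mat 1"
  using Sp_iff matrix_left_right_inverse by blast

lemma adj_Sp: "A \<in> Sp \<Longrightarrow> adj A \<in> Sp"
  by (simp add: Sp_iff Sp_adj_right)

lemma one_Sp [simp]: "mat 1 \<in> Sp"
  by (simp add: Sp_def)

lemma mult_Sp: "A \<in> Sp \<Longrightarrow> C \<in> Sp \<Longrightarrow> A ** C \<in> Sp"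
  by (simp add: Sp_def matrix_vector_mul_assoc[symmetric])

lemma Sp_adj_vec [simp]: "A \<in> Sp \<Longrightarrow> adj A *v (A *v v) = v" "A \<in> Sp \<Longrightarrow> A *v (adj A *v v) = v"
  by (simp_all add: matrix_vector_mul_assoc Sp_adj_left Sp_adj_right)

lemma Sp_adj_mat [simp]: "A \<in> Sp \<Longrightarrow> adj A ** (A ** C) = C" "A \<in> Sp \<Longrightarrow> A ** (adj A ** C) = C"
  by (simp_all add: matrix_mul_assoc Sp_adj_left Sp_adj_right)

lemma Sp_inj: "A \<in> Sp \<Longrightarrow> A *v v = A *v w \<Longrightarrow> v = w"
  by (metis Sp_adj_vec(1))

lemma Sp_nonzero: "A \<in> Sp \<Longrightarrow> v \<noteq> 0 \<Longrightarrow> A *v v \<noteq> 0"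
  using Sp_inj[of A v 0] by auto

subsection \<open>Root elements\<close>

text \<open>For orthogonal \<open>p\<close> and \<open>q\<close> these are the unipotent elements \<open>1 + N\<close> with \<open>N\<close> in the Lie
  algebra corresponding to the quadratic form \<open>2kpq\<close>; for \<open>p = q\<close> they are transvections.\<close>

definition R :: "complex \<Rightarrow> cvec \<Rightarrow> cvec \<Rightarrow> cmat" where
  "R k p q = (\<chi> i j. (if i = j then 1 else 0) + k * (om (axis j 1) p * q $ i + om (axis j 1) q * p $ i))"

lemma om_expand: "om w p = (\<Sum>j\<in>UNIV. w $ j * om (axis j 1) p)"
  by (simp add: om_axis_left) (simp add: om_def mult_ac)

lemma R_vec: "R k p q *v w = w + (k * om w p) *s q + (k * om w q) *s p"
proof (subst vec_eq_iff, intro allI)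
  fix i
  have "(R k p q *v w) $ i = (\<Sum>j\<in>UNIV. (if i = j then w $ j else 0)
     + (k * q $ i * (w $ j * om (axis j 1) p) + k * p $ i * (w $ j * om (axis j 1) q)))"
    unfolding matrix_vector_mult_def R_def by (auto intro!: sum.cong simp: algebra_simps)
  also have "\<dots> = w $ i + k * q $ i * om w p + k * p $ i * om w q"
    unfolding sum.distrib sum_distrib_left[symmetric] om_expand[symmetric] by simp
  finally show "(R k p q *v w) $ i = (w + (k * om w p) *s q + (k * om w q) *s p) $ i"
    by (simp add: mult_ac)
qed

lemma R_Sp: assumes "om p q = 0" shows "R k p q \<in> Sp"
  unfolding Sp_def
proof (intro CollectI allI)
  fix v w
  have "om q p = 0" "om p w = - om w p" "om q w = - om w q"
    using assms om_skew[of q p] om_skew[of p w] om_skew[of q w] by simp_all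
  then show "om (R k p q *v v) (R k p q *v w) = om v w"
    using assms by (simp add: R_vec om_simps algebra_simps)
qed

lemma R_mult: assumes "om p q = 0" shows "R k p q ** R l p q = R (k + l) p q"
proof -
  have "om q p = 0" using assms om_skew[of q p] by simp
  then show ?thesis using assms
    by (simp add: matrix_eq matrix_vector_mul_assoc[symmetric] R_vec om_simps vec_eq_iff algebra_simps)
qed

lemma R_0 [simp]: "R 0 p q = mat 1"
  by (simp add: matrix_eq R_vec)

lemma adj_R: assumes "om p q = 0" shows "adj (R k p q) = R (- k) p q"
proof -
  have "adj (R k p q) = adj (R k p q) ** (R k p q ** R (- k) p q)"
    using assms by (simp add: R_mult)
  then show ?thesis using R_Sp[OF assms] by simp
qed

lemma upoly_R: "upoly (\<lambda>z. R (z * k) p q $ i $ j)"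
  unfolding R_def by (auto intro!: upoly_intros)

subsection \<open>Transitivity\<close>

fun lv :: "3 + 3 \<Rightarrow> nat" where
  "lv (Inl i) = (if i = 1 then 1 else if i = 2 then 2 else 3)"
| "lv (Inr i) = (if i = 1 then 6 else if i = 2 then 5 else 4)"

lemma lv_flip: "lv (flip j) = 7 - lv j"
  by (cases j) auto

lemma lv_bounds: "1 \<le> lv j" "lv j \<le> 6"
  by (cases j; auto)+

lemma index3_cases: obtains "i = (1::3)" | "i = 2" | "i = 3"
  using exhaust_3[of i] by blast

lemma lv_inj: "lv i = lv j \<Longrightarrow> i = j"
  by (cases i; cases j; rename_tac a b; rule_tac i = a in index3_cases; rule_tac i = b in index3_cases) auto

lemma lv_surj: assumes "1 \<le> m" "m \<le> 6" obtains j where "lv j = m"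
proof -
  have "m = 1 \<or> m = 2 \<or> m = 3 \<or> m = 4 \<or> m = 5 \<or> m = 6" using assms by auto
  then show ?thesis
    using that[of "Inl 1"] that[of "Inl 2"] that[of "Inl 3"] that[of "Inr 1"] that[of "Inr 2"]
      that[of "Inr 3"] by auto
qed

lemma lv_values: "lv (Inl 1) = 1" "lv (Inl 2) = 2" "lv (Inl 3) = 3"
  "lv (Inr 3) = 4" "lv (Inr 2) = 5" "lv (Inr 1) = 6"
  by auto

lemma lv_less: "lv (Inl j) < lv (Inl 1) \<longleftrightarrow> False" "lv (Inl j) < lv (Inl 2) \<longleftrightarrow> j = 1"
  "lv (Inl j) < lv (Inl 3) \<longleftrightarrow> j = 1 \<or> j = 2"
  by (rule index3_cases[of j]; simp)+

lemma lv_le_3: "lv j \<le> 3 \<longleftrightarrow> (\<exists>i. j = Inl i)"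
  by (cases j) auto

declare lv.simps [simp del]

lemma axis_nth': "axis k x $ i = (if i = k then x else 0)"
  by (simp add: axis_def)

lemma mult_axis_nth: "((A :: complex ^ 'n ^ 'm) *v axis j 1) $ i = A $ i $ j"
  by (simp add: matrix_vector_mult_def axis_nth' if_distrib[of "\<lambda>x. _ * x"] cong: if_cong)

abbreviation ev :: "3 \<Rightarrow> cvec" where "ev i \<equiv> axis (Inl i) 1"
abbreviation fv :: "3 \<Rightarrow> cvec" where "fv i \<equiv> axis (Inr i) 1"

lemma om_basis: "om (ev i) (ev j) = 0" "om (fv i) (fv j) = 0"
  "om (ev i) (fv j) = (if i = j then 1 else 0)" "om (fv i) (ev j) = (if i = j then - 1 else 0)"
  by (auto simp: om_axis_left axis_nth')

text \<open>The complement of the hyperbolic planes spanned by the pairs \<open>ev j\<close>, \<open>fv j\<close> before the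
  \<open>i\<close>-th one, and the condition to act trivially on these planes.\<close>

definition Cmp :: "3 \<Rightarrow> cvec set" where
  "Cmp i = {v. \<forall>j. lv (Inl j) < lv (Inl i) \<longrightarrow> v $ Inl j = 0 \<and> v $ Inr j = 0}"

definition Fx :: "3 \<Rightarrow> cmat \<Rightarrow> bool" where
  "Fx i A \<longleftrightarrow> (\<forall>u. (\<forall>x\<in>Cmp i. om u x = 0) \<longrightarrow> A *v u = u)"

inductive gen :: "cmat \<Rightarrow> bool" where
  gen_one: "gen (mat 1)"
| gen_R: "gen A \<Longrightarrow> om p q = 0 \<Longrightarrow> gen (R k p q ** A)"

lemma gen_mult: "gen A \<Longrightarrow> gen C \<Longrightarrow> gen (A ** C)"
  by (induction rule: gen.induct) (auto simp: matrix_mul_assoc[symmetric] intro: gen.intros)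

lemma gen_R1: "om p q = 0 \<Longrightarrow> gen (R k p q)"
  using gen_R[OF gen_one] by simp

lemma gen_Sp: "gen A \<Longrightarrow> A \<in> Sp"
  by (induction rule: gen.induct) (auto intro: mult_Sp R_Sp)

lemma Fx_mult: "Fx i A \<Longrightarrow> Fx i C \<Longrightarrow> Fx i (A ** C)"
  by (simp add: Fx_def matrix_vector_mul_assoc[symmetric])

lemma Fx_one: "Fx i (mat 1)"
  by (simp add: Fx_def)

lemma Fx_R: "p \<in> Cmp i \<Longrightarrow> q \<in> Cmp i \<Longrightarrow> Fx i (R k p q)"
  by (auto simp: Fx_def R_vec)

lemma Cmp_add: "v \<in> Cmp i \<Longrightarrow> w \<in> Cmp i \<Longrightarrow> v + w \<in> Cmp i"
  and Cmp_diff: "v \<in> Cmp i \<Longrightarrow> w \<in> Cmp i \<Longrightarrow> v - w \<in> Cmp i"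
  by (auto simp: Cmp_def)

lemma Cmp_partner: assumes "v \<in> Cmp i" "v \<noteq> 0" obtains a where "a \<in> Cmp i" "om v a \<noteq> 0"
proof -
  obtain j where j: "om v (axis (flip j) 1) \<noteq> 0" "v $ j \<noteq> 0"
    using om_nondegenerate[OF assms(2)] .
  have "axis (flip j) 1 \<in> Cmp i"
    using assms(1) j(2) by (cases j) (auto simp: Cmp_def axis_nth')
  then show ?thesis using j that by blast
qed

lemma transvection_move:
  assumes "v \<in> Cmp i" "w \<in> Cmp i" "om v w \<noteq> 0"
  shows "\<exists>A. gen A \<and> Fx i A \<and> A *v v = w \<and> (\<forall>u. om u v = om u w \<longrightarrow> A *v u = u)"
proof (intro exI conjI allI impI)
  let ?A = "R (1 / (2 * om v w)) (w - v) (w - v)"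
  show "gen ?A" by (rule gen_R1) simp
  show "Fx i ?A" using assms by (intro Fx_R Cmp_diff)
  show "?A *v v = w"
    using assms(3) by (simp add: R_vec om_simps vec_eq_iff)
  show "?A *v u = u" if "om u v = om u w" for u
    using that by (simp add: R_vec om_simps)
qed

lemma Cmp_transitive:
  assumes v: "v \<in> Cmp i" "v \<noteq> 0" and w: "w \<in> Cmp i" "w \<noteq> 0"
  shows "\<exists>A. gen A \<and> Fx i A \<and> A *v v = w"
proof -
  obtain a b where a: "a \<in> Cmp i" "om v a \<noteq> 0" and b: "b \<in> Cmp i" "om w b \<noteq> 0"
    using Cmp_partner v w by metis
  have "\<exists>z\<in>Cmp i. om v z \<noteq> 0 \<and> om w z \<noteq> 0"
  proof (cases "om w a = 0 \<and> om v b = 0")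
    case True then show ?thesis
      using a b by (intro bexI[of _ "a + b"]) (auto simp: om_simps Cmp_add)
  qed (use a b in blast)
  then obtain z where z: "z \<in> Cmp i" "om v z \<noteq> 0" "om z w \<noteq> 0"
    using om_skew[of _ w] by (metis neg_equal_0_iff_equal)
  obtain A where A: "gen A" "Fx i A" "A *v v = z" using transvection_move[OF v(1) z(1,2)] by blast
  obtain C where C: "gen C" "Fx i C" "C *v z = w" using transvection_move[OF z(1) w(1) z(3)] by blast
  show ?thesis
    by (rule exI[of _ "C ** A"]) (use A C in \<open>simp add: gen_mult Fx_mult matrix_vector_mul_assoc[symmetric]\<close>)
qed

lemma Cmp_move_second:
  assumes v: "v \<in> Cmp i" and w: "w \<in> Cmp i" "om v w = 1" and w': "w' \<in> Cmp i" "om v w' = 1"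
  shows "\<exists>A. gen A \<and> Fx i A \<and> A *v v = v \<and> A *v w = w'"
proof (cases "om w w' = 0")
  case False
  then show ?thesis using transvection_move[OF w(1) w'(1)] w(2) w'(2) by metis
next
  case True
  define z where "z = v + w"
  have z: "z \<in> Cmp i" "om v z = 1" "om w z \<noteq> 0" "om z w' \<noteq> 0"
    using v w w' True om_skew[of w v] by (auto simp: z_def Cmp_add om_simps)
  obtain A where A: "gen A" "Fx i A" "A *v w = z" "A *v v = v"
    using transvection_move[OF w(1) z(1,3)] w(2) z(2) by metis
  obtain C where C: "gen C" "Fx i C" "C *v z = w'" "C *v v = v"
    using transvection_move[OF z(1) w'(1) z(4)] w'(2) z(2) by metis
  show ?thesis
    by (rule exI[of _ "C ** A"]) (use A C in \<open>simp add: gen_mult Fx_mult matrix_vector_mul_assoc[symmetric]\<close>)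
qed

lemma e_Cmp [simp]: "ev i \<in> Cmp i" and f_Cmp [simp]: "fv i \<in> Cmp i"
  by (auto simp: Cmp_def axis_nth')

lemma axis_nz [simp]: "axis j (1::complex) \<noteq> (0 :: complex ^ 'n)"
  by (simp add: axis_eq_0_iff)

lemma Cmp_hyperbolic:
  assumes v: "v \<in> Cmp i" "w \<in> Cmp i" "om v w = 1"
  shows "\<exists>A. gen A \<and> Fx i A \<and> A *v ev i = v \<and> A *v fv i = w"
proof -
  have "v \<noteq> 0" using v(3) by (auto simp: om_simps)
  then obtain A where A: "gen A" "Fx i A" "A *v ev i = v"
    using Cmp_transitive[OF e_Cmp _ v(1)] by auto
  have Sp: "A \<in> Sp" by (rule gen_Sp[OF A(1)])
  have "A *v fv i \<in> Cmp i"
  proof -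
    have "(A *v fv i) $ Inl j = 0 \<and> (A *v fv i) $ Inr j = 0" if j: "lv (Inl j) < lv (Inl i)" for j
    proof -
      have "A *v ev j = ev j" "A *v fv j = fv j" using A(2) j unfolding Fx_def
        by (auto simp: Cmp_def om_axis_left)
      then have "om (ev j) (A *v fv i) = om (ev j) (fv i)" "om (fv j) (A *v fv i) = om (fv j) (fv i)"
        using Sp_om[OF Sp] by metis+
      then show ?thesis using j by (auto simp: om_axis_left axis_nth')
    qed
    then show ?thesis by (simp add: Cmp_def)
  qed
  moreover have "om v (A *v fv i) = 1" using Sp_om[OF Sp, of "ev i" "fv i"] A(3) by (simp add: om_basis)
  ultimately obtain C where C: "gen C" "Fx i C" "C *v v = v" "C *v (A *v fv i) = w"
    using Cmp_move_second[OF v(1) _ _ v(2,3)] by blast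
  show ?thesis
    by (rule exI[of _ "C ** A"]) (use A C in \<open>simp add: gen_mult Fx_mult matrix_vector_mul_assoc[symmetric]\<close>)
qed

lemma mat_eqI_basis:
  assumes "\<And>i. A *v ev i = C *v ev i" "\<And>i. A *v fv i = C *v fv i" shows "A = (C :: cmat)"
proof -
  have "A *v axis j 1 = C *v axis j 1" for j using assms by (cases j) auto
  then have "A $ i $ j = C $ i $ j" for i j by (metis mult_axis_nth)
  then show ?thesis by (simp add: vec_eq_iff)
qed

lemma Cmp_iff: "v \<in> Cmp i \<longleftrightarrow> (\<forall>j. lv (Inl j) < lv (Inl i) \<longrightarrow> om (ev j) v = 0 \<and> om (fv j) v = 0)"
  by (auto simp: Cmp_def om_axis_left)

lemma Fx_basis: "Fx i A \<Longrightarrow> lv (Inl j) < lv (Inl i) \<Longrightarrow> A *v ev j = ev j \<and> A *v fv j = fv j"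
  unfolding Fx_def by (simp add: Cmp_iff)

lemma Sp_fix_Cmp:
  assumes "A \<in> Sp" "\<And>j. lv (Inl j) < lv (Inl i) \<Longrightarrow> A *v ev j = ev j \<and> A *v fv j = fv j" "v \<in> Cmp i"
  shows "A *v v \<in> Cmp i"
  using assms(3) Sp_om[OF assms(1)] assms(2) unfolding Cmp_iff by metis

lemma Sp_step:
  assumes "A \<in> Sp" "\<And>j. lv (Inl j) < lv (Inl i) \<Longrightarrow> A *v ev j = ev j \<and> A *v fv j = fv j"
  obtains g C where "gen g" "C \<in> Sp" "A = g ** C"
    "\<And>j. lv (Inl j) \<le> lv (Inl i) \<Longrightarrow> C *v ev j = ev j \<and> C *v fv j = fv j"
proof -
  obtain g where g: "gen g" "Fx i g" "g *v ev i = A *v ev i" "g *v fv i = A *v fv i"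
    using Cmp_hyperbolic[of "A *v ev i" i "A *v fv i"] Sp_fix_Cmp[OF assms] Sp_om[OF assms(1)]
    by (auto simp: om_basis)
  have gS: "g \<in> Sp" by (rule gen_Sp[OF g(1)])
  have "(adj g ** A) *v ev j = ev j \<and> (adj g ** A) *v fv j = fv j" if "lv (Inl j) \<le> lv (Inl i)" for j
  proof -
    have "A *v ev j = g *v ev j \<and> A *v fv j = g *v fv j"
    proof (cases "j = i")
      case False
      then have "lv (Inl j) < lv (Inl i)" using that lv_inj[of "Inl j" "Inl i"] by force
      then show ?thesis using assms(2) Fx_basis[OF g(2)] by simp
    qed (simp add: g)
    then show ?thesis using gS by (simp add: matrix_vector_mul_assoc[symmetric])
  qed
  then show ?thesis
    using that[of g "adj g ** A"] g(1) gS assms(1) by (simp add: mult_Sp adj_Sp)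
qed

lemma Sp_gen: assumes "A \<in> Sp" shows "gen A"
proof -
  obtain g1 A1 where 1: "gen g1" "A1 \<in> Sp" "A = g1 ** A1"
    "\<And>j. lv (Inl j) \<le> lv (Inl 1) \<Longrightarrow> A1 *v ev j = ev j \<and> A1 *v fv j = fv j"
    using Sp_step[OF assms, of 1] unfolding lv_less by blast
  have le: "lv (Inl j) < lv (Inl 2) \<Longrightarrow> lv (Inl j) \<le> lv (Inl 1)"
    "lv (Inl j) < lv (Inl 3) \<Longrightarrow> lv (Inl j) \<le> lv (Inl 2)" "lv (Inl j) \<le> lv (Inl 3)" for j
    by (rule index3_cases[of j]; simp add: lv_values)+
  obtain g2 A2 where 2: "gen g2" "A2 \<in> Sp" "A1 = g2 ** A2"
    "\<And>j. lv (Inl j) \<le> lv (Inl 2) \<Longrightarrow> A2 *v ev j = ev j \<and> A2 *v fv j = fv j"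
    using Sp_step[OF 1(2), of 2] 1(4) le(1) by metis
  obtain g3 A3 where 3: "gen g3" "A3 \<in> Sp" "A2 = g3 ** A3"
    "\<And>j. lv (Inl j) \<le> lv (Inl 3) \<Longrightarrow> A3 *v ev j = ev j \<and> A3 *v fv j = fv j"
    using Sp_step[OF 2(2), of 3] 2(4) le(2) by metis
  have "A3 = mat 1" by (rule mat_eqI_basis) (use 3(4) le(3) in simp_all)
  then show ?thesis using 1 2 3 by (simp add: gen_mult)
qed

lemma gen_path:
  "gen A \<Longrightarrow> \<exists>\<phi>. (\<forall>i j. upoly (\<lambda>z. \<phi> z $ i $ j)) \<and> (\<forall>z. \<phi> z \<in> Sp) \<and> \<phi> 0 = mat 1 \<and> \<phi> 1 = A"
proof (induction rule: gen.induct)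
  case gen_one
  show ?case by (rule exI[of _ "\<lambda>_. mat 1"]) (auto intro: upoly_intros)
next
  case (gen_R A p q k)
  then obtain \<phi> where \<phi>: "\<forall>i j. upoly (\<lambda>z. \<phi> z $ i $ j)" "\<forall>z. \<phi> z \<in> Sp" "\<phi> 0 = mat 1" "\<phi> 1 = A"
    by blast
  have "upoly (\<lambda>z. (R (z * k) p q ** \<phi> z) $ i $ j)" for i j
    unfolding matrix_matrix_mult_def
    by (simp, intro upoly_sum upoly_mult upoly_R) (use \<phi>(1) in auto)
  then show ?case
    by (intro exI[of _ "\<lambda>z. R (z * k) p q ** \<phi> z"]) (use \<phi> gen_R(2) in \<open>auto intro: mult_Sp R_Sp\<close>)
qed

lemma Sp_hyperbolic_pair:
  assumes "om v w = 1" obtains g where "g \<in> Sp" "g *v ev 1 = v" "g *v fv 1 = w"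
proof -
  have "v \<in> Cmp 1" "w \<in> Cmp 1" by (auto simp: Cmp_def lv_less)
  then show ?thesis using Cmp_hyperbolic[of v 1 w] assms that gen_Sp by blast
qed

lemma Sp_transitive:
  assumes "v \<noteq> 0" "w \<noteq> 0" obtains g where "g \<in> Sp" "g *v v = w"
proof -
  have "v \<in> Cmp 1" "w \<in> Cmp 1" by (auto simp: Cmp_def lv_less)
  then show ?thesis using Cmp_transitive[of v 1 w] assms that gen_Sp by blast
qed

lemma Sp_orthogonal_pair:
  assumes uv: "om u v = 0" and ind: "u \<noteq> 0" "\<And>c. v \<noteq> c *s u"
  obtains g where "g \<in> Sp" "g *v ev 1 = u" "g *v ev 2 = v"
proof -
  obtain g where g: "g \<in> Sp" "g *v ev 1 = u" using Sp_transitive[of "ev 1" u] ind by auto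
  define v' where "v' = adj g *v v"
  define v2 where "v2 = v' - (v' $ Inl 1) *s ev 1"
  have gv': "g *v v' = v" using g by (simp add: v'_def)
  have "om (ev 1) v' = 0" using Sp_om[OF g(1), of "ev 1" v'] g(2) gv' uv by simp
  then have v'1: "v' $ Inr 1 = 0" by (simp add: om_axis_left)
  have C: "v2 \<in> Cmp 2" unfolding Cmp_def lv_less using v'1 by (simp add: v2_def axis_nth')
  have nz: "v2 \<noteq> 0"
  proof
    assume "v2 = 0"
    then have "v' = (v' $ Inl 1) *s ev 1" by (simp add: v2_def)
    then have "v = (v' $ Inl 1) *s u" using gv' g(2) by (metis vector_scalar_commute)
    then show False using ind(2) by blast
  qed
  obtain h where h: "gen h" "Fx 2 h" "h *v ev 2 = v2"
    using Cmp_transitive[OF e_Cmp _ C nz] by auto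
  have h1: "h *v ev 1 = ev 1" using Fx_basis[OF h(2), of 1] by (simp add: lv_values)
  obtain z where z: "z \<in> Cmp 2" "om v2 z \<noteq> 0" using Cmp_partner[OF C nz] .
  have ez: "om (ev 1) z = 0" "om (ev 1) v2 = 0" using z(1) C unfolding Cmp_iff lv_less by auto
  define r where "r = R (v' $ Inl 1 / om v2 z) (ev 1) z"
  have r: "r \<in> Sp" "r *v ev 1 = ev 1" unfolding r_def using ez by (auto intro: R_Sp simp: R_vec)
  have "r *v v2 = v'"
    unfolding r_def using ez(2) om_skew[of v2 "ev 1"] z(2) by (simp add: R_vec v2_def)
  then have "(g ** r ** h) *v ev 1 = u" "(g ** r ** h) *v ev 2 = v"
    using h h1 r g gv' by (simp_all add: matrix_vector_mul_assoc[symmetric])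
  moreover have "g ** r ** h \<in> Sp" using g r gen_Sp[OF h(1)] by (simp add: mult_Sp)
  ultimately show ?thesis using that by blast
qed

subsection \<open>The stabilizer of the standard flag\<close>

definition Fl :: "nat \<Rightarrow> cvec set" where
  "Fl m = {v. \<forall>j. m < lv j \<longrightarrow> v $ j = 0}"

definition Bm :: "cmat set" where
  "Bm = {A \<in> Sp. \<forall>i j. lv j < lv i \<longrightarrow> A $ i $ j = 0}"

definition Tm :: "cmat set" where
  "Tm = {A \<in> Sp. \<forall>i j. i \<noteq> j \<longrightarrow> A $ i $ j = 0}"

lemma Bm_Sp: "A \<in> Bm \<Longrightarrow> A \<in> Sp" by (simp add: Bm_def)

lemma Tm_Bm: "Tm \<subseteq> Bm" 
proof
  fix A assume A: "A \<in> Tm"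
  have "A $ i $ j = 0" if "lv j < lv i" for i j
    using A that by (cases "i = j") (auto simp: Tm_def)
  then show "A \<in> Bm" using A by (simp add: Bm_def Tm_def)
qed

lemma one_Bm [simp]: "mat 1 \<in> Bm"
  using one_Sp by (simp add: Bm_def) (auto simp: mat_def)

lemma mult_Bm: assumes "A \<in> Bm" "C \<in> Bm" shows "A ** C \<in> Bm"
proof -
  have "(A ** C) $ i $ j = 0" if ij: "lv j < lv i" for i j
  proof -
    have "A $ i $ k * C $ k $ j = 0" for k
      using assms ij by (cases "lv k < lv i") (auto simp: Bm_def)
    then show ?thesis by (simp only: matrix_matrix_mult_def vec_lambda_beta sum.neutral_const)
  qed
  then show ?thesis using assms by (simp add: Bm_def mult_Sp)
qed

lemma adj_Bm: "A \<in> Bm \<Longrightarrow> adj A \<in> Bm"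
proof -
  assume A: "A \<in> Bm"
  have "A $ flip j $ flip i = 0" if "lv j < lv i" for i j
  proof -
    have "lv (flip i) < lv (flip j)" using that lv_bounds[of i] lv_bounds[of j] by (simp add: lv_flip)
    then show ?thesis using A by (simp add: Bm_def)
  qed
  then show "adj A \<in> Bm" using A adj_Sp by (auto simp: Bm_def adj_def)
qed

lemma axis_Fl [simp]: "axis j 1 \<in> Fl m \<longleftrightarrow> lv j \<le> m"
  by (auto simp: Fl_def axis_nth' not_less)

lemma Fl_add: "v \<in> Fl m \<Longrightarrow> w \<in> Fl m \<Longrightarrow> v + w \<in> Fl m"
  and Fl_diff: "v \<in> Fl m \<Longrightarrow> w \<in> Fl m \<Longrightarrow> v - w \<in> Fl m"
  and Fl_scale: "v \<in> Fl m \<Longrightarrow> c *s v \<in> Fl m"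
  by (auto simp: Fl_def)

lemma Fl_mono: "v \<in> Fl m \<Longrightarrow> m \<le> n \<Longrightarrow> v \<in> Fl n"
  by (auto simp: Fl_def)

lemma Bm_Fl: assumes "A \<in> Bm" "v \<in> Fl m" shows "A *v v \<in> Fl m"
proof -
  have "A $ i $ j * v $ j = 0" if "m < lv i" for i j
    using assms that by (cases "lv j < lv i") (auto simp: Bm_def Fl_def)
  then show ?thesis
    unfolding Fl_def matrix_vector_mult_def by (auto intro!: sum.neutral simp del: mult_eq_0_iff)
qed

lemma om_Fl: assumes "v \<in> Fl a" "w \<in> Fl b" "a + b \<le> 6" shows "om v w = 0"
proof -
  have "v $ j * w $ flip j = 0" for j
    using assms lv_bounds[of j] by (cases "a < lv j") (auto simp: Fl_def lv_flip)
  then show ?thesis by (simp only: om_def mult.assoc mult_zero_right sum.neutral_const)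
qed

lemma R_Bm:
  assumes "om p q = 0" "p \<in> Fl a" "q \<in> Fl b" "a + b \<le> 7" shows "R k p q \<in> Bm"
proof -
  have 1: "om (axis j 1) p * q $ i = 0" if "p \<in> Fl a" "q \<in> Fl b" "a + b \<le> 7" "lv j < lv i"
    for i j p q a b
    using that lv_bounds[of j] by (cases "b < lv i") (auto simp: om_axis_left Fl_def lv_flip)
  have "R k p q $ i $ j = 0" if "lv j < lv i" for i j
    using 1[of p a q b j i] 1[of q b p a j i] assms that by (auto simp: R_def)
  then show ?thesis using R_Sp[OF assms(1)] by (simp add: Bm_def)
qed

text \<open>A symplectic matrix preserving the isotropic part of the flag preserves all of it.\<close>

lemma Bm_criterion:
  assumes "A \<in> Sp" "\<And>j. lv j \<le> 3 \<Longrightarrow> A *v axis j 1 \<in> Fl (lv j)"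
    "\<And>j. lv j \<le> 3 \<Longrightarrow> adj A *v axis j 1 \<in> Fl (lv j)"
  shows "A \<in> Bm"
proof -
  have "A $ i $ j = 0" if ij: "lv j < lv i" for i j
  proof (cases "lv j \<le> 3")
    case True
    then show ?thesis using assms(2)[OF True] ij unfolding Fl_def by (auto simp: mult_axis_nth)
  next
    case False
    then have "lv (flip i) \<le> 3" "lv (flip i) < lv (flip j)"
      using ij lv_bounds[of i] lv_bounds[of j] by (auto simp: lv_flip)
    then have "(adj A *v axis (flip i) 1) $ flip j = 0" using assms(3) by (auto simp: Fl_def)
    then have "adj A $ flip j $ flip i = 0" by (simp only: mult_axis_nth)
    then show ?thesis by (simp add: adj_def)
  qed
  then show ?thesis using assms(1) by (simp add: Bm_def)
qed

section \<open>The algebraic group\<close>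

text \<open>Matrices are turned into points of affine space by an arbitrary enumeration of the 36
  positions.\<close>

definition ent :: "nat \<Rightarrow> (3 + 3) \<times> (3 + 3)" where
  "ent = (SOME h. bij_betw h {..<36} UNIV)"

definition pos :: "(3 + 3) \<times> (3 + 3) \<Rightarrow> nat" where
  "pos = inv_into {..<36} ent"

lemma bij_ent: "bij_betw ent {..<36} UNIV"
proof -
  have "CARD((3 + 3) \<times> (3 + 3)) = 36" by simp
  then have "\<exists>h :: nat \<Rightarrow> (3 + 3) \<times> (3 + 3). bij_betw h {..<36} UNIV"
    using ex_bij_betw_nat_finite[of "UNIV :: ((3 + 3) \<times> (3 + 3)) set"] by (simp add: lessThan_atLeast0)
  then show ?thesis unfolding ent_def by (rule someI_ex)
qed

lemma ent_pos [simp]: "ent (pos p) = p"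
  unfolding pos_def using bij_betw_inv_into_right[OF bij_ent] by simp

lemma pos_ent [simp]: "n < 36 \<Longrightarrow> pos (ent n) = n"
  unfolding pos_def using bij_betw_inv_into_left[OF bij_ent] by simp

lemma pos_less [simp]: "pos p < 36"
  using bij_betw_inv_into[OF bij_ent] unfolding pos_def bij_betw_def by auto

definition enc :: "cmat \<Rightarrow> complex point" where
  "enc A = (\<lambda>n\<in>{..<36}. A $ fst (ent n) $ snd (ent n))"

definition dec :: "complex point \<Rightarrow> cmat" where
  "dec x = (\<chi> i j. x (pos (i, j)))"

lemma dec_enc [simp]: "dec (enc A) = A"
  by (simp add: dec_def enc_def vec_eq_iff)

lemma enc_affine [simp]: "enc A \<in> \<A> 36"
  by (auto simp: enc_def affine_CC)

lemma enc_dec [simp]: assumes "x \<in> \<A> 36" shows "enc (dec x) = x"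
proof
  fix n show "enc (dec x) n = x n"
    using assms by (cases "n < 36") (auto simp: enc_def dec_def affine_CC PiE_def extensional_def)
qed

lemma enc_inject [simp]: "enc A = enc C \<longleftrightarrow> A = C"
  by (metis dec_enc)

lemma inj_enc: "inj enc"
  by (simp add: inj_def)

text \<open>Families of matrices with polynomial entries.\<close>

definition mp :: "('p \<Rightarrow> complex) set \<Rightarrow> ('p \<Rightarrow> cmat) \<Rightarrow> bool" where
  "mp S \<phi> \<longleftrightarrow> (\<forall>i j. (\<lambda>x. \<phi> x $ i $ j) \<in> pf S)"

definition vp :: "('p \<Rightarrow> complex) set \<Rightarrow> ('p \<Rightarrow> cvec) \<Rightarrow> bool" where
  "vp S \<phi> \<longleftrightarrow> (\<forall>i. (\<lambda>x. \<phi> x $ i) \<in> pf S)"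

lemma mp_const: "mp S (\<lambda>_. A)" and vp_const: "vp S (\<lambda>_. v)"
  by (simp_all add: mp_def vp_def pf_const)

lemma mp_mult: "mp S \<phi> \<Longrightarrow> mp S \<psi> \<Longrightarrow> mp S (\<lambda>x. \<phi> x ** \<psi> x)"
  by (simp add: mp_def matrix_matrix_mult_def pf_sum pf_mult)

lemma mp_adj: "mp S \<phi> \<Longrightarrow> mp S (\<lambda>x. adj (\<phi> x))"
  by (simp add: mp_def adj_def pf_mult pf_const)

lemma mp_add: "mp S \<phi> \<Longrightarrow> mp S \<psi> \<Longrightarrow> mp S (\<lambda>x. \<phi> x + \<psi> x)"
  and mp_diff: "mp S \<phi> \<Longrightarrow> mp S \<psi> \<Longrightarrow> mp S (\<lambda>x. \<phi> x - \<psi> x)"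
  by (simp_all add: mp_def pf_add pf_diff)

lemma vp_mult: "mp S \<phi> \<Longrightarrow> vp S \<psi> \<Longrightarrow> vp S (\<lambda>x. \<phi> x *v \<psi> x)"
  by (simp add: mp_def vp_def matrix_vector_mult_def pf_sum pf_mult)

lemma vp_om: "vp S \<phi> \<Longrightarrow> vp S \<psi> \<Longrightarrow> (\<lambda>x. om (\<phi> x) (\<psi> x)) \<in> pf S"
  unfolding om_def vp_def by (intro pf_sum pf_mult pf_const) auto

lemma mp_entry: "mp S \<phi> \<Longrightarrow> (\<lambda>x. \<phi> x $ i $ j) \<in> pf S"
  by (simp add: mp_def)

lemma mp_enc: "mp S \<phi> \<Longrightarrow> n < 36 \<Longrightarrow> (\<lambda>x. enc (\<phi> x) n) \<in> pf S"
  by (simp add: mp_def enc_def)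

lemma mp_dec: "mp (coords 36) dec"
  unfolding mp_def dec_def by (simp add: pf_coord)

lemma mp_dec_fst: "mp (pair_coords 36) (\<lambda>z. dec (fst z))"
  and mp_dec_snd: "mp (pair_coords 36) (\<lambda>z. dec (snd z))"
  unfolding mp_def dec_def by (auto intro!: poly_funs.coord simp: pair_coords_def intro: pos_less)

lemmas mp_intros = mp_const vp_const mp_mult mp_adj mp_add mp_diff vp_mult vp_om mp_dec mp_entry

text \<open>A polynomial function of the entries restricts to a polynomial on curves of matrices.\<close>

lemma upoly_mult_matrix:
  assumes "\<And>i j. upoly (\<lambda>z. \<phi> z $ i $ j)" "\<And>i j. upoly (\<lambda>z. \<psi> z $ i $ j)"
  shows "upoly (\<lambda>z. ((\<phi> z :: cmat) ** \<psi> z) $ i $ j)"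
  by (simp add: matrix_matrix_mult_def upoly_sum upoly_mult assms)

lemma upoly_enc: "(\<And>i j. upoly (\<lambda>z. \<phi> z $ i $ j)) \<Longrightarrow> n < 36 \<Longrightarrow> upoly (\<lambda>z. enc (\<phi> z) n)"
  by (simp add: enc_def)

definition G :: "complex point monoid" where
  "G = \<lparr>carrier = enc ` Sp, mult = (\<lambda>x y. enc (dec x ** dec y)), one = enc (mat 1)\<rparr>"

lemma G_simps [simp]: "carrier G = enc ` Sp" "x \<otimes>\<^bsub>G\<^esub> y = enc (dec x ** dec y)"
  "\<one>\<^bsub>G\<^esub> = enc (mat 1)"
  by (simp_all add: G_def)

lemma group_G: "group G"
proof (rule groupI)
  fix x assume "x \<in> carrier G"
  then obtain A where A: "x = enc A" "A \<in> Sp" by auto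
  then show "\<exists>y\<in>carrier G. y \<otimes>\<^bsub>G\<^esub> x = \<one>\<^bsub>G\<^esub>"
    by (intro bexI[of _ "enc (adj A)"]) (auto simp: Sp_adj_left adj_Sp)
qed (auto simp: mult_Sp matrix_mul_assoc)

interpretation G: group G by (rule group_G)

lemma inv_G [simp]: "A \<in> Sp \<Longrightarrow> inv\<^bsub>G\<^esub> (enc A) = enc (adj A)"
  by (rule G.inv_equality) (auto simp: Sp_adj_left adj_Sp)

lemma carrier_G_closed: "closedin (zar 36) (carrier G)"
proof -
  define F where "F = (\<lambda>(i, j) x. (adj (dec x) ** dec x) $ i $ j - mat 1 $ i $ j) ` UNIV"
  have "F \<subseteq> pf (coords 36)"
    unfolding F_def by (auto intro!: pf_diff pf_const mp_intros)
  moreover have "enc ` Sp = {x \<in> \<A> 36. \<forall>g\<in>F. g x = 0}"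
  proof -
    have "(\<forall>g\<in>F. g x = 0) \<longleftrightarrow> dec x \<in> Sp" for x
      by (simp add: F_def Sp_iff vec_eq_iff)
    then show ?thesis by (auto simp: image_iff) (metis enc_dec)
  qed
  ultimately show ?thesis unfolding closedin_zar by auto
qed

lemma affine_alg_group_G: "affine_alg_group CC 36 G"
  unfolding affine_alg_group_def
proof (intro conjI)
  show "regular_map CC (pair_coords 36) (carrier G \<times> carrier G) (coords 36) (\<lambda>z. fst z \<otimes>\<^bsub>G\<^esub> snd z)"
    unfolding regular_map_def
  proof
    fix s :: "complex point \<Rightarrow> complex" assume "s \<in> coords 36"
    then obtain n where n: "s = (\<lambda>x. x n)" "n < 36" by (auto simp: coords_def)
    have "(\<lambda>z. enc (dec (fst z) ** dec (snd z)) n) \<in> pf (pair_coords 36)"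
      by (intro mp_enc n mp_mult mp_dec_fst mp_dec_snd)
    then show "\<exists>p\<in>pf (pair_coords 36). \<forall>x\<in>carrier G \<times> carrier G. s (fst x \<otimes>\<^bsub>G\<^esub> snd x) = p x"
      by (intro bexI) (auto simp: n)
  qed
  show "regular_map CC (coords 36) (carrier G) (coords 36) (\<lambda>x. inv\<^bsub>G\<^esub> x)"
    unfolding regular_map_def
  proof
    fix s :: "complex point \<Rightarrow> complex" assume "s \<in> coords 36"
    then obtain n where n: "s = (\<lambda>x. x n)" "n < 36" by (auto simp: coords_def)
    have "(\<lambda>x. enc (adj (dec x)) n) \<in> pf (coords 36)"
      by (intro mp_enc n mp_intros)
    then show "\<exists>p\<in>pf (coords 36). \<forall>x\<in>carrier G. s (inv\<^bsub>G\<^esub> x) = p x"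
      by (intro bexI) (auto simp: n)
  qed
qed (auto simp: group_G carrier_G_closed[simplified])

subsection \<open>Conjugacy classes\<close>

definition cls :: "cmat \<Rightarrow> cmat set" where
  "cls A = {g ** A ** adj g | g. g \<in> Sp}"

lemma clsI: "g \<in> Sp \<Longrightarrow> g ** A ** adj g \<in> cls A"
  by (auto simp: cls_def)

lemma cls_Sp: "A \<in> Sp \<Longrightarrow> cls A \<subseteq> Sp"
  by (auto simp: cls_def mult_Sp adj_Sp)

lemma adj_mult: assumes "A \<in> Sp" "C \<in> Sp" shows "adj (A ** C) = adj C ** adj A"
proof -
  have "adj (A ** C) = adj (A ** C) ** ((A ** C) ** (adj C ** adj A))"
    using assms by (simp add: matrix_mul_assoc[symmetric] Sp_adj_right)
  then show ?thesis using mult_Sp[OF assms] by simp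
qed

lemma cls_conj: "C \<in> cls A \<Longrightarrow> g \<in> Sp \<Longrightarrow> g ** C ** adj g \<in> cls A"
proof -
  assume "C \<in> cls A" and g: "g \<in> Sp"
  then obtain h where h: "h \<in> Sp" "C = h ** A ** adj h" by (auto simp: cls_def)
  then show "g ** C ** adj g \<in> cls A"
    unfolding cls_def using g
    by (auto intro!: exI[of _ "g ** h"] simp: mult_Sp adj_mult matrix_mul_assoc)
qed

lemma cls_self: "A \<in> cls A"
  unfolding cls_def by (rule CollectI, rule exI[of _ "mat 1"]) (simp add: adj_R[of 0 0 0, simplified])

lemma cls_eq: assumes "C \<in> cls A" shows "cls C = cls A"
proof -
  obtain g where g: "g \<in> Sp" "C = g ** A ** adj g" using assms by (auto simp: cls_def)
  have "adj g ** C ** adj (adj g) = A"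
    using g by (simp add: matrix_mul_assoc[symmetric] Sp_adj_left)
  then have "A \<in> cls C" using cls_conj[OF cls_self adj_Sp[OF g(1)]] by metis
  then show ?thesis using assms cls_conj unfolding cls_def by blast
qed

lemma conj_class_G: "A \<in> Sp \<Longrightarrow> conj_class G (enc A) = enc ` cls A"
  unfolding conj_class_def cls_def by (force simp: image_iff)

lemma conj_classes_G: "conj_classes G = {enc ` cls A | A. A \<in> Sp}"
  unfolding conj_classes_def by (auto simp: conj_class_G) (metis conj_class_G image_eqI)

lemma Sp_curve: assumes "A \<in> Sp" "C \<in> Sp"
  obtains \<phi> where "\<And>i j. upoly (\<lambda>z. \<phi> z $ i $ j)" "\<And>z. \<phi> z \<in> Sp" "\<phi> 0 = A" "\<phi> 1 = C"
proof -
  obtain \<phi> where \<phi>: "\<forall>i j. upoly (\<lambda>z. \<phi> z $ i $ j)" "\<forall>z. \<phi> z \<in> Sp" "\<phi> 0 = mat 1" "\<phi> 1 = adj A ** C"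
    using gen_path[OF Sp_gen, of "adj A ** C"] assms by (auto simp: mult_Sp adj_Sp)
  show ?thesis
    by (rule that[of "\<lambda>z. A ** \<phi> z"])
      (use \<phi> assms in \<open>auto simp: mult_Sp intro: upoly_mult_matrix upoly_const\<close>)
qed

lemma irreducible_Sp: "zar_irreducible 36 (enc ` Sp)"
proof (rule zar_irreducibleI_curves, clarify)
  fix A C assume "A \<in> Sp" "C \<in> Sp"
  then obtain \<phi> where "\<And>i j. upoly (\<lambda>z. \<phi> z $ i $ j)" "\<And>z. \<phi> z \<in> Sp" "\<phi> 0 = A" "\<phi> 1 = C"
    using Sp_curve by blast
  then show "\<exists>\<phi> a b. (\<forall>z. \<phi> z \<in> enc ` Sp) \<and> (\<forall>i<36. upoly (\<lambda>z. \<phi> z i)) \<and> \<phi> a = enc A \<and> \<phi> b = enc C"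
    by (rule_tac exI[of _ "\<lambda>z. enc (\<phi> z)"], rule_tac exI[of _ 0], rule_tac exI[of _ 1]) (auto intro: upoly_enc)
qed

lemma irreducible_cls: "zar_irreducible 36 (enc ` cls A)"
proof (rule zar_irreducibleI_curves, clarify)
  fix C D assume "C \<in> cls A" "D \<in> cls A"
  then obtain g h where gh: "g \<in> Sp" "h \<in> Sp" "C = g ** A ** adj g" "D = h ** A ** adj h"
    unfolding cls_def by auto
  then obtain \<phi> where \<phi>: "\<And>i j. upoly (\<lambda>z. \<phi> z $ i $ j)" "\<And>z. \<phi> z \<in> Sp" "\<phi> 0 = g" "\<phi> 1 = h"
    using Sp_curve by blast
  have "upoly (\<lambda>z. adj (\<phi> z) $ i $ j)" for i j
    unfolding adj_def by (simp, intro upoly_mult upoly_const \<phi>)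
  then show "\<exists>\<phi> a b. (\<forall>z. \<phi> z \<in> enc ` cls A) \<and> (\<forall>i<36. upoly (\<lambda>z. \<phi> z i)) \<and> \<phi> a = enc C \<and> \<phi> b = enc D"
    by (rule_tac exI[of _ "\<lambda>z. enc (\<phi> z ** A ** adj (\<phi> z))"], rule_tac exI[of _ 0], rule_tac exI[of _ 1])
      (use \<phi> gh in \<open>auto intro!: clsI imageI upoly_enc upoly_mult_matrix upoly_const\<close>)
qed

subsection \<open>Reductivity\<close>

lemma unipotent_nilpotent:
  assumes "unipotent CC 36 G (enc A)"
  shows "\<exists>m. (((*v) (A - mat 1)) ^^ m) v = 0"
proof -
  define T where "T = (\<lambda>(h :: complex point \<Rightarrow> complex) y. h (y \<otimes>\<^bsub>G\<^esub> enc A) \<ominus>\<^bsub>CC\<^esub> h y)"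
  let ?i = "Inl 1 :: 3 + 3"
  define F where "F = (\<lambda>v x. (dec x *v v) $ ?i)"
  have TF: "T (F v) = F ((A - mat 1) *v v)" for v
    by (simp add: T_def F_def fun_eq_iff matrix_vector_mul_assoc[symmetric] matrix_vector_mult_diff_rdistrib
      matrix_vector_mult_diff_distrib)
  have Tm: "(T ^^ m) (F v) = F ((((*v) (A - mat 1)) ^^ m) v)" for m v
    by (induction m) (simp_all only: funpow.simps comp_apply TF id_apply)
  have "vp (coords 36) (\<lambda>x. dec x *v v)" by (intro mp_intros)
  then have "F v \<in> pf (coords 36)" by (simp add: F_def vp_def)
  then obtain m where m: "\<And>x. x \<in> carrier G \<Longrightarrow> (T ^^ m) (F v) x = 0"
    using assms unfolding unipotent_def T_def CC_simps by blast
  define w where "w = (((*v) (A - mat 1)) ^^ m) v"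
  have inv: "(h *v w) $ ?i = 0" if h: "h \<in> Sp" for h
  proof -
    have "(T ^^ m) (F v) (enc h) = 0" using h by (intro m) simp
    then show ?thesis unfolding Tm by (simp add: F_def w_def)
  qed
  have "w = 0"
  proof (rule ccontr)
    assume "w \<noteq> 0"
    then obtain h where "h \<in> Sp" "h *v w = axis ?i 1"
      using Sp_transitive[of w "axis ?i 1"] by (metis axis_nz)
    then show False using inv[of h] by (simp add: axis_nth')
  qed
  then show ?thesis unfolding w_def by blast
qed

lemma unipotent_eigenvalue:
  assumes "unipotent CC 36 G (enc A)" "A *v v = c *s v" "v \<noteq> 0"
  shows "c = 1"
proof -
  have 1: "(A - mat 1) *v v = (c - 1) *s v"
    by (simp add: matrix_vector_mult_diff_rdistrib assms(2) vec_eq_iff algebra_simps)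
  have "(((*v) (A - mat 1)) ^^ m) v = (c - 1) ^ m *s v" for m
    by (induction m) (simp, simp only: funpow.simps comp_apply vector_scalar_commute 1, simp add: vec_eq_iff algebra_simps)
  then show ?thesis using unipotent_nilpotent[OF assms(1), of v] assms(3) by (auto simp: vec_eq_iff)
qed

lemma conj_R: assumes "g \<in> Sp" shows "g ** R k p q ** adj g = R k (g *v p) (g *v q)"
proof -
  have "om (adj g *v w) p = om w (g *v p)" for w p using om_adj'[of w g p] by simp
  then show ?thesis
    using assms by (simp add: matrix_eq matrix_vector_mul_assoc[symmetric] R_vec
      matrix_vector_right_distrib vector_scalar_commute)
qed

text \<open>A noncentral normal subgroup contains products of a transvection and the inverse of another
  one that have the eigenvalue 2.\<close>

lemma unipotent_normal_trivial:
  assumes H: "subgroup (enc ` H) G" "H \<subseteq> Sp"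
    and normal: "\<And>g h. g \<in> Sp \<Longrightarrow> h \<in> H \<Longrightarrow> g ** h ** adj g \<in> H"
    and unip: "\<And>h. h \<in> H \<Longrightarrow> unipotent CC 36 G (enc h)"
    and A: "A \<in> H"
  shows "A = mat 1"
proof (cases "\<exists>u. om (A *v u) u \<noteq> 0")
  case True
  then obtain u where u: "om (A *v u) u \<noteq> 0" by auto
  define a where "a = A *v u"
  define \<tau> where "\<tau> = csqrt (1 / 2)"
  have \<tau>: "\<tau> * \<tau> = 1 / 2" using power2_csqrt[of "1/2"] unfolding \<tau>_def power2_eq_square by simp
  define s where "s = om a u"
  have s: "s \<noteq> 0" "om u a = - s" using u om_skew[of u a] by (simp_all add: s_def a_def)
  define k where "k = \<tau> / (2 * s)"
  have AS: "A \<in> Sp" using A H by auto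
  have uS: "R k u u \<in> Sp" "R (- k) u u \<in> Sp" by (auto intro: R_Sp)
  have Ai: "adj A \<in> H"
    using subgroup.m_inv_closed[OF H(1), of "enc A"] A AS by auto
  have "R k u u ** adj A ** adj (R k u u) \<in> H" by (rule normal[OF uS(1) Ai])
  then have "A ** (R k u u ** adj A ** adj (R k u u)) \<in> H"
    using subgroup.m_closed[OF H(1), of "enc A" "enc (R k u u ** adj A ** adj (R k u u))"] A by auto
  moreover have "A ** (R k u u ** adj A ** adj (R k u u)) = R k a a ** R (- k) u u"
    using conj_R[OF AS, of k u u] by (simp add: matrix_mul_assoc adj_R a_def)
  ultimately have "unipotent CC 36 G (enc (R k a a ** R (- k) u u))" using unip by simp
  moreover have "(R k a a ** R (- k) u u) *v (a - \<tau> *s u) = 2 *s (a - \<tau> *s u)"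
  proof -
    have 1: "2 * k * s = \<tau>" using s by (simp add: k_def)
    have "R (- k) u u *v (a - \<tau> *s u) = a - (2 * \<tau>) *s u"
      using 1 by (simp add: R_vec om_simps s_def[symmetric] vec_eq_iff algebra_simps)
    moreover have "R k a a *v (a - (2 * \<tau>) *s u) = (1 + 2 * (\<tau> * \<tau>)) *s a - (2 * \<tau>) *s u"
      using 1 by (simp add: R_vec om_simps s(2) vec_eq_iff algebra_simps) 
    ultimately have "(R k a a ** R (- k) u u) *v (a - \<tau> *s u) = (1 + 2 * (\<tau> * \<tau>)) *s a - (2 * \<tau>) *s u"
      by (simp only: matrix_vector_mul_assoc[symmetric])
    then show ?thesis by (simp add: \<tau> vec_eq_iff algebra_simps)
  qed
  moreover have "a - \<tau> *s u \<noteq> 0"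
  proof
    assume "a - \<tau> *s u = 0"
    then have "om (a - \<tau> *s u) u = 0" by (simp add: om_simps)
    then show False using s by (simp add: om_simps s_def)
  qed
  ultimately have "(2::complex) = 1" by (rule unipotent_eigenvalue)
  then show ?thesis by simp
next
  case False
  then have 0: "\<And>u. om (A *v u) u = 0" by auto
  have AS: "A \<in> Sp" using A H by auto
  have AA: "A *v (A *v u) = u" for u
  proof -
    have "om (A *v u) w = om u (A *v w)" for w
      using 0[of "u + w"] 0[of u] 0[of w] om_skew[of u "A *v w"]
      by (simp add: matrix_vector_right_distrib om_simps add_eq_0_iff)
    then have "om (adj A *v u - A *v u) w = 0" for w
      using om_adj'[of u A w] by (simp add: om_simps)
    then have "adj A *v u - A *v u = 0" by (rule om_eq_zero)
    then show ?thesis using AS Sp_adj_vec(2)[of A u] by simp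
  qed
  have "A *v v - v = 0" for v
  proof (rule ccontr)
    assume "A *v v - v \<noteq> 0"
    moreover have "A *v (A *v v - v) = (-1) *s (A *v v - v)"
      by (simp add: matrix_vector_mult_diff_distrib AA vec_eq_iff)
    ultimately have "(-1::complex) = 1" using unipotent_eigenvalue unip[OF A] by blast
    then show False by simp
  qed
  then show ?thesis by (simp add: matrix_eq)
qed

theorem connected_reductive_G: "connected_reductive CC 36 G"
  unfolding connected_reductive_def
proof (intro conjI allI impI)
  show "affine_alg_group CC 36 G" by (rule affine_alg_group_G)
  show "connectedin (zar 36) (carrier G)"
    using zar_irreducible_connected[OF irreducible_Sp] by (simp add: image_subset_iff)
  fix H' assume H': "closed_subgroup CC 36 G H' \<and> connectedin (zar 36) H' \<and> H' \<lhd> G \<and>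
    (\<forall>h\<in>H'. unipotent CC 36 G h)"
  then have sub: "subgroup H' G" and nrm: "H' \<lhd> G" by (auto simp: closed_subgroup_def)
  define H where "H = {A \<in> Sp. enc A \<in> H'}"
  have eq: "H' = enc ` H" using subgroup.subset[OF sub] by (auto simp: H_def)
  have "A = mat 1" if "A \<in> H" for A
  proof (rule unipotent_normal_trivial[of H])
    show "subgroup (enc ` H) G" using sub eq by simp
    show "g ** h ** adj g \<in> H" if "g \<in> Sp" "h \<in> H" for g h
      using normal.inv_op_closed2[OF nrm, of "enc g" "enc h"] that
      by (auto simp: H_def mult_Sp adj_Sp)
  qed (use that H' in \<open>auto simp: H_def\<close>)
  moreover have "mat 1 \<in> H" using subgroup.one_closed[OF sub] by (simp add: H_def)
  ultimately have "H = {mat 1}" by blast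
  then show "H' = {\<one>\<^bsub>G\<^esub>}" by (simp add: eq)
qed

lemma zero_or_good_char_G: "zero_or_good_char CC 36 G"
  unfolding zero_or_good_char_def by (auto simp: prime_gt_0_nat)

section \<open>The theorem of Lie and Kolchin\<close>

subsection \<open>Connectedness of derived groups\<close>

lemma continuous_map_mp:
  assumes "mp (coords 36) \<phi>" shows "continuous_map (zar 36) (zar 36) (\<lambda>x. enc (\<phi> x))"
  by (rule continuous_map_zar) (auto intro: mp_enc assms)

lemma connectedin_mp_image:
  assumes "connectedin (zar 36) H" "mp (coords 36) \<phi>"
  shows "connectedin (zar 36) ((\<lambda>x. enc (\<phi> x)) ` H)"
  using connectedin_continuous_map_image[OF continuous_map_mp[OF assms(2)] assms(1)] .

lemma inv_G': "x \<in> carrier G \<Longrightarrow> inv\<^bsub>G\<^esub> x = enc (adj (dec x))"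
  by auto

lemma generate_connected:
  assumes S: "connectedin (zar 36) S" "S \<subseteq> carrier G" "\<one>\<^bsub>G\<^esub> \<in> S"
  shows "connectedin (zar 36) (generate G S)"
proof -
  have gen_sub: "generate G S \<subseteq> carrier G" by (rule G.generate_incl[OF S(2)])
  have "\<exists>C. connectedin (zar 36) C \<and> \<one>\<^bsub>G\<^esub> \<in> C \<and> x \<in> C \<and> C \<subseteq> generate G S" if "x \<in> generate G S" for x
    using that
  proof induction
    case one
    then show ?case using S by (intro exI[of _ S]) (auto intro: generate.incl)
  next
    case (incl h)
    then show ?case using S by (intro exI[of _ S]) (auto intro: generate.incl)
  next
    case (inv h)
    have eq: "(\<lambda>x. enc (adj (dec x))) ` S = (\<lambda>x. inv\<^bsub>G\<^esub> x) ` S"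
      using S(2) by (intro image_cong) auto
    have "connectedin (zar 36) ((\<lambda>x. enc (adj (dec x))) ` S)"
      by (intro connectedin_mp_image S mp_intros)
    moreover have "\<one>\<^bsub>G\<^esub> \<in> (\<lambda>x. inv\<^bsub>G\<^esub> x) ` S" using S(3) by (metis G.inv_one imageI)
    ultimately show ?case unfolding eq
      by (intro exI[of _ "(\<lambda>x. inv\<^bsub>G\<^esub> x) ` S"]) (use inv in \<open>auto intro: generate.inv\<close>)
  next
    case (eng h1 h2)
    then obtain C1 C2 where C: "connectedin (zar 36) C1" "\<one>\<^bsub>G\<^esub> \<in> C1" "h1 \<in> C1" "C1 \<subseteq> generate G S"
      "connectedin (zar 36) C2" "\<one>\<^bsub>G\<^esub> \<in> C2" "h2 \<in> C2" "C2 \<subseteq> generate G S" by blast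
    define D where "D = (\<lambda>x. enc (dec h1 ** dec x)) ` C2"
    have "connectedin (zar 36) D" unfolding D_def by (intro connectedin_mp_image C mp_intros)
    moreover have h1: "h1 \<in> carrier G" using eng gen_sub by auto
    then have "h1 \<in> D" unfolding D_def using C(6) by (intro image_eqI[of _ _ "\<one>\<^bsub>G\<^esub>"]) auto
    ultimately have "connectedin (zar 36) (C1 \<union> D)" using C by (intro connectedin_Un) auto
    moreover have "D \<subseteq> generate G S"
      unfolding D_def using generate.eng[OF eng(1)] C(8) by auto
    ultimately show ?case
      by (intro exI[of _ "C1 \<union> D"]) (use C in \<open>auto simp: D_def\<close>)
  qed
  then obtain C where C: "\<And>x. x \<in> generate G S \<Longrightarrow>
    connectedin (zar 36) (C x) \<and> \<one>\<^bsub>G\<^esub> \<in> C x \<and> x \<in> C x \<and> C x \<subseteq> generate G S" by metis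
  have "connectedin (zar 36) (\<Union>(C ` generate G S))"
    using C by (intro connectedin_Union) auto
  moreover have "\<Union>(C ` generate G S) = generate G S" using C by blast
  ultimately show ?thesis by simp
qed

lemma derived_connected:
  assumes "subgroup H G" "connectedin (zar 36) H"
  shows "connectedin (zar 36) (derived G H)"
  unfolding derived_def
proof (rule generate_connected)
  have H: "H \<subseteq> carrier G" "\<one>\<^bsub>G\<^esub> \<in> H" using assms(1) by (auto simp: subgroup_def)
  define S where "S = (\<lambda>k. (\<lambda>h. enc (dec h ** dec k ** adj (dec h) ** adj (dec k))) ` H)"
  have eq: "derived_set G H = \<Union>(S ` H)"
  proof -
    have "h \<otimes>\<^bsub>G\<^esub> k \<otimes>\<^bsub>G\<^esub> inv\<^bsub>G\<^esub> h \<otimes>\<^bsub>G\<^esub> inv\<^bsub>G\<^esub> k = enc (dec h ** dec k ** adj (dec h) ** adj (dec k))"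
      if hk: "h \<in> H" "k \<in> H" for h k
    proof -
      from hk H have "h \<in> enc ` Sp" "k \<in> enc ` Sp" by auto
      then obtain A C where "h = enc A" "k = enc C" "A \<in> Sp" "C \<in> Sp" by blast
      then show ?thesis by simp
    qed
    then have "derived_set G H = (\<Union>h\<in>H. \<Union>k\<in>H. {enc (dec h ** dec k ** adj (dec h) ** adj (dec k))})"
      by (intro SUP_cong refl) (simp only:)
    then show ?thesis unfolding S_def by (auto simp: image_iff)
  qed
  have "\<one>\<^bsub>G\<^esub> \<in> S k" if "k \<in> H" for k
    unfolding S_def using that H by (intro image_eqI[of _ _ "\<one>\<^bsub>G\<^esub>"]) (auto simp: Sp_adj_right Sp_adj_left[of "mat 1", simplified])
  moreover have "connectedin (zar 36) (S k)" for k
    unfolding S_def by (intro connectedin_mp_image assms mp_intros)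
  ultimately show "connectedin (zar 36) (derived_set G H)" "\<one>\<^bsub>G\<^esub> \<in> derived_set G H"
    unfolding eq using H(2) by (auto intro!: connectedin_Union)
  show "derived_set G H \<subseteq> carrier G" by (rule G.derived_set_in_carrier[OF H(1)])
qed

subsection \<open>Eigenvectors modulo a subspace\<close>

lemma annihilating_polynomial:
  fixes A :: cmat
  shows "\<exists>p. p \<noteq> 0 \<and> (\<forall>v. (\<Sum>k\<le>Polynomial.degree p. Polynomial.coeff p k *s ((*v) A ^^ k) v) = 0)"
proof -
  define M where "M = (\<lambda>k. (\<chi> i j. (((*v) A ^^ k) (axis j 1)) $ i) :: cmat)"
  have M: "M k *v v = ((*v) A ^^ k) v" for k v
  proof (induction k arbitrary: v)
    case 0
    have "M 0 = mat 1" by (simp add: M_def mat_def vec_eq_iff axis_nth')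
    then show ?case by simp
  next
    case (Suc k)
    have "M (Suc k) $ i $ j = (A ** M k) $ i $ j" for i j
    proof -
      have "M (Suc k) $ i $ j = (A *v (M k *v axis j 1)) $ i" unfolding Suc by (simp add: M_def)
      also have "\<dots> = (A ** M k) $ i $ j" by (simp add: matrix_vector_mul_assoc mult_axis_nth)
      finally show ?thesis .
    qed
    then have "M (Suc k) = A ** M k" by (simp add: vec_eq_iff)
    then show ?case by (simp add: matrix_vector_mul_assoc[symmetric] Suc)
  qed
  obtain x where x: "\<exists>k\<in>{..36::nat}. x k \<noteq> 0" "\<And>i j. (\<Sum>k\<le>36. M k $ i $ j * x k) = 0"
    using homogeneous_system[of "UNIV :: ((3 + 3) \<times> (3 + 3)) set" "{..36}" "\<lambda>(i, j) k. M k $ i $ j"]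
    by auto
  define p where "p = (\<Sum>k\<le>36. Polynomial.monom (x k) k)"
  have cp: "Polynomial.coeff p k = (if k \<le> 36 then x k else 0)" for k
    by (simp add: p_def Polynomial.coeff_sum)
  have deg: "Polynomial.degree p \<le> 36" by (rule degree_le) (simp add: cp)
  have "p \<noteq> 0" using x(1) cp by (metis atMost_iff Polynomial.coeff_0)
  moreover have "(\<Sum>k\<le>Polynomial.degree p. Polynomial.coeff p k *s ((*v) A ^^ k) v) = 0" for v
  proof -
    have "(\<Sum>k\<le>Polynomial.degree p. Polynomial.coeff p k *s ((*v) A ^^ k) v)
        = (\<Sum>k\<le>36. Polynomial.coeff p k *s ((*v) A ^^ k) v)"
      by (intro sum.mono_neutral_left) (use deg in \<open>auto simp: coeff_eq_0\<close>)
    also have "\<dots> = (\<Sum>k\<le>36. x k *s (M k *v v))" by (intro sum.cong) (auto simp: cp M)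
    also have "\<dots> = 0"
    proof (subst vec_eq_iff, intro allI)
      fix i
      have "(\<Sum>k\<le>36. x k *s (M k *v v)) $ i = (\<Sum>k\<le>36. \<Sum>j\<in>UNIV. M k $ i $ j * x k * v $ j)"
        by (simp add: matrix_vector_mult_def sum_distrib_left mult_ac)
      also have "\<dots> = (\<Sum>j\<in>UNIV. (\<Sum>k\<le>36. M k $ i $ j * x k) * v $ j)"
        by (subst sum.swap) (simp add: sum_distrib_right)
      finally show "(\<Sum>k\<le>36. x k *s (M k *v v)) $ i = 0 $ i" by (simp add: x(2))
    qed
    finally show ?thesis .
  qed
  ultimately show ?thesis by blast
qed

lemma annihilating_roots:
  fixes A :: cmat shows "\<exists>\<mu>s. \<forall>v. fold (\<lambda>\<mu> w. A *v w - \<mu> *s w) \<mu>s v = 0"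
proof -
  define P where "P = (\<lambda>p v. \<Sum>k\<le>Polynomial.degree p. Polynomial.coeff p k *s ((*v) A ^^ k) v)"
  have Pn: "P p v = (\<Sum>k\<le>n. Polynomial.coeff p k *s ((*v) A ^^ k) v)" if "Polynomial.degree p \<le> n" for p n v
    unfolding P_def by (intro sum.mono_neutral_left) (use that in \<open>auto simp: coeff_eq_0\<close>)
  have pow_diff: "((*v) A ^^ k) (u - c *s w) = ((*v) A ^^ k) u - c *s ((*v) A ^^ k) w" for k u c w
    by (induction k) (simp_all add: vector_scalar_commute matrix_vector_mult_diff_distrib)
  have lin: "P ([:- \<mu>, 1:] * q) v = P q (A *v v - \<mu> *s v)" for \<mu> q v
  proof -
    define n where "n = Polynomial.degree q"
    have "P ([:- \<mu>, 1:] * q) v = (\<Sum>k\<le>Suc n. Polynomial.coeff ([:- \<mu>, 1:] * q) k *s ((*v) A ^^ k) v)"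
      unfolding n_def by (intro Pn order_trans[OF degree_mult_le]) simp
    also have "\<dots> = (\<Sum>k\<le>Suc n. Polynomial.coeff (pCons 0 q) k *s ((*v) A ^^ k) v)
        - (\<Sum>k\<le>Suc n. (\<mu> * Polynomial.coeff q k) *s ((*v) A ^^ k) v)"
      by (simp add: sum_subtractf[symmetric] vec_eq_iff algebra_simps del: sum.atMost_Suc)
    also have "(\<Sum>k\<le>Suc n. Polynomial.coeff (pCons 0 q) k *s ((*v) A ^^ k) v)
        = (\<Sum>k\<le>n. Polynomial.coeff q k *s ((*v) A ^^ k) (A *v v))"
      by (subst sum.atMost_Suc_shift) (simp add: funpow_swap1)
    also have "(\<Sum>k\<le>Suc n. (\<mu> * Polynomial.coeff q k) *s ((*v) A ^^ k) v)
        = (\<Sum>k\<le>n. (\<mu> * Polynomial.coeff q k) *s ((*v) A ^^ k) v)"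
      by (simp add: n_def coeff_eq_0)
    also have "(\<Sum>k\<le>n. Polynomial.coeff q k *s ((*v) A ^^ k) (A *v v)) - \<dots> = P q (A *v v - \<mu> *s v)"
      unfolding P_def n_def[symmetric] pow_diff
      by (simp add: sum_subtractf[symmetric] vec_eq_iff algebra_simps)
    finally show ?thesis .
  qed
  have "\<exists>\<mu>s c. c \<noteq> 0 \<and> (\<forall>v. P p v = c *s fold (\<lambda>\<mu> w. A *v w - \<mu> *s w) \<mu>s v)" if "p \<noteq> 0" for p
    using that
  proof (induction "Polynomial.degree p" arbitrary: p)
    case 0
    then have "Polynomial.coeff p 0 \<noteq> 0" by (metis leading_coeff_0_iff)
    then show ?case using 0 by (intro exI[of _ "[]"] exI[of _ "Polynomial.coeff p 0"]) (auto simp: P_def)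
  next
    case (Suc n)
    then obtain \<mu> where "poly p \<mu> = 0"
      using fundamental_theorem_of_algebra[of p] constant_degree[of p] by auto
    then obtain q where q: "p = [:- \<mu>, 1:] * q" by (auto simp: poly_eq_0_iff_dvd)
    then have "q \<noteq> 0" using Suc.prems by auto
    moreover from this have "Polynomial.degree p = Suc (Polynomial.degree q)"
      unfolding q by (subst degree_mult_eq) auto
    ultimately have "q \<noteq> 0" "Polynomial.degree q = n" using Suc.hyps(2) by auto
    then have "\<exists>\<mu>s c. c \<noteq> 0 \<and> (\<forall>v. P q v = c *s fold (\<lambda>\<mu> w. A *v w - \<mu> *s w) \<mu>s v)"
      by (intro Suc.hyps(1)) simp_all
    then obtain \<mu>s c where "c \<noteq> 0" "\<forall>v. P q v = c *s fold (\<lambda>\<mu> w. A *v w - \<mu> *s w) \<mu>s v"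
      by (elim exE conjE)
    then show ?case unfolding q
      by (rule_tac exI[of _ "\<mu> # \<mu>s"], rule_tac exI[of _ c]) (simp only: lin fold_simps simp_thms)
  qed
  note split = this
  obtain p where p: "p \<noteq> 0" "\<forall>v. P p v = 0"
    using annihilating_polynomial[of A] unfolding P_def by (elim exE conjE)
  then have P0: "P p v = 0" for v by simp
  obtain \<mu>s c where c: "c \<noteq> 0" "\<forall>v. P p v = c *s fold (\<lambda>\<mu> w. A *v w - \<mu> *s w) \<mu>s v"
    using split[OF p(1)] by (elim exE conjE)
  have "c *s fold (\<lambda>\<mu> w. A *v w - \<mu> *s w) \<mu>s v = 0" for v
    using c(2)[rule_format, of v] P0[of v] by argo
  then have "fold (\<lambda>\<mu> w. A *v w - \<mu> *s w) \<mu>s v = 0" for v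
    using c(1) vec.scale_eq_0_iff by blast
  then show ?thesis by blast
qed

definition eig :: "cmat \<Rightarrow> complex set" where
  "eig A = {\<mu>. \<exists>W v. vec.subspace W \<and> (\<forall>w\<in>W. A *v w \<in> W) \<and> v \<notin> W \<and> A *v v - \<mu> *s v \<in> W}"

lemma eigI: "vec.subspace W \<Longrightarrow> (\<And>w. w \<in> W \<Longrightarrow> A *v w \<in> W) \<Longrightarrow> v \<notin> W \<Longrightarrow> A *v v - \<mu> *s v \<in> W \<Longrightarrow> \<mu> \<in> eig A"
  unfolding eig_def by blast

lemma finite_eig: "finite (eig A)"
proof -
  obtain \<mu>s where 0: "\<And>v. fold (\<lambda>\<mu> w. A *v w - \<mu> *s w) \<mu>s v = 0" using annihilating_roots by blast
  have "\<mu> \<in> set \<mu>s" if \<mu>: "\<mu> \<in> eig A" for \<mu>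
  proof -
    obtain W v where W: "vec.subspace W" "\<And>w. w \<in> W \<Longrightarrow> A *v w \<in> W" and v: "v \<notin> W" "A *v v - \<mu> *s v \<in> W"
      using \<mu> unfolding eig_def by blast
    have "fold (\<lambda>\<mu> w. A *v w - \<mu> *s w) \<nu>s u \<notin> W" if "\<mu> \<notin> set \<nu>s" "u \<notin> W" "A *v u - \<mu> *s u \<in> W" for \<nu>s u
      using that
    proof (induction \<nu>s arbitrary: u)
      case (Cons \<nu> \<nu>s)
      define d where "d = A *v u - \<mu> *s u"
      have d: "d \<in> W" using Cons.prems by (simp add: d_def)
      define u' where "u' = A *v u - \<nu> *s u"
      have u': "u' = d + (\<mu> - \<nu>) *s u" by (simp add: u'_def d_def vec_eq_iff algebra_simps)
      have "u' \<notin> W"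
      proof
        assume "u' \<in> W"
        then have "(1 / (\<mu> - \<nu>)) *s (u' - d) \<in> W"
          using W(1) d by (intro vec.subspace_scale vec.subspace_diff)
        moreover have "(1 / (\<mu> - \<nu>)) *s (u' - d) = u"
          using Cons.prems(1) unfolding u' by (simp add: vec_eq_iff left_diff_distrib[symmetric] diff_divide_distrib[symmetric])
        ultimately show False using Cons.prems(2) by simp
      qed
      moreover have "A *v u' - \<mu> *s u' = (A *v d - \<mu> *s d) + (\<mu> - \<nu>) *s d"
        unfolding u' by (simp add: d_def matrix_vector_right_distrib vector_scalar_commute
          matrix_vector_mult_diff_distrib vec_eq_iff algebra_simps)
      then have "A *v u' - \<mu> *s u' \<in> W"
        using W d by (auto intro!: vec.subspace_add vec.subspace_diff vec.subspace_scale)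
      ultimately show ?case using Cons by (simp add: u'_def)
    qed simp
    note key = this
    show ?thesis
    proof (rule ccontr)
      assume "\<mu> \<notin> set \<mu>s"
      then have "fold (\<lambda>\<mu> w. A *v w - \<mu> *s w) \<mu>s v \<notin> W" using v by (rule key)
      then show False unfolding 0 using vec.subspace_0[OF W(1)] by simp
    qed
  qed
  then show ?thesis by (meson List.finite_set finite_subset subsetI)
qed

lemma eigenvector_exists:
  fixes A :: cmat
  assumes W: "vec.subspace W" "vec.subspace E" "W \<subset> E" and st: "\<And>w. w \<in> W \<Longrightarrow> A *v w \<in> W" "\<And>w. w \<in> E \<Longrightarrow> A *v w \<in> E"
  obtains v \<mu> where "v \<in> E" "v \<notin> W" "A *v v - \<mu> *s v \<in> W"
proof -
  obtain \<mu>s where 0: "\<And>v. fold (\<lambda>\<mu> w. A *v w - \<mu> *s w) \<mu>s v = 0" using annihilating_roots by blast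
  obtain u where u: "u \<in> E" "u \<notin> W" using W(3) by blast
  have "\<exists>v \<mu>. v \<in> E \<and> v \<notin> W \<and> A *v v - \<mu> *s v \<in> W"
    if "u \<in> E" "u \<notin> W" "fold (\<lambda>\<mu> w. A *v w - \<mu> *s w) \<nu>s u \<in> W" for u \<nu>s
    using that
  proof (induction \<nu>s arbitrary: u)
    case (Cons \<nu> \<nu>s)
    show ?case
    proof (cases "A *v u - \<nu> *s u \<in> W")
      case True then show ?thesis using Cons.prems by blast
    next
      case False
      have "A *v u - \<nu> *s u \<in> E" using Cons.prems st(2) W(2) by (intro vec.subspace_diff vec.subspace_scale)
      then show ?thesis using Cons.IH[OF _ False] Cons.prems by simp
    qed
  qed simp
  note key = this
  have "fold (\<lambda>\<mu> w. A *v w - \<mu> *s w) \<mu>s u \<in> W" unfolding 0 by (rule vec.subspace_0[OF W(1)])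
  then obtain v \<mu> where "v \<in> E" "v \<notin> W" "A *v v - \<mu> *s v \<in> W" using key[OF u] by blast
  then show ?thesis by (rule that)
qed

lemma separating_matrix:
  assumes "vec.subspace W" "v \<notin> W"
  shows "\<exists>M :: cmat. (\<forall>w\<in>W. M *v w = 0) \<and> M *v v = axis (Inl 1) 1"
proof -
  obtain B where B: "B \<subseteq> W" "vec.independent B" "W \<subseteq> vec.span B"
    by (rule vec.basis_exists[of W])
  have "v \<notin> vec.span B" using assms(2) vec.span_minimal[OF B(1) assms(1)] by blast
  then have ind: "vec.independent (insert v B)" using B(2) by (rule vec.independent_insertI)
  obtain g :: "cvec \<Rightarrow> cvec" where g: "Vector_Spaces.linear (*s) (*s) g" "\<forall>x\<in>insert v B. g x = (if x = v then axis (Inl 1) 1 else 0)"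
    using vec.linear_independent_extend[OF ind, of "\<lambda>x. if x = v then axis (Inl 1) 1 else (0::cvec)"] by blast
  interpret g: Vector_Spaces.linear "(*s)" "(*s)" g by (rule g(1))
  have vB: "v \<notin> B" using assms B(1) by blast
  have "g w = 0" if "w \<in> vec.span B" for w
    by (rule g.eq_0_on_span[OF _ that]) (use g(2) vB in auto)
  then show ?thesis using matrix_works[OF g(1)] g(2) B(3) by (intro exI[of _ "matrix g"]) auto
qed

lemma subspace_eigenvectors:
  fixes A :: "'i \<Rightarrow> cmat"
  assumes "vec.subspace W" "vec.subspace L"
  shows "vec.subspace {v \<in> L. \<forall>i\<in>I. A i *v v - c i *s v \<in> W}"
proof (rule vec.subspaceI)
  show "0 \<in> {v \<in> L. \<forall>i\<in>I. A i *v v - c i *s v \<in> W}" using assms by (auto simp: vec.subspace_0)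
next
  fix x y assume "x \<in> {v \<in> L. \<forall>i\<in>I. A i *v v - c i *s v \<in> W}" "y \<in> {v \<in> L. \<forall>i\<in>I. A i *v v - c i *s v \<in> W}"
  then have x: "x \<in> L" "\<forall>i\<in>I. A i *v x - c i *s x \<in> W" and y: "y \<in> L" "\<forall>i\<in>I. A i *v y - c i *s y \<in> W"
    by simp_all
  have "A i *v (x + y) - c i *s (x + y) \<in> W" if "i \<in> I" for i
  proof -
    have "A i *v (x + y) - c i *s (x + y) = (A i *v x - c i *s x) + (A i *v y - c i *s y)"
      by (simp add: matrix_vector_right_distrib vec_eq_iff algebra_simps)
    also have "\<dots> \<in> W" using x y that by (intro vec.subspace_add[OF assms(1)]) auto
    finally show ?thesis .
  qed
  then show "x + y \<in> {v \<in> L. \<forall>i\<in>I. A i *v v - c i *s v \<in> W}"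
    using vec.subspace_add[OF assms(2) x(1) y(1)] by blast
next
  fix a x assume "x \<in> {v \<in> L. \<forall>i\<in>I. A i *v v - c i *s v \<in> W}"
  then have x: "x \<in> L" "\<forall>i\<in>I. A i *v x - c i *s x \<in> W" by simp_all
  have "A i *v (a *s x) - c i *s (a *s x) \<in> W" if "i \<in> I" for i
  proof -
    have "A i *v (a *s x) - c i *s (a *s x) = a *s (A i *v x - c i *s x)"
      by (simp add: vector_scalar_commute vec_eq_iff algebra_simps)
    also have "\<dots> \<in> W" using x that by (intro vec.subspace_scale[OF assms(1)]) auto
    finally show ?thesis .
  qed
  then show "a *s x \<in> {v \<in> L. \<forall>i\<in>I. A i *v v - c i *s v \<in> W}"
    using vec.subspace_scale[OF assms(2) x(1)] by blast
qed

subsection \<open>Common eigenvectors\<close>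

text \<open>The eigenvalue of \<open>h k inverse h\<close> on a common eigenvector of the normal subgroup containing
  \<open>k\<close> is a polynomial in \<open>h\<close> with values among the finitely many eigenvalues of \<open>k\<close>; so it does
  not depend on \<open>h\<close> in a connected group.\<close>

theorem lie_kolchin:
  assumes "subgroup H G" "connectedin (zar 36) H" "(derived G ^^ n) H = {\<one>\<^bsub>G\<^esub>}"
    and "vec.subspace W0" "vec.subspace W" "W0 \<subset> W"
    and "\<And>h w. h \<in> H \<Longrightarrow> w \<in> W0 \<Longrightarrow> dec h *v w \<in> W0" "\<And>h w. h \<in> H \<Longrightarrow> w \<in> W \<Longrightarrow> dec h *v w \<in> W"
  shows "\<exists>v\<in>W. v \<notin> W0 \<and> (\<forall>h\<in>H. \<exists>c. dec h *v v - c *s v \<in> W0)"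
  using assms
proof (induction n arbitrary: H W)
  case 0
  obtain v where v: "v \<in> W" "v \<notin> W0" using 0 by blast
  moreover have "dec h *v v - 1 *s v \<in> W0" if "h \<in> H" for h
    using 0 that vec.subspace_0 by auto
  ultimately show ?case by blast
next
  case (Suc n)
  note H = Suc.prems(1) and conn = Suc.prems(2) and W0 = Suc.prems(4) and W = Suc.prems(5) and sub = Suc.prems(6)
    and st0 = Suc.prems(7) and st = Suc.prems(8)
  have Hc: "H \<subseteq> carrier G" and H1: "\<one>\<^bsub>G\<^esub> \<in> H" using H by (auto simp: subgroup_def)
  have SpH: "dec h \<in> Sp" if "h \<in> H" for h using that Hc by auto
  have mulH: "enc (dec h ** dec k) \<in> H" if "h \<in> H" "k \<in> H" for h k
    using subgroup.m_closed[OF H that] by simp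
  have invH: "enc (adj (dec h)) \<in> H" if h: "h \<in> H" for h
  proof -
    from h Hc have "h \<in> enc ` Sp" by auto
    then obtain A where "h = enc A" "A \<in> Sp" by blast
    then show ?thesis using subgroup.m_inv_closed[OF H h] by simp
  qed
  have st0': "adj (dec h) *v w \<in> W0" if "h \<in> H" "w \<in> W0" for h w using st0[OF invH] that by simp
  have st': "adj (dec h) *v w \<in> W" if "h \<in> H" "w \<in> W" for h w using st[OF invH] that by simp
  define H' where "H' = derived G H"
  have H'sub: "H' \<subseteq> H" unfolding H'_def by (rule G.derived_incl[OF subset_refl H])
  have comm: "enc (dec g ** dec k ** adj (dec g) ** adj (dec k)) \<in> H'" if "g \<in> H" "k \<in> H" for g k
  proof -
    have "g \<otimes>\<^bsub>G\<^esub> k \<otimes>\<^bsub>G\<^esub> inv\<^bsub>G\<^esub> g \<otimes>\<^bsub>G\<^esub> inv\<^bsub>G\<^esub> k \<in> H'"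
      unfolding H'_def derived_def using that by (intro generate.incl) blast
    then show ?thesis using inv_G'[OF subsetD[OF Hc]] that by simp
  qed
  have nrm: "enc (adj (dec g) ** dec h ** dec g) \<in> H'" if "g \<in> H" "h \<in> H'" for g h
  proof -
    have hH: "h \<in> H" using that H'sub by blast
    have "enc (dec (enc (adj (dec g))) ** dec h ** adj (dec (enc (adj (dec g)))) ** adj (dec h)) \<in> H'"
      by (rule comm[OF invH[OF that(1)] hH])
    then have "enc (adj (dec g) ** dec h ** dec g ** adj (dec h)) \<otimes>\<^bsub>G\<^esub> h \<in> H'"
      using that(2) G.derived_is_subgroup[OF Hc] by (intro subgroup.m_closed) (auto simp: H'_def)
    then show ?thesis using SpH[OF hH] by (simp add: matrix_mul_assoc[symmetric] Sp_adj_left)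
  qed
  have "(derived G ^^ n) H' = {\<one>\<^bsub>G\<^esub>}" using Suc.prems(3) by (simp add: H'_def funpow_swap1)
  then have "\<exists>v\<in>W. v \<notin> W0 \<and> (\<forall>h\<in>H'. \<exists>c. dec h *v v - c *s v \<in> W0)"
    unfolding H'_def
    by (rule Suc.IH[OF G.derived_is_subgroup[OF Hc] derived_connected[OF H conn] _ W0 W sub])
      (use st0 st H'sub H'_def in blast)+
  then obtain v0 where v0: "v0 \<in> W" "v0 \<notin> W0" "\<forall>h\<in>H'. \<exists>c. dec h *v v0 - c *s v0 \<in> W0"
    by (elim bexE conjE)
  obtain ch where "\<forall>h\<in>H'. dec h *v v0 - ch h *s v0 \<in> W0"
    using bchoice[OF v0(3)] by (elim exE)
  then have ch: "\<And>h. h \<in> H' \<Longrightarrow> dec h *v v0 - ch h *s v0 \<in> W0" by simp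
  obtain M :: cmat where "\<forall>w\<in>W0. M *v w = 0" "M *v v0 = axis (Inl 1) 1"
    using separating_matrix[OF W0 v0(2)] by (elim exE conjE)
  then have M: "\<And>w. w \<in> W0 \<Longrightarrow> M *v w = 0" "M *v v0 = axis (Inl 1) 1" by simp_all
  have ch_eq: "ch h = (M *v (dec h *v v0)) $ Inl 1" if "h \<in> H'" for h
    using arg_cong[OF M(1)[OF ch[OF that]], of "\<lambda>w. w $ Inl 1"]
    by (simp add: matrix_vector_mult_diff_distrib vector_scalar_commute M(2) axis_nth')
  have ch1: "ch (enc (mat 1)) = 1"
  proof -
    have "enc (mat 1) \<in> H'" using G.derived_is_subgroup[OF Hc] by (auto simp: H'_def subgroup_def)
    then show ?thesis using ch_eq by (simp add: M(2) axis_nth')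
  qed
  have ch_conj: "ch (enc (adj (dec g) ** dec h ** dec g)) = ch h" if g: "g \<in> H" and h: "h \<in> H'" for g h
  proof -
    define F where "F = (\<lambda>g. (M *v ((adj (dec g) ** dec h ** dec g) *v v0)) $ Inl 1)"
    have "vp (coords 36) (\<lambda>g. M *v ((adj (dec g) ** dec h ** dec g) *v v0))" by (intro mp_intros)
    then have "F \<in> pf (coords 36)" by (simp add: F_def vp_def)
    moreover have F: "F g = ch (enc (adj (dec g) ** dec h ** dec g))" if "g \<in> H" for g
      unfolding F_def using ch_eq[OF nrm[OF that h]] by simp
    moreover have "F ` H \<subseteq> eig (dec h)"
    proof clarify
      fix g assume g: "g \<in> H"
      have "(adj (dec g) ** dec h ** dec g) *v v0 - F g *s v0 \<in> W0"
        using ch[OF nrm[OF g h]] F[OF g] by simp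
      then have "dec g *v ((adj (dec g) ** dec h ** dec g) *v v0 - F g *s v0) \<in> W0" by (rule st0[OF g])
      then have "dec h *v (dec g *v v0) - F g *s (dec g *v v0) \<in> W0"
        using SpH[OF g] by (simp add: matrix_vector_mult_diff_distrib vector_scalar_commute
          matrix_vector_mul_assoc[symmetric])
      moreover have "dec g *v v0 \<notin> W0" using st0'[OF g, of "dec g *v v0"] SpH[OF g] v0(2) by auto
      ultimately show "F g \<in> eig (dec h)" using h H'sub by (intro eigI[OF W0 st0]) auto
    qed
    then have "finite (F ` H)" using finite_eig finite_subset by blast
    ultimately have "F g = F \<one>\<^bsub>G\<^esub>" using connectedin_zar_finite_values[OF conn _ _ g H1] by blast
    then show ?thesis using F[OF g] F[OF H1] h H'sub Hc
      by (auto simp: Sp_adj_left[of "mat 1", simplified])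
  qed
  define E where "E = {v \<in> W. \<forall>h\<in>H'. dec h *v v - ch h *s v \<in> W0}"
  have E: "vec.subspace E"
    unfolding E_def by (rule subspace_eigenvectors[OF W0 W])
  have W0E: "W0 \<subseteq> E" using sub st0 H'sub W0
    by (auto simp: E_def intro!: vec.subspace_diff vec.subspace_scale)
  have v0E: "v0 \<in> E" using v0(1) ch by (simp add: E_def)
  have stE: "dec g *v v \<in> E" if g: "g \<in> H" and v: "v \<in> E" for g v
  proof -
    have "dec h *v (dec g *v v) - ch h *s (dec g *v v) \<in> W0" if h: "h \<in> H'" for h
    proof -
      have "(adj (dec g) ** dec h ** dec g) *v v - ch h *s v \<in> W0"
        using v nrm[OF g h] ch_conj[OF g h] unfolding E_def by fastforce
      then have "dec g *v ((adj (dec g) ** dec h ** dec g) *v v - ch h *s v) \<in> W0" by (rule st0[OF g])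
      then show ?thesis using SpH[OF g]
        by (simp add: matrix_vector_mult_diff_distrib vector_scalar_commute matrix_vector_mul_assoc[symmetric])
    qed
    then show ?thesis using v st[OF g] by (simp add: E_def)
  qed
  have ch_comm: "ch (enc (dec g ** dec k ** adj (dec g) ** adj (dec k))) = 1" if g: "g \<in> H" and k: "k \<in> H" for g k
  proof -
    obtain u \<mu> where u: "u \<in> E" "u \<notin> W0" "dec k *v u - \<mu> *s u \<in> W0"
      using eigenvector_exists[OF W0 E, of "dec k"] W0E v0E v0(2) st0[OF k] stE[OF k] by blast
    have \<mu>: "\<mu> \<noteq> 0"
    proof
      assume "\<mu> = 0"
      then have "adj (dec k) *v (dec k *v u) \<in> W0" using u(3) by (intro st0'[OF k]) simp
      then show False using u(2) SpH[OF k] by simp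
    qed
    define F where "F = (\<lambda>g. (M *v ((dec g ** dec k ** adj (dec g) ** adj (dec k)) *v v0)) $ Inl 1)"
    have "vp (coords 36) (\<lambda>g. M *v ((dec g ** dec k ** adj (dec g) ** adj (dec k)) *v v0))" by (intro mp_intros)
    then have "F \<in> pf (coords 36)" by (simp add: F_def vp_def)
    moreover have F: "F g = ch (enc (dec g ** dec k ** adj (dec g) ** adj (dec k)))" if "g \<in> H" for g
      unfolding F_def using ch_eq[OF comm[OF that k]] by simp
    moreover have "F ` H \<subseteq> (\<lambda>\<nu>. \<nu> / \<mu>) ` eig (dec k)"
    proof clarify
      fix g assume g: "g \<in> H"
      define c where "c = dec g ** dec k ** adj (dec g) ** adj (dec k)"
      have kuE: "dec k *v u \<in> E" by (rule stE[OF k u(1)])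
      have 1: "c *v (dec k *v u) - F g *s (dec k *v u) \<in> W0"
        using kuE comm[OF g k] F[OF g] unfolding E_def c_def[symmetric] by fastforce
      have "c *v (dec k *v u) = dec g *v (dec k *v (adj (dec g) *v u))"
        using SpH[OF k] by (simp add: c_def matrix_vector_mul_assoc[symmetric])
      then have "dec g *v (dec k *v (adj (dec g) *v u)) - (F g * \<mu>) *s u
          = (c *v (dec k *v u) - F g *s (dec k *v u)) + F g *s (dec k *v u - \<mu> *s u)"
        by (simp add: vec_eq_iff algebra_simps)
      then have "dec g *v (dec k *v (adj (dec g) *v u)) - (F g * \<mu>) *s u \<in> W0"
        by (simp only:) (intro vec.subspace_add vec.subspace_scale W0 1 u(3))
      then have "adj (dec g) *v (dec g *v (dec k *v (adj (dec g) *v u)) - (F g * \<mu>) *s u) \<in> W0"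
        by (rule st0'[OF g])
      then have "dec k *v (adj (dec g) *v u) - (F g * \<mu>) *s (adj (dec g) *v u) \<in> W0"
        using SpH[OF g] by (simp add: matrix_vector_mult_diff_distrib vector_scalar_commute)
      moreover have "adj (dec g) *v u \<notin> W0"
        using st0[OF g, of "adj (dec g) *v u"] SpH[OF g] u(2) by auto
      ultimately have "F g * \<mu> \<in> eig (dec k)" by (intro eigI[OF W0 st0[OF k]])
      then show "F g \<in> (\<lambda>\<nu>. \<nu> / \<mu>) ` eig (dec k)" using \<mu> by (intro image_eqI[of _ _ "F g * \<mu>"]) auto
    qed
    then have "finite (F ` H)" using finite_eig finite_subset by blast
    ultimately have "F g = F \<one>\<^bsub>G\<^esub>" using connectedin_zar_finite_values[OF conn _ _ g H1] by blast
    then show ?thesis using F[OF g] F[OF H1] SpH[OF k] ch1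
      by (simp add: Sp_adj_left[of "mat 1", simplified] Sp_adj_right)
  qed
  have commutes: "dec g *v (dec k *v v) - dec k *v (dec g *v v) \<in> W0" if g: "g \<in> H" and k: "k \<in> H" and v: "v \<in> E" for g k v
  proof -
    let ?c = "dec g ** dec k ** adj (dec g) ** adj (dec k)"
    have "dec k *v (dec g *v v) \<in> E" using stE g k v by blast
    then have "?c *v (dec k *v (dec g *v v)) - 1 *s (dec k *v (dec g *v v)) \<in> W0"
      using comm[OF g k] ch_comm[OF g k] unfolding E_def by fastforce
    then show ?thesis using SpH[OF g] SpH[OF k] by (simp add: matrix_vector_mul_assoc[symmetric])
  qed
  define good where "good = (\<lambda>L. vec.subspace L \<and> W0 \<subset> L \<and> L \<subseteq> E \<and> (\<forall>h\<in>H. \<forall>w\<in>L. dec h *v w \<in> L))"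
  have "good E" using E W0E v0E v0(2) stE by (auto simp: good_def)
  then obtain L where L: "good L" "\<And>Y. good Y \<Longrightarrow> vec.dim L \<le> vec.dim Y"
    using ex_has_least_nat[of good E vec.dim] by blast
  have Xs: "vec.subspace L" "W0 \<subset> L" "L \<subseteq> E" "\<And>h w. h \<in> H \<Longrightarrow> w \<in> L \<Longrightarrow> dec h *v w \<in> L"
    using L(1) by (auto simp: good_def)
  have "\<exists>c. \<forall>v\<in>L. dec k *v v - c *s v \<in> W0" if k: "k \<in> H" for k
  proof -
    obtain u \<mu> where u: "u \<in> L" "u \<notin> W0" "dec k *v u - \<mu> *s u \<in> W0"
      using eigenvector_exists[OF W0 Xs(1,2), of "dec k"] st0[OF k] Xs(4)[OF k] by blast
    define Y where "Y = {v \<in> L. dec k *v v - \<mu> *s v \<in> W0}"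
    have "vec.subspace Y"
      unfolding Y_def using subspace_eigenvectors[OF W0 Xs(1), of "{k}" dec "\<lambda>_. \<mu>"] by simp
    moreover have "W0 \<subseteq> Y" using Xs(2) st0[OF k] W0
      by (auto simp: Y_def intro!: vec.subspace_diff vec.subspace_scale)
    moreover have "dec g *v v \<in> Y" if g: "g \<in> H" and v: "v \<in> Y" for g v
    proof -
      have vX: "v \<in> L" using v by (simp add: Y_def)
      have "dec k *v (dec g *v v) - \<mu> *s (dec g *v v)
          = dec g *v (dec k *v v - \<mu> *s v) - (dec g *v (dec k *v v) - dec k *v (dec g *v v))"
        by (simp add: matrix_vector_mult_diff_distrib vector_scalar_commute)
      also have "\<dots> \<in> W0"
        by (rule vec.subspace_diff[OF W0 st0[OF g] commutes[OF g k]])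
          (use v vX Xs(3) in \<open>auto simp: Y_def\<close>)
      finally show ?thesis using Xs(4)[OF g vX] by (simp add: Y_def)
    qed
    ultimately have "good Y" using u Xs(3) by (auto simp: good_def Y_def)
    then have "Y = L" using L(2) Xs(1)
      by (intro vec.subspace_dim_equal) (auto simp: good_def Y_def)
    then show ?thesis by (auto simp: Y_def)
  qed
  note scalar = this
  obtain v where v: "v \<in> L" "v \<notin> W0" using Xs(2) by blast
  have "\<exists>c. dec h *v v - c *s v \<in> W0" if "h \<in> H" for h using scalar[OF that] v(1) by blast
  moreover have "v \<in> W" using v(1) Xs(3) by (auto simp: E_def)
  ultimately show ?case using v(2) by blast
qed

subsection \<open>Invariant isotropic flags\<close>

lemma adj_one [simp]: "adj (mat 1) = mat 1"
  using adj_R[of 0 0 0] by (simp add: om_simps)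

lemma Fl_zero [simp]: "0 \<in> Fl m"
  by (simp add: Fl_def)

definition flagged :: "cmat \<Rightarrow> complex point set \<Rightarrow> nat \<Rightarrow> bool" where
  "flagged g H k \<longleftrightarrow> (\<forall>h\<in>H. \<forall>m\<le>k. \<forall>v\<in>Fl m. (adj g ** dec h ** g) *v v \<in> Fl m)"

lemma Fl_perp: assumes "\<And>x. x \<in> Fl k \<Longrightarrow> om x w = 0" "k \<le> 6" shows "w \<in> Fl (6 - k)"
proof -
  have "w $ j = 0" if "6 - k < lv j" for j
  proof -
    have "lv (flip j) \<le> k" using that assms(2) by (simp add: lv_flip)
    then have "om (axis (flip j) 1) w = 0" by (intro assms(1)) simp
    then show ?thesis by (simp add: om_axis_left)
  qed
  then show ?thesis by (simp add: Fl_def)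
qed

lemma subspace_Fl: "vec.subspace {v. A *v v \<in> Fl m}" for A :: cmat
  by (rule vec.subspaceI) (auto simp: matrix_vector_right_distrib vector_scalar_commute Fl_def)

lemma Cmp_Fl: assumes "v \<in> Cmp i" "lv (Inl i) = Suc k" shows "v \<in> Fl (6 - k)"
proof -
  have "v $ j = 0" if "6 - k < lv j" for j
  proof (cases j)
    case (Inl a)
    then have "lv (Inl a) < lv (Inl i)" using that assms(2) lv_le_3[of j] lv_le_3[of "Inl i"] by auto
    then show ?thesis using assms(1) Inl by (auto simp: Cmp_def)
  next
    case (Inr a)
    have "lv (Inr a) = 7 - lv (Inl a)" using lv_flip[of "Inl a"] by simp
    then have "lv (Inl a) < lv (Inl i)" using that assms(2) Inr lv_bounds[of "Inl a"] by auto
    then show ?thesis using assms(1) Inr by (auto simp: Cmp_def)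
  qed
  then show ?thesis by (simp add: Fl_def)
qed

lemma flag_step:
  assumes H: "subgroup H G" "connectedin (zar 36) H" "(derived G ^^ n) H = {\<one>\<^bsub>G\<^esub>}"
    and g: "g \<in> Sp" "flagged g H k" and i: "lv (Inl i) = Suc k"
  shows "\<exists>g'\<in>Sp. flagged g' H (Suc k)"
proof -
  have k2: "k \<le> 2" using i lv_le_3[of "Inl i"] by auto
  have Hc: "H \<subseteq> carrier G" using H(1) by (auto simp: subgroup_def)
  have SpH: "dec h \<in> Sp" if "h \<in> H" for h using subsetD[OF Hc that] by auto
  have invH: "enc (adj (dec h)) \<in> H" if "h \<in> H" for h
    using subgroup.m_inv_closed[OF H(1) that] inv_G'[OF subsetD[OF Hc that]] by simp
  define A where "A = (\<lambda>h. adj g ** dec h ** g)"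
  have A: "A h \<in> Sp" if "h \<in> H" for h using SpH[OF that] g(1) by (simp add: A_def mult_Sp adj_Sp)
  have AFl: "A h *v v \<in> Fl m" if "h \<in> H" "m \<le> k" "v \<in> Fl m" for h m v
    using g(2) that by (auto simp: flagged_def A_def)
  have Ag: "adj g *v (dec h *v v) = A h *v (adj g *v v)" for h v
    using g(1) by (simp add: A_def matrix_vector_mul_assoc[symmetric])
  have adjA: "adj (A h) = A (enc (adj (dec h)))" if "h \<in> H" for h
    using SpH[OF that] g(1) by (simp add: A_def adj_mult mult_Sp adj_Sp matrix_mul_assoc)
  have AFl': "A h *v v \<in> Fl (6 - k)" if h: "h \<in> H" and v: "v \<in> Fl (6 - k)" for h v
  proof (rule Fl_perp)
    fix x assume x: "x \<in> Fl k"
    have "adj (A h) *v x \<in> Fl k" unfolding adjA[OF h] by (rule AFl[OF invH[OF h] _ x]) simp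
    then show "om x (A h *v v) = 0" unfolding om_adj' by (rule om_Fl[OF _ v]) (use k2 in simp)
  qed (use k2 in simp)
  define W0 where "W0 = {v. adj g *v v \<in> Fl k}"
  define W where "W = {v. adj g *v v \<in> Fl (6 - k)}"
  have "ev i \<in> Fl (6 - k)" "ev i \<notin> Fl k" using i k2 by auto
  then have "g *v ev i \<in> W" "g *v ev i \<notin> W0" using g(1) by (auto simp: W_def W0_def)
  moreover have "W0 \<subseteq> W" using Fl_mono[of _ k "6 - k"] k2 by (auto simp: W_def W0_def)
  ultimately have sub: "W0 \<subset> W" by blast
  have "\<exists>v\<in>W. v \<notin> W0 \<and> (\<forall>h\<in>H. \<exists>c. dec h *v v - c *s v \<in> W0)"
  proof (rule lie_kolchin[OF H _ _ sub])
    show "dec h *v w \<in> W0" if "h \<in> H" "w \<in> W0" for h w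
      using AFl[OF that(1) order_refl] that(2) by (simp add: W0_def Ag)
    show "dec h *v w \<in> W" if "h \<in> H" "w \<in> W" for h w
      using AFl'[OF that(1)] that(2) by (simp add: W_def Ag)
  qed (simp_all add: W0_def W_def subspace_Fl)
  then obtain v where v: "v \<in> W" "v \<notin> W0" "\<forall>h\<in>H. \<exists>c. dec h *v v - c *s v \<in> W0"
    by (elim bexE conjE)
  define v' where "v' = adj g *v v"
  define v2 where "v2 = ((\<chi> j. if lv j \<le> k then 0 else v' $ j) :: cvec)"
  have v': "v' \<in> Fl (6 - k)" "v' \<notin> Fl k" using v by (auto simp: v'_def W_def W0_def)
  have d: "v' - v2 \<in> Fl k" by (auto simp: v2_def Fl_def)
  have "v2 $ Inl j = 0 \<and> v2 $ Inr j = 0" if j: "lv (Inl j) < lv (Inl i)" for j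
  proof -
    have "lv (Inr j) = 7 - lv (Inl j)" using lv_flip[of "Inl j"] by simp
    then have "6 - k < lv (Inr j)" using j i lv_bounds[of "Inl j"] by simp
    then show ?thesis using v'(1) j i by (auto simp: v2_def Fl_def)
  qed
  then have C: "v2 \<in> Cmp i" by (simp add: Cmp_def)
  have nz: "v2 \<noteq> 0" using v'(2) d by auto
  obtain r where r: "gen r" "Fx i r" "r *v ev i = v2" using Cmp_transitive[OF e_Cmp _ C nz] by auto
  have rS: "r \<in> Sp" by (rule gen_Sp[OF r(1)])
  have rfix: "r *v x = x" "adj r *v x = x" if "x \<in> Fl k" for x
  proof -
    have "om x y = 0" if "y \<in> Cmp i" for y
      using om_Fl[OF \<open>x \<in> Fl k\<close> Cmp_Fl[OF that i]] k2 by simp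
    then show rx: "r *v x = x" using r(2) by (simp add: Fx_def)
    then show "adj r *v x = x" using Sp_adj_vec(1)[OF rS, of x] by simp
  qed
  have "(adj (g ** r) ** dec h ** (g ** r)) *v x \<in> Fl m" if h: "h \<in> H" and m: "m \<le> Suc k" and x: "x \<in> Fl m" for h m x
  proof -
    have eq: "(adj (g ** r) ** dec h ** (g ** r)) *v x = adj r *v (A h *v (r *v x))" for x
      using g(1) rS by (simp add: adj_mult A_def matrix_vector_mul_assoc[symmetric])
    have low: "adj r *v (A h *v (r *v x)) \<in> Fl m" if "m \<le> k" "x \<in> Fl m" for m x
    proof -
      have "x \<in> Fl k" using that Fl_mono by blast
      moreover have "A h *v x \<in> Fl m" using AFl[OF h] that by blast
      moreover from this have "A h *v x \<in> Fl k" using that(1) Fl_mono by blast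
      ultimately show ?thesis using rfix(1)[of x] rfix(2)[of "A h *v x"] by simp
    qed
    show ?thesis
    proof (cases "m \<le> k")
      case True then show ?thesis unfolding eq using low x by blast
    next
      case False
      then have m: "m = Suc k" using m by simp
      obtain c where c: "dec h *v v - c *s v \<in> W0" using v(3) h by blast
      have "adj g *v (dec h *v v - c *s v) \<in> Fl k" using c by (simp add: W0_def)
      then have 1: "A h *v v' - c *s v' \<in> Fl k"
        by (simp add: matrix_vector_mult_diff_distrib vector_scalar_commute Ag v'_def)
      have "A h *v v2 - c *s v2 = (A h *v v' - c *s v') - (A h *v (v' - v2)) + c *s (v' - v2)"
        by (simp add: matrix_vector_mult_diff_distrib vec_eq_iff algebra_simps)
      then have "A h *v v2 - c *s v2 \<in> Fl k" (is "?w \<in> _")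
        using Fl_add[OF Fl_diff[OF 1 AFl[OF h order_refl d]] Fl_scale[OF d]] by (simp only:)
      then have w: "adj r *v ?w = ?w" "?w \<in> Fl m" using rfix(2) Fl_mono[of ?w k m] m by simp_all
      have "adj r *v (A h *v v2) = adj r *v ?w + c *s ev i"
        using Sp_adj_vec(1)[OF rS, of "ev i"]
        by (simp add: matrix_vector_mult_diff_distrib vector_scalar_commute r(3))
      moreover have ei: "ev i \<in> Fl m" using i m by simp
      ultimately have e: "adj r *v (A h *v (r *v ev i)) \<in> Fl m"
        unfolding r(3) w(1) by (simp only: Fl_add[OF w(2) Fl_scale[OF ei]])
      define a where "a = x $ Inl i"
      have "x - a *s ev i \<in> Fl k"
      proof -
        have "(x - a *s ev i) $ j = 0" if "k < lv j" for j
        proof (cases "j = Inl i")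
          case False
          then have "m < lv j" using that m i lv_inj[of j "Inl i"] by linarith
          then show ?thesis using x False by (auto simp: Fl_def axis_nth')
        qed (simp add: a_def axis_nth')
        then show ?thesis by (simp add: Fl_def)
      qed
      then have kk: "adj r *v (A h *v (r *v (x - a *s ev i))) \<in> Fl m"
        using Fl_mono[OF low[OF order_refl], of "x - a *s ev i" m] m by simp
      have "adj r *v (A h *v (r *v x)) = adj r *v (A h *v (r *v (x - a *s ev i)))
          + a *s (adj r *v (A h *v (r *v ev i)))"
        by (simp add: matrix_vector_mult_diff_distrib vector_scalar_commute)
      then show ?thesis unfolding eq by (simp only: Fl_add[OF kk Fl_scale[OF e]])
    qed
  qed
  then have "flagged (g ** r) H (Suc k)" by (simp add: flagged_def)
  then show ?thesis using g(1) rS mult_Sp by blast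
qed

theorem solvable_into_Bm:
  assumes H: "subgroup H G" "connectedin (zar 36) H" "(derived G ^^ n) H = {\<one>\<^bsub>G\<^esub>}"
  obtains g where "g \<in> Sp" "\<And>h. h \<in> H \<Longrightarrow> adj g ** dec h ** g \<in> Bm"
proof -
  have Hc: "H \<subseteq> carrier G" using H(1) by (auto simp: subgroup_def)
  have SpH: "dec h \<in> Sp" if "h \<in> H" for h using subsetD[OF Hc that] by auto
  have invH: "enc (adj (dec h)) \<in> H" if "h \<in> H" for h
    using subgroup.m_inv_closed[OF H(1) that] inv_G'[OF subsetD[OF Hc that]] by simp
  have 0: "v = 0" if v: "v \<in> Fl 0" for v
  proof -
    have "v $ j = 0" for j using v lv_bounds(1)[of j] by (simp add: Fl_def)
    then show ?thesis by (simp add: vec_eq_iff)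
  qed
  have f0: "flagged (mat 1) H 0"
    unfolding flagged_def
  proof (intro ballI allI impI)
    fix h m v assume "m \<le> 0" "v \<in> Fl m"
    then have "v = 0" using 0 by simp
    then show "(adj (mat 1) ** dec h ** mat 1) *v v \<in> Fl m" by simp
  qed
  obtain g1 where g1: "g1 \<in> Sp" "flagged g1 H (Suc 0)"
    using flag_step[OF H one_Sp f0, of 1] by (auto simp: lv_values)
  obtain g2 where g2: "g2 \<in> Sp" "flagged g2 H (Suc (Suc 0))"
    using flag_step[OF H g1, of 2] by (auto simp: lv_values)
  obtain g where g: "g \<in> Sp" "flagged g H (Suc (Suc (Suc 0)))"
    using flag_step[OF H g2, of 3] by (auto simp: lv_values)
  have fl: "(adj g ** dec h ** g) *v axis j 1 \<in> Fl (lv j)" if "h \<in> H" "lv j \<le> 3" for h j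
    using g(2)[unfolded flagged_def, rule_format, OF that(1), of "lv j" "axis j 1"] that(2) by simp
  have "adj g ** dec h ** g \<in> Bm" if h: "h \<in> H" for h
  proof (rule Bm_criterion)
    show "adj g ** dec h ** g \<in> Sp" using g(1) SpH[OF h] by (simp add: mult_Sp adj_Sp)
    have "adj (adj g ** dec h ** g) = adj g ** dec (enc (adj (dec h))) ** g"
      using SpH[OF h] g(1) by (simp add: adj_mult mult_Sp adj_Sp matrix_mul_assoc)
    then show "adj (adj g ** dec h ** g) *v axis j 1 \<in> Fl (lv j)" if "lv j \<le> 3" for j
      using fl[OF invH[OF h] that] by simp
  qed (rule fl[OF h])
  then show ?thesis by (rule that[OF g(1)])
qed

section \<open>Borel subgroups\<close>

definition csc :: "complex point set \<Rightarrow> bool" where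
  "csc H \<longleftrightarrow> closed_subgroup CC 36 G H \<and> connectedin (zar 36) H \<and> solvable (G\<lparr>carrier := H\<rparr>)"

lemma borel_iff: "borel_subgroup CC 36 G B \<longleftrightarrow> csc B \<and> (\<forall>H. csc H \<and> B \<subseteq> H \<longrightarrow> H = B)"
  unfolding borel_subgroup_def csc_def Let_def by blast

lemma solvable_subgroup_iff:
  assumes "subgroup H G" shows "solvable (G\<lparr>carrier := H\<rparr>) \<longleftrightarrow> (\<exists>n. (derived G ^^ n) H = {\<one>\<^bsub>G\<^esub>})"
proof -
  interpret K: group "G\<lparr>carrier := H\<rparr>" by (rule subgroup.subgroup_is_group[OF assms group_G])
  have "(derived (G\<lparr>carrier := H\<rparr>) ^^ n) H = (derived G ^^ n) H \<and> (derived G ^^ n) H \<subseteq> H" for n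
  proof (induction n)
    case (Suc n)
    then show ?case
      using G.derived_consistent[OF _ assms, of "(derived G ^^ n) H"] G.derived_incl[OF _ assms] by simp
  qed simp
  then show ?thesis using K.solvable_iff_trivial_derived_seq by simp
qed

lemma csc_into_Bm:
  assumes "csc H" obtains g where "g \<in> Sp" "\<And>h. h \<in> H \<Longrightarrow> adj g ** dec h ** g \<in> Bm"
proof -
  have H: "subgroup H G" "connectedin (zar 36) H" using assms by (auto simp: csc_def closed_subgroup_def)
  obtain n where "(derived G ^^ n) H = {\<one>\<^bsub>G\<^esub>}"
    using assms solvable_subgroup_iff[OF H(1)] by (auto simp: csc_def)
  then show ?thesis using solvable_into_Bm[OF H] that by blast
qed

subsection \<open>The standard Borel subgroup\<close>

lemma subgroup_encI:
  assumes "M \<subseteq> Sp" "mat 1 \<in> M" "\<And>A C. A \<in> M \<Longrightarrow> C \<in> M \<Longrightarrow> A ** C \<in> M" "\<And>A. A \<in> M \<Longrightarrow> adj A \<in> M"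
  shows "subgroup (enc ` M) G"
proof (rule G.subgroupI)
  fix a assume "a \<in> enc ` M"
  then obtain A where A: "a = enc A" "A \<in> M" by blast
  then show "inv\<^bsub>G\<^esub> a \<in> enc ` M" using assms(1,4) inv_G[of A] by auto
  fix b assume "b \<in> enc ` M"
  then obtain C where "b = enc C" "C \<in> M" by blast
  then show "a \<otimes>\<^bsub>G\<^esub> b \<in> enc ` M" using A assms(3) by auto
qed (use assms(1,2) in auto)

lemma subgroup_Bm: "subgroup (enc ` Bm) G"
  by (rule subgroup_encI) (auto simp: Bm_Sp mult_Bm adj_Bm)

lemma closedin_entries:
  assumes "M = {A \<in> Sp. \<forall>i j. P i j \<longrightarrow> A $ i $ j = 0}"
  shows "closedin (zar 36) (enc ` M)"
proof -
  have "closedin (zar 36) {x \<in> \<A> 36. \<forall>g\<in>(\<lambda>(i, j) x. dec x $ i $ j) ` {(i, j). P i j}. g x = 0}"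
    unfolding closedin_zar
    by (rule exI[of _ "(\<lambda>(i, j) x. dec x $ i $ j) ` {(i, j). P i j}"]) (auto intro: mp_entry mp_dec)
  then have "closedin (zar 36) (enc ` Sp \<inter> {x \<in> \<A> 36. \<forall>g\<in>(\<lambda>(i, j) x. dec x $ i $ j) ` {(i, j). P i j}. g x = 0})"
    using carrier_G_closed by (intro closedin_Int) auto
  moreover have "enc ` Sp \<inter> {x \<in> \<A> 36. \<forall>g\<in>(\<lambda>(i, j) x. dec x $ i $ j) ` {(i, j). P i j}. g x = 0} = enc ` M"
    using assms by auto
  ultimately show ?thesis by simp
qed

lemma closed_Bm: "closedin (zar 36) (enc ` Bm)"
  by (rule closedin_entries[where P = "\<lambda>i j. lv j < lv i"]) (auto simp: Bm_def)

text \<open>Conjugation by the similitudes \<open>diag (z ^ - lv i)\<close> joins an upper triangular matrix to its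
  diagonal part.\<close>

lemma Bm_contract:
  assumes A: "A \<in> Bm"
  shows "\<exists>\<phi>. (\<forall>z. \<phi> z \<in> Bm) \<and> \<phi> 1 = A \<and> \<phi> 0 \<in> Tm \<and> (\<forall>i j. upoly (\<lambda>z. \<phi> z $ i $ j))"
proof -
  define \<phi> :: "complex \<Rightarrow> cmat" where
    "\<phi> = (\<lambda>z. \<chi> i j. if lv i \<le> lv j then z ^ (lv j - lv i) * A $ i $ j else 0)"
  have up: "A $ i $ j = 0" if "lv j < lv i" for i j using A that by (simp add: Bm_def)
  have up': "adj A $ i $ j = 0" if "lv j < lv i" for i j using adj_Bm[OF A] that by (simp add: Bm_def)
  have \<phi>_nth: "\<phi> z $ i $ j = (if lv i \<le> lv j then z ^ (lv j - lv i) * A $ i $ j else 0)" for z i j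
    by (simp add: \<phi>_def)
  have adj\<phi>: "adj (\<phi> z) $ i $ j = (if lv i \<le> lv j then z ^ (lv j - lv i) * adj A $ i $ j else 0)" for z i j
    using lv_bounds[of i] lv_bounds[of j] by (auto simp: adj_def \<phi>_def lv_flip)
  have "adj (\<phi> z) ** \<phi> z = mat 1" for z
  proof -
    have "(adj (\<phi> z) ** \<phi> z) $ i $ j = mat 1 $ i $ j" for i j
    proof (cases "lv i \<le> lv j")
      case True
      have "adj (\<phi> z) $ i $ k * \<phi> z $ k $ j = z ^ (lv j - lv i) * (adj A $ i $ k * A $ k $ j)" for k
      proof (cases "lv i \<le> lv k \<and> lv k \<le> lv j")
        case True
        then show ?thesis by (simp add: adj\<phi> \<phi>_nth power_add[symmetric])
      next
        case False
        then show ?thesis using up[of j k] up'[of k i] by (auto simp: adj\<phi> \<phi>_nth)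
      qed
      then have "(adj (\<phi> z) ** \<phi> z) $ i $ j = z ^ (lv j - lv i) * (adj A ** A) $ i $ j"
        by (simp add: matrix_matrix_mult_def sum_distrib_left)
      also have "\<dots> = mat 1 $ i $ j"
        using A lv_inj[of i j] by (auto simp: Bm_Sp Sp_adj_left mat_def)
      finally show ?thesis .
    next
      case False
      have "adj (\<phi> z) $ i $ k * \<phi> z $ k $ j = 0" for k
        using False by (cases "lv i \<le> lv k") (auto simp: adj\<phi> \<phi>_nth)
      then have "(adj (\<phi> z) ** \<phi> z) $ i $ j = 0"
        by (simp only: matrix_matrix_mult_def vec_lambda_beta sum.neutral_const)
      then show ?thesis using False by (auto simp: mat_def)
    qed
    then show ?thesis by (simp add: vec_eq_iff)
  qed
  then have Sp: "\<phi> z \<in> Sp" for z by (simp add: Sp_iff)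
  then have "\<phi> z \<in> Bm" for z by (auto simp: Bm_def \<phi>_nth)
  moreover have "\<phi> 1 = A" using up by (auto simp: \<phi>_def vec_eq_iff)
  moreover have "\<phi> 0 $ i $ j = 0" if "i \<noteq> j" for i j
    using that lv_inj[of i j] by (auto simp: \<phi>_def power_0_left)
  then have "\<phi> 0 \<in> Tm" using Sp by (simp add: Tm_def)
  moreover have "upoly (\<lambda>z. \<phi> z $ i $ j)" for i j unfolding \<phi>_def
    by (cases "lv i \<le> lv j") (auto intro!: upoly_intros)
  ultimately show ?thesis by (intro exI[of _ \<phi>]) blast
qed

lemma connected_curve:
  assumes "\<And>i j. upoly (\<lambda>z. \<phi> z $ i $ j)" shows "connectedin (zar 36) (range (\<lambda>z. enc (\<phi> z)))"
proof (rule zar_irreducible_connected[OF zar_irreducibleI_curves])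
  fix x y assume "x \<in> range (\<lambda>z. enc (\<phi> z))" "y \<in> range (\<lambda>z. enc (\<phi> z))"
  then obtain a b where "x = enc (\<phi> a)" "y = enc (\<phi> b)" by auto
  then show "\<exists>\<psi> a b. (\<forall>z. \<psi> z \<in> range (\<lambda>z. enc (\<phi> z))) \<and> (\<forall>i<36. upoly (\<lambda>z. \<psi> z i)) \<and> \<psi> a = x \<and> \<psi> b = y"
    using assms by (rule_tac exI[of _ "\<lambda>z. enc (\<phi> z)"], rule_tac exI[of _ a], rule_tac exI[of _ b])
      (auto intro: upoly_enc)
qed auto

lemma Tm_diag: assumes "A \<in> Tm" shows "A $ Inl i $ Inl i \<noteq> 0" "A $ Inr i $ Inr i = inverse (A $ Inl i $ Inl i)"
proof -
  have A: "A \<in> Sp" "\<And>i j. i \<noteq> j \<Longrightarrow> A $ i $ j = 0" using assms by (auto simp: Tm_def)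
  have vec: "A *v axis j 1 = (A $ j $ j) *s axis j 1" for j
    using A(2) by (auto simp: vec_eq_iff mult_axis_nth axis_nth')
  have "om (A *v ev i) (A *v fv i) = 1" using Sp_om[OF A(1)] by (simp add: om_basis)
  then have "A $ Inl i $ Inl i * A $ Inr i $ Inr i = 1" by (simp add: vec om_simps om_basis mult.commute)
  then show "A $ Inl i $ Inl i \<noteq> 0" "A $ Inr i $ Inr i = inverse (A $ Inl i $ Inl i)"
    using inverse_unique[of "A $ Inl i $ Inl i" "A $ Inr i $ Inr i"] by auto
qed

definition tor :: "(3 \<Rightarrow> complex) \<Rightarrow> cmat" where
  "tor a = (\<chi> i j. if i = j then case i of Inl k \<Rightarrow> a k | Inr k \<Rightarrow> inverse (a k) else 0)"

lemma tor_vec: "tor a *v axis (Inl k) c = axis (Inl k) (a k * c)" "tor a *v axis (Inr k) c = axis (Inr k) (inverse (a k) * c)"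
  by (auto simp: vec_eq_iff matrix_vector_mult_def axis_nth' tor_def if_distrib[of "\<lambda>x. _ * x"] cong: if_cong)

lemma tor_vec_nth: "(tor a *v v) $ i = tor a $ i $ i * v $ i"
proof -
  have "(tor a *v v) $ i = (\<Sum>j\<in>UNIV. if i = j then tor a $ i $ i * v $ i else 0)"
    unfolding matrix_vector_mult_def vec_lambda_beta by (intro sum.cong) (auto simp: tor_def)
  then show ?thesis by simp
qed

lemma tor_Sp: assumes "\<And>k. a k \<noteq> 0" shows "tor a \<in> Sp"
proof -
  have "tor a $ Inl k $ Inl k * tor a $ Inr k $ Inr k = 1" for k using assms by (simp add: tor_def)
  then have "om (tor a *v v) (tor a *v w) = om v w" for v w
    by (simp add: om_eq tor_vec_nth) (simp add: algebra_simps mult.assoc[symmetric])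
  then show ?thesis by (simp add: Sp_def)
qed

lemma tor_Tm: "(\<And>k. a k \<noteq> 0) \<Longrightarrow> tor a \<in> Tm"
  using tor_Sp[of a] unfolding Tm_def by (simp add: tor_def)

lemma Tm_tor: assumes "A \<in> Tm" shows "A = tor (\<lambda>k. A $ Inl k $ Inl k)"
proof -
  have "A $ i $ j = tor (\<lambda>k. A $ Inl k $ Inl k) $ i $ j" for i j
    using assms Tm_diag[OF assms] by (cases "i = j"; cases i) (auto simp: tor_def Tm_def)
  then show ?thesis by (intro iffD2[OF vec_eq_iff] allI)
qed

lemma Tm_eq: "Tm = tor ` {a. \<forall>k. a k \<noteq> 0}"
  using tor_Tm Tm_tor Tm_diag(1) by (auto intro!: image_eqI)

text \<open>The torus is connected because a Laurent polynomial becomes a polynomial on a line, after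
  multiplication with a power of the product of the coordinates.\<close>

lemma Tm_line_rational:
  assumes "h \<in> pf (coords 36)" and b: "\<And>k. upoly (b k)"
  shows "\<exists>D g. upoly g \<and> (\<forall>z. (\<forall>k. b k z \<noteq> 0) \<longrightarrow>
    h (enc (tor (\<lambda>k. b k z))) * (b 1 z * b 2 z * b 3 z) ^ D = g z)"
  using assms(1)
proof induction
  case (const c)
  show ?case by (rule exI[of _ 0], rule exI[of _ "\<lambda>_. c"]) (auto intro: upoly_intros)
next
  case (coord s)
  then obtain n where n: "s = (\<lambda>x. x n)" "n < 36" by (auto simp: coords_def)
  define i j where "i = fst (ent n)" "j = snd (ent n)"
  have s: "s (enc A) = A $ i $ j" for A using n by (simp add: enc_def i_j_def)
  have "\<exists>g. upoly g \<and> (\<forall>z. (\<forall>k. b k z \<noteq> 0) \<longrightarrow> tor (\<lambda>k. b k z) $ i $ j * (b 1 z * b 2 z * b 3 z) = g z)"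
  proof (cases "i = j")
    case True
    show ?thesis
    proof (cases i)
      case (Inl k)
      then show ?thesis using True b
        by (intro exI[of _ "\<lambda>z. b k z * (b 1 z * b 2 z * b 3 z)"]) (auto simp: tor_def intro!: upoly_mult)
    next
      case (Inr k)
      show ?thesis
        by (rule index3_cases[of k];
          rule exI[of _ "\<lambda>z. (if k = 1 then b 2 z * b 3 z else if k = 2 then b 1 z * b 3 z else b 1 z * b 2 z)"])
          (use True Inr b in \<open>auto simp: tor_def intro: upoly_mult\<close>)
    qed
  qed (auto simp: tor_def intro!: exI[of _ "\<lambda>_. 0"] upoly_intros)
  then show ?case unfolding s by (intro exI[of _ 1]) simp
next
  case (add f1 f2)
  then obtain D1 g1 D2 g2 where 1: "upoly g1" "upoly g2" and
    2: "\<And>z. (\<forall>k. b k z \<noteq> 0) \<Longrightarrow> f1 (enc (tor (\<lambda>k. b k z))) * (b 1 z * b 2 z * b 3 z) ^ D1 = g1 z"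
    "\<And>z. (\<forall>k. b k z \<noteq> 0) \<Longrightarrow> f2 (enc (tor (\<lambda>k. b k z))) * (b 1 z * b 2 z * b 3 z) ^ D2 = g2 z" by blast
  define p where "p = (\<lambda>z. b 1 z * b 2 z * b 3 z)"
  have p: "upoly p" unfolding p_def by (intro upoly_intros b)
  have "(f1 (enc (tor (\<lambda>k. b k z))) + f2 (enc (tor (\<lambda>k. b k z)))) * p z ^ (D1 + D2)
      = g1 z * p z ^ D2 + g2 z * p z ^ D1" if "\<forall>k. b k z \<noteq> 0" for z
  proof -
    have e: "g1 z = f1 (enc (tor (\<lambda>k. b k z))) * p z ^ D1" "g2 z = f2 (enc (tor (\<lambda>k. b k z))) * p z ^ D2"
      using 2[OF that] by (simp_all only: p_def)
    show ?thesis unfolding e by (simp add: power_add algebra_simps)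
  qed
  then have key: "\<forall>z. (\<forall>k. b k z \<noteq> 0) \<longrightarrow> (f1 (enc (tor (\<lambda>k. b k z))) + f2 (enc (tor (\<lambda>k. b k z)))) *
      (b 1 z * b 2 z * b 3 z) ^ (D1 + D2) = g1 z * p z ^ D2 + g2 z * p z ^ D1"
    by (simp add: p_def)
  have up: "upoly (\<lambda>z. g1 z * p z ^ D2 + g2 z * p z ^ D1)" by (intro upoly_intros 1 p)
  show ?case unfolding CC_simps
    by (rule exI[of _ "D1 + D2"], rule exI[of _ "\<lambda>z. g1 z * p z ^ D2 + g2 z * p z ^ D1"],
      rule conjI[OF up key])
next
  case (mult f1 f2)
  then obtain D1 g1 D2 g2 where 1: "upoly g1" "upoly g2" and
    2: "\<And>z. (\<forall>k. b k z \<noteq> 0) \<Longrightarrow> f1 (enc (tor (\<lambda>k. b k z))) * (b 1 z * b 2 z * b 3 z) ^ D1 = g1 z"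
    "\<And>z. (\<forall>k. b k z \<noteq> 0) \<Longrightarrow> f2 (enc (tor (\<lambda>k. b k z))) * (b 1 z * b 2 z * b 3 z) ^ D2 = g2 z" by blast
  have "(f1 (enc (tor (\<lambda>k. b k z))) * f2 (enc (tor (\<lambda>k. b k z)))) * (b 1 z * b 2 z * b 3 z) ^ (D1 + D2)
      = g1 z * g2 z" if "\<forall>k. b k z \<noteq> 0" for z
    unfolding 2[OF that, symmetric] by (simp add: power_add mult_ac)
  then show ?case using 1
    by (rule_tac exI[of _ "D1 + D2"], rule_tac exI[of _ "\<lambda>z. g1 z * g2 z"]) (auto intro: upoly_mult)
qed

lemma irreducible_Tm: "zar_irreducible 36 (enc ` Tm)"
  unfolding zar_irreducible_def
proof (intro ballI impI, rule ccontr)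
  fix h1 h2 assume h: "h1 \<in> pf (coords 36)" "h2 \<in> pf (coords 36)" "\<forall>x\<in>enc ` Tm. h1 x * h2 x = 0"
    and "\<not> ((\<forall>x\<in>enc ` Tm. h1 x = 0) \<or> (\<forall>x\<in>enc ` Tm. h2 x = 0))"
  then obtain a c where a: "\<forall>k. a k \<noteq> 0" "h1 (enc (tor a)) \<noteq> 0" and c: "\<forall>k. c k \<noteq> 0" "h2 (enc (tor c)) \<noteq> 0"
    unfolding Tm_eq by auto
  define b where "b = (\<lambda>k z. a k + z * (c k - a k))"
  have b: "upoly (b k)" for k unfolding b_def by (intro upoly_intros)
  have b01: "(\<lambda>k. b k 0) = a" "(\<lambda>k. b k 1) = c" by (auto simp: b_def)
  define p where "p = (\<lambda>z. b 1 z * b 2 z * b 3 z)"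
  have p: "upoly p" unfolding p_def by (intro upoly_intros b)
  have pnz: "(\<forall>k. b k z \<noteq> 0) \<longleftrightarrow> p z \<noteq> 0" for z by (auto simp: p_def forall_3)
  obtain D1 g1 where g1: "upoly g1" and g1': "\<forall>z. (\<forall>k. b k z \<noteq> 0) \<longrightarrow>
      h1 (enc (tor (\<lambda>k. b k z))) * (b 1 z * b 2 z * b 3 z) ^ D1 = g1 z"
    using Tm_line_rational[where b = b, OF h(1) b] by (elim exE conjE)
  have g1e: "g1 z = h1 (enc (tor (\<lambda>k. b k z))) * p z ^ D1" if "p z \<noteq> 0" for z
    using g1'[rule_format, of z] that pnz[of z] by (simp add: p_def)
  obtain D2 g2 where g2: "upoly g2" and g2': "\<forall>z. (\<forall>k. b k z \<noteq> 0) \<longrightarrow>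
      h2 (enc (tor (\<lambda>k. b k z))) * (b 1 z * b 2 z * b 3 z) ^ D2 = g2 z"
    using Tm_line_rational[where b = b, OF h(2) b] by (elim exE conjE)
  have g2e: "g2 z = h2 (enc (tor (\<lambda>k. b k z))) * p z ^ D2" if "p z \<noteq> 0" for z
    using g2'[rule_format, of z] that pnz[of z] by (simp add: p_def)
  have p0: "p 0 \<noteq> 0" "p 1 \<noteq> 0" using a(1) c(1) unfolding pnz[symmetric] by (simp_all add: b_def)
  have "g1 0 \<noteq> 0" unfolding g1e[OF p0(1)] b01 using a(2) p0(1) by simp
  moreover have "g2 1 \<noteq> 0" unfolding g2e[OF p0(2)] b01 using c(2) p0(2) by simp
  ultimately have fin: "finite ({z. p z = 0} \<union> {z. g1 z = 0} \<union> {z. g2 z = 0})"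
    using upoly_finite_zeros[OF p p0(1)] upoly_finite_zeros[OF g1] upoly_finite_zeros[OF g2] by simp
  obtain z where "z \<notin> {z. p z = 0} \<union> {z. g1 z = 0} \<union> {z. g2 z = 0}"
    using ex_new_if_finite[OF infinite_UNIV_char_0 fin] by (elim exE)
  then have z: "p z \<noteq> 0" "g1 z \<noteq> 0" "g2 z \<noteq> 0" by auto
  have "tor (\<lambda>k. b k z) \<in> Tm" using z(1) unfolding pnz[symmetric] by (intro tor_Tm) simp
  then have "h1 (enc (tor (\<lambda>k. b k z))) * h2 (enc (tor (\<lambda>k. b k z))) = 0" using h(3) by simp
  then show False using z unfolding g1e[OF z(1)] g2e[OF z(1)] by auto
qed

lemma connected_Tm: "connectedin (zar 36) (enc ` Tm)"
  by (rule zar_irreducible_connected[OF irreducible_Tm]) auto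

lemma connected_Bm: "connectedin (zar 36) (enc ` Bm)"
proof -
  have "\<exists>C. connectedin (zar 36) C \<and> enc ` Tm \<subseteq> C \<and> enc A \<in> C \<and> C \<subseteq> enc ` Bm" if A: "A \<in> Bm" for A
  proof -
    obtain \<phi> where \<phi>: "\<forall>z. \<phi> z \<in> Bm" "\<phi> 1 = A" "\<phi> 0 \<in> Tm" "\<forall>i j. upoly (\<lambda>z. \<phi> z $ i $ j)"
      using Bm_contract[OF A] by (elim exE conjE)
    let ?C = "enc ` Tm \<union> range (\<lambda>z. enc (\<phi> z))"
    have "connectedin (zar 36) ?C"
      by (rule connectedin_Un[OF connected_Tm connected_curve]) (use \<phi> in auto)
    then show ?thesis using \<phi> Tm_Bm by (intro exI[of _ ?C]) auto
  qed
  then have "\<exists>C. \<forall>A\<in>Bm. connectedin (zar 36) (C A) \<and> enc ` Tm \<subseteq> C A \<and> enc A \<in> C A \<and> C A \<subseteq> enc ` Bm"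
    by (intro bchoice ballI)
  then obtain C where C: "\<forall>A\<in>Bm. connectedin (zar 36) (C A) \<and> enc ` Tm \<subseteq> C A \<and> enc A \<in> C A \<and> C A \<subseteq> enc ` Bm"
    by (elim exE)
  have T1: "enc (mat 1) \<in> enc ` Tm" using one_Sp by (intro imageI) (simp add: Tm_def mat_def)
  have "connectedin (zar 36) (\<Union>(C ` Bm))"
  proof (rule connectedin_Union)
    have "enc (mat 1) \<in> C A" if "A \<in> Bm" for A using C that T1 by blast
    then show "\<Inter>(C ` Bm) \<noteq> {}" by blast
  qed (use C in blast)
  moreover have "\<Union>(C ` Bm) = enc ` Bm" using C by blast
  ultimately show ?thesis by simp
qed

definition Um :: "nat \<Rightarrow> cmat set" where
  "Um k = {A \<in> Bm. \<forall>i j. lv j < lv i + k \<longrightarrow> (A - mat 1) $ i $ j = 0}"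

subsection \<open>Solvability and maximality\<close>

definition Jm :: "nat \<Rightarrow> cmat set" where
  "Jm k = {N. \<forall>i j. lv j < lv i + k \<longrightarrow> N $ i $ j = 0}"

definition Um' :: "nat \<Rightarrow> cmat set" where
  "Um' k = {A \<in> Bm. A - mat 1 \<in> Jm k}"

lemma Jm_mult: assumes "N \<in> Jm k" "M \<in> Jm l" shows "N ** M \<in> Jm (k + l)"
proof -
  have "(N ** M) $ i $ j = 0" if ij: "lv j < lv i + (k + l)" for i j
  proof -
    have "N $ i $ a * M $ a $ j = 0" for a
      using assms ij by (cases "lv a < lv i + k") (auto simp: Jm_def)
    then show ?thesis by (simp only: matrix_matrix_mult_def vec_lambda_beta sum.neutral_const)
  qed
  then show ?thesis by (simp add: Jm_def)
qed

lemma Jm_add: "N \<in> Jm k \<Longrightarrow> M \<in> Jm k \<Longrightarrow> N + M \<in> Jm k"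
  and Jm_diff: "N \<in> Jm k \<Longrightarrow> M \<in> Jm k \<Longrightarrow> N - M \<in> Jm k"
  by (simp_all add: Jm_def)

lemma Jm_mono: "N \<in> Jm l \<Longrightarrow> k \<le> l \<Longrightarrow> N \<in> Jm k"
  by (simp add: Jm_def)

lemma Bm_Jm: "A \<in> Bm \<Longrightarrow> A \<in> Jm 0"
  by (simp add: Bm_def Jm_def)

lemma Um'_0: "Um' 0 = Bm"
  using Jm_diff[OF Bm_Jm Bm_Jm[OF one_Bm]] by (auto simp: Um'_def)

lemma Um'_6: "Um' 6 = {mat 1}"
proof -
  have z: "N = 0" if "N \<in> Jm 6" for N
  proof -
    have "lv j < lv i + 6" for i j using lv_bounds[of i] lv_bounds[of j] by simp
    then have "N $ i $ j = 0" for i j using that by (simp add: Jm_def)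
    then show ?thesis by (simp add: vec_eq_iff)
  qed
  have "A = mat 1" if "A \<in> Um' 6" for A
    using z[of "A - mat 1"] that by (simp add: Um'_def)
  moreover have "(0::cmat) \<in> Jm 6" by (simp add: Jm_def)
  then have "mat 1 \<in> Um' 6" by (simp add: Um'_def)
  ultimately show ?thesis by blast
qed

lemma matrix_diff_left: "(A - C) ** D = A ** D - C ** (D :: cmat)"
  and matrix_diff_right: "D ** (A - C) = D ** A - D ** (C :: cmat)"
  by (simp_all add: vec_eq_iff matrix_matrix_mult_def sum_subtractf algebra_simps)

lemma subgroup_Um': "subgroup (enc ` Um' k) G"
proof (rule subgroup_encI)
  show "Um' k \<subseteq> Sp" by (auto simp: Um'_def Bm_Sp)
  show "mat 1 \<in> Um' k" by (simp add: Um'_def Jm_def)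
  fix A assume A: "A \<in> Um' k"
  then have AB: "A \<in> Bm" "A - mat 1 \<in> Jm k" by (auto simp: Um'_def)
  have "adj A - mat 1 = 0 - adj A ** (A - mat 1)"
    using AB by (simp add: matrix_diff_right Sp_adj_left Bm_Sp)
  also have "\<dots> \<in> Jm k"
    using Jm_mult[OF Bm_Jm[OF adj_Bm[OF AB(1)]] AB(2)] by (intro Jm_diff) (simp_all add: Jm_def)
  finally show "adj A \<in> Um' k" using AB by (simp add: Um'_def adj_Bm)
  fix C assume C: "C \<in> Um' k"
  then have CB: "C \<in> Bm" "C - mat 1 \<in> Jm k" by (auto simp: Um'_def)
  have "A ** C - mat 1 = (A - mat 1) ** C + (C - mat 1)" by (simp add: matrix_diff_left)
  also have "\<dots> \<in> Jm k" using Jm_mult[OF AB(2) Bm_Jm[OF CB(1)]] CB(2) by (intro Jm_add) simp_all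
  finally show "A ** C \<in> Um' k" using AB CB by (simp add: Um'_def mult_Bm)
qed

lemma commutator_Um':
  assumes A: "A \<in> Um' k" and C: "C \<in> Um' k" shows "A ** C ** adj A ** adj C \<in> Um' (Suc k)"
proof -
  have AB: "A \<in> Bm" "A - mat 1 \<in> Jm k" and CB: "C \<in> Bm" "C - mat 1 \<in> Jm k"
    using A C by (auto simp: Um'_def)
  have "A ** C - C ** A \<in> Jm (Suc k)"
  proof (cases k)
    case 0
    have d: "(A ** C) $ i $ i = A $ i $ i * C $ i $ i" if "A \<in> Bm" "C \<in> Bm" for A C i
    proof -
      have "A $ i $ a * C $ a $ i = (if a = i then A $ i $ i * C $ i $ i else 0)" for a
      proof -
        consider "a = i" | "lv a < lv i" | "lv i < lv a" using lv_inj[of a i] by linarith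
        then show ?thesis using that by cases (auto simp: Bm_def)
      qed
      then have "(A ** C) $ i $ i = (\<Sum>a\<in>UNIV. if a = i then A $ i $ i * C $ i $ i else 0)"
        unfolding matrix_matrix_mult_def vec_lambda_beta by (intro sum.cong refl)
      then show ?thesis by simp
    qed
    have "(A ** C - C ** A) $ i $ j = 0" if ij: "lv j < lv i + Suc 0" for i j
    proof (cases "i = j")
      case True then show ?thesis using d AB(1) CB(1) by simp
    next
      case False
      then have "lv j < lv i" using ij lv_inj[of i j] by linarith
      then show ?thesis using mult_Bm[OF AB(1) CB(1)] mult_Bm[OF CB(1) AB(1)] by (simp add: Bm_def)
    qed
    then show ?thesis by (simp add: Jm_def 0)
  next
    case (Suc l)
    have "A ** C - C ** A = (A - mat 1) ** (C - mat 1) - (C - mat 1) ** (A - mat 1)"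
      by (simp add: matrix_diff_left matrix_diff_right)
    also have "\<dots> \<in> Jm (k + k)" by (intro Jm_diff Jm_mult AB CB)
    finally show ?thesis using Suc by (auto intro: Jm_mono)
  qed
  then have "(A ** C - C ** A) ** (adj A ** adj C) \<in> Jm (Suc k + 0)"
    by (rule Jm_mult) (intro Bm_Jm mult_Bm adj_Bm AB CB)
  moreover have "(A ** C - C ** A) ** (adj A ** adj C) = A ** C ** adj A ** adj C - mat 1"
    using AB CB by (simp add: matrix_diff_left matrix_mul_assoc[symmetric] Bm_Sp Sp_adj_right)
  ultimately show ?thesis using AB CB by (simp add: Um'_def mult_Bm adj_Bm)
qed

lemma derived_Um': "derived G (enc ` Um' k) \<subseteq> enc ` Um' (Suc k)"
  unfolding derived_def
proof (rule G.generate_subgroup_incl[OF _ subgroup_Um'])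
  show "derived_set G (enc ` Um' k) \<subseteq> enc ` Um' (Suc k)"
  proof (intro UN_least subsetI)
    fix x y z assume "x \<in> enc ` Um' k" "y \<in> enc ` Um' k" and z: "z \<in> {x \<otimes>\<^bsub>G\<^esub> y \<otimes>\<^bsub>G\<^esub> inv\<^bsub>G\<^esub> x \<otimes>\<^bsub>G\<^esub> inv\<^bsub>G\<^esub> y}"
    then obtain A C where AC: "x = enc A" "y = enc C" "A \<in> Um' k" "C \<in> Um' k" by blast
    then have "A \<in> Sp" "C \<in> Sp" by (auto simp: Um'_def Bm_Sp)
    then show "z \<in> enc ` Um' (Suc k)" using z AC commutator_Um'[OF AC(3,4)] by simp
  qed
qed

lemma derived_Bm: "(derived G ^^ 6) (enc ` Bm) = {\<one>\<^bsub>G\<^esub>}"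
proof
  have "(derived G ^^ n) (enc ` Bm) \<subseteq> enc ` Um' n" for n
  proof (induction n)
    case (Suc n)
    then show ?case using G.mono_derived[OF Suc] derived_Um'[of n] by simp
  qed (simp add: Um'_0)
  from this[of 6] show "(derived G ^^ 6) (enc ` Bm) \<subseteq> {\<one>\<^bsub>G\<^esub>}" by (simp add: Um'_6)
  show "{\<one>\<^bsub>G\<^esub>} \<subseteq> (derived G ^^ 6) (enc ` Bm)"
    using subgroup.one_closed[OF G.exp_of_derived_is_subgroup[OF subgroup_Bm]] by blast
qed

lemma csc_Bm: "csc (enc ` Bm)"
  unfolding csc_def closed_subgroup_def solvable_subgroup_iff[OF subgroup_Bm]
  using subgroup_Bm closed_Bm connected_Bm derived_Bm by blast

text \<open>The subspaces of the standard flag are the only isotropic ones that are stable under the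
  upper triangular group.\<close>

lemma Bm_eigenvector:
  assumes v: "\<And>b. b \<in> Bm \<Longrightarrow> \<exists>c. b *v v - c *s v \<in> Fl m" and m: "m \<le> 2"
  shows "v \<in> Fl (Suc m)"
proof (rule ccontr)
  assume "v \<notin> Fl (Suc m)"
  then obtain j where j: "Suc m < lv j" "v $ j \<noteq> 0" by (auto simp: Fl_def)
  obtain k where k: "lv k = Suc m" using lv_surj[of "Suc m"] m by auto
  let ?b = "R 1 (axis k 1) (axis (flip j) 1)"
  have fl: "axis k 1 \<in> Fl (Suc m)" "axis (flip j) 1 \<in> Fl (5 - m)"
    using j k by (simp_all add: lv_flip)
  have b: "?b \<in> Bm"
    by (rule R_Bm[OF om_Fl[OF fl] fl]) (use m in simp_all)
  obtain c where c: "?b *v v - c *s v \<in> Fl m" using v[OF b] by blast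
  have kj: "k \<noteq> j" using j k by auto
  have fj: "flip j \<noteq> j" by (cases j) auto
  have "(?b *v v - c *s v) $ j = 0" using c j by (simp add: Fl_def)
  then have "c = 1" using kj fj j by (simp add: R_vec axis_nth')
  then have "(?b *v v - v) $ k = 0" using c k by (simp add: Fl_def)
  then show False using j(2) by (auto simp: R_vec axis_nth' om_axis_right split: if_splits)
qed

lemma Sp_subspace_image:
  assumes A: "A \<in> Sp" and S: "vec.subspace S" "\<And>v. v \<in> S \<Longrightarrow> A *v v \<in> S" and w: "w \<in> S"
  shows "adj A *v w \<in> S"
proof -
  have "inj ((*v) A)" using Sp_inj[OF A] by (auto simp: inj_def)
  then have "inj_on ((*v) A) (vec.span S)" by (rule inj_on_subset) simp
  then have "vec.dim ((*v) A ` S) = vec.dim S"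
    by (rule vec.dim_image_eq[OF matrix_vector_mul_linear_gen])
  then have "(*v) A ` S = S"
    using S by (intro vec.subspace_dim_equal) (auto intro: vec.subspace_image)
  then obtain u where "u \<in> S" "w = A *v u" using w by blast
  then show ?thesis using A by simp
qed

lemma borel_Bm: "borel_subgroup CC 36 G (enc ` Bm)"
  unfolding borel_iff
proof (intro conjI allI impI)
  show "csc (enc ` Bm)" by (rule csc_Bm)
  fix H assume H: "csc H \<and> enc ` Bm \<subseteq> H"
  then obtain g where g: "g \<in> Sp" "\<And>h. h \<in> H \<Longrightarrow> adj g ** dec h ** g \<in> Bm"
    using csc_into_Bm[of H] by (metis (no_types, lifting))
  have gb: "adj g ** b ** g \<in> Bm" if "b \<in> Bm" for b using g(2)[of "enc b"] H that by auto
  have step: "g *v axis j 1 \<in> Fl (Suc m)" if j: "lv j = Suc m" and m: "m \<le> 2" and low: "\<And>v. v \<in> Fl m \<Longrightarrow> g *v v \<in> Fl m" for j m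
  proof (rule Bm_eigenvector[OF _ m])
    fix b assume "b \<in> Bm"
    define A where "A = adj g ** b ** g"
    define c where "c = A $ j $ j"
    have A: "A \<in> Bm" using gb[OF \<open>b \<in> Bm\<close>] by (simp add: A_def)
    have "(A *v axis j 1 - c *s axis j 1) $ i = 0" if "m < lv i" for i
    proof (cases "i = j")
      case False
      then have "lv j < lv i" using that j lv_inj[of i j] by linarith
      then show ?thesis using A False by (simp add: mult_axis_nth axis_nth' Bm_def)
    qed (simp add: mult_axis_nth axis_nth' c_def)
    then have "A *v axis j 1 - c *s axis j 1 \<in> Fl m" by (simp add: Fl_def)
    then have "g *v (A *v axis j 1 - c *s axis j 1) \<in> Fl m" by (rule low)
    moreover have "g *v (A *v axis j 1 - c *s axis j 1) = b *v (g *v axis j 1) - c *s (g *v axis j 1)"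
      using g(1) by (simp add: matrix_vector_mult_diff_distrib vector_scalar_commute A_def
          matrix_vector_mul_assoc[symmetric])
    ultimately show "\<exists>c. b *v (g *v axis j 1) - c *s (g *v axis j 1) \<in> Fl m" by auto
  qed
  have gFl: "m \<le> 3 \<Longrightarrow> v \<in> Fl m \<Longrightarrow> g *v v \<in> Fl m" for m v
  proof (induction m arbitrary: v)
    case 0
    have "v $ j = 0" for j using 0 lv_bounds(1)[of j] by (simp add: Fl_def)
    then have "v = 0" by (simp add: vec_eq_iff)
    then show ?case by simp
  next
    case (Suc m)
    obtain j where j: "lv j = Suc m" using lv_surj[of "Suc m"] Suc.prems(1) by auto
    have d: "v - v $ j *s axis j 1 \<in> Fl m"
    proof -
      have "(v - v $ j *s axis j 1) $ i = 0" if "m < lv i" for i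
      proof (cases "i = j")
        case False
        then have "Suc m < lv i" using that j lv_inj[of i j] by linarith
        then show ?thesis using Suc.prems(2) False by (simp add: Fl_def axis_nth')
      qed (simp add: axis_nth')
      then show ?thesis by (simp add: Fl_def)
    qed
    have m: "m \<le> 3" "m \<le> 2" using Suc.prems(1) by simp_all
    have 1: "g *v (v - v $ j *s axis j 1) \<in> Fl (Suc m)"
      by (rule Fl_mono[OF Suc.IH[OF m(1) d]]) simp
    have 2: "g *v axis j 1 \<in> Fl (Suc m)"
      by (rule step[OF j m(2) Suc.IH[OF m(1)]])
    have "g *v v = g *v (v - v $ j *s axis j 1) + v $ j *s (g *v axis j 1)"
      by (simp add: matrix_vector_mult_diff_distrib vector_scalar_commute)
    then show ?case by (simp only: Fl_add[OF 1 Fl_scale[OF 2]])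
  qed
  have sub: "vec.subspace (Fl m)" for m using subspace_Fl[of "mat 1" m] by simp
  have "g \<in> Bm"
  proof (rule Bm_criterion[OF g(1)])
    fix j assume j: "lv j \<le> 3"
    show "g *v axis j 1 \<in> Fl (lv j)" by (rule gFl[OF j]) simp
    show "adj g *v axis j 1 \<in> Fl (lv j)"
      by (rule Sp_subspace_image[OF g(1) sub gFl[OF j]]) simp_all
  qed
  have "H \<subseteq> enc ` Bm"
  proof
    fix h assume h: "h \<in> H"
    have "h \<in> carrier G" using H h by (auto simp: csc_def closed_subgroup_def subgroup_def)
    then obtain A where A: "h = enc A" "A \<in> Sp" by auto
    have "adj g ** A ** g \<in> Bm" using g(2)[OF h] A(1) by simp
    then have "g ** (adj g ** A ** g) ** adj g \<in> Bm"
      by (rule mult_Bm[OF mult_Bm[OF \<open>g \<in> Bm\<close>] adj_Bm[OF \<open>g \<in> Bm\<close>]])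
    moreover have "g ** (adj g ** A ** g) ** adj g = A"
      using g(1) by (simp add: matrix_mul_assoc[symmetric] Sp_adj_right)
    ultimately show "h \<in> enc ` Bm" using A(1) by simp
  qed
  then show "H = enc ` Bm" using H by blast
qed

lemma conj_hom: assumes g: "g \<in> Sp" shows "group_hom G G (\<lambda>x. enc (g ** dec x ** adj g))"
proof -
  have "(\<lambda>x. enc (g ** dec x ** adj g)) \<in> hom G G"
    using g by (auto simp: hom_def mult_Sp adj_Sp matrix_mul_assoc[symmetric])
  then show ?thesis by (simp add: group_hom_def group_hom_axioms_def group_G)
qed

lemma csc_conj:
  assumes H: "csc H" and g: "g \<in> Sp"
  shows "csc ((\<lambda>x. enc (g ** dec x ** adj g)) ` H)"
proof -
  interpret cj: group_hom G G "\<lambda>x. enc (g ** dec x ** adj g)" by (rule conj_hom[OF g])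
  have sub: "subgroup H G" and cl: "closedin (zar 36) H" and con: "connectedin (zar 36) H"
    using H by (auto simp: csc_def closed_subgroup_def)
  have Hc: "H \<subseteq> carrier G" using sub by (auto simp: subgroup_def)
  have sub': "subgroup ((\<lambda>x. enc (g ** dec x ** adj g)) ` H) G"
    by (rule cj.subgroup_img_is_subgroup[OF sub])
  have "closedin (zar 36) {x \<in> topspace (zar 36). enc (adj g ** dec x ** g) \<in> H}"
    by (rule closedin_continuous_map_preimage[OF continuous_map_mp cl]) (intro mp_intros)
  moreover have "{x \<in> topspace (zar 36). enc (adj g ** dec x ** g) \<in> H} = (\<lambda>x. enc (g ** dec x ** adj g)) ` H"
  proof (intro equalityI subsetI)
    fix x assume x: "x \<in> {x \<in> topspace (zar 36). enc (adj g ** dec x ** g) \<in> H}"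
    then have "x = enc (g ** dec (enc (adj g ** dec x ** g)) ** adj g)"
      using g by (simp add: topspace_zar matrix_mul_assoc[symmetric] Sp_adj_right)
    then show "x \<in> (\<lambda>x. enc (g ** dec x ** adj g)) ` H" using x by blast
  next
    fix x assume "x \<in> (\<lambda>x. enc (g ** dec x ** adj g)) ` H"
    then obtain y where y: "y \<in> H" "x = enc (g ** dec y ** adj g)" by blast
    have "y \<in> \<A> 36" using y(1) Hc by auto
    then have "enc (adj g ** dec x ** g) = y" using y g by (simp add: matrix_mul_assoc[symmetric] Sp_adj_left)
    then show "x \<in> {x \<in> topspace (zar 36). enc (adj g ** dec x ** g) \<in> H}" using y by (simp add: topspace_zar)
  qed
  ultimately have "closedin (zar 36) ((\<lambda>x. enc (g ** dec x ** adj g)) ` H)" by simp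
  moreover have "connectedin (zar 36) ((\<lambda>x. enc (g ** dec x ** adj g)) ` H)"
    by (rule connectedin_mp_image[OF con]) (intro mp_intros)
  moreover obtain n where n: "(derived G ^^ n) H = {\<one>\<^bsub>G\<^esub>}"
    using H solvable_subgroup_iff[OF sub] by (auto simp: csc_def)
  have "(derived G ^^ n) ((\<lambda>x. enc (g ** dec x ** adj g)) ` H) = {\<one>\<^bsub>G\<^esub>}"
    unfolding cj.exp_of_derived_img[OF Hc] n using g by (simp add: Sp_adj_right)
  then have "solvable (G\<lparr>carrier := (\<lambda>x. enc (g ** dec x ** adj g)) ` H\<rparr>)"
    unfolding solvable_subgroup_iff[OF sub'] by blast
  ultimately show ?thesis using sub' by (simp add: csc_def closed_subgroup_def)
qed

theorem borel_conjugate: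
  assumes "borel_subgroup CC 36 G B"
  obtains g where "g \<in> Sp" "B = (\<lambda>A. enc (g ** A ** adj g)) ` Bm"
proof -
  have B: "csc B" "\<And>H. csc H \<Longrightarrow> B \<subseteq> H \<Longrightarrow> H = B" using assms by (auto simp: borel_iff)
  have "B \<subseteq> carrier G" using B(1) by (auto simp: csc_def closed_subgroup_def subgroup_def)
  obtain g where g: "g \<in> Sp" "\<And>h. h \<in> B \<Longrightarrow> adj g ** dec h ** g \<in> Bm"
    using csc_into_Bm[OF B(1)] by (metis (no_types, lifting))
  have "csc ((\<lambda>x. enc (g ** dec x ** adj g)) ` enc ` Bm)" by (rule csc_conj[OF csc_Bm g(1)])
  then have "csc ((\<lambda>A. enc (g ** A ** adj g)) ` Bm)" by (simp add: image_image)
  moreover have "B \<subseteq> (\<lambda>A. enc (g ** A ** adj g)) ` Bm"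
  proof
    fix h assume h: "h \<in> B"
    then obtain A where A: "h = enc A" "A \<in> Sp" using \<open>B \<subseteq> carrier G\<close> by auto
    have "h = enc (g ** (adj g ** dec h ** g) ** adj g)"
      using g(1) A by (simp add: matrix_mul_assoc[symmetric] Sp_adj_right)
    then show "h \<in> (\<lambda>A. enc (g ** A ** adj g)) ` Bm" using g(2)[OF h] by blast
  qed
  ultimately have "(\<lambda>A. enc (g ** A ** adj g)) ` Bm = B" by (rule B(2))
  then show ?thesis using that[OF g(1)] by simp
qed

section \<open>The maximal torus and the longest element of the Weyl group\<close>

definition idx :: "3 \<Rightarrow> nat" where
  "idx k = (if k = 1 then 0 else if k = 2 then 1 else 2)"

lemma idx_less [simp]: "idx k < 3" by (simp add: idx_def)

lemma idx_inj: "idx k = idx l \<Longrightarrow> k = l"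
  by (rule index3_cases[of k]; rule index3_cases[of l]) (auto simp: idx_def)

lemma idx_surj: assumes "n < 3" obtains k where "idx k = n"
proof -
  have "n = 0 \<or> n = 1 \<or> n = 2" using assms by auto
  then show ?thesis using that[of 1] that[of 2] that[of 3] by (auto simp: idx_def)
qed

lemma tor_mult: "tor a ** tor c = tor (\<lambda>k. a k * c k)"
proof (rule mat_eqI_basis)
  show "(tor a ** tor c) *v ev i = tor (\<lambda>k. a k * c k) *v ev i" for i
    by (simp add: matrix_vector_mul_assoc[symmetric] tor_vec)
  show "(tor a ** tor c) *v fv i = tor (\<lambda>k. a k * c k) *v fv i" for i
    by (simp add: matrix_vector_mul_assoc[symmetric] tor_vec mult.commute)
qed

lemma tor_inj: "tor a = tor c \<Longrightarrow> a = c"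
proof
  fix k assume "tor a = tor c"
  then have "tor a $ Inl k $ Inl k = tor c $ Inl k $ Inl k" by simp
  then show "a k = c k" by (simp add: tor_def)
qed

lemma tor_one: "tor (\<lambda>_. 1) = mat 1"
  by (rule mat_eqI_basis) (simp_all add: tor_vec)

lemma adj_tor: assumes "\<And>k. a k \<noteq> 0" shows "adj (tor a) = tor (\<lambda>k. inverse (a k))"
proof -
  have "adj (tor a) = adj (tor a) ** (tor a ** tor (\<lambda>k. inverse (a k)))"
    using assms by (simp add: tor_mult tor_one)
  then show ?thesis using tor_Sp[of a] assms by simp
qed

lemma subgroup_Tm: "subgroup (enc ` Tm) G"
proof (rule subgroup_encI)
  show "Tm \<subseteq> Sp" by (auto simp: Tm_def)
  show "mat 1 \<in> Tm" using tor_Tm[of "\<lambda>_. 1"] by (simp add: tor_one)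
  fix A assume "A \<in> Tm"
  then obtain a where a: "A = tor a" "\<forall>k. a k \<noteq> 0" by (auto simp: Tm_eq)
  then show "adj A \<in> Tm" by (simp add: adj_tor tor_Tm)
  fix C assume "C \<in> Tm"
  then obtain c where "C = tor c" "\<forall>k. c k \<noteq> 0" by (auto simp: Tm_eq)
  then show "A ** C \<in> Tm" using a by (simp add: tor_mult tor_Tm)
qed

lemma split_torus_simps [simp]:
  "carrier (split_torus CC 3) = {..<3} \<rightarrow>\<^sub>E - {0}"
  "x \<otimes>\<^bsub>split_torus CC 3\<^esub> y = (\<lambda>i\<in>{..<3}. x i * y i)"
  by (simp_all add: split_torus_def)

lemma torus_Tm: "torus CC 36 G (enc ` Tm)"
proof -
  define \<psi> where "\<psi> = (\<lambda>t :: complex point. enc (tor (\<lambda>k. t (idx k))))"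
  let ?S = "{..<3} \<rightarrow>\<^sub>E - {0 :: complex}"
  have nz: "t (idx k) \<noteq> 0" if "t \<in> ?S" for t k
    using PiE_mem[OF that, of "idx k"] by simp
  have \<psi>T: "\<psi> t \<in> enc ` Tm" if "t \<in> ?S" for t
    unfolding \<psi>_def using nz[OF that] by (intro imageI tor_Tm)
  have inj: "inj_on \<psi> ?S"
  proof (rule inj_onI)
    fix t u assume tu: "t \<in> ?S" "u \<in> ?S" "\<psi> t = \<psi> u"
    then have "(\<lambda>k. t (idx k)) = (\<lambda>k. u (idx k))" unfolding \<psi>_def by (intro tor_inj) simp
    then have "t (idx k) = u (idx k)" for k by (rule fun_cong)
    then have "t n = u n" if "n < 3" for n using idx_surj[OF that] by metis
    then show "t = u" by (intro PiE_ext[OF tu(1,2)]) simp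
  qed
  have surj: "\<psi> ` ?S = enc ` Tm"
  proof (intro equalityI subsetI)
    fix x assume "x \<in> enc ` Tm"
    then obtain a where a: "x = enc (tor a)" "\<forall>k. a k \<noteq> 0" by (auto simp: Tm_eq)
    define t where "t = (\<lambda>n\<in>{..<3}. a (inv_into UNIV idx n))"
    have "inj idx" using idx_inj by (auto simp: inj_def)
    then have "t (idx k) = a k" for k by (simp add: t_def)
    then have "x = \<psi> t" by (simp add: \<psi>_def a(1))
    moreover have "t \<in> ?S" using a(2) by (auto simp: t_def)
    ultimately show "x \<in> \<psi> ` ?S" by blast
  qed (use \<psi>T in blast)
  have "closed_subgroup CC 36 G (enc ` Tm)"
    unfolding closed_subgroup_def
    by (intro conjI subgroup_Tm closedin_entries[where P = "\<lambda>i j. i \<noteq> j"]) (simp add: Tm_def)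
  moreover have "\<psi> \<in> iso (split_torus CC 3) (G\<lparr>carrier := enc ` Tm\<rparr>)"
    unfolding iso_def hom_def bij_betw_def
    using \<psi>T inj surj by (auto simp: \<psi>_def tor_mult)
  moreover have "regular_map CC (laurent_coords CC 3) (carrier (split_torus CC 3)) (coords 36) \<psi>"
    unfolding regular_map_def
  proof
    fix s :: "complex point \<Rightarrow> complex" assume "s \<in> coords 36"
    then obtain n where n: "s = (\<lambda>x. x n)" "n < 36" by (auto simp: coords_def)
    obtain i j where ij: "ent n = (i, j)" by (cases "ent n")
    have s: "s (\<psi> t) = tor (\<lambda>k. t (idx k)) $ i $ j" for t using n ij by (simp add: \<psi>_def enc_def)
    show "\<exists>p\<in>pf (laurent_coords CC 3). \<forall>t\<in>carrier (split_torus CC 3). s (\<psi> t) = p t"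
    proof (cases "i = j")
      case False
      then show ?thesis unfolding s by (intro bexI[of _ "\<lambda>_. 0"]) (auto simp: tor_def pf_const)
    next
      case True
      show ?thesis
      proof (cases i)
        case (Inl k)
        have "(\<lambda>t. t (idx k)) \<in> pf (laurent_coords CC 3)"
          by (rule poly_funs.coord) (auto simp: laurent_coords_def)
        then show ?thesis unfolding s by (rule bexI[rotated]) (simp add: tor_def True[symmetric] Inl)
      next
        case (Inr k)
        have "(\<lambda>t. inv\<^bsub>CC\<^esub> (t (idx k))) \<in> pf (laurent_coords CC 3)"
          by (rule poly_funs.coord) (auto simp: laurent_coords_def)
        then show ?thesis unfolding s
          by (rule bexI[rotated]) (simp add: tor_def True[symmetric] Inr nz)
      qed
    qed
  qed
  moreover have "regular_map CC (coords 36) (enc ` Tm) (laurent_coords CC 3) (inv_into (carrier (split_torus CC 3)) \<psi>)"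
    unfolding regular_map_def
  proof
    fix s :: "complex point \<Rightarrow> complex" assume s: "s \<in> laurent_coords CC 3"
    have inv: "\<exists>t\<in>?S. x = \<psi> t \<and> inv_into (carrier (split_torus CC 3)) \<psi> x = t" if x: "x \<in> enc ` Tm" for x
    proof -
      have "x \<in> \<psi> ` ?S" using x surj by simp
      then obtain t where t: "t \<in> ?S" "x = \<psi> t" by (elim imageE)
      have "inv_into (carrier (split_torus CC 3)) \<psi> x = t"
        unfolding t(2) split_torus_simps by (rule inv_into_f_f[OF inj t(1)])
      then show ?thesis using t by (intro bexI[of _ t] conjI)
    qed
    consider n where "s = (\<lambda>t. t n)" "n < 3" | n where "s = (\<lambda>t. inv\<^bsub>CC\<^esub> (t n))" "n < 3"
      using s by (auto simp: laurent_coords_def)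
    then show "\<exists>p\<in>pf (coords 36). \<forall>x\<in>enc ` Tm. s (inv_into (carrier (split_torus CC 3)) \<psi> x) = p x"
    proof cases
      case (1 n)
      obtain k where k: "idx k = n" using idx_surj[OF 1(2)] .
      have "s (inv_into (carrier (split_torus CC 3)) \<psi> x) = dec x $ Inl k $ Inl k" if x: "x \<in> enc ` Tm" for x
      proof -
        obtain t where "t \<in> ?S" "x = \<psi> t" "inv_into (carrier (split_torus CC 3)) \<psi> x = t" 
          using inv[OF x] by (elim bexE conjE)
        then show ?thesis by (simp add: 1 k[symmetric] \<psi>_def tor_def)
      qed
      then show ?thesis by (intro bexI[of _ "\<lambda>x. dec x $ Inl k $ Inl k"] ballI mp_intros)
    next
      case (2 n)
      obtain k where k: "idx k = n" using idx_surj[OF 2(2)] .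
      have "s (inv_into (carrier (split_torus CC 3)) \<psi> x) = dec x $ Inr k $ Inr k" if x: "x \<in> enc ` Tm" for x
      proof -
        obtain t where "t \<in> ?S" "x = \<psi> t" "inv_into (carrier (split_torus CC 3)) \<psi> x = t" 
          using inv[OF x] by (elim bexE conjE)
        then show ?thesis by (simp add: 2 k[symmetric] \<psi>_def tor_def nz)
      qed
      then show ?thesis by (intro bexI[of _ "\<lambda>x. dec x $ Inr k $ Inr k"] ballI mp_intros)
    qed
  qed
  ultimately show ?thesis unfolding torus_def by blast
qed

definition reg :: cmat where "reg = tor (\<lambda>k. if k = 1 then 2 else if k = 2 then 3 else 5)"

lemma reg_Tm: "reg \<in> Tm"
  unfolding reg_def by (rule tor_Tm) simp

lemma centralizer_reg: assumes "A \<in> Sp" "A ** reg = reg ** A" shows "A \<in> Tm"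
proof -
  have ne: "reg $ i $ i \<noteq> reg $ j $ j" if "i \<noteq> j" for i j
    using that by (cases i; cases j; rename_tac a b; rule_tac i = a in index3_cases; rule_tac i = b in index3_cases)
      (auto simp: reg_def tor_def)
  have "A $ i $ j = 0" if "i \<noteq> j" for i j
  proof -
    have "(A *v (reg *v axis j 1)) $ i = (reg *v (A *v axis j 1)) $ i"
      using assms(2) by (simp add: matrix_vector_mul_assoc)
    moreover have "reg *v axis j 1 = reg $ j $ j *s axis j 1"
      by (auto simp: vec_eq_iff reg_def tor_vec_nth axis_nth')
    ultimately have "reg $ j $ j * A $ i $ j = reg $ i $ i * A $ i $ j"
      by (simp add: vector_scalar_commute mult_axis_nth) (simp add: reg_def tor_vec_nth mult_axis_nth)
    then show ?thesis using ne[OF that] by simp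
  qed
  then show ?thesis using assms(1) by (simp add: Tm_def)
qed

lemma maximal_torus_Tm: "maximal_torus CC 36 G (enc ` Tm)"
  unfolding maximal_torus_def
proof (intro conjI allI impI)
  show "torus CC 36 G (enc ` Tm)" by (rule torus_Tm)
  fix T' assume T': "torus CC 36 G T' \<and> enc ` Tm \<subseteq> T'"
  then obtain r \<psi> where sub: "subgroup T' G" and \<psi>: "\<psi> \<in> iso (split_torus CC r) (G\<lparr>carrier := T'\<rparr>)"
    unfolding torus_def closed_subgroup_def by (elim exE bexE conjE) blast
  have comm: "x \<otimes>\<^bsub>G\<^esub> y = y \<otimes>\<^bsub>G\<^esub> x" if "x \<in> T'" "y \<in> T'" for x y
  proof -
    have "\<psi> ` carrier (split_torus CC r) = T'" using \<psi> by (simp add: iso_def bij_betw_def)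
    then obtain s t where st: "s \<in> carrier (split_torus CC r)" "t \<in> carrier (split_torus CC r)" "x = \<psi> s" "y = \<psi> t"
      using \<open>x \<in> T'\<close> \<open>y \<in> T'\<close> by blast
    have "\<psi> (s \<otimes>\<^bsub>split_torus CC r\<^esub> t) = x \<otimes>\<^bsub>G\<^esub> y" "\<psi> (t \<otimes>\<^bsub>split_torus CC r\<^esub> s) = y \<otimes>\<^bsub>G\<^esub> x"
      using \<psi> st by (simp_all add: iso_def hom_def)
    moreover have "s \<otimes>\<^bsub>split_torus CC r\<^esub> t = t \<otimes>\<^bsub>split_torus CC r\<^esub> s"
      by (simp add: split_torus_def mult.commute)
    ultimately show ?thesis by simp
  qed
  have "x \<in> enc ` Tm" if x: "x \<in> T'" for x
  proof -
    have "x \<in> carrier G" using sub x by (auto simp: subgroup_def)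
    then obtain A where A: "x = enc A" "A \<in> Sp" by auto
    have "enc reg \<in> T'" using T' reg_Tm by blast
    then have "enc (A ** reg) = enc (reg ** A)" using comm[OF x, of "enc reg"] A by simp
    then have "A ** reg = reg ** A" by (simp only: enc_inject)
    then show ?thesis using centralizer_reg A by blast
  qed
  then show "T' = enc ` Tm" using T' by blast
qed

lemma borel_pair_Bm: "borel_pair CC 36 G (enc ` Tm) (enc ` Bm)"
  unfolding borel_pair_def using maximal_torus_Tm borel_Bm Tm_Bm by blast

definition w0 :: cmat where
  "w0 = (\<chi> i j. if i = flip j then sg j else 0)"

lemma w0_vec: "w0 *v ev i = fv i" "w0 *v fv i = - ev i"
  by (auto simp: vec_eq_iff mult_axis_nth axis_nth' w0_def flip_eq_iff)

lemma w0_Sp: "w0 \<in> Sp"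
proof -
  have "(w0 *v v) $ i = sg (flip i) * v $ flip i" for v i
  proof -
    have "(w0 *v v) $ i = (\<Sum>j\<in>UNIV. if j = flip i then sg (flip i) * v $ flip i else 0)"
      unfolding matrix_vector_mult_def vec_lambda_beta
      by (intro sum.cong) (auto simp: w0_def flip_eq_iff)
    then show ?thesis by simp
  qed
  then have "om (w0 *v v) (w0 *v w) = om v w" for v w by (simp add: om_eq mult.commute sum_negf)
  then show ?thesis by (simp add: Sp_def)
qed

lemma w0_tor: "w0 ** tor a = tor (\<lambda>k. inverse (a k)) ** w0"
proof (rule mat_eqI_basis)
  have m: "A *v - v = - (A *v v)" for A :: cmat and v by (simp add: vec.neg)
  have s: "axis i c = c *s axis i (1::complex)" for i :: "3 + 3" and c by (auto simp: vec_eq_iff axis_nth')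
  show "(w0 ** tor a) *v ev i = (tor (\<lambda>k. inverse (a k)) ** w0) *v ev i" for i
    by (simp add: matrix_vector_mul_assoc[symmetric] tor_vec w0_vec)
      (subst s, subst (2) s, simp add: vector_scalar_commute w0_vec)
  show "(w0 ** tor a) *v fv i = (tor (\<lambda>k. inverse (a k)) ** w0) *v fv i" for i
    by (simp add: matrix_vector_mul_assoc[symmetric] tor_vec w0_vec m)
      (subst s, subst (2) s, simp add: vector_scalar_commute w0_vec)
qed

lemma w0_Tm: assumes "D \<in> Tm" shows "w0 ** D = adj D ** w0"
proof -
  obtain a where a: "D = tor a" "\<forall>k. a k \<noteq> 0" using assms by (auto simp: Tm_eq)
  then show ?thesis by (simp add: w0_tor adj_tor)
qed

lemma adj_Tm: "D \<in> Tm \<Longrightarrow> adj D \<in> Tm"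
  by (auto simp: Tm_eq adj_tor intro!: image_eqI)

lemma adj_w0_Tm: assumes "D \<in> Tm" shows "adj w0 ** D = adj D ** adj w0"
proof -
  have D: "D \<in> Sp" using assms by (simp add: Tm_def)
  have "w0 ** adj D = D ** w0" using w0_Tm[OF adj_Tm[OF assms]] by simp
  then have "adj w0 ** (w0 ** adj D) ** adj w0 = adj w0 ** (D ** w0) ** adj w0" by simp
  then show ?thesis using w0_Sp by (simp add: matrix_mul_assoc[symmetric] Sp_adj_right)
qed

abbreviation TT :: "complex point set" where "TT \<equiv> enc ` Tm"

lemma TT_carrier: "TT \<subseteq> carrier G"
  by (auto simp: Tm_def)

lemma normalizer_TT: "n \<in> normalizer G TT \<longleftrightarrow> n \<in> carrier G \<and> n <#\<^bsub>G\<^esub> TT #>\<^bsub>G\<^esub> inv\<^bsub>G\<^esub> n = TT"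
  using TT_carrier by (simp add: normalizer_def stabilizer_def)

lemma conj_TT: "A \<in> Sp \<Longrightarrow> enc A <#\<^bsub>G\<^esub> TT #>\<^bsub>G\<^esub> inv\<^bsub>G\<^esub> (enc A) = (\<lambda>D. enc (A ** D ** adj A)) ` Tm"
  by (auto simp: l_coset_def r_coset_def)

lemma w0_normalizer: "enc w0 \<in> normalizer G TT"
proof -
  have "w0 ** D ** adj w0 = adj D" if "D \<in> Tm" for D
    using w0_Tm[OF that] w0_Sp by (simp add: matrix_mul_assoc[symmetric] Sp_adj_right)
  then have "(\<lambda>D. enc (w0 ** D ** adj w0)) ` Tm = (\<lambda>D. enc (adj D)) ` Tm" by (intro image_cong) auto
  also have "\<dots> = TT"
  proof (intro equalityI subsetI)
    fix x assume "x \<in> TT"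
    then obtain D where "D \<in> Tm" "x = enc D" by blast
    then show "x \<in> (\<lambda>D. enc (adj D)) ` Tm" using adj_Tm by (intro image_eqI[of _ _ "adj D"]) auto
  qed (use adj_Tm in auto)
  finally show ?thesis unfolding normalizer_TT using conj_TT[OF w0_Sp] w0_Sp by simp
qed

definition w0c :: "complex point set" where
  "w0c = TT #>\<^bsub>G\<^esub> enc w0"

text \<open>The longest element acts on the torus by inversion, so its conjugates by elements of the
  normalizer differ from it by elements that centralize the torus.\<close>

lemma w0_commutes:
  assumes "A \<in> Sp" "enc A \<in> normalizer G TT"
  shows "A ** w0 ** adj A ** adj w0 \<in> Tm"
proof (rule centralizer_reg)
  show "A ** w0 ** adj A ** adj w0 \<in> Sp" using assms(1) w0_Sp by (simp add: mult_Sp adj_Sp)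
  have "enc reg \<in> (\<lambda>D. enc (A ** D ** adj A)) ` Tm"
    using assms reg_Tm unfolding normalizer_TT conj_TT[OF assms(1)] by simp
  then obtain r where r: "r \<in> Tm" "reg = A ** r ** adj A" by auto
  have Sp: "reg \<in> Sp" "r \<in> Sp" using reg_Tm r by (auto simp: Tm_def)
  have 1: "adj A ** adj reg = adj r ** adj A"
    unfolding r(2) using assms(1) Sp(2) by (simp add: adj_mult mult_Sp adj_Sp matrix_mul_assoc[symmetric])
  have 2: "w0 ** adj r = r ** w0" using w0_Tm[OF adj_Tm[OF r(1)]] by simp
  have 3: "A ** r = reg ** A" unfolding r(2) using assms(1) by (simp add: matrix_mul_assoc[symmetric] Sp_adj_left)
  have "(A ** w0 ** adj A ** adj w0) ** reg = A ** w0 ** (adj A ** (adj w0 ** reg))"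
    by (simp add: matrix_mul_assoc)
  also have "\<dots> = A ** w0 ** ((adj A ** adj reg) ** adj w0)"
    by (simp add: adj_w0_Tm[OF reg_Tm] matrix_mul_assoc)
  also have "\<dots> = A ** (w0 ** adj r) ** adj A ** adj w0" unfolding 1 by (simp add: matrix_mul_assoc)
  also have "\<dots> = (A ** r) ** w0 ** adj A ** adj w0" unfolding 2 by (simp add: matrix_mul_assoc)
  also have "\<dots> = reg ** (A ** w0 ** adj A ** adj w0)" unfolding 3 by (simp add: matrix_mul_assoc)
  finally show "(A ** w0 ** adj A ** adj w0) ** reg = reg ** (A ** w0 ** adj A ** adj w0)" .
qed

lemma conj_class_w0c:
  "w0c \<in> carrier (weyl_group G TT)" "conj_class (weyl_group G TT) w0c = {w0c}"
proof -
  define M where "M = G\<lparr>carrier := normalizer G TT\<rparr>"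
  have subN: "subgroup (normalizer G TT) G" by (rule G.normalizer_imp_subgroup[OF TT_carrier])
  have nrm: "TT \<lhd> M" unfolding M_def by (rule group.subgroup_in_normalizer[OF group_G subgroup_Tm])
  have W: "weyl_group G TT = M Mod TT" by (simp add: weyl_group_def M_def)
  have cM: "carrier M = normalizer G TT" and mM: "x \<otimes>\<^bsub>M\<^esub> y = x \<otimes>\<^bsub>G\<^esub> y" for x y by (simp_all add: M_def)
  have rM: "TT #>\<^bsub>M\<^esub> x = TT #>\<^bsub>G\<^esub> x" for x by (simp add: M_def r_coset_def)
  have w0c: "w0c = TT #>\<^bsub>M\<^esub> enc w0" unfolding w0c_def rM ..
  have w0M: "enc w0 \<in> carrier M" unfolding cM by (rule w0_normalizer)
  show w0W: "w0c \<in> carrier (weyl_group G TT)"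
    unfolding W w0c using w0M by (auto simp: FactGroup_def RCOSETS_def)
  have grW: "group (M Mod TT)" by (rule normal.factorgroup_is_group[OF nrm])
  interpret W: group "M Mod TT" by (rule grW)
  interpret M: group M using nrm by (simp add: normal_def)
  have "g \<otimes>\<^bsub>M Mod TT\<^esub> w0c = w0c \<otimes>\<^bsub>M Mod TT\<^esub> g" if g: "g \<in> carrier (M Mod TT)" for g
  proof -
    obtain n where n: "n \<in> carrier M" "g = TT #>\<^bsub>M\<^esub> n" using g by (auto simp: FactGroup_def RCOSETS_def)
    have "n \<in> carrier G" using n(1) subgroup.subset[OF subN] unfolding cM by blast
    then obtain A where A: "n = enc A" "A \<in> Sp" by auto
    define t where "t = A ** w0 ** adj A ** adj w0"
    have t: "t \<in> Tm" unfolding t_def using n(1) A unfolding cM by (intro w0_commutes) auto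
    have "n \<otimes>\<^bsub>M\<^esub> enc w0 = enc t \<otimes>\<^bsub>M\<^esub> (enc w0 \<otimes>\<^bsub>M\<^esub> n)"
      unfolding mM using A w0_Sp by (simp add: t_def matrix_mul_assoc[symmetric] Sp_adj_left)
    then have "n \<otimes>\<^bsub>M\<^esub> enc w0 \<in> TT #>\<^bsub>M\<^esub> (enc w0 \<otimes>\<^bsub>M\<^esub> n)" using t by (auto simp: r_coset_def)
    then have "TT #>\<^bsub>M\<^esub> (enc w0 \<otimes>\<^bsub>M\<^esub> n) = TT #>\<^bsub>M\<^esub> (n \<otimes>\<^bsub>M\<^esub> enc w0)"
      by (rule M.repr_independence[OF _ M.m_closed[OF w0M n(1)] normal_imp_subgroup[OF nrm]])
    then show ?thesis
      unfolding n(2) w0c by (simp add: FactGroup_def normal.rcos_sum[OF nrm n(1) w0M] normal.rcos_sum[OF nrm w0M n(1)])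
  qed
  note comm = this
  have "g \<otimes>\<^bsub>M Mod TT\<^esub> w0c \<otimes>\<^bsub>M Mod TT\<^esub> inv\<^bsub>M Mod TT\<^esub> g = w0c" if g: "g \<in> carrier (M Mod TT)" for g
    by (simp only: comm[OF g] W.m_assoc[OF w0W[unfolded W] g W.inv_closed[OF g]] W.r_inv[OF g]
        W.r_one[OF w0W[unfolded W]])
  then show "conj_class (weyl_group G TT) w0c = {w0c}"
    unfolding conj_class_def W using W.one_closed by blast
qed

section \<open>Strata\<close>

definition cell :: "cmat set" where
  "cell = {b ** w0 ** c | b c. b \<in> Bm \<and> c \<in> Bm}"

lemma double_coset_w0: "enc ` Bm <#>\<^bsub>G\<^esub> w0c <#>\<^bsub>G\<^esub> enc ` Bm = enc ` cell"
proof (intro equalityI subsetI)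
  fix x assume "x \<in> enc ` Bm <#>\<^bsub>G\<^esub> w0c <#>\<^bsub>G\<^esub> enc ` Bm"
  then obtain b t c where b: "b \<in> Bm" "c \<in> Bm" and t: "t \<in> Tm" and x: "x = enc (b ** (t ** w0) ** c)"
    by (auto simp: set_mult_def w0c_def r_coset_def)
  then have "x = enc ((b ** t) ** w0 ** c)" by (simp add: matrix_mul_assoc)
  moreover have "b ** t \<in> Bm" using b t Tm_Bm by (intro mult_Bm) auto
  ultimately show "x \<in> enc ` cell" using b by (auto simp: cell_def)
next
  fix x assume "x \<in> enc ` cell"
  then obtain b c where b: "b \<in> Bm" "c \<in> Bm" "x = enc (b ** w0 ** c)" by (auto simp: cell_def)
  have "mat 1 \<in> Tm" using tor_Tm[of "\<lambda>_. 1"] by (simp add: tor_one)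
  then have "enc w0 \<in> w0c" unfolding w0c_def r_coset_def
    by (auto intro!: bexI[of _ "mat 1"])
  then have "(enc b \<otimes>\<^bsub>G\<^esub> enc w0) \<otimes>\<^bsub>G\<^esub> enc c \<in> enc ` Bm <#>\<^bsub>G\<^esub> w0c <#>\<^bsub>G\<^esub> enc ` Bm"
    unfolding set_mult_def using b by blast
  then show "x \<in> enc ` Bm <#>\<^bsub>G\<^esub> w0c <#>\<^bsub>G\<^esub> enc ` Bm" by (simp add: b)
qed

definition cdim :: "cmat \<Rightarrow> enat" where
  "cdim A = var_dim CC 36 (enc ` cls A)"

definition VV :: "complex point set" where
  "VV = stratum_of CC 36 G (enc ` Bm) w0c"

lemma VV_stratum: "VV \<in> strata CC 36 G"
proof -
  have "{w0c} \<in> conj_classes (weyl_group G TT)"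
    unfolding conj_classes_def using conj_class_w0c by (intro image_eqI) auto
  then show ?thesis unfolding strata_def VV_def using borel_pair_Bm
    by (intro CollectI exI[of _ TT] exI[of _ "enc ` Bm"] exI[of _ "{w0c}"] exI[of _ w0c]) auto
qed

lemma cls_cases: "enc ` cls A = enc ` cls C \<longleftrightarrow> cls A = cls C"
  by (rule inj_image_eq_iff[OF inj_enc])

lemma meets_cell: "enc ` cls A \<inter> enc ` cell \<noteq> {} \<longleftrightarrow> cls A \<inter> cell \<noteq> {}"
  by (auto simp: image_iff)

lemma stratum_of_iff:
  fixes B w defines "D \<equiv> B <#>\<^bsub>G\<^esub> w <#>\<^bsub>G\<^esub> B"
  shows "enc A \<in> stratum_of CC 36 G B w \<longleftrightarrow>
    A \<in> Sp \<and> enc ` cls A \<inter> D \<noteq> {} \<and> (\<forall>C\<in>Sp. enc ` cls C \<inter> D \<noteq> {} \<longrightarrow> cdim A \<le> cdim C)"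
    (is "_ \<longleftrightarrow> ?R")
proof
  assume "enc A \<in> stratum_of CC 36 G B w"
  then obtain K where K: "K \<in> conj_classes G" "K \<inter> D \<noteq> {}" "enc A \<in> K"
    "\<forall>K'\<in>conj_classes G. K' \<inter> D \<noteq> {} \<longrightarrow> var_dim CC 36 K \<le> var_dim CC 36 K'"
    unfolding stratum_of_def Let_def D_def by auto
  obtain A' where A': "K = enc ` cls A'" "A' \<in> Sp" using K(1) by (auto simp: conj_classes_G)
  then have "A \<in> cls A'" using K(3) by auto
  then have "A \<in> Sp" and KA: "K = enc ` cls A" using A' cls_Sp[OF A'(2)] cls_eq by auto
  moreover have "cdim A \<le> cdim C" if "C \<in> Sp" "enc ` cls C \<inter> D \<noteq> {}" for C
  proof -
    have "enc ` cls C \<in> conj_classes G" using that(1) by (auto simp: conj_classes_G)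
    then have "var_dim CC 36 K \<le> var_dim CC 36 (enc ` cls C)" using K(4) that(2) by simp
    then show ?thesis by (simp add: cdim_def KA)
  qed
  ultimately show ?R using K(2) by blast
next
  assume R: ?R
  have "enc ` cls A \<in> conj_classes G" using R by (auto simp: conj_classes_G)
  moreover have "var_dim CC 36 (enc ` cls A) \<le> var_dim CC 36 K'" if K': "K' \<in> conj_classes G" "K' \<inter> D \<noteq> {}" for K'
  proof -
    obtain C where "K' = enc ` cls C" "C \<in> Sp" using K'(1) by (auto simp: conj_classes_G)
    then show ?thesis using R K'(2) by (auto simp: cdim_def)
  qed
  ultimately show "enc A \<in> stratum_of CC 36 G B w"
    unfolding stratum_of_def Let_def D_def[symmetric] using R cls_self by blast
qed

lemma VV_iff:
  "enc A \<in> VV \<longleftrightarrow> A \<in> Sp \<and> cls A \<inter> cell \<noteq> {} \<and> (\<forall>C\<in>Sp. cls C \<inter> cell \<noteq> {} \<longrightarrow> cdim A \<le> cdim C)"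
  unfolding VV_def stratum_of_iff double_coset_w0 meets_cell ..

text \<open>Membership in a stratum is inherited by classes of no larger dimension, provided that they
  meet every double coset of the standard Borel subgroup that is met by the given class.\<close>

lemma strata_transfer:
  assumes Y: "Y \<in> strata CC 36 G" and A: "A \<in> Sp" "enc A \<in> Y" and C: "C \<in> Sp" "cdim C \<le> cdim A"
    and meet: "\<And>y. y \<in> cls A \<Longrightarrow> \<exists>b\<in>Bm. \<exists>c\<in>Bm. b ** y ** c \<in> cls C"
  shows "enc C \<in> Y"
proof -
  obtain B w where Yeq: "Y = stratum_of CC 36 G B w" and B: "borel_subgroup CC 36 G B"
    using Y unfolding strata_def borel_pair_def by blast
  obtain g where g: "g \<in> Sp" "B = (\<lambda>A. enc (g ** A ** adj g)) ` Bm" using borel_conjugate[OF B] .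
  let ?D = "B <#>\<^bsub>G\<^esub> w <#>\<^bsub>G\<^esub> B"
  have A': "enc ` cls A \<inter> ?D \<noteq> {}" "\<And>K. K \<in> Sp \<Longrightarrow> enc ` cls K \<inter> ?D \<noteq> {} \<Longrightarrow> cdim A \<le> cdim K"
    using A(2) unfolding Yeq stratum_of_iff by blast+
  then obtain y where y: "y \<in> cls A" "enc y \<in> ?D" by blast
  then obtain b1 m b2 where b: "b1 \<in> Bm" "b2 \<in> Bm" "m \<in> w"
    and ye: "enc y = enc ((g ** b1 ** adj g) ** dec m ** (g ** b2 ** adj g))"
    unfolding set_mult_def g(2) by auto
  have ye: "y = (g ** b1 ** adj g) ** dec m ** (g ** b2 ** adj g)" using ye by (simp only: enc_inject)
  have "adj g ** y ** adj (adj g) \<in> cls A" by (rule cls_conj[OF y(1) adj_Sp[OF g(1)]])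
  then have "\<exists>b\<in>Bm. \<exists>c\<in>Bm. b ** (adj g ** y ** g) ** c \<in> cls C" using meet by simp
  then obtain b c where bc: "b \<in> Bm" "c \<in> Bm" "b ** (adj g ** y ** g) ** c \<in> cls C" by (elim bexE)
  define z where "z = g ** (b ** (adj g ** y ** g) ** c) ** adj g"
  have z: "z \<in> cls C" unfolding z_def by (rule cls_conj[OF bc(3) g(1)])
  have "z = (g ** (b ** b1) ** adj g) ** dec m ** (g ** (b2 ** c) ** adj g)"
    unfolding z_def ye using g(1) by (simp add: matrix_mul_assoc[symmetric])
  moreover have "enc (g ** (b ** b1) ** adj g) \<in> B" "enc (g ** (b2 ** c) ** adj g) \<in> B"
    unfolding g(2) using bc(1,2) b mult_Bm by blast+
  ultimately have "enc z = enc (g ** (b ** b1) ** adj g) \<otimes>\<^bsub>G\<^esub> m \<otimes>\<^bsub>G\<^esub> enc (g ** (b2 ** c) ** adj g)"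
    "enc (g ** (b ** b1) ** adj g) \<in> B" "enc (g ** (b2 ** c) ** adj g) \<in> B" by simp_all
  then have "enc z \<in> ?D" unfolding set_mult_def using b(3) by blast
  then have "enc ` cls C \<inter> ?D \<noteq> {}" using z by blast
  then show ?thesis
    unfolding Yeq stratum_of_iff using C A'(2) order_trans by blast
qed

section \<open>Dimensions of classes\<close>

subsection \<open>Orbits of the Borel subgroup in the big cell\<close>

lemma thickI:
  assumes "finite S" "\<And>a. a \<notin> S \<Longrightarrow> thick (Suc k) n V (y(k := a))" shows "thick k (Suc n) V y"
proof -
  have "{a. \<not> thick (Suc k) n V (y(k := a))} \<subseteq> S" using assms(2) by blast
  then show ?thesis using assms(1) finite_subset by auto
qed

lemma thick_all:
  assumes "\<And>z. (\<And>i. i < k \<Longrightarrow> z i = y i) \<Longrightarrow> (\<And>i. k + n \<le> i \<Longrightarrow> z i = y i) \<Longrightarrow> z \<in> V"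
  shows "thick k n V y"
  using assms
proof (induction n arbitrary: k y)
  case 0
  show ?case unfolding thick.simps by (rule 0) auto
next
  case (Suc n)
  have "thick (Suc k) n V (y(k := a))" for a
  proof (rule Suc.IH)
    fix z assume z: "\<And>i. i < Suc k \<Longrightarrow> z i = (y(k := a)) i" "\<And>i. Suc k + n \<le> i \<Longrightarrow> z i = (y(k := a)) i"
    show "z \<in> V"
    proof (rule Suc.prems)
      show "z i = y i" if "i < k" for i using z(1)[of i] that by simp
      show "z i = y i" if "k + Suc n \<le> i" for i using z(2)[of i] that by simp
    qed
  qed
  then show ?case by simp
qed

lemma quadratic_root:
  assumes "A \<noteq> (0::complex)" "t \<noteq> D" obtains s where "s \<noteq> 0" "A * s * s + B * s + D = t"
proof -
  have "Polynomial.degree [:D - t, B, A:] = 2" using assms(1) by simp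
  then obtain s where s: "poly [:D - t, B, A:] s = 0"
    using fundamental_theorem_of_algebra[of "[:D - t, B, A:]"] constant_degree[of "[:D - t, B, A:]"] by auto
  then have "A * s * s + B * s + D = t" by (simp add: algebra_simps)
  moreover have "s \<noteq> 0" using s assms(2) by auto
  ultimately show ?thesis using that by blast
qed

definition orb :: "cmat \<Rightarrow> cmat set" where
  "orb x = {b ** x ** adj b | b. b \<in> Bm}"

lemma R_ev_fv: "i \<noteq> j \<Longrightarrow> R k (ev i) (fv j) *v ev l = ev l + (if l = j then k *s ev i else 0)"
  by (simp add: R_vec om_basis)

definition upE :: "complex \<Rightarrow> complex \<Rightarrow> complex \<Rightarrow> complex \<Rightarrow> complex \<Rightarrow> complex \<Rightarrow> cmat" where
  "upE a b c p q r = R (p / b) (ev 1) (fv 2) ** R (q / c - r / c * (p / b)) (ev 1) (fv 3)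
     ** R (r / c) (ev 2) (fv 3) ** tor (\<lambda>k. if k = 1 then a else if k = 2 then b else c)"

lemma R_ef_Bm: "lv (Inl i) < lv (Inl j) \<Longrightarrow> R k (ev i) (fv j) \<in> Bm"
  using lv_flip[of "Inl j"] lv_bounds[of "Inl j"]
  by (intro R_Bm[of _ _ "lv (Inl i)" "lv (Inr j)"]) (auto simp: om_basis)

lemma upE_Bm: "a \<noteq> 0 \<Longrightarrow> b \<noteq> 0 \<Longrightarrow> c \<noteq> 0 \<Longrightarrow> upE a b c p q r \<in> Bm"
  unfolding upE_def by (intro mult_Bm R_ef_Bm subsetD[OF Tm_Bm tor_Tm]) (auto simp: lv_values)

lemma axis_scale: "axis i c = c *s axis i (1::complex)"
  by (auto simp: vec_eq_iff axis_nth')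

lemma upE_vec:
  assumes "a \<noteq> 0" "b \<noteq> 0" "c \<noteq> 0"
  shows "upE a b c p q r *v ev 1 = a *s ev 1" "upE a b c p q r *v ev 2 = p *s ev 1 + b *s ev 2"
    "upE a b c p q r *v ev 3 = q *s ev 1 + r *s ev 2 + c *s ev 3"
proof -
  have 1: "upE a b c p q r *v v = R (p / b) (ev 1) (fv 2) *v (R (q / c - r / c * (p / b)) (ev 1) (fv 3)
     *v (R (r / c) (ev 2) (fv 3) *v (tor (\<lambda>k. if k = 1 then a else if k = 2 then b else c) *v v)))" for v
    by (simp add: upE_def matrix_vector_mul_assoc[symmetric])
  show "upE a b c p q r *v ev 1 = a *s ev 1" "upE a b c p q r *v ev 2 = p *s ev 1 + b *s ev 2"
    "upE a b c p q r *v ev 3 = q *s ev 1 + r *s ev 2 + c *s ev 3"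
    unfolding 1 using assms
    by (simp_all add: tor_vec axis_scale[of _ a] axis_scale[of _ b] axis_scale[of _ c]
      vector_scalar_commute matrix_vector_right_distrib R_ev_fv vec_eq_iff algebra_simps)
qed

definition upP :: "complex ^ 3 ^ 3 \<Rightarrow> cmat" where
  "upP S = (\<chi> i j. case (i, j) of (Inl k, Inr l) \<Rightarrow> - S $ k $ l | _ \<Rightarrow> if i = j then 1 else 0)"

lemma upP_vec: "upP S *v ev j = ev j" "upP S *v fv j = fv j - (\<Sum>l\<in>UNIV. S $ l $ j *s ev l)"
  by (auto simp: vec_eq_iff mult_axis_nth axis_nth' upP_def if_distrib[of "\<lambda>x. _ * x"] split: sum.split cong: if_cong)

lemma Sp_basisI:
  assumes "\<And>i j. om (A *v ev i) (A *v ev j) = 0" "\<And>i j. om (A *v fv i) (A *v fv j) = 0"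
    "\<And>i j. om (A *v ev i) (A *v fv j) = (if i = j then 1 else 0)"
  shows "A \<in> Sp"
proof -
  have "om (A *v axis i 1) (A *v axis j 1) = om (axis i 1) (axis j 1)" for i j
    using assms om_skew[of "A *v axis i 1"] by (cases i; cases j) (auto simp: om_basis)
  then have "om (axis i 1) (adj A *v (A *v axis j 1)) = om (axis i 1) (axis j 1)" for i j by (simp add: om_adj)
  then have "(adj A *v (A *v axis j 1)) $ flip i = axis j 1 $ flip i" for i j by (simp add: om_axis_left)
  then have e: "(adj A *v (A *v axis j 1)) $ i = axis j 1 $ i" for i j by (metis flip_flip)
  have "(adj A ** A) $ i $ j = mat 1 $ i $ j" for i j
    using e[of j i] by (simp add: matrix_vector_mul_assoc mult_axis_nth) (simp add: mat_def axis_nth')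
  then show ?thesis by (simp add: Sp_iff vec_eq_iff)
qed

lemma om_sum_right: "om v (\<Sum>l\<in>I. g l) = (\<Sum>l\<in>I. om v (g l))"
  and om_sum_left: "om (\<Sum>l\<in>I. g l) v = (\<Sum>l\<in>I. om (g l) v)"
  by (induction I rule: infinite_finite_induct) (simp_all add: om_simps)

lemma upP_Bm: assumes "\<And>i j. S $ i $ j = S $ j $ i" shows "upP S \<in> Bm"
proof -
  have "upP S \<in> Sp"
    by (rule Sp_basisI) (simp_all add: upP_vec om_simps om_sum_right om_sum_left om_basis assms
      if_distrib[of "\<lambda>x. _ * x"] cong: if_cong)
  moreover have "upP S $ i $ j = 0" if "lv j < lv i" for i j
    using that lv_le_3[of i] lv_le_3[of j] by (cases i; cases j) (auto simp: upP_def)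
  ultimately show ?thesis by (simp add: Bm_def)
qed

definition lowA :: "cmat \<Rightarrow> complex ^ 3 ^ 3" where
  "lowA y = (\<chi> i j. y $ Inr i $ Inl j)"

definition uppA :: "cmat \<Rightarrow> complex ^ 3 ^ 3" where
  "uppA y = (\<chi> i j. y $ Inl i $ Inl j)"

lemma lowA_om: "lowA y $ i $ j = om (ev i) (y *v ev j)"
  by (simp add: lowA_def om_axis_left mult_axis_nth)

lemma uppA_om: "uppA y $ i $ j = - om (fv i) (y *v ev j)"
  by (simp add: uppA_def om_axis_left mult_axis_nth)

text \<open>Twelve functions on a matrix: the lower triangular entries of its lower left block \<open>c\<close> and of
  the product of the transpose of \<open>c\<close> with its upper left block.\<close>

definition twelve :: "nat \<Rightarrow> cmat \<Rightarrow> complex" where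
  "twelve i y = (let c = lowA y; s = transpose (lowA y) ** uppA y in
     [c $ 1 $ 1, c $ 2 $ 1, c $ 3 $ 1, c $ 2 $ 2, c $ 3 $ 2, c $ 3 $ 3,
      s $ 1 $ 1, s $ 2 $ 1, s $ 3 $ 1, s $ 2 $ 2, s $ 3 $ 2, s $ 3 $ 3] ! i)"

lemma less_12: "(\<forall>i<12. P i) \<longleftrightarrow> P 0 \<and> P 1 \<and> P 2 \<and> P 3 \<and> P 4 \<and> P 5 \<and> P 6 \<and> P 7 \<and> P 8 \<and> P 9 \<and> P 10 \<and> P (11::nat)"
  by (simp add: numeral_eq_Suc All_less_Suc conj_ac)

lemma twelve_simps:
  "twelve 0 y = lowA y $ 1 $ 1" "twelve 1 y = lowA y $ 2 $ 1" "twelve 2 y = lowA y $ 3 $ 1"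
  "twelve 3 y = lowA y $ 2 $ 2" "twelve 4 y = lowA y $ 3 $ 2" "twelve 5 y = lowA y $ 3 $ 3"
  "twelve 6 y = (transpose (lowA y) ** uppA y) $ 1 $ 1" "twelve 7 y = (transpose (lowA y) ** uppA y) $ 2 $ 1"
  "twelve 8 y = (transpose (lowA y) ** uppA y) $ 3 $ 1" "twelve 9 y = (transpose (lowA y) ** uppA y) $ 2 $ 2"
  "twelve 10 y = (transpose (lowA y) ** uppA y) $ 3 $ 2" "twelve 11 y = (transpose (lowA y) ** uppA y) $ 3 $ 3"
  by (simp_all add: twelve_def Let_def numeral_eq_Suc)

lemma twelve_pf: "i < 12 \<Longrightarrow> (\<lambda>x. twelve i (dec x)) \<in> pf (coords 36)"
proof -
  have "\<forall>i<12. (\<lambda>x. twelve i (dec x)) \<in> pf (coords 36)"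
    unfolding less_12 twelve_simps matrix_matrix_mult_def transpose_def lowA_def uppA_def
    by (simp, intro conjI pf_sum pf_mult mp_entry mp_dec)
  then show "i < 12 \<Longrightarrow> (\<lambda>x. twelve i (dec x)) \<in> pf (coords 36)" by blast
qed

lemma symmetric_extension: "\<exists>M :: complex ^ 3 ^ 3. transpose M = M \<and> M $ 1 $ 1 = a \<and> M $ 2 $ 1 = b \<and> M $ 3 $ 1 = c \<and>
    M $ 2 $ 2 = d \<and> M $ 3 $ 2 = e \<and> M $ 3 $ 3 = f"
  by (rule exI[of _ "\<chi> i j. if i = 1 \<and> j = 1 then a else if i = 2 \<and> j = 2 then d else if i = 3 \<and> j = 3 then f
    else if i \<noteq> 3 \<and> j \<noteq> 3 then b else if i \<noteq> 2 \<and> j \<noteq> 2 then c else e"])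
    (simp add: vec_eq_iff forall_3 transpose_def)

lemma orb_twelve:
  assumes d: "d \<in> Bm" and m: "m \<in> Bm" and C: "invertible (lowA (adj m ** (w0 ** d) ** m))"
  shows "\<exists>m'\<in>Bm. lowA (adj m' ** (w0 ** d) ** m') = lowA (adj m ** (w0 ** d) ** m) \<and>
    (let s = transpose (lowA (adj m' ** (w0 ** d) ** m')) ** uppA (adj m' ** (w0 ** d) ** m') in
      s $ 1 $ 1 = t1 \<and> s $ 2 $ 1 = t2 \<and> s $ 3 $ 1 = t3 \<and> s $ 2 $ 2 = t4 \<and> s $ 3 $ 2 = t5 \<and> s $ 3 $ 3 = t6)"
proof -
  define y where "y = adj m ** (w0 ** d) ** m"
  define C where "C = lowA y"
  define s0 where "s0 = transpose C ** uppA y"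
  obtain M :: "complex ^ 3 ^ 3" where M: "transpose M = M" "M $ 1 $ 1 = t1 - s0 $ 1 $ 1" "M $ 2 $ 1 = t2 - s0 $ 2 $ 1" "M $ 3 $ 1 = t3 - s0 $ 3 $ 1"
    "M $ 2 $ 2 = t4 - s0 $ 2 $ 2" "M $ 3 $ 2 = t5 - s0 $ 3 $ 2" "M $ 3 $ 3 = t6 - s0 $ 3 $ 3"
    using symmetric_extension[of "t1 - s0 $ 1 $ 1" "t2 - s0 $ 2 $ 1" "t3 - s0 $ 3 $ 1" "t4 - s0 $ 2 $ 2" "t5 - s0 $ 3 $ 2" "t6 - s0 $ 3 $ 3"]
    by (elim exE conjE)
  have inv: "invertible C" using assms(3) by (simp add: C_def y_def)
  then obtain I where I: "C ** I = mat 1" "I ** C = mat 1" by (auto simp: invertible_def)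
  define S where "S = transpose I ** M ** I"
  have S: "transpose S = S" by (simp add: S_def matrix_transpose_mul M(1) matrix_mul_assoc)
  have "transpose C ** transpose I = mat 1" using I(2) by (metis matrix_transpose_mul transpose_mat)
  then have CSC: "transpose C ** (S ** C) = M"
    unfolding S_def using I(2) by (metis matrix_mul_assoc matrix_mul_lid matrix_mul_rid)
  have Ssym: "S $ i $ j = S $ j $ i" for i j using arg_cong[OF S, of "\<lambda>A. A $ i $ j"] by (simp add: transpose_def)
  define u where "u = upP S"
  have u: "u \<in> Bm" unfolding u_def using Ssym by (rule upP_Bm)
  define y' where "y' = adj (m ** u) ** (w0 ** d) ** (m ** u)"
  have y': "y' = adj u ** y ** u" using m u by (simp add: y'_def y_def adj_mult Bm_Sp matrix_mul_assoc)
  have om': "om v (y' *v ev j) = om (u *v v) (y *v ev j)" for v j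
    unfolding y' by (simp add: matrix_vector_mul_assoc[symmetric] om_adj u_def upP_vec(1))
  have l: "lowA y' = C"
    by (simp add: vec_eq_iff lowA_om om' C_def) (simp add: u_def upP_vec)
  have "uppA y' = uppA y + S ** C"
    by (simp add: vec_eq_iff uppA_om om') (simp add: u_def upP_vec om_simps om_sum_left matrix_matrix_mult_def
      C_def lowA_om Ssym)
  then have "transpose C ** uppA y' = s0 + M"
    by (simp add: s0_def matrix_add_ldistrib CSC)
  then have "lowA y' = C \<and> (let s = transpose (lowA y') ** uppA y' in
      s $ 1 $ 1 = t1 \<and> s $ 2 $ 1 = t2 \<and> s $ 3 $ 1 = t3 \<and> s $ 2 $ 2 = t4 \<and> s $ 3 $ 2 = t5 \<and> s $ 3 $ 3 = t6)"
    using M by (simp add: l Let_def)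
  then show ?thesis unfolding y'_def C_def y_def using mult_Bm[OF m u] by blast
qed

lemma w0_upper:
  assumes d: "d \<in> Bm"
  shows "om (ev i) ((w0 ** d) *v ev j) = (if lv (Inl i) \<le> lv (Inl j) then d $ Inl i $ Inl j else 0)"
proof -
  have "om (ev i) ((w0 ** d) *v ev j) = om (adj w0 *v ev i) (d *v ev j)"
    by (simp add: matrix_vector_mul_assoc[symmetric] om_adj')
  also have "adj w0 *v ev i = - fv i"
    using Sp_adj_vec(1)[OF w0_Sp, of "- fv i"] by (simp add: vec.neg w0_vec)
  also have "om (- fv i) (d *v ev j) = d $ Inl i $ Inl j"
    by (simp add: om_simps om_axis_left mult_axis_nth)
  finally show ?thesis using d by (auto simp: Bm_def not_le)
qed

lemma Bm_diag_nz: assumes "A \<in> Bm" shows "A $ j $ j \<noteq> 0"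
proof
  assume "A $ j $ j = 0"
  have "(adj A ** A) $ j $ j = 0"
  proof -
    have "adj A $ j $ k * A $ k $ j = 0" for k
    proof -
      consider "k = j" | "lv k < lv j" | "lv j < lv k" using lv_inj[of k j] by linarith
      then show ?thesis
        using assms adj_Bm[OF assms] \<open>A $ j $ j = 0\<close> by cases (auto simp: Bm_def)
    qed
    then show ?thesis by (simp only: matrix_matrix_mult_def vec_lambda_beta sum.neutral_const)
  qed
  then show False using Sp_adj_left[OF Bm_Sp[OF assms]] by (simp add: mat_def)
qed

theorem cell_orbit_dim:
  assumes "x \<in> cell" shows "enat 12 \<le> var_dim CC 36 (enc ` orb x)"
proof (rule var_dim_ge_thick)
  obtain b1 b2 where b: "b1 \<in> Bm" "b2 \<in> Bm" "x = b1 ** w0 ** b2" using assms by (auto simp: cell_def)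
  define d where "d = b2 ** b1"
  have d: "d \<in> Bm" using b by (simp add: d_def mult_Bm)
  have orb: "adj m ** (w0 ** d) ** m \<in> orb x" if "m \<in> Bm" for m
  proof -
    have "adj m ** (w0 ** d) ** m = (adj m ** adj b1) ** x ** adj (adj m ** adj b1)"
      using b that by (simp add: d_def adj_mult adj_Sp Bm_Sp matrix_mul_assoc[symmetric] Sp_adj_left)
    then show ?thesis unfolding orb_def using that b by (blast intro: mult_Bm adj_Bm)
  qed
  define bt where "bt = (\<lambda>v w. om v ((w0 ** d) *v w))"
  have bt_simps: "bt (v + w) u = bt v u + bt w u" "bt u (v + w) = bt u v + bt u w" "bt (k *s v) u = k * bt v u"
    "bt u (k *s v) = k * bt u v" for v w u k
    by (simp_all add: bt_def om_simps matrix_vector_right_distrib vector_scalar_commute)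
  define d1 d2 d3 where "d1 = d $ Inl 1 $ Inl 1" "d2 = d $ Inl 2 $ Inl 2" "d3 = d $ Inl 3 $ Inl 3"
  define e12 e13 e23 where "e12 = d $ Inl 1 $ Inl 2" "e13 = d $ Inl 1 $ Inl 3" "e23 = d $ Inl 2 $ Inl 3"
  have nz: "d1 \<noteq> 0" "d2 \<noteq> 0" "d3 \<noteq> 0" using Bm_diag_nz[OF d] by (simp_all add: d1_d2_d3_def)
  have bt: "bt (ev 1) (ev 1) = d1" "bt (ev 2) (ev 2) = d2" "bt (ev 3) (ev 3) = d3" "bt (ev 2) (ev 1) = 0"
    "bt (ev 3) (ev 1) = 0" "bt (ev 3) (ev 2) = 0" "bt (ev 1) (ev 2) = e12" "bt (ev 1) (ev 3) = e13" "bt (ev 2) (ev 3) = e23"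
    by (simp_all add: bt_def w0_upper[OF d] lv_values d1_d2_d3_def e12_e13_e23_def)
  define V where "V = (\<lambda>x. \<lambda>i\<in>{..<12}. twelve i (dec x)) ` (enc ` orb x)"
  let ?u = "(\<lambda>_. undefined) :: nat \<Rightarrow> complex"
  have "thick 0 (Suc (Suc (Suc (Suc (Suc (Suc 6)))))) V ?u"
  proof (rule thickI[of "{0}"])
    fix c11 :: complex assume "c11 \<notin> {0}"
    then have c11: "c11 \<noteq> 0" by simp
    define a where "a = csqrt (c11 / d1)"
    have a2: "a * a * d1 = c11" using nz power2_csqrt[of "c11 / d1"] unfolding a_def power2_eq_square by simp
    have a: "a \<noteq> 0" using a2 c11 by auto
    show "thick (Suc 0) (Suc (Suc (Suc (Suc (Suc 6))))) V (?u(0 := c11))"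
    proof (rule thickI[of "{}"])
      fix c21
      define p where "p = c21 / (a * d1)"
      have p: "p * a * d1 = c21" using a nz by (simp add: p_def)
      show "thick (Suc (Suc 0)) (Suc (Suc (Suc (Suc 6)))) V (?u(0 := c11, Suc 0 := c21))"
      proof (rule thickI[of "{}"])
        fix c31
        define q where "q = c31 / (a * d1)"
        have q: "q * a * d1 = c31" using a nz by (simp add: q_def)
        show "thick (Suc (Suc (Suc 0))) (Suc (Suc (Suc 6))) V (?u(0 := c11, Suc 0 := c21, Suc (Suc 0) := c31))"
        proof (rule thickI[of "{p * p * d1}"])
          fix c22 assume "c22 \<notin> {p * p * d1}"
          then obtain b where b: "b \<noteq> 0" "d2 * b * b + p * e12 * b + p * p * d1 = c22"
            using quadratic_root[OF nz(2)] by (metis singletonI)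
          show "thick (Suc (Suc (Suc (Suc 0)))) (Suc (Suc 6)) V
            (?u(0 := c11, Suc 0 := c21, Suc (Suc 0) := c31, Suc (Suc (Suc 0)) := c22))"
          proof (rule thickI[of "{}"])
            fix c32
            define r where "r = (c32 - q * p * d1 - q * b * e12) / (b * d2)"
            have r: "q * p * d1 + q * b * e12 + r * b * d2 = c32" using b nz by (simp add: r_def)
            show "thick (Suc (Suc (Suc (Suc (Suc 0))))) (Suc 6) V
              (?u(0 := c11, Suc 0 := c21, Suc (Suc 0) := c31, Suc (Suc (Suc 0)) := c22, Suc (Suc (Suc (Suc 0))) := c32))"
            proof (rule thickI[of "{q * q * d1 + q * r * e12 + r * r * d2}"])
              fix c33 assume "c33 \<notin> {q * q * d1 + q * r * e12 + r * r * d2}"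
              then obtain c where c: "c \<noteq> 0" "d3 * c * c + (q * e13 + r * e23) * c + (q * q * d1 + q * r * e12 + r * r * d2) = c33"
                using quadratic_root[OF nz(3)] by (metis singletonI)
              define m where "m = upE a b c p q r"
              have m: "m \<in> Bm" unfolding m_def by (rule upE_Bm[OF a b(1) c(1)])
              define y where "y = adj m ** (w0 ** d) ** m"
              have low: "lowA y $ i $ j = bt (m *v ev i) (m *v ev j)" for i j
                by (simp add: lowA_om y_def bt_def matrix_vector_mul_assoc[symmetric] om_adj[symmetric] om_adj')
              note mv = upE_vec[OF a b(1) c(1), of p q r, folded m_def]
              have L: "lowA y $ 1 $ 1 = c11" "lowA y $ 2 $ 1 = c21" "lowA y $ 3 $ 1 = c31" "lowA y $ 2 $ 2 = c22"
                "lowA y $ 3 $ 2 = c32" "lowA y $ 3 $ 3 = c33"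
                using a2 p q b(2) r c(2) by (simp_all add: low mv bt_simps bt algebra_simps)
              have "det (lowA y) = (a * b * c) * (a * b * c) * (d1 * d2 * d3)"
                by (simp add: det_3 low mv bt_simps bt algebra_simps)
              then have "invertible (lowA y)"
                using a b(1) c(1) nz by (simp add: invertible_det_nz)
              note ex = orb_twelve[OF d m this[unfolded y_def]]
              show "thick (Suc (Suc (Suc (Suc (Suc (Suc 0)))))) 6 V (?u(0 := c11, Suc 0 := c21, Suc (Suc 0) := c31,
                Suc (Suc (Suc 0)) := c22, Suc (Suc (Suc (Suc 0))) := c32, Suc (Suc (Suc (Suc (Suc 0)))) := c33))"
                (is "thick _ _ _ ?y")
              proof (rule thick_all)
                fix z assume z: "\<And>i. i < Suc (Suc (Suc (Suc (Suc (Suc 0))))) \<Longrightarrow> z i = ?y i"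
                  "\<And>i. Suc (Suc (Suc (Suc (Suc (Suc 0))))) + 6 \<le> i \<Longrightarrow> z i = ?y i"
                obtain m' where m': "m' \<in> Bm" and l: "lowA (adj m' ** (w0 ** d) ** m') = lowA y"
                  and s: "let s = transpose (lowA (adj m' ** (w0 ** d) ** m')) ** uppA (adj m' ** (w0 ** d) ** m') in
                    s $ 1 $ 1 = z 6 \<and> s $ 2 $ 1 = z 7 \<and> s $ 3 $ 1 = z 8 \<and> s $ 2 $ 2 = z 9 \<and> s $ 3 $ 2 = z 10 \<and> s $ 3 $ 3 = z 11"
                  using ex[of "z 6" "z 7" "z 8" "z 9" "z 10" "z 11"] unfolding y_def[symmetric] by (elim bexE conjE)
                define y' where "y' = adj m' ** (w0 ** d) ** m'"
                have z0: "z 0 = c11" "z 1 = c21" "z 2 = c31" "z 3 = c22" "z 4 = c32" "z 5 = c33"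
                  using z(1)[of 0] z(1)[of 1] z(1)[of 2] z(1)[of 3] z(1)[of 4] z(1)[of 5] by (simp_all add: numeral_eq_Suc)
                have "\<forall>i<12. twelve i y' = z i"
                  unfolding less_12 twelve_simps using s l L by (simp add: z0 z0(2)[simplified] y'_def Let_def)
                moreover have "z i = undefined" if "\<not> i < 12" for i using z(2)[of i] that by simp
                ultimately have "z = (\<lambda>i\<in>{..<12}. twelve i (dec (enc y')))" by (auto simp: restrict_def)
                moreover have "y' \<in> orb x" unfolding y'_def by (rule orb[OF m'])
                ultimately show "z \<in> V" unfolding V_def by blast
              qed
            qed simp
          qed simp
        qed simp
      qed simp
    qed simp
  qed simp
  then show "thick 0 12 ((\<lambda>x. \<lambda>i\<in>{..<12}. twelve i (dec x)) ` (enc ` orb x)) ?u"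
    unfolding V_def[symmetric] by (simp only: numeral_eq_Suc pred_numeral_simps BitM.simps One_nat_def) 
qed (rule twelve_pf)

subsection \<open>A twelve-dimensional class meeting the big cell\<close>

definition blk :: "complex ^ 3 ^ 3 \<Rightarrow> complex ^ 3 ^ 3 \<Rightarrow> complex ^ 3 ^ 3 \<Rightarrow> complex ^ 3 ^ 3 \<Rightarrow> cmat" where
  "blk a b c d = (\<chi> i j. case (i, j) of (Inl k, Inl l) \<Rightarrow> a $ k $ l | (Inl k, Inr l) \<Rightarrow> b $ k $ l
     | (Inr k, Inl l) \<Rightarrow> c $ k $ l | (Inr k, Inr l) \<Rightarrow> d $ k $ l)"

lemma blk_exhaust: obtains a b c d where "A = blk a b c d"
  by (rule that[of "\<chi> k l. A $ Inl k $ Inl l" "\<chi> k l. A $ Inl k $ Inr l" "\<chi> k l. A $ Inr k $ Inl l" "\<chi> k l. A $ Inr k $ Inr l"])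
    (auto simp: vec_eq_iff blk_def split: sum.split)

lemma blk_nth: "blk a b c d $ Inl k $ Inl l = a $ k $ l" "blk a b c d $ Inl k $ Inr l = b $ k $ l"
  "blk a b c d $ Inr k $ Inl l = c $ k $ l" "blk a b c d $ Inr k $ Inr l = d $ k $ l"
  by (simp_all add: blk_def)

lemma blk_eq_iff: "blk a b c d = blk a' b' c' d' \<longleftrightarrow> a = a' \<and> b = b' \<and> c = c' \<and> d = d'"
  by (auto simp: vec_eq_iff forall_33 blk_nth)

lemma blk_mult: "blk a b c d ** blk a' b' c' d' = blk (a ** a' + b ** c') (a ** b' + b ** d') (c ** a' + d ** c') (c ** b' + d ** d')"
  by (simp add: vec_eq_iff forall_33 blk_nth matrix_matrix_mult_def sum_33)

lemma blk_add: "blk a b c d + blk a' b' c' d' = blk (a + a') (b + b') (c + c') (d + d')"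
  and blk_uminus: "- blk a b c d = blk (- a) (- b) (- c) (- d)"
  and blk_one: "mat 1 = blk (mat 1) 0 0 (mat 1)"
  and blk_zero: "0 = blk 0 0 0 0"
  and adj_blk: "adj (blk a b c d) = blk (transpose d) (- transpose b) (- transpose c) (transpose a)"
  by (simp_all add: vec_eq_iff forall_33 blk_nth adj_def transpose_def mat_def)

definition x1 :: cmat where "x1 = blk (mat 1) 0 (mat 1) (mat 1)"

lemma x1_cell: "x1 \<in> cell"
proof -
  define u where "u = upP (- mat 1)"
  have u: "u \<in> Bm" unfolding u_def by (rule upP_Bm) (auto simp: mat_def)
  have 1: "u = blk (mat 1) (mat 1) 0 (mat 1)"
    by (simp add: u_def upP_def vec_eq_iff forall_33 blk_nth mat_def)
  have 2: "w0 = blk 0 (- mat 1) (mat 1) 0"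
    by (simp add: w0_def vec_eq_iff forall_33 blk_nth mat_def)
  have "u ** w0 ** u = x1" unfolding 1 2 by (simp add: blk_mult x1_def)
  then show ?thesis using u unfolding cell_def by (intro CollectI exI[of _ u]) simp
qed

lemma cell_Sp: "cell \<subseteq> Sp"
  using w0_Sp by (auto simp: cell_def mult_Sp Bm_Sp)

definition chart12 :: "complex ^ 3 ^ 3 \<Rightarrow> complex ^ 3 ^ 3 \<Rightarrow> cmat" where
  "chart12 P S = blk (mat 1 + P ** S) (- (P ** S ** P)) S (mat 1 - S ** P)"

text \<open>The members \<open>1 + N\<close> of the class of \<open>x1\<close> have \<open>N ** N = 0\<close>; when the lower left block \<open>S\<close> of
  \<open>N\<close> is invertible, the block equations determine \<open>N\<close> from two symmetric matrices.\<close>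

lemma matrix_mult_minus_left: "(- A) ** B = - (A ** B)" for A :: "'a::comm_ring_1 ^ 'n::finite ^ 'm::finite"
  by (simp add: vec_eq_iff matrix_matrix_mult_def sum_negf)

lemma matrix_mult_minus_right: "A ** (- B) = - (A ** B)" for A :: "'a::comm_ring_1 ^ 'n::finite ^ 'm::finite"
  by (simp add: vec_eq_iff matrix_matrix_mult_def sum_negf)

lemma adj_product: "adj (A ** C) = adj C ** adj A"
proof -
  obtain a b c d where A: "A = blk a b c d" by (rule blk_exhaust)
  obtain a' b' c' d' where C: "C = blk a' b' c' d'" by (rule blk_exhaust)
  show ?thesis
    unfolding A C adj_blk blk_mult blk_eq_iff
    by (simp add: vec_eq_iff transpose_def matrix_matrix_mult_def sum_negf mult.commute)
qed

lemma matrix_mult_add_right: "(A + B) ** C = A ** C + B ** C" for A :: "'a::comm_ring_1 ^ 'n::finite ^ 'm::finite"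
  by (simp add: vec_eq_iff matrix_matrix_mult_def sum.distrib ring_distribs)

lemma matrix_vector_minus_left: "(- A) *v x = - (A *v x)" for A :: "'a::comm_ring_1 ^ 'n::finite ^ 'm::finite"
  by (simp add: vec_eq_iff matrix_vector_mult_def sum_negf)

lemma cls_x1_chart:
  assumes y: "y \<in> cls x1" and det: "det (lowA y) \<noteq> 0"
  shows "\<exists>P S. transpose P = P \<and> transpose S = S \<and> y = chart12 P S"
proof -
  obtain g where g: "g \<in> Sp" "y = g ** x1 ** adj g" using y by (auto simp: cls_def)
  define N1 where "N1 = blk 0 0 (mat 1) 0"
  have x1: "x1 = mat 1 + N1" by (simp add: x1_def N1_def blk_one blk_add)
  define N where "N = g ** N1 ** adj g"
  have yN: "y = mat 1 + N"
    unfolding g(2) x1 N_def using g(1)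
    by (simp add: matrix_add_ldistrib matrix_mult_add_right matrix_mul_assoc Sp_adj_right)
  have "N ** N = g ** (N1 ** N1) ** adj g"
    unfolding N_def using g(1) by (simp add: matrix_mul_assoc[symmetric] Sp_adj_left)
  also have "N1 ** N1 = 0" by (simp add: N1_def blk_mult blk_zero)
  finally have NN: "N ** N = 0" by simp
  have "adj N1 = - N1" by (simp add: N1_def adj_blk blk_uminus transpose_mat blk_eq_iff) (simp add: transpose_def vec_eq_iff)
  then have adjN: "adj N = - N"
    unfolding N_def by (simp add: adj_product matrix_mul_assoc[symmetric] matrix_mult_minus_left matrix_mult_minus_right)
  obtain a b S d where blkN: "N = blk a b S d" by (rule blk_exhaust)
  have "lowA y = S" by (simp add: yN blkN lowA_def vec_eq_iff blk_nth mat_def)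
  then have "invertible S" using det by (simp add: invertible_det_nz)
  then obtain I where I: "S ** I = mat 1" "I ** S = mat 1" by (auto simp: invertible_def)
  have t: "d = - transpose a" "transpose b = b" "transpose S = S"
  proof -
    have 1: "transpose d = - a" "- transpose b = - b" "- transpose S = - S"
      using adjN unfolding blkN adj_blk blk_uminus blk_eq_iff by blast+
    have "d = transpose (transpose d)" by (rule transpose_transpose[symmetric])
    then show "d = - transpose a" unfolding 1(1) by (simp add: transpose_def vec_eq_iff)
    show "transpose b = b" "transpose S = S" using 1 by simp_all
  qed
  have eqs: "a ** a + b ** S = 0" "S ** a + d ** S = 0"
    using NN unfolding blkN blk_mult blk_zero blk_eq_iff by auto
  define P where "P = a ** I"
  have PS: "P ** S = a" by (simp add: P_def matrix_mul_assoc[symmetric] I)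
  have "S ** a = transpose a ** S"
    using eqs(2) unfolding t(1) by (simp add: matrix_mult_minus_left add_eq_0_iff2)
  then have 1: "S ** P = transpose a"
    unfolding P_def by (simp add: matrix_mul_assoc) (simp add: matrix_mul_assoc[symmetric] I)
  have "transpose a = S ** transpose P" using arg_cong[OF PS, of transpose] by (simp add: matrix_transpose_mul t(3))
  then have "I ** (S ** P) = I ** (S ** transpose P)" using 1 by simp
  then have P: "transpose P = P" by (simp add: matrix_mul_assoc I)
  have "b = b ** S ** I" by (simp add: matrix_mul_assoc[symmetric] I)
  also have "b ** S = - (a ** a)" using eqs(1) by (simp add: add_eq_0_iff)
  also have "- (a ** a) ** I = - (P ** S ** P)"
    unfolding PS by (simp add: P_def matrix_mult_minus_left matrix_mul_assoc)
  finally have b: "b = - (P ** S ** P)" .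
  have "y = chart12 P S"
    unfolding yN blkN chart12_def blk_one blk_add blk_eq_iff using PS b 1 t(1) by simp
  then show ?thesis using P t(3) by blast
qed

definition sidx :: "3 \<Rightarrow> 3 \<Rightarrow> nat" where
  "sidx i j = (if i = j then idx i else 2 + idx i + idx j)"

lemma sidx_less: "sidx i j < 6"
  by (rule index3_cases[of i]; rule index3_cases[of j]) (simp_all add: sidx_def idx_def)

lemma symmetric_coords:
  fixes M :: "complex ^ 3 ^ 3" assumes "transpose M = M"
  shows "\<exists>h. M = (\<chi> i j. h (sidx i j))"
proof -
  have s: "M $ i $ j = M $ j $ i" for i j using arg_cong[OF assms, of "\<lambda>A. A $ i $ j"] by (simp add: transpose_def)
  show ?thesis
    by (rule exI[of _ "\<lambda>n. [M $ 1 $ 1, M $ 2 $ 2, M $ 3 $ 3, M $ 1 $ 2, M $ 1 $ 3, M $ 2 $ 3] ! n"])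
      (simp add: vec_eq_iff forall_3 sidx_def idx_def s[of 2 1] s[of 3 1] s[of 3 2])
qed

definition psi12 :: "complex point \<Rightarrow> cmat" where
  "psi12 z = chart12 (\<chi> i j. z (sidx i j)) (\<chi> i j. z (6 + sidx i j))"

lemma psi12_pf: "(\<lambda>z. psi12 z $ i $ j) \<in> pf (coords 12)"
proof -
  have c: "(\<lambda>z. z (sidx k l)) \<in> pf (coords 12)" "(\<lambda>z. z (6 + sidx k l)) \<in> pf (coords 12)" for k l
    using sidx_less[of k l] by (auto intro!: pf_coord)
  show ?thesis
    unfolding psi12_def chart12_def
    by (cases i; cases j) (simp_all add: blk_nth matrix_matrix_mult_def pf_add pf_diff pf_uminus pf_sum pf_mult pf_const c)
qed

lemma cdim_x1: "cdim x1 \<le> enat 12"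
  unfolding cdim_def
proof (rule var_dim_le_chart[where \<psi> = "\<lambda>z. enc (psi12 z)" and g = "\<lambda>x. det (lowA (dec x))" and ?x0.0 = "enc x1"])
  show "zar_irreducible 36 (enc ` cls x1)" by (rule irreducible_cls)
  show "(\<lambda>z. enc (psi12 z) i) \<in> pf (coords 12)" if "i < 36" for i
    by (rule mp_enc[OF _ that]) (simp add: mp_def psi12_pf)
  show "(\<lambda>x. det (lowA (dec x))) \<in> pf (coords 36)"
    unfolding det_3 lowA_def by (simp, intro pf_add pf_diff pf_mult mp_entry mp_dec)
  show "enc x1 \<in> enc ` cls x1" using cls_self by blast
  have "lowA x1 = mat 1" by (simp add: lowA_def x1_def blk_nth vec_eq_iff)
  then show "det (lowA (dec (enc x1))) \<noteq> 0" by simp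
  fix x assume "x \<in> enc ` cls x1" and g: "det (lowA (dec x)) \<noteq> 0"
  then obtain y where y: "y \<in> cls x1" "x = enc y" by blast
  then obtain P S where PS: "transpose P = P" "transpose S = S" "y = chart12 P S"
    using cls_x1_chart[OF y(1)] g by auto
  obtain h where h: "P = (\<chi> i j. h (sidx i j))" using symmetric_coords[OF PS(1)] by (elim exE)
  obtain h' where h': "S = (\<chi> i j. h' (sidx i j))" using symmetric_coords[OF PS(2)] by (elim exE)
  define z where "z = (\<lambda>n. if n < 6 then h n else h' (n - 6))"
  have "y = psi12 z" unfolding PS(3) psi12_def h h' using sidx_less by (simp add: z_def)
  then show "\<exists>z. x = enc (psi12 z)" using y(2) by blast
qed

lemma x1_Sp: "x1 \<in> Sp"
  using x1_cell cell_Sp by blast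

lemma orb_cls: assumes "C \<in> cls A" shows "orb C \<subseteq> cls A"
  unfolding orb_def using cls_conj[OF assms] Bm_Sp by blast

lemma cell_cdim: assumes "cls A \<inter> cell \<noteq> {}" shows "enat 12 \<le> cdim A"
proof -
  obtain C where C: "C \<in> cls A" "C \<in> cell" using assms by blast
  have "enat 12 \<le> var_dim CC 36 (enc ` orb C)" by (rule cell_orbit_dim[OF C(2)])
  also have "\<dots> \<le> cdim A"
    unfolding cdim_def var_dim_def
  proof (rule Sup_mono)
    fix n assume "n \<in> {enat d |d. \<exists>f. alg_independent CC 36 (enc ` orb C) d f}"
    then obtain d f where "n = enat d" "alg_independent CC 36 (enc ` orb C) d f" by blast
    moreover from this have "alg_independent CC 36 (enc ` cls A) d f"
      using orb_cls[OF C(1)] unfolding alg_independent_def by (auto 0 3)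
    ultimately show "\<exists>m\<in>{enat d |d. \<exists>f. alg_independent CC 36 (enc ` cls A) d f}. n \<le> m" by blast
  qed
  finally show ?thesis .
qed

lemma VV_iff': "enc A \<in> VV \<longleftrightarrow> A \<in> Sp \<and> cls A \<inter> cell \<noteq> {} \<and> cdim A \<le> enat 12"
proof -
  have "cls x1 \<inter> cell \<noteq> {}" using cls_self x1_cell by blast
  then show ?thesis unfolding VV_iff using cdim_x1 cell_cdim x1_Sp order_trans by blast
qed

text \<open>For dimension reasons the orbits of the Borel subgroup in the intersection of the big cell with
  a class of the stratum are dense.\<close>

lemma orbit_dense:
  assumes A: "enc A \<in> VV" and C: "C \<in> cls A" "C \<in> cell"
    and F: "F \<in> pf (coords 36)" "\<And>y. y \<in> orb C \<Longrightarrow> F (enc y) = 0" and y: "y \<in> cls A"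
  shows "F (enc y) = 0"
proof (rule ccontr)
  assume "F (enc y) \<noteq> 0"
  then have "enat (Suc 12) \<le> cdim A"
    unfolding cdim_def
    using orb_cls[OF C(1)] y F(2)
    by (intro var_dim_drop[OF irreducible_cls _ F(1) _ _ _ cell_orbit_dim[OF C(2)], of A "enc y"]) auto
  moreover have "cdim A \<le> enat 12" using A by (simp add: VV_iff')
  ultimately show False using order_trans[of "enat (Suc 12)" "cdim A" "enat 12"] by simp
qed

lemma VV_spherical:
  assumes "K \<in> conj_classes G" "K \<subseteq> VV" shows "spherical_class CC 36 G K"
proof -
  obtain A where A: "K = enc ` cls A" "A \<in> Sp" using assms(1) by (auto simp: conj_classes_G)
  have V: "enc A \<in> VV" using A assms(2) cls_self by blast
  then obtain C where C: "C \<in> cls A" "C \<in> cell" unfolding VV_iff' by blast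
  have CS: "C \<in> Sp" using C cls_Sp[OF A(2)] by blast
  have orbeq: "{b \<otimes>\<^bsub>G\<^esub> enc C \<otimes>\<^bsub>G\<^esub> inv\<^bsub>G\<^esub> b | b. b \<in> enc ` Bm} = enc ` orb C"
  proof (intro equalityI subsetI)
    fix x assume "x \<in> {b \<otimes>\<^bsub>G\<^esub> enc C \<otimes>\<^bsub>G\<^esub> inv\<^bsub>G\<^esub> b | b. b \<in> enc ` Bm}"
    then obtain b where b: "b \<in> Bm" "x = enc b \<otimes>\<^bsub>G\<^esub> enc C \<otimes>\<^bsub>G\<^esub> inv\<^bsub>G\<^esub> (enc b)" by blast
    then show "x \<in> enc ` orb C" using Bm_Sp[of b] unfolding orb_def by auto
  next
    fix x assume "x \<in> enc ` orb C"
    then obtain b where b: "b \<in> Bm" "x = enc (b ** C ** adj b)" unfolding orb_def by blast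
    then show "x \<in> {b \<otimes>\<^bsub>G\<^esub> enc C \<otimes>\<^bsub>G\<^esub> inv\<^bsub>G\<^esub> b | b. b \<in> enc ` Bm}"
      using Bm_Sp[of b] by (auto intro!: exI[of _ "enc b"])
  qed
  have "K \<subseteq> zar 36 closure_of (enc ` orb C)"
  proof
    fix x assume "x \<in> K"
    then obtain y where y: "y \<in> cls A" "x = enc y" using A by blast
    have sub: "enc ` orb C \<subseteq> \<A> 36" by auto
    show "x \<in> zar 36 closure_of (enc ` orb C)"
      unfolding closure_zar[OF sub] using y(2) orbit_dense[OF V C _ _ y(1)] by auto
  qed
  then have "K \<subseteq> zar 36 closure_of {b \<otimes>\<^bsub>G\<^esub> enc C \<otimes>\<^bsub>G\<^esub> inv\<^bsub>G\<^esub> b | b. b \<in> enc ` Bm}"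
    unfolding orbeq .
  moreover have "enc C \<in> K" using C A by blast
  ultimately show ?thesis
    unfolding spherical_class_def using assms(1) borel_Bm by blast
qed

section \<open>Two classes of dimension ten\<close>

subsection \<open>The semisimple class\<close>

text \<open>For \<open>om p q = 1\<close> the element \<open>Hm p q\<close> has eigenvalues \<open>1/2\<close> on \<open>p\<close>, \<open>2\<close> on \<open>q\<close>, and \<open>1\<close> on the
  orthogonal complement of \<open>p\<close> and \<open>q\<close>.\<close>

definition Hm :: "cvec \<Rightarrow> cvec \<Rightarrow> cmat" where
  "Hm p q = (\<chi> i j. (if i = j then 1 else 0) - (om (axis j 1) p * q $ i + (1 / 2) * (om (axis j 1) q * p $ i)))"

definition y2 :: cmat where "y2 = Hm (ev 1) (fv 1)"

lemma Hm_vec: "Hm p q *v w = w - om w p *s q - (1 / 2 * om w q) *s p"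
proof (subst vec_eq_iff, intro allI)
  fix i
  have "(Hm p q *v w) $ i = (\<Sum>j\<in>UNIV. (if i = j then w $ j else 0)
     - (q $ i * (w $ j * om (axis j 1) p) + 1 / 2 * p $ i * (w $ j * om (axis j 1) q)))"
    unfolding matrix_vector_mult_def Hm_def by (auto intro!: sum.cong simp: algebra_simps)
  also have "\<dots> = w $ i - (q $ i * om w p + 1 / 2 * p $ i * om w q)"
    unfolding sum.distrib sum_subtractf sum_distrib_left[symmetric] om_expand[symmetric] by simp
  finally show "(Hm p q *v w) $ i = (w - om w p *s q - (1 / 2 * om w q) *s p) $ i"
    by (simp add: mult_ac)
qed

lemma Hm_Sp: assumes "om p q = 1" shows "Hm p q \<in> Sp"
  unfolding Sp_def
proof (intro CollectI allI)
  fix v w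
  have "om q p = - 1" "om p w = - om w p" "om q w = - om w q"
    using assms om_skew[of q p] om_skew[of p w] om_skew[of q w] by simp_all
  then show "om (Hm p q *v v) (Hm p q *v w) = om v w"
    using assms by (simp add: Hm_vec om_simps algebra_simps)
qed

lemma conj_Hm: assumes "g \<in> Sp" shows "g ** Hm p q ** adj g = Hm (g *v p) (g *v q)"
proof -
  have 1: "om (adj g *v w) p = om w (g *v p)" for w p using om_adj'[of w g p] by simp
  have "(g ** Hm p q ** adj g) *v w = Hm (g *v p) (g *v q) *v w" for w
  proof -
    have "(g ** Hm p q ** adj g) *v w = g *v (Hm p q *v (adj g *v w))"
      by (simp add: matrix_vector_mul_assoc[symmetric])
    also have "\<dots> = Hm (g *v p) (g *v q) *v w"
      unfolding Hm_vec using assms by (simp add: 1 vec.diff vec.scale)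
    finally show ?thesis .
  qed
  then show ?thesis by (simp add: matrix_eq)
qed

lemma y2_Sp: "y2 \<in> Sp"
  unfolding y2_def by (rule Hm_Sp) (simp add: om_basis)

lemma Hm_cls: assumes "om p q = 1" shows "Hm p q \<in> cls y2"
proof -
  obtain g where g: "g \<in> Sp" "g *v ev 1 = p" "g *v fv 1 = q" using Sp_hyperbolic_pair[OF assms] .
  then show ?thesis using clsI[OF g(1), of y2] unfolding y2_def conj_Hm[OF g(1)] by simp
qed

lemma cls_y2: assumes "x \<in> cls y2" obtains p q where "om p q = 1" "x = Hm p q"
proof -
  obtain g where g: "g \<in> Sp" "x = g ** y2 ** adj g" using assms by (auto simp: cls_def)
  then show ?thesis
    using that[of "g *v ev 1" "g *v fv 1"] by (simp add: y2_def conj_Hm Sp_om om_basis)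
qed

text \<open>A vector \<open>a\<close> spanning together with \<open>x a\<close> a nondegenerate plane on which \<open>x\<close> has trace \<open>5/2\<close>,
  while \<open>x\<close> is trivial on the orthogonal complement, witnesses membership in the class.\<close>

lemma cls_y2_criterion:
  assumes x: "x \<in> Sp" and nz: "om a (x *v a) \<noteq> 0" and char: "x *v (x *v a) = (5 / 2) *s (x *v a) - a"
    and fx: "\<And>w. om a w = 0 \<Longrightarrow> om (x *v a) w = 0 \<Longrightarrow> x *v w = w"
  shows "x \<in> cls y2"
proof -
  define b where "b = x *v a"
  define m where "m = om a b"
  have m: "m \<noteq> 0" using nz by (simp add: m_def b_def)
  have ba: "om b a = - m" unfolding m_def by (rule om_skew)
  define p where "p = b - 2 *s a"
  define q where "q = (- 2 / (3 * m)) *s (b - (1 / 2) *s a)"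
  have xb: "x *v b = (5 / 2) *s b - a" using char by (simp add: b_def)
  have xp: "x *v p = (1 / 2) *s p"
    unfolding p_def vec.diff vec.scale xb b_def[symmetric] by (simp add: vec_eq_iff algebra_simps)
  have xq: "x *v q = 2 *s q"
    unfolding q_def vec.diff vec.scale xb b_def[symmetric] using m by (simp add: vec_eq_iff field_simps)
  have pq: "om p q = 1" unfolding p_def q_def using m by (simp add: om_simps ba m_def[symmetric] field_simps)
  have qp: "om q p = - 1" using pq om_skew[of q p] by simp
  have "x *v w = Hm p q *v w" for w
  proof -
    define w' where "w' = w + om w p *s q - om w q *s p"
    have w'p: "om w' p = 0" "om w' q = 0" unfolding w'_def by (simp_all add: om_simps pq qp)
    have ab: "a = (- 2 / 3) *s (p + (3 * m / 2) *s q)" "b = p + 2 *s a"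
      unfolding p_def q_def using m by (simp_all add: vec_eq_iff field_simps)
    have a: "om a w' = 0" using w'p om_skew[of _ w'] unfolding ab(1) by (simp add: om_simps)
    have b: "om b w' = 0" using w'p a om_skew[of p w'] unfolding ab(2) by (simp add: om_simps)
    have "x *v w' = w'" using fx[OF a] b by (simp add: b_def)
    then have "x *v w + om w p *s (2 *s q) - om w q *s ((1 / 2) *s p) = w + om w p *s q - om w q *s p"
      unfolding w'_def by (simp add: vec.diff vec.add vec.scale xp xq)
    then show ?thesis unfolding Hm_vec by (simp add: vec_eq_iff algebra_simps)
  qed
  then have "x = Hm p q" by (simp add: matrix_eq)
  then show ?thesis using Hm_cls[OF pq] by simp
qed

lemma R_self: "R k v v *v w = w + (2 * k * om w v) *s v"
  by (simp add: R_vec vec_eq_iff algebra_simps)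

lemma two_transvections:
  assumes "4 * k * (om z v)\<^sup>2 = - 1"
  shows "R (1 / 2) v v ** R k z z \<in> cls y2"
proof -
  define c where "c = om z v"
  define x where "x = R (1 / 2) v v ** R k z z"
  have c: "c \<noteq> 0" and kc: "4 * k * c\<^sup>2 = - 1" using assms unfolding c_def by auto
  have vz: "om v z = - c" unfolding c_def by (rule om_skew)
  have xw: "x *v w = R (1 / 2) v v *v (R k z z *v w)" for w by (simp add: x_def matrix_vector_mul_assoc[symmetric])
  have xz: "x *v z = z + c *s v" unfolding xw R_self by (simp add: om_simps c_def vec_eq_iff)
  have kcc: "k * c * c = - 1 / 4" using kc by (simp add: power2_eq_square field_simps)
  show ?thesis
    unfolding x_def[symmetric]
  proof (rule cls_y2_criterion[of _ z])
    show "x \<in> Sp" unfolding x_def by (intro mult_Sp R_Sp) simp_all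
    show "om z (x *v z) \<noteq> 0" unfolding xz using c by (simp add: om_simps c_def[symmetric])
    have "x *v v = v - (2 * k * c) *s z - (2 * (k * c * c)) *s v"
      unfolding xw R_self by (simp add: om_simps vz c_def[symmetric] vec_eq_iff algebra_simps)
    then have xv: "x *v v = (3 / 2) *s v - (2 * k * c) *s z" unfolding kcc by (simp add: vec_eq_iff algebra_simps)
    have "x *v (x *v z) = (1 - 2 * (k * c * c)) *s z + (c + c * (3 / 2)) *s v"
      unfolding xz vec.add vec.scale xv by (simp add: vec_eq_iff algebra_simps)
    then show "x *v (x *v z) = (5 / 2) *s (x *v z) - z"
      unfolding xz kcc by (simp add: vec_eq_iff algebra_simps)
    fix w assume "om z w = 0" "om (x *v z) w = 0"
    then have "om z w = 0" "om v w = 0" using c unfolding xz by (simp_all add: om_simps)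
    then show "x *v w = w" using om_skew[of w z] om_skew[of w v] unfolding xw R_self by (simp add: om_simps)
  qed
qed

lemma Hm_Bm: assumes "om p z = 1" "p \<in> Fl h" "z \<in> Fl (7 - h)" "h \<le> 6" shows "Hm p z \<in> Bm"
proof -
  have 1: "om (axis j 1) p * z $ i = 0" if "p \<in> Fl a" "z \<in> Fl b" "a + b \<le> 7" "lv j < lv i"
    for i j p z a b
    using that lv_bounds[of j] by (cases "b < lv i") (auto simp: om_axis_left Fl_def lv_flip)
  have "Hm p z $ i $ j = 0" if "lv j < lv i" for i j
    using 1[of p h z "7 - h" j i] 1[of z "7 - h" p h j i] assms that by (auto simp: Hm_def)
  then show ?thesis using Hm_Sp[OF assms(1)] by (simp add: Bm_def)
qed

definition pv :: "complex point \<Rightarrow> cvec" where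
  "pv z = (\<chi> i. case i of Inl k \<Rightarrow> if k = 1 then 1 else if k = 2 then z 0 else z 1
     | Inr k \<Rightarrow> if k = 1 then z 2 else if k = 2 then z 3 else z 4)"

definition qv :: "complex point \<Rightarrow> cvec" where
  "qv z = (\<chi> i. case i of Inl k \<Rightarrow> if k = 1 then z 5 else if k = 2 then z 6 else z 7
     | Inr k \<Rightarrow> if k = 1 then 1 - z 0 * z 8 - z 1 * z 9 + z 2 * z 5 + z 3 * z 6 + z 4 * z 7
       else if k = 2 then z 8 else z 9)"

lemma mat_vec: "mat c *v w = c *s (w :: cvec)"
  by (simp add: vec_eq_iff matrix_vector_mult_def mat_def if_distrib[of "\<lambda>x. x * _"] cong: if_cong)

lemma cdim_y2: "cdim y2 \<le> enat 10"
  unfolding cdim_def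
proof (rule var_dim_le_chart[where \<psi> = "\<lambda>z. enc (Hm (pv z) (qv z))" and ?x0.0 = "enc y2"
    and g = "\<lambda>x. ((dec x - mat 2) ** (dec x - mat 1)) $ Inl 1 $ Inl 1"])
  have g: "((Hm p q - mat 2) ** (Hm p q - mat 1)) $ Inl 1 $ Inl 1 = 3 / 4 * (q $ Inr 1 * p $ Inl 1)"
    if "om p q = 1" for p q
  proof -
    have "om q p = - 1" using that om_skew[of q p] by simp
    then have "((Hm p q - mat 2) ** (Hm p q - mat 1)) *v w = (3 / 4 * om w q) *s p" for w
      using that by (simp add: matrix_vector_mul_assoc[symmetric] Hm_vec matrix_vector_mult_diff_rdistrib
          mat_vec om_simps vec_eq_iff algebra_simps)
    then have "(((Hm p q - mat 2) ** (Hm p q - mat 1)) *v ev 1) $ Inl 1 = 3 / 4 * (om (ev 1) q * p $ Inl 1)"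
      by simp
    then show ?thesis by (simp only: mult_axis_nth) (simp add: om_axis_left)
  qed
  show "zar_irreducible 36 (enc ` cls y2)" by (rule irreducible_cls)
  show "(\<lambda>z. enc (Hm (pv z) (qv z)) i) \<in> pf (coords 10)" if "i < 36" for i
  proof (rule mp_enc[OF _ that])
    have c: "(\<lambda>z. pv z $ j) \<in> pf (coords 10)" "(\<lambda>z. qv z $ j) \<in> pf (coords 10)" for j
      unfolding pv_def qv_def
      by (cases j; rename_tac k; rule_tac i = k in index3_cases; simp add: pf_add pf_diff pf_mult pf_const pf_coord)+
    then show "mp (coords 10) (\<lambda>z. Hm (pv z) (qv z))"
      unfolding mp_def Hm_def om_axis_left vec_lambda_beta by (intro allI pf_diff pf_add pf_mult pf_const) simp_all
  qed
  show "(\<lambda>x. ((dec x - mat 2) ** (dec x - mat 1)) $ Inl 1 $ Inl 1) \<in> pf (coords 36)"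
    by (intro mp_intros)
  show "enc y2 \<in> enc ` cls y2" using cls_self by blast
  have "om (ev 1) (fv 1) = 1" by (simp add: om_basis)
  from g[OF this] have "((y2 - mat 2) ** (y2 - mat 1)) $ Inl 1 $ Inl 1 \<noteq> 0"
    unfolding y2_def by (simp only:) (simp add: axis_nth')
  then show "((dec (enc y2) - mat 2) ** (dec (enc y2) - mat 1)) $ Inl 1 $ Inl 1 \<noteq> 0"
    unfolding dec_enc .
  fix x assume "x \<in> enc ` cls y2" and nz: "((dec x - mat 2) ** (dec x - mat 1)) $ Inl 1 $ Inl 1 \<noteq> 0"
  then obtain y where "y \<in> cls y2" and xy: "x = enc y" by blast
  then obtain p q where pq: "om p q = 1" "y = Hm p q" using cls_y2 by metis
  have p1: "p $ Inl 1 \<noteq> 0" using nz unfolding xy dec_enc pq(2) g[OF pq(1)] by auto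
  define p' where "p' = (1 / p $ Inl 1) *s p"
  define q' where "q' = p $ Inl 1 *s q"
  have 1: "om p' q' = 1" using pq(1) p1 by (simp add: p'_def q'_def om_simps)
  have 2: "Hm p q = Hm p' q'"
    using p1 by (simp add: matrix_eq Hm_vec p'_def q'_def om_simps vec_eq_iff)
  define z where "z = (\<lambda>n. [p' $ Inl 2, p' $ Inl 3, p' $ Inr 1, p' $ Inr 2, p' $ Inr 3,
    q' $ Inl 1, q' $ Inl 2, q' $ Inl 3, q' $ Inr 2, q' $ Inr 3] ! n)"
  have p: "pv z = p'" using p1 by (simp add: vec_eq_iff forall_33 forall_3 pv_def z_def) (simp add: p'_def)
  have "q' $ Inr 1 = 1 - p' $ Inl 2 * q' $ Inr 2 - p' $ Inl 3 * q' $ Inr 3 + p' $ Inr 1 * q' $ Inl 1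
    + p' $ Inr 2 * q' $ Inl 2 + p' $ Inr 3 * q' $ Inl 3"
  proof -
    have "p' $ Inl 1 = 1" using p1 by (simp add: p'_def)
    then show ?thesis using 1 unfolding om_eq sum_3 by (simp add: algebra_simps)
  qed
  then have q: "qv z = q'" by (simp add: vec_eq_iff forall_33 forall_3 qv_def z_def)
  have "x = enc (Hm (pv z) (qv z))" unfolding p q xy pq(2) 2 ..
  then show "\<exists>z. x = enc (Hm (pv z) (qv z))" by blast
qed

subsection \<open>The unipotent class\<close>

definition yu :: cmat where "yu = R (1 / 2) (fv 1) (fv 1) ** R (1 / 2) (fv 2) (fv 2)"

lemma yu_Sp: "yu \<in> Sp"
  unfolding yu_def by (intro mult_Sp R_Sp) simp_all

lemma transvection_pair: assumes "om u v = 0"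
  shows "(R (1 / 2) u u ** R (1 / 2) v v) *v w = w + om w u *s u + om w v *s v"
proof -
  have "om v u = 0" using assms om_skew[of v u] by simp
  then show ?thesis by (simp add: matrix_vector_mul_assoc[symmetric] R_self om_simps vec_eq_iff algebra_simps)
qed

lemma transvection_pair_null: assumes "om u v = 0"
  shows "R (1 / 2) u u ** R (1 / 2) v v = R (1 / 2) (u + \<i> *s v) (u - \<i> *s v)"
  using i_squared by (simp add: matrix_eq transvection_pair[OF assms] R_vec om_simps vec_eq_iff algebra_simps)

lemma yu_cls:
  assumes "om u v = 0" "u \<noteq> 0" "\<And>c. v \<noteq> c *s u"
  shows "R (1 / 2) u u ** R (1 / 2) v v \<in> cls yu"
proof -
  obtain g where g: "g \<in> Sp" "g *v ev 1 = u" "g *v ev 2 = v" using Sp_orthogonal_pair[OF assms] .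
  have n: "fv 2 \<noteq> c *s fv (1 :: 3)" for c
  proof
    assume "fv 2 = c *s fv (1 :: 3)"
    then have "(fv 2 :: cvec) $ Inr 2 = (c *s fv 1) $ Inr 2" by simp
    then show False by (simp add: axis_nth')
  qed
  obtain h where h: "h \<in> Sp" "h *v ev 1 = fv 1" "h *v ev 2 = fv 2"
    by (rule Sp_orthogonal_pair[of "fv 1" "fv 2"]) (auto simp: om_basis n)
  define k where "k = g ** adj h"
  have k: "k \<in> Sp" using g h by (simp add: k_def mult_Sp adj_Sp)
  have "k *v fv 1 = u" "k *v fv 2 = v"
    using g h Sp_adj_vec(1)[OF h(1), of "ev 1"] Sp_adj_vec(1)[OF h(1), of "ev 2"]
    by (simp_all add: k_def matrix_vector_mul_assoc[symmetric])
  moreover have "k ** yu ** adj k = (k ** R (1 / 2) (fv 1) (fv 1) ** adj k) ** (k ** R (1 / 2) (fv 2) (fv 2) ** adj k)"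
    using k by (simp add: yu_def matrix_mul_assoc[symmetric])
  ultimately have "k ** yu ** adj k = R (1 / 2) u u ** R (1 / 2) v v" by (simp add: conj_R[OF k])
  then show ?thesis using clsI[OF k, of yu] by simp
qed

lemma cls_yu:
  assumes "x \<in> cls yu"
  shows "\<exists>p q. om p q = 0 \<and> p \<noteq> 0 \<and> (\<forall>c. q \<noteq> c *s p) \<and> x = R (1 / 2) p q"
proof -
  obtain g where g: "g \<in> Sp" "x = g ** yu ** adj g" using assms by (auto simp: cls_def)
  define p where "p = fv 1 + \<i> *s fv (2 :: 3)"
  define q where "q = fv 1 - \<i> *s fv (2 :: 3)"
  have yu: "yu = R (1 / 2) p q"
    unfolding yu_def p_def q_def by (rule transvection_pair_null) (simp add: om_basis)
  have pq: "om p q = 0" by (simp add: p_def q_def om_simps om_basis)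
  have c: "q \<noteq> c *s p" for c
  proof
    assume "q = c *s p"
    then have "q $ Inr 1 = (c *s p) $ Inr 1" "q $ Inr 2 = (c *s p) $ Inr 2" by simp_all
    then show False by (simp add: p_def q_def axis_nth')
  qed
  have "p $ Inr 1 = 1" by (simp add: p_def axis_nth')
  then have p0: "p \<noteq> 0" by (metis zero_index zero_neq_one)
  have 1: "om (g *v p) (g *v q) = 0" using g pq by (simp add: Sp_om)
  have 2: "g *v p \<noteq> 0" using p0 g(1) by (rule Sp_nonzero[rotated])
  have 3: "g *v q \<noteq> c *s (g *v p)" for c
  proof
    assume "g *v q = c *s (g *v p)"
    then have "g *v q = g *v (c *s p)" by (simp add: vec.scale)
    then show False using Sp_inj[OF g(1)] c by blast
  qed
  have 4: "x = R (1 / 2) (g *v p) (g *v q)" unfolding g(2) yu by (rule conj_R[OF g(1)])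
  show ?thesis
    by (rule exI[of _ "g *v p"], rule exI[of _ "g *v q"]) (intro conjI allI 1 2 3 4)
qed

definition Qf :: "3 + 3 \<Rightarrow> 3 + 3 \<Rightarrow> cmat \<Rightarrow> complex" where
  "Qf i k x = sg (flip k) * ((x - mat 1) $ i $ flip k)"

lemma Qf_pair: assumes "om u v = 0"
  shows "Qf i k (R (1 / 2) u u ** R (1 / 2) v v) = u $ i * u $ k + v $ i * v $ k"
proof -
  define x where "x = R (1 / 2) u u ** R (1 / 2) v v"
  have sq: "sg (flip k) * (sg (flip k) * t) = t" for t by (cases k) auto
  have "(x - mat 1) *v axis (flip k) 1 = om (axis (flip k) 1) u *s u + om (axis (flip k) 1) v *s v"
    using transvection_pair[OF assms, of "axis (flip k) 1"] unfolding x_def[symmetric]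
    by (simp add: matrix_vector_mult_diff_rdistrib)
  then have "((x - mat 1) *v axis (flip k) 1) $ i = (om (axis (flip k) 1) u *s u + om (axis (flip k) 1) v *s v) $ i"
    by (rule arg_cong)
  then have "(x - mat 1) $ i $ flip k = sg (flip k) * u $ k * u $ i + sg (flip k) * v $ k * v $ i"
    unfolding mult_axis_nth by (simp add: om_axis_left)
  then show ?thesis unfolding x_def[symmetric] Qf_def by (simp add: ring_distribs mult.assoc sq)
qed

definition Qidx :: "((3 + 3) \<times> (3 + 3)) list" where
  "Qidx = [(Inl 1, Inl 1), (Inl 1, Inl 2), (Inl 2, Inl 2), (Inl 1, Inl 3), (Inl 1, Inr 3), (Inl 1, Inr 1),
     (Inl 1, Inr 2), (Inl 2, Inl 3), (Inl 2, Inr 3), (Inl 2, Inr 2)]"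

lemma all_less_10: "(\<forall>i<10. P i) \<longleftrightarrow> P 0 \<and> P 1 \<and> P 2 \<and> P 3 \<and> P 4 \<and> P 5 \<and> P 6 \<and> P 7 \<and> P 8 \<and> P (9 :: nat)"
proof -
  have "i < 10 \<longleftrightarrow> i = 0 \<or> i = 1 \<or> i = 2 \<or> i = 3 \<or> i = 4 \<or> i = 5 \<or> i = 6 \<or> i = 7 \<or> i = 8 \<or> i = 9" for i :: nat
    by presburger
  then show ?thesis by (simp only: imp_disjL imp_conjL all_conj_distrib simp_thms HOL.simp_thms(41))
qed

lemma yu_coords:
  assumes z: "z 0 \<noteq> 0" "z 2 \<noteq> (z 1)\<^sup>2 / z 0"
  shows "\<exists>x\<in>cls yu. \<forall>i<10. Qf (fst (Qidx ! i)) (snd (Qidx ! i)) x = z i"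
proof -
  define a where "a = csqrt (z 0)"
  have a: "a \<noteq> 0" "a * a = z 0" using z(1) by (simp_all add: a_def power2_eq_square[symmetric])
  define b where "b = csqrt (z 2 - (z 1 / a)\<^sup>2)"
  have "(z 1 / a)\<^sup>2 = (z 1)\<^sup>2 / z 0" by (simp add: power_divide power2_eq_square[of a] a)
  then have b: "b \<noteq> 0" "b * b = z 2 - (z 1 / a) * (z 1 / a)"
    using z(2) by (simp_all add: b_def power2_eq_square[symmetric])
  define u :: cvec where "u = (\<chi> i. case i of Inl k \<Rightarrow> if k = 1 then a else if k = 2 then z 1 / a else z 3 / a
     | Inr k \<Rightarrow> if k = 1 then z 5 / a else if k = 2 then z 6 / a else z 4 / a)"
  have u: "u $ Inl 1 = a" "u $ Inl 2 = z 1 / a" "u $ Inl 3 = z 3 / a"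
    "u $ Inr 1 = z 5 / a" "u $ Inr 2 = z 6 / a" "u $ Inr 3 = z 4 / a" by (simp_all add: u_def)
  define v2 where "v2 = (z 9 - z 1 / a * (z 6 / a)) / b"
  define v3 where "v3 = (z 8 - z 1 / a * (z 4 / a)) / b"
  define l3 where "l3 = (z 7 - z 1 / a * (z 3 / a)) / b"
  define v :: cvec where "v = (\<chi> i. case i of Inl k \<Rightarrow> if k = 1 then 0 else if k = 2 then b else l3
     | Inr k \<Rightarrow> if k = 1 then - (z 1 / a * v2 + z 3 / a * v3 - z 6 / a * b - z 4 / a * l3) / a
       else if k = 2 then v2 else v3)"
  have v: "v $ Inl 1 = 0" "v $ Inl 2 = b" "v $ Inl 3 = l3"
    "v $ Inr 1 = - (z 1 / a * v2 + z 3 / a * v3 - z 6 / a * b - z 4 / a * l3) / a"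
    "v $ Inr 2 = v2" "v $ Inr 3 = v3" by (simp_all add: v_def)
  have b': "b * v2 = z 9 - z 1 / a * (z 6 / a)" "b * v3 = z 8 - z 1 / a * (z 4 / a)"
    "b * l3 = z 7 - z 1 / a * (z 3 / a)" using b(1) by (simp_all add: v2_def v3_def l3_def)
  have uv: "om u v = 0" unfolding om_eq sum_3 u v using a(1) by (simp add: field_simps)
  have "u \<noteq> 0" using u(1) a(1) by (metis zero_index)
  moreover have "v \<noteq> c *s u" for c
  proof
    assume "v = c *s u"
    then have "v $ Inl 1 = c * u $ Inl 1" "v $ Inl 2 = c * u $ Inl 2" by simp_all
    then show False using a(1) b(1) unfolding u v by simp
  qed
  ultimately have "R (1 / 2) u u ** R (1 / 2) v v \<in> cls yu" by (rule yu_cls[OF uv])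
  moreover have "\<forall>i<10. Qf (fst (Qidx ! i)) (snd (Qidx ! i)) (R (1 / 2) u u ** R (1 / 2) v v) = z i"
    unfolding all_less_10 Qf_pair[OF uv] Qidx_def using a(1) by (simp add: u v a(2) b(2) b')
  ultimately show ?thesis by blast
qed

lemma cdim_yu: "enat 10 \<le> cdim yu"
  unfolding cdim_def
proof (rule var_dim_ge_thick[where f = "\<lambda>i x. Qf (fst (Qidx ! i)) (snd (Qidx ! i)) (dec x)"])
  show "(\<lambda>x. Qf (fst (Qidx ! i)) (snd (Qidx ! i)) (dec x)) \<in> pf (coords 36)" for i
    unfolding Qf_def by (intro pf_mult pf_const mp_intros)
  let ?S = "(\<lambda>x. \<lambda>i\<in>{..<10}. Qf (fst (Qidx ! i)) (snd (Qidx ! i)) (dec x)) ` enc ` cls yu"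
  have mem: "z \<in> ?S" if z: "z 0 \<noteq> 0" "z 2 \<noteq> (z 1)\<^sup>2 / z 0" "\<And>i. 10 \<le> i \<Longrightarrow> z i = undefined" for z
  proof -
    obtain x where x: "x \<in> cls yu" "\<forall>i<10. Qf (fst (Qidx ! i)) (snd (Qidx ! i)) x = z i"
      using yu_coords[OF z(1,2)] by blast
    have "z = (\<lambda>i\<in>{..<10}. Qf (fst (Qidx ! i)) (snd (Qidx ! i)) (dec (enc x)))"
      using x(2) z(3) by (intro ext) (simp add: restrict_def)
    then show ?thesis using x(1) by blast
  qed
  have "thick (Suc (Suc 0)) (Suc 7) ?S ((\<lambda>_. undefined)(0 := a0, Suc 0 := a1))" if a0: "a0 \<notin> {0}" for a0 a1
  proof (rule thickI[of "{a1\<^sup>2 / a0}"])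
    fix a2 assume a2: "a2 \<notin> {a1\<^sup>2 / a0}"
    let ?y = "(\<lambda>_. undefined)(0 := a0, Suc 0 := a1, Suc (Suc 0) := a2)"
    show "thick (Suc (Suc (Suc 0))) 7 ?S ?y"
    proof (rule thick_all)
      fix z assume z: "\<And>i. i < Suc (Suc (Suc 0)) \<Longrightarrow> z i = ?y i" "\<And>i. Suc (Suc (Suc 0)) + 7 \<le> i \<Longrightarrow> z i = ?y i"
      show "z \<in> ?S"
        using z(1)[of 0] z(1)[of 1] z(1)[of 2] z(2) a0 a2 by (intro mem) auto
    qed
  qed simp
  note t = this
  have "thick 0 (Suc (Suc (Suc 7))) ?S (\<lambda>_. undefined)"
    by (rule thickI[of "{0}"], simp, rule thickI[of "{}"], simp, rule t, assumption)
  moreover have "Suc (Suc (Suc 7)) = 10" by simp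
  ultimately show "thick 0 10 ?S (\<lambda>_. undefined)" by metis
qed

subsection \<open>Double cosets met by the two classes\<close>

lemma level: assumes "v \<noteq> 0" obtains j where "v $ j \<noteq> 0" "v \<in> Fl (lv j)"
proof -
  define M where "M = lv ` {j. v $ j \<noteq> 0}"
  have M: "finite M" "M \<noteq> {}" using assms by (auto simp: M_def vec_eq_iff)
  from Max_in[OF M] obtain j where j: "v $ j \<noteq> 0" "lv j = Max M" by (subst (asm) (2) M_def) auto
  have "v \<in> Fl (lv j)"
    unfolding Fl_def
  proof (intro CollectI allI impI, rule ccontr)
    fix i assume i: "lv j < lv i" "v $ i \<noteq> 0"
    then have "lv i \<le> Max M" using M by (intro Max_ge) (auto simp: M_def)
    then show False using i j by simp
  qed
  then show ?thesis using j that by blast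
qed

lemma om_dual: "om (axis (flip j) 1) v = 0 \<longleftrightarrow> v $ j = 0" "om v (axis (flip j) 1) = 0 \<longleftrightarrow> v $ j = 0"
  by (cases j; simp add: om_axis_left om_axis_right)+

definition meets :: "cmat \<Rightarrow> bool" where
  "meets y \<longleftrightarrow> (\<exists>b\<in>Bm. \<exists>c\<in>Bm. b ** y ** c \<in> cls y2)"

lemma meets_Bm: assumes "y \<in> Bm" shows "meets y"
proof -
  have "y2 \<in> Bm" unfolding y2_def by (rule Hm_Bm[of _ _ 1]) (simp_all add: om_basis lv_values)
  then have "y2 ** adj y \<in> Bm" using assms by (intro mult_Bm adj_Bm)
  moreover have "y2 ** adj y ** y ** mat 1 = y2"
    using Bm_Sp[OF assms] by (simp add: matrix_mul_assoc[symmetric] Sp_adj_left)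
  ultimately show ?thesis unfolding meets_def using cls_self one_Bm by metis
qed

lemma meets_low_high:
  assumes uv: "om u v = 0" and u: "u \<in> Fl 3" and v: "v $ j \<noteq> 0" "4 \<le> lv j"
  shows "meets (R (1 / 2) u u ** R (1 / 2) v v)"
proof -
  define z :: cvec where "z = axis (flip j) 1"
  define k where "k = - 1 / (4 * (om z v)\<^sup>2)"
  have zv: "om z v \<noteq> 0" using v(1) unfolding z_def by (simp add: om_dual)
  then have "4 * k * (om z v)\<^sup>2 = - 1" by (simp add: k_def)
  then have m: "R (1 / 2) v v ** R k z z \<in> cls y2" by (rule two_transvections)
  have tu: "R (1 / 2) u u \<in> Bm" using u by (intro R_Bm[of _ _ 3 3]) auto
  have "z \<in> Fl (7 - lv j)" by (simp add: z_def lv_flip)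
  then have tz: "R k z z \<in> Bm" using v(2) by (intro R_Bm[of _ _ "7 - lv j" "7 - lv j"]) auto
  have "adj (R (1 / 2) u u) ** (R (1 / 2) u u ** R (1 / 2) v v) ** R k z z = R (1 / 2) v v ** R k z z"
    using Bm_Sp[OF tu] by (simp add: matrix_mul_assoc Sp_adj_left)
  then show ?thesis unfolding meets_def using m adj_Bm[OF tu] tz by metis
qed

text \<open>Here conjugating the factor \<open>R (1 / 2) v v\<close> by a root element of the Borel subgroup does not
  change the double coset, since the root element commutes with \<open>R (1 / 2) u u\<close> up to the Borel
  subgroup, but it makes the scalar product of \<open>u\<close> and \<open>v\<close> arbitrary.\<close>

lemma meets_high_high:
  assumes uv: "om u v = 0" and u: "u $ i \<noteq> 0" "u \<in> Fl (lv i)" and v: "v $ j \<noteq> 0"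
    and ij: "4 \<le> lv i" "lv i < lv j"
  shows "meets (R (1 / 2) u u ** R (1 / 2) v v)"
proof -
  define z :: cvec where "z = axis (flip j) 1"
  define z' :: cvec where "z' = axis (flip i) 1"
  have "u $ j = 0" using u(2) ij by (simp add: Fl_def)
  then have zu: "om z u = 0" unfolding z_def by (simp add: om_dual)
  have uz: "om u z = 0" using zu om_skew[of u z] by simp
  have vz: "om v z \<noteq> 0" using v unfolding z_def by (simp add: om_dual)
  have uz': "om u z' \<noteq> 0" using u unfolding z'_def by (simp add: om_dual)
  have zF: "z \<in> Fl (7 - lv j)" "z' \<in> Fl (7 - lv i)" by (simp_all add: z_def z'_def lv_flip)
  have zz: "om z z' = 0" using zF ij by (intro om_Fl[of z "7 - lv j" z' "7 - lv i"]) auto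
  define \<kappa> where "\<kappa> = csqrt (- 1 / 2)"
  define k where "k = \<kappa> / (om v z * om u z')"
  define b where "b = R k z z'"
  define tu where "tu = R (1 / 2) u u"
  define tv where "tv = R (1 / 2) v v"
  define v' where "v' = b *v v"
  have tuS: "tu \<in> Sp" unfolding tu_def by (rule R_Sp) simp
  have b: "b \<in> Bm" unfolding b_def using zz zF ij by (intro R_Bm[of _ _ "7 - lv j" "7 - lv i"]) auto
  have bS: "b \<in> Sp" by (rule Bm_Sp[OF b])
  have tz: "tu *v z = z" unfolding tu_def R_vec by (simp add: zu)
  have tz': "tu *v z' \<in> Fl (lv i)"
    unfolding tu_def R_vec using u(2) Fl_mono[OF zF(2), of "lv i"] ij by (intro Fl_add Fl_scale) auto
  have "om z (tu *v z') = 0" using Sp_om[OF tuS, of z z'] tz zz by simp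
  then have "R k z (tu *v z') \<in> Bm"
    using zF(1) tz' ij lv_bounds[of j] by (intro R_Bm[of _ _ "7 - lv j" "lv i"]) auto
  then have c: "tu ** b ** adj tu \<in> Bm" unfolding b_def conj_R[OF tuS] tz .
  have v': "v' = v + (k * om v z) *s z' + (k * om v z') *s z" unfolding v'_def b_def R_vec ..
  have "om u v' = k * om v z * om u z'" unfolding v' by (simp add: om_simps uv uz)
  then have "om u v' = \<kappa>" using vz uz' by (simp add: k_def)
  then have "om v' u = - \<kappa>" using om_skew[of v' u] by simp
  moreover have "\<kappa>\<^sup>2 = - 1 / 2" unfolding \<kappa>_def by (rule power2_csqrt)
  ultimately have "4 * (1 / 2) * (om v' u)\<^sup>2 = - 1" by simp
  then have "tu ** R (1 / 2) v' v' \<in> cls y2" unfolding tu_def by (rule two_transvections)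
  moreover have "R (1 / 2) v' v' = b ** tv ** adj b" unfolding tv_def v'_def conj_R[OF bS] ..
  then have "tu ** R (1 / 2) v' v' = (tu ** b ** adj tu) ** (tu ** tv) ** adj b"
    using tuS by (simp add: matrix_mul_assoc[symmetric])
  ultimately show ?thesis unfolding meets_def tu_def[symmetric] tv_def[symmetric] using c adj_Bm[OF b] by metis
qed

text \<open>When the plane of \<open>y - 1\<close> is spanned by isotropic vectors \<open>p\<close> and \<open>q\<close> of different levels, a
  suitable \<open>Hm p z\<close> in the Borel subgroup is moved by \<open>y\<close> to another element of the same form.\<close>

lemma meets_isotropic:
  assumes pq: "om p q = 0" and p: "p $ i \<noteq> 0" "p \<in> Fl (lv i)" and q: "q $ j \<noteq> 0" and ij: "lv i < lv j"
  shows "meets (R (1 / 2) p q)"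
proof -
  define z1 :: cvec where "z1 = axis (flip i) 1"
  define z2 :: cvec where "z2 = axis (flip j) 1"
  have "p $ j = 0" using p(2) ij by (simp add: Fl_def)
  then have pz: "om p z2 = 0" "om p z1 \<noteq> 0" "om q z2 \<noteq> 0"
    using p q by (simp_all add: z1_def z2_def om_dual)
  define z where "z = (1 / om p z1) *s (z1 - (om q z1 / om q z2) *s z2)"
  have pz1: "om p z = 1" and qz: "om q z = 0" using pz by (simp_all add: z_def om_simps)
  have zp: "om z p = - 1" "om z q = 0" using pz1 qz om_skew[of z p] om_skew[of z q] by simp_all
  have qp: "om q p = 0" using pq om_skew[of q p] by simp
  have "z1 \<in> Fl (7 - lv i)" "z2 \<in> Fl (7 - lv i)" using ij by (simp_all add: z1_def z2_def lv_flip)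
  then have "z \<in> Fl (7 - lv i)" unfolding z_def by (intro Fl_scale Fl_diff)
  then have h: "Hm p z \<in> Bm" using pz1 p lv_bounds[of i] by (intro Hm_Bm[of _ _ "lv i"]) auto
  have "R (1 / 2) p q ** Hm p z = Hm p (z - q)"
    unfolding matrix_eq matrix_vector_mul_assoc[symmetric] Hm_vec R_vec
    by (simp add: om_simps pq qp zp vec_eq_iff algebra_simps)
  moreover have "om p (z - q) = 1" by (simp add: om_simps pz1 pq)
  ultimately have "mat 1 ** R (1 / 2) p q ** Hm p z \<in> cls y2" using Hm_cls by simp
  then show ?thesis unfolding meets_def using h one_Bm by blast
qed

lemma R_commute: "R k p q = R k q p"
  by (simp add: matrix_eq R_vec add_ac)

lemma cls_yu_meets: assumes "y \<in> cls yu" shows "meets y"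
proof -
  obtain p q where pq: "om p q = 0" "p \<noteq> 0" "\<forall>c. q \<noteq> c *s p" "y = R (1 / 2) p q"
    using cls_yu[OF assms] by (elim exE conjE)
  have "q \<noteq> 0" using spec[OF pq(3), of 0] by simp
  obtain i where i: "p $ i \<noteq> 0" "p \<in> Fl (lv i)" using level[OF pq(2)] .
  obtain j where j: "q $ j \<noteq> 0" "q \<in> Fl (lv j)" using level[OF \<open>q \<noteq> 0\<close>] .
  consider "lv i < lv j" | "lv j < lv i" | "lv i = lv j" by linarith
  then show ?thesis
  proof cases
    case 1 then show ?thesis unfolding pq(4) using meets_isotropic[OF pq(1) i j(1)] by simp
  next
    case 2
    have "om q p = 0" using pq(1) om_skew[of q p] by simp
    then show ?thesis unfolding pq(4) R_commute[of _ p] using meets_isotropic[OF _ j i(1) 2] by simp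
  next
    case 3
    then have ij: "i = j" by (rule lv_inj)
    define a where "a = csqrt (- (q $ j / (4 * p $ j)))"
    define b where "b = 1 / (4 * a)"
    have a: "a \<noteq> 0" "a * a = - (q $ j / (4 * p $ j))"
      using i j unfolding ij by (simp_all add: a_def power2_eq_square[symmetric])
    define u where "u = a *s p + b *s q"
    define v where "v = \<i> *s (a *s p - b *s q)"
    have ab: "a * b = 1 / 4" using a by (simp add: b_def)
    have "a * (u $ j) = a * a * p $ j + a * b * q $ j" by (simp add: u_def algebra_simps)
    also have "\<dots> = 0" unfolding a(2) ab using i ij by simp
    finally have uj: "u $ j = 0" using a(1) by simp
    have "v $ j = 2 * \<i> * a * p $ j - \<i> * u $ j" by (simp add: u_def v_def algebra_simps)
    then have vj: "v $ j \<noteq> 0" using uj a i ij by simp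
    have qp: "om q p = 0" using pq(1) om_skew[of q p] by simp
    have uv: "om u v = 0" by (simp add: u_def v_def om_simps pq(1) qp)
    have "y = R (1 / 2) u u ** R (1 / 2) v v"
    proof -
      have "om w u *s u + om w v *s v = (1 / 2 * om w p) *s q + (1 / 2 * om w q) *s p" for w
      proof -
        have "om w u *s u + om w v *s v = (2 * (a * b) * om w p) *s q + (2 * (a * b) * om w q) *s p"
          using i_squared by (simp add: u_def v_def om_simps vec_eq_iff algebra_simps)
        then show ?thesis unfolding ab by simp
      qed
      then show ?thesis
        unfolding pq(4) by (simp add: matrix_eq R_vec transvection_pair[OF uv] add.assoc)
    qed
    moreover have uF: "u \<in> Fl (lv j)" unfolding u_def using i j ij by (intro Fl_add Fl_scale) auto
    moreover have vF: "v \<in> Fl (lv j)" unfolding v_def using i j ij by (intro Fl_diff Fl_scale) auto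
    have "meets (R (1 / 2) u u ** R (1 / 2) v v)"
    proof (cases "lv j \<le> 3")
      case True
      then have "u \<in> Fl 3" "v \<in> Fl 3" using uF vF Fl_mono by blast+
      then show ?thesis by (intro meets_Bm mult_Bm R_Bm[of _ _ 3 3]) auto
    next
      case False
      then have j4: "4 \<le> lv j" by simp
      have "u \<noteq> 0"
      proof
        assume "u = 0"
        then have "b *s q = b *s ((- (a / b)) *s p)"
          using a by (simp add: u_def b_def vec_eq_iff add_eq_0_iff)
        then have "q = (- (a / b)) *s p" using a by (simp add: b_def vec_eq_iff field_simps)
        then show False using pq(3) by blast
      qed
      then obtain h where h: "u $ h \<noteq> 0" "u \<in> Fl (lv h)" by (rule level)
      have hj: "lv h < lv j"
      proof (rule ccontr)
        assume "\<not> lv h < lv j"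
        then have "lv j < lv h \<or> h = j" using lv_inj[of h j] by linarith
        then show False using h(1) uF uj by (auto simp: Fl_def)
      qed
      show ?thesis
      proof (cases "lv h \<le> 3")
        case True
        then show ?thesis using meets_low_high[OF uv Fl_mono[OF h(2)] vj j4] by simp
      next
        case False
        then show ?thesis using meets_high_high[OF uv h vj _ hj] by simp
      qed
    qed
    ultimately show ?thesis by simp
  qed
qed

lemma strata_yu_y2: assumes "Y \<in> strata CC 36 G" "enc yu \<in> Y" shows "enc y2 \<in> Y"
proof (rule strata_transfer[OF assms(1) yu_Sp assms(2) y2_Sp])
  show "cdim y2 \<le> cdim yu" using cdim_y2 cdim_yu by (rule order_trans)
  show "\<exists>b\<in>Bm. \<exists>c\<in>Bm. b ** y ** c \<in> cls y2" if "y \<in> cls yu" for y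
    using cls_yu_meets[OF that] by (simp add: meets_def)
qed

section \<open>Points in the closure of the stratum\<close>

subsection \<open>The unipotent class lies in the closure\<close>

lemma VV_cls: assumes "enc A \<in> VV" "C \<in> cls A" shows "enc C \<in> VV"
  using assms cls_Sp[of A] cls_eq[OF assms(2)] unfolding VV_iff' cdim_def by auto

definition crv :: "complex \<Rightarrow> cmat" where
  "crv z = R (1 / 2) (fv 1) (fv 1) ** R (1 / 2) (fv 2) (fv 2) ** R (z * (1 / 2)) (fv 3) (fv 3)"

lemma crv_1: "crv 1 = x1"
proof (rule mat_eqI_basis)
  have c: "crv 1 *v w = R (1 / 2) (fv 1) (fv 1) *v (R (1 / 2) (fv 2) (fv 2) *v (R (1 / 2) (fv 3) (fv 3) *v w))" for w
    by (simp add: crv_def matrix_vector_mul_assoc[symmetric])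
  have e: "x1 *v ev j = ev j + fv j" "x1 *v fv j = fv j" for j
    by (auto simp: vec_eq_iff forall_33 mult_axis_nth x1_def blk_nth mat_def axis_nth')
  show "crv 1 *v ev j = x1 *v ev j" for j
    unfolding c e by (rule index3_cases[of j]) (simp_all add: R_self om_simps om_basis)
  show "crv 1 *v fv j = x1 *v fv j" for j
    unfolding c e by (rule index3_cases[of j]) (simp_all add: R_self om_simps om_basis)
qed

lemma crv_cls: assumes "z \<noteq> 0" shows "crv z \<in> cls x1"
proof -
  define a where "a = csqrt z"
  have a: "a \<noteq> 0" "a * a = z" using assms by (simp_all add: a_def power2_eq_square[symmetric])
  define t where "t = tor (\<lambda>k. if k = 3 then inverse a else 1)"
  have t: "t \<in> Sp" unfolding t_def using a by (intro tor_Sp) simp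
  have tf: "t *v fv 1 = fv 1" "t *v fv 2 = fv 2" "t *v fv 3 = a *s fv 3"
    by (simp_all add: t_def tor_vec axis_scale[of _ a])
  have "t ** crv 1 ** adj t = (t ** R (1 / 2) (fv 1) (fv 1) ** adj t) ** (t ** R (1 / 2) (fv 2) (fv 2) ** adj t)
      ** (t ** R (1 / 2) (fv 3) (fv 3) ** adj t)"
    using t by (simp add: crv_def matrix_mul_assoc[symmetric])
  also have "\<dots> = crv z"
  proof -
    have "R (1 / 2) (a *s fv 3) (a *s fv 3) = R (z * (1 / 2)) (fv 3) (fv 3)"
      unfolding a(2)[symmetric] by (simp add: matrix_eq R_self om_simps vec_eq_iff mult_ac)
    then show ?thesis by (simp add: conj_R[OF t] tf crv_def)
  qed
  finally show ?thesis using clsI[OF t, of x1] by (simp add: crv_1)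
qed

lemma x1_VV: "enc x1 \<in> VV"
  unfolding VV_iff' using x1_Sp cdim_x1 cls_self x1_cell by blast

lemma yu_closure:
  assumes F: "F \<in> pf (coords 36)" and van: "\<And>s. s \<in> VV \<Longrightarrow> F s = 0" shows "F (enc yu) = 0"
proof (rule ccontr)
  assume nz: "F (enc yu) \<noteq> 0"
  have "crv 0 = yu" by (simp add: crv_def yu_def)
  moreover have "upoly (\<lambda>z. crv z $ i $ j)" for i j
    unfolding crv_def by (intro upoly_mult_matrix upoly_const upoly_R)
  then have "upoly (\<lambda>z. F (enc (crv z)))" by (intro upoly_coords_compose[OF F] upoly_enc)
  ultimately have "finite {z. F (enc (crv z)) = 0}" using nz by (intro upoly_finite_zeros[of _ 0]) simp_all
  moreover have "- {0} \<subseteq> {z. F (enc (crv z)) = 0}"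
    using van VV_cls[OF x1_VV crv_cls] by blast
  ultimately have "finite (- {0 :: complex})" by (rule finite_subset[rotated])
  then have "finite (UNIV :: complex set)" by (metis Compl_eq_Diff_UNIV finite.emptyI finite_Diff_insert Diff_empty)
  then show False using infinite_UNIV_char_0 by blast
qed

subsection \<open>Semiinvariants of the Borel subgroup\<close>

text \<open>On the intersection of a class of the stratum with the big cell, which contains a dense orbit of
  the Borel subgroup, two semiinvariants of the same weight are proportional, hence they are
  proportional on the whole class.\<close>

lemma VV_cell_rep: assumes "enc A \<in> VV" shows "\<exists>d\<in>Bm. w0 ** d \<in> cls A \<and> w0 ** d \<in> cell"
proof -
  obtain C where C: "C \<in> cls A" "C \<in> cell" using assms unfolding VV_iff' by blast
  obtain b c where bc: "b \<in> Bm" "c \<in> Bm" "C = b ** w0 ** c" using C(2) unfolding cell_def by blast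
  have bS: "b \<in> Sp" by (rule Bm_Sp[OF bc(1)])
  have "adj b ** C ** adj (adj b) = w0 ** (c ** b)"
    unfolding bc(3) using bS by (simp add: matrix_mul_assoc[symmetric])
  then have "w0 ** (c ** b) \<in> cls A" using cls_conj[OF C(1) adj_Sp[OF bS]] by simp
  moreover have "w0 ** (c ** b) \<in> cell"
    unfolding cell_def using mult_Bm[OF bc(2,1)] one_Bm
    by (intro CollectI exI[of _ "mat 1"] exI[of _ "c ** b"]) simp
  ultimately show ?thesis using mult_Bm[OF bc(2,1)] by blast
qed

lemma Bm_ev:
  assumes "b \<in> Bm"
  shows "b *v ev 1 = b $ Inl 1 $ Inl 1 *s ev 1"
    "b *v ev 2 = b $ Inl 1 $ Inl 2 *s ev 1 + b $ Inl 2 $ Inl 2 *s ev 2"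
proof -
  have "b $ i $ j = 0" if "lv j < lv i" for i j using assms that by (simp add: Bm_def)
  then show "b *v ev 1 = b $ Inl 1 $ Inl 1 *s ev 1"
    "b *v ev 2 = b $ Inl 1 $ Inl 2 *s ev 1 + b $ Inl 2 $ Inl 2 *s ev 2"
    by (simp_all add: vec_eq_iff forall_33 forall_3 mult_axis_nth axis_nth' lv_values)
qed

lemma conj_om:
  assumes "g \<in> Sp"
  shows "om u ((g ** x ** adj g) *v w) = om (adj g *v u) (x *v (adj g *v w))"
    "om u ((g ** x ** adj g) *v ((g ** x ** adj g) *v w)) = om (adj g *v u) (x *v (x *v (adj g *v w)))"
    "om u (adj (g ** x ** adj g) *v w) = om (adj g *v u) (adj x *v (adj g *v w))"
  using assms by (simp_all add: adj_product matrix_vector_mul_assoc[symmetric] om_adj'[of u g])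

lemma square_relation:
  assumes A: "enc A \<in> VV"
  shows "\<exists>c. \<forall>x\<in>cls A. \<forall>f. om f (x *v (x *v f)) = c * om f (x *v f)"
proof -
  obtain d where d: "d \<in> Bm" "w0 ** d \<in> cls A" "w0 ** d \<in> cell" using VV_cell_rep[OF A] by blast
  define C where "C = w0 ** d"
  have nz: "om (ev 1) (C *v ev 1) \<noteq> 0" unfolding C_def w0_upper[OF d(1)] using Bm_diag_nz[OF d(1)] by simp
  define c where "c = om (ev 1) (C *v (C *v ev 1)) / om (ev 1) (C *v ev 1)"
  define F where "F = (\<lambda>p. om (ev 1) (dec p *v (dec p *v ev 1)) - c * om (ev 1) (dec p *v ev 1))"
  have F: "F \<in> pf (coords 36)" unfolding F_def by (intro pf_diff pf_mult pf_const mp_intros)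
  have van: "F (enc y) = 0" if "y \<in> orb C" for y
  proof -
    obtain b where b: "b \<in> Bm" "y = b ** C ** adj b" using \<open>y \<in> orb C\<close> unfolding orb_def by blast
    show ?thesis
      unfolding F_def dec_enc b(2)
      unfolding conj_om(2)[OF Bm_Sp[OF b(1)]]
      unfolding conj_om(1)[OF Bm_Sp[OF b(1)]] Bm_ev[OF adj_Bm[OF b(1)]]
      using nz by (simp add: vec.scale om_simps c_def)
  qed
  have rel: "om (ev 1) (x *v (x *v ev 1)) = c * om (ev 1) (x *v ev 1)" if "x \<in> cls A" for x
    using orbit_dense[OF A d(2,3) F _ that] van unfolding C_def F_def by simp
  have "om f (x *v (x *v f)) = c * om f (x *v f)" if x: "x \<in> cls A" for x f
  proof (cases "f = 0")
    case False
    obtain g where g: "g \<in> Sp" "g *v ev 1 = f" using Sp_transitive[of "ev 1" f] False by auto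
    have gf: "adj g *v f = ev 1" unfolding g(2)[symmetric] using g(1) by simp
    define x' where "x' = adj g ** x ** adj (adj g)"
    have "x' \<in> cls A" unfolding x'_def by (rule cls_conj[OF x adj_Sp[OF g(1)]])
    from rel[OF this] show ?thesis
      unfolding x'_def
      unfolding conj_om(2)[OF adj_Sp[OF g(1)]]
      unfolding conj_om(1)[OF adj_Sp[OF g(1)]] unfolding adj_adj g(2) .
  qed (simp add: om_simps)
  then show ?thesis by blast
qed

lemma om_eq_zero': assumes "\<And>w. om w v = 0" shows "v = 0"
  by (rule om_eq_zero) (use assms om_skew[of v] in simp)

lemma square_relation_polarized:
  assumes "\<And>f. om f (x *v (x *v f)) = c * om f (x *v f)"
  shows "x *v (x *v w) - adj x *v (adj x *v w) = c *s (x *v w - adj x *v w)"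
proof -
  define M where "M = (\<lambda>w. x *v (x *v w) - c *s (x *v w))"
  have M0: "om f (M f) = 0" for f using assms[of f] by (simp add: M_def om_simps)
  have Madd: "M (f + h) = M f + M h" for f h by (simp add: M_def vec.add vec_eq_iff algebra_simps)
  define Z where "Z = adj x *v (adj x *v w) - c *s (adj x *v w)"
  have "om f (M w - Z) = 0" for f
  proof -
    have "om f (M w) + om w (M f) = 0"
      using M0[of "f + w"] M0[of f] M0[of w] unfolding Madd by (simp add: om_simps add.commute)
    moreover have "om w (M f) = om Z f" by (simp add: M_def Z_def om_simps om_adj'[of _ x])
    moreover have "om f Z = - om Z f" by (rule om_skew)
    ultimately show ?thesis by (simp add: om_diff_right)
  qed
  then have "M w - Z = 0" by (rule om_eq_zero')
  then show ?thesis by (simp add: M_def Z_def vec_eq_iff algebra_simps)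
qed

lemma plane_relation:
  assumes A: "enc A \<in> VV"
  shows "\<exists>c. \<forall>x\<in>cls A. \<forall>f g. om f g = 0 \<longrightarrow> (om f (x *v g) + om f (adj x *v g))\<^sup>2
    = c * (om f (x *v f) * om g (x *v g) - om f (x *v g) * om g (x *v f))"
proof -
  obtain d where d: "d \<in> Bm" "w0 ** d \<in> cls A" "w0 ** d \<in> cell" using VV_cell_rep[OF A] by blast
  define C where "C = w0 ** d"
  define \<eta> where "\<eta> = (\<lambda>x f g. om f (x *v g) + om f (adj x *v g))"
  define \<delta> where "\<delta> = (\<lambda>x f g. om f (x *v f) * om g (x *v g) - om f (x *v g) * om g (x *v f))"
  have \<eta>0: "\<eta> x f f = 0" for x f
    using om_adj'[of f x f] om_skew[of "adj x *v f" f] by (simp add: \<eta>_def)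
  have \<eta>c: "\<eta> x (a *s f) (p *s f + b *s g) = a * b * \<eta> x f g" for x a b p f g
    using \<eta>0[of x f] by (simp add: \<eta>_def om_simps vec.add vec.scale algebra_simps add_eq_0_iff2)
  have \<delta>c: "\<delta> x (a *s f) (p *s f + b *s g) = (a * b)\<^sup>2 * \<delta> x f g" for x a b p f g
    by (simp add: \<delta>_def om_simps vec.add vec.scale power2_eq_square algebra_simps)
  have conj: "\<eta> (g ** x ** adj g) u w = \<eta> x (adj g *v u) (adj g *v w)"
    "\<delta> (g ** x ** adj g) u w = \<delta> x (adj g *v u) (adj g *v w)" if "g \<in> Sp" for g x u w
    unfolding \<eta>_def \<delta>_def conj_om[OF that] by (rule refl)+
  have nz: "\<delta> C (ev 1) (ev 2) \<noteq> 0"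
    unfolding C_def \<delta>_def w0_upper[OF d(1)] using Bm_diag_nz[OF d(1)] by (simp add: lv_values)
  define c where "c = (\<eta> C (ev 1) (ev 2))\<^sup>2 / \<delta> C (ev 1) (ev 2)"
  define F where "F = (\<lambda>p. \<eta> (dec p) (ev 1) (ev 2) * \<eta> (dec p) (ev 1) (ev 2) - c * \<delta> (dec p) (ev 1) (ev 2))"
  have F: "F \<in> pf (coords 36)"
    unfolding F_def \<eta>_def \<delta>_def by (intro pf_diff pf_mult pf_const pf_add mp_intros)
  have van: "F (enc y) = 0" if "y \<in> orb C" for y
  proof -
    obtain b where b: "b \<in> Bm" "y = b ** C ** adj b" using \<open>y \<in> orb C\<close> unfolding orb_def by blast
    show ?thesis
      unfolding F_def dec_enc b(2) conj[OF Bm_Sp[OF b(1)]] Bm_ev[OF adj_Bm[OF b(1)]] \<eta>c \<delta>c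
      using nz by (simp add: c_def power2_eq_square)
  qed
  have rel: "(\<eta> x (ev 1) (ev 2))\<^sup>2 = c * \<delta> x (ev 1) (ev 2)" if "x \<in> cls A" for x
    using orbit_dense[OF A d(2,3) F _ that] van unfolding C_def F_def by (simp add: power2_eq_square)
  have "(\<eta> x f g)\<^sup>2 = c * \<delta> x f g" if x: "x \<in> cls A" and fg: "om f g = 0" for x f g
  proof (cases "f = 0 \<or> (\<exists>a. g = a *s f)")
    case True
    then show ?thesis
    proof
      assume "f = 0" then show ?thesis by (simp add: \<eta>_def \<delta>_def om_simps)
    next
      assume "\<exists>a. g = a *s f"
      then obtain a where "g = a *s f + 0 *s f" by auto
      then have "g = a *s f + 0 *s f" "f = 1 *s f" by simp_all
      then show ?thesis using \<eta>c[of x 1 f a 0 f] \<delta>c[of x 1 f a 0 f] by simp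
    qed
  next
    case False
    then have ne: "f \<noteq> 0" "\<And>a. g \<noteq> a *s f" by auto
    obtain h where h: "h \<in> Sp" "h *v ev 1 = f" "h *v ev 2 = g" using Sp_orthogonal_pair[OF fg ne] .
    define x' where "x' = adj h ** x ** adj (adj h)"
    have "x' \<in> cls A" unfolding x'_def by (rule cls_conj[OF x adj_Sp[OF h(1)]])
    from rel[OF this] show ?thesis
      unfolding x'_def unfolding conj[OF adj_Sp[OF h(1)]] unfolding adj_adj h(2,3) .
  qed
  then show ?thesis unfolding \<eta>_def \<delta>_def by blast
qed

lemma Fl3_nondegenerate:
  assumes d: "d \<in> Bm" and r: "r \<in> Fl 3" "r \<noteq> 0" shows "\<exists>g\<in>Fl 3. om g ((w0 ** d) *v r) \<noteq> 0"
proof -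
  obtain j where j: "r $ j \<noteq> 0" "r \<in> Fl (lv j)" using level[OF r(2)] .
  have j3: "lv j \<le> 3" using j(1) r(1) by (auto simp: Fl_def not_less[symmetric])
  then obtain i where i: "j = Inl i" unfolding lv_le_3 by blast
  have "om (ev i) ((w0 ** d) *v r) = om (adj w0 *v ev i) (d *v r)"
    by (simp add: matrix_vector_mul_assoc[symmetric] om_adj')
  also have "adj w0 *v ev i = - fv i"
    using w0_Sp Sp_adj_vec(1)[OF w0_Sp, of "- fv i"] by (simp add: w0_vec vec.neg)
  also have "om (- fv i) (d *v r) = (d *v r) $ j" by (simp add: om_simps om_axis_left i)
  also have "\<dots> = (\<Sum>k\<in>UNIV. if k = j then d $ j $ j * r $ j else 0)"
    unfolding matrix_vector_mult_def vec_lambda_beta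
  proof (intro sum.cong refl)
    fix k
    consider "k = j" | "lv k < lv j" | "lv j < lv k" using lv_inj[of j k] by force
    then show "d $ j $ k * r $ k = (if k = j then d $ j $ j * r $ j else 0)"
      using d j(2) by cases (auto simp: Bm_def Fl_def)
  qed
  also have "\<dots> = d $ j $ j * r $ j" by simp
  finally have "om (ev i) ((w0 ** d) *v r) \<noteq> 0" using j(1) Bm_diag_nz[OF d] by simp
  moreover have "ev i \<in> Fl 3" using j3 i by simp
  ultimately show ?thesis by blast
qed


subsection \<open>The trace relation\<close>

text \<open>The operator \<open>x + adj x\<close> is selfadjoint and commutes with \<open>x\<close>.\<close>

lemma scalar_trace:
  fixes x :: cmat and c c' :: complex and w :: cvec
  defines "D \<equiv> \<lambda>w. x *v w + adj x *v w"
  assumes x: "x \<in> Sp"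
    and sq: "\<And>f. om f (x *v (x *v f)) = c * om f (x *v f)"
    and pl: "\<And>f g. om f g = 0 \<Longrightarrow> (om f (x *v g) + om f (adj x *v g))\<^sup>2
      = c' * (om f (x *v f) * om g (x *v g) - om f (x *v g) * om g (x *v f))"
    and e1: "om (ev 1) (x *v ev 1) \<noteq> 0"
    and nd: "\<And>r. r \<in> Fl 3 \<Longrightarrow> r \<noteq> 0 \<Longrightarrow> \<exists>g\<in>Fl 3. om g (x *v r) \<noteq> 0"
    and c: "c \<noteq> 0" "c \<noteq> 2" "c \<noteq> - 2"
  shows "D w = c *s w"
proof (rule ccontr)
  assume w: "D w \<noteq> c *s w"
  note [simp] = Sp_adj_vec[OF x]
  have oI: "om (adj x *v u) v = om u (x *v v)" for u v by (simp add: om_adj')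
  have oX: "om (x *v u) v = om u (adj x *v v)" for u v by (rule om_adj)
  have oXX: "om (x *v u) (x *v v) = om u v" for u v by (rule Sp_om[OF x])
  have DD: "om (D u) v = om u (D v)" for u v by (simp add: D_def om_simps oI oX)
  have Dl: "D (u + v) = D u + D v" "D (u - v) = D u - D v" "D (k *s u) = k *s D u" for u v k
    by (simp_all add: D_def vec.add vec.diff vec.scale vec_eq_iff algebra_simps)
  have Dx: "D (x *v u) = x *v D u" for u by (simp add: D_def vec.add add.commute)
  define V where "V = (\<lambda>u. D u - c *s u)"
  have VV: "om (V u) v = om u (V v)" for u v by (simp add: V_def om_simps DD)
  have Vx: "V (x *v u) = x *v V u" for u by (simp add: V_def Dx vec.diff vec.scale)
  have Vl: "V (u + v) = V u + V v" "V (k *s u) = k *s V u" for u v k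
    by (simp_all add: V_def Dl vec_eq_iff algebra_simps)
  have xV: "adj x *v V u = x *v V u" for u
  proof -
    have "x *v (x *v u) - adj x *v (adj x *v u) = c *s (x *v u - adj x *v u)"
      by (rule square_relation_polarized[OF sq])
    moreover have "x *v V u - adj x *v V u = (x *v (x *v u) - adj x *v (adj x *v u)) - c *s (x *v u - adj x *v u)"
      by (simp add: V_def D_def vec.add vec.diff vec.scale vec_eq_iff algebra_simps)
    ultimately show ?thesis by simp
  qed
  have xxV: "x *v (x *v V u) = V u" for u using xV[of u] Sp_adj_vec(2)[OF x, of "V u"] by simp
  have kV: "om k (V u) = 0" if "D k = c *s k" for k u using VV[of k u] that by (simp add: V_def om_simps)
  have DV: "D (V u) = 2 *s (x *v V u)" for u unfolding D_def xV by (simp add: vec_eq_iff)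
  have DDV: "D (D (V u)) = 4 *s V u" for u unfolding DV Dl Dx vec.scale xxV by (simp add: vec_eq_iff)
  have VD: "V (D u) = D (V u)" for u by (simp add: V_def Dl)
  have eig: "om a k = 0" if "D a = l *s a" "D k = c *s k" "l \<noteq> c" for a k l
  proof -
    have "l * om a k = c * om a k" using DD[of a k] that by (simp add: om_simps)
    then show ?thesis using that(3) by simp
  qed
  have eI: "adj x *v a = \<epsilon> *s a" "D a = (2 * \<epsilon>) *s a" if "x *v a = \<epsilon> *s a" "\<epsilon> = 1 \<or> \<epsilon> = - 1" for a \<epsilon>
  proof -
    have "a = \<epsilon> *s (adj x *v a)" using arg_cong[OF that(1), of "\<lambda>v. adj x *v v"] by (simp add: vec.scale)
    then have "\<epsilon> *s a = \<epsilon> *s (\<epsilon> *s (adj x *v a))" by (rule arg_cong)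
    then have "\<epsilon> *s a = (\<epsilon> * \<epsilon>) *s (adj x *v a)" unfolding vector_smult_assoc .
    then show "adj x *v a = \<epsilon> *s a" using that(2) by auto
    then show "D a = (2 * \<epsilon>) *s a" by (simp add: D_def that(1) vec_eq_iff)
  qed
  \<comment> \<open>a vector of the eigenspace of \<open>D\<close> for \<open>c\<close> that is not isotropic for \<open>om f (x f)\<close>\<close>
  define t where "t = V (ev 1)"
  define \<tau> where "\<tau> = c\<^sup>2 - 4"
  have cs: "2 - c \<noteq> 0" "2 + c \<noteq> 0" "c - 2 \<noteq> 0" "c + 2 \<noteq> 0" 
    using c unfolding eq_neg_iff_add_eq_0 by (simp_all add: add.commute)
  have cs': "- c \<noteq> 2" "2 \<noteq> - c" using c by (simp_all add: minus_equation_iff[of c] equation_minus_iff[of 2])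
  have \<tau>: "\<tau> \<noteq> 0"
  proof
    assume "\<tau> = 0"
    then have "(c - 2) * (c + 2) = 0" by (simp add: \<tau>_def power2_eq_square algebra_simps)
    then show False using c by (simp add: add_eq_0_iff2)
  qed
  define h where "h = (1 / \<tau>) *s (D (ev 1) + c *s ev 1)"
  define k where "k = ev 1 + V h"
  have Vh: "V h = (1 / \<tau>) *s (D t + c *s t)" unfolding h_def Vl VD t_def ..
  have "V (V h) = (1 / \<tau>) *s (D (D t) - (c * c) *s t)"
    unfolding Vh by (simp add: V_def Dl vec_eq_iff algebra_simps)
  also have "\<dots> = - t"
  proof -
    have "(1 / \<tau>) *s (4 *s t - (c * c) *s t) = (- (\<tau> / \<tau>)) *s t"
      by (simp add: \<tau>_def power2_eq_square vec_eq_iff field_simps)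
    then show ?thesis using \<tau> unfolding t_def DDV by (simp add: vec_eq_iff)
  qed
  finally have "V k = 0" unfolding k_def Vl t_def by simp
  then have Dk: "D k = c *s k" by (simp add: V_def)
  have Dxk: "D (x *v k) = c *s (x *v k)" unfolding Dx Dk vec.scale ..
  define B where "B = om k (x *v k)"
  have Bk: "om (x *v k) k = - B" unfolding B_def by (rule om_skew)
  have B: "B \<noteq> 0"
  proof -
    have "om k (x *v V h) = 0" unfolding Vx[symmetric] by (rule kV[OF Dk])
    moreover have "om (V h) (x *v k) = 0" unfolding VV using Dxk by (simp add: V_def om_simps)
    moreover have "om (V h) (x *v V h) = 0"
    proof -
      have "om (V h) (x *v V h) = om (x *v V h) (V h)" unfolding oX xV ..
      then show ?thesis using om_skew[of "V h" "x *v V h"] by simp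
    qed
    moreover have "ev 1 = k - V h" by (simp add: k_def)
    ultimately have "om (ev 1) (x *v ev 1) = B"
      by (simp only: vec.diff om_simps B_def) simp
    then show ?thesis using e1 by simp
  qed
  have Ik: "adj x *v k = c *s k - x *v k" using Dk by (simp add: D_def algebra_simps)
  have xxk: "x *v (x *v k) = c *s (x *v k) - k"
  proof -
    have "k = c *s (x *v k) - x *v (x *v k)"
      using arg_cong[OF Ik, of "\<lambda>v. x *v v"] by (simp add: vec.diff vec.scale)
    then have "c *s (x *v k) - k = c *s (x *v k) - (c *s (x *v k) - x *v (x *v k))" by (rule arg_cong)
    then show ?thesis by simp
  qed
  have c': "c' = 2 - c * \<epsilon>" if a: "x *v a = \<epsilon> *s a" "a \<noteq> 0" and \<epsilon>: "\<epsilon> = 1 \<or> \<epsilon> = - 1" for a \<epsilon>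
  proof -
    have ne: "2 * \<epsilon> \<noteq> c" and ee: "\<epsilon> * \<epsilon> = 1" using \<epsilon> c by auto
    obtain j where "om a (axis (flip j) 1) \<noteq> 0" using om_nondegenerate[OF a(2)] by metis
    then obtain g where g: "om a g \<noteq> 0" by blast
    define a1 where "a1 = x *v V g + \<epsilon> *s V g"
    have xa1: "x *v a1 = \<epsilon> *s a1"
      unfolding a1_def vec.add vec.scale xxV by (simp add: vec_eq_iff algebra_simps mult.assoc[symmetric] ee)
    have Va: "V a = (2 * \<epsilon> - c) *s a" unfolding V_def eI(2)[OF a(1) \<epsilon>] by (simp add: vec_eq_iff algebra_simps)
    have "om a (V g) = (2 * \<epsilon> - c) * om a g" using VV[of a g] unfolding Va om_scale_left by (rule sym)
    moreover have "om a a1 = 2 * \<epsilon> * om a (V g)"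
      unfolding a1_def by (simp add: om_simps oI[symmetric] eI(1)[OF a(1) \<epsilon>])
    ultimately have aa1: "om a a1 \<noteq> 0" using g ne ee by auto
    define a' where "a' = (1 / om a a1) *s a1"
    have xa': "x *v a' = \<epsilon> *s a'" unfolding a'_def vec.scale xa1 by (simp add: vec_eq_iff)
    have aa': "om a a' = 1" using aa1 by (simp add: a'_def om_simps)
    have a'a: "om a' a = - 1" using aa' om_skew[of a' a] by simp
    have Da: "D a = (2 * \<epsilon>) *s a" "D a' = (2 * \<epsilon>) *s a'" using eI(2) a(1) xa' \<epsilon> by blast+
    have o: "om a k = 0" "om a (x *v k) = 0" "om a' k = 0" "om a' (x *v k) = 0"
      using eig[OF Da(1) Dk ne] eig[OF Da(1) Dxk ne] eig[OF Da(2) Dk ne] eig[OF Da(2) Dxk ne] by auto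
    then have o': "om k a = 0" "om (x *v k) a = 0" "om k a' = 0" "om (x *v k) a' = 0"
      using om_skew[of k] om_skew[of "x *v k"] by simp_all
    define s where "s = - 1 / B"
    have sB: "s * B = - 1" using B by (simp add: s_def)
    define f where "f = a + k"
    define g where "g = a' + s *s (x *v k)"
    have xf: "x *v f = \<epsilon> *s a + x *v k" unfolding f_def vec.add a(1) ..
    have xg: "x *v g = \<epsilon> *s a' + s *s (c *s (x *v k) - k)" unfolding g_def vec.add vec.scale xa' xxk ..
    have Dg: "D g = (2 * \<epsilon>) *s a' + (s * c) *s (x *v k)" unfolding g_def Dl Da Dxk by (simp add: vec_eq_iff)
    note simps = om_simps o o' aa' a'a B_def[symmetric] Bk
    have fg: "om f g = 0" unfolding f_def g_def using sB by (simp add: simps)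
    have 1: "om f (x *v g) + om f (adj x *v g) = 2 * \<epsilon> + c * (s * B)"
      unfolding om_add_right[symmetric] D_def[symmetric] Dg[unfolded D_def] unfolding f_def by (simp add: simps)
    have 2: "om f (x *v f) = B" "om g (x *v g) = s * (s * B)" "om f (x *v g) = \<epsilon> + c * (s * B)"
      "om g (x *v f) = - \<epsilon>"
      unfolding xf xg unfolding f_def g_def by (simp_all add: simps)
    have "B * (s * (s * B)) = (s * B) * (s * B)" by (simp only: mult_ac)
    then have BB: "B * (s * (s * B)) = 1" unfolding sB by simp
    have "(2 * \<epsilon> + c * (s * B))\<^sup>2 = c' * (B * (s * (s * B)) - (\<epsilon> + c * (s * B)) * - \<epsilon>)"
      using pl[OF fg] unfolding 1 unfolding 2 .
    then have "(2 * \<epsilon> - c)\<^sup>2 = c' * (2 - c * \<epsilon>)"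
      unfolding BB unfolding sB by (simp add: ee algebra_simps)
    moreover have "(2 * \<epsilon> - c)\<^sup>2 = (2 - c * \<epsilon>) * (2 - c * \<epsilon>)"
      using \<epsilon> by (auto simp: power2_eq_square algebra_simps)
    moreover have "2 - c * \<epsilon> \<noteq> 0" using \<epsilon> c cs cs' by auto
    ultimately show ?thesis by simp
  qed
  have eigV: "x *v (x *v V u + \<epsilon> *s V u) = \<epsilon> *s (x *v V u + \<epsilon> *s V u)" if "\<epsilon> = 1 \<or> \<epsilon> = - 1" for u \<epsilon>
    unfolding vec.add vec.scale xxV using that by (auto simp: vec_eq_iff)
  have "\<exists>\<epsilon> a. (\<epsilon> = 1 \<or> \<epsilon> = - 1) \<and> x *v a = \<epsilon> *s a \<and> a \<noteq> 0"
  proof (rule ccontr)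
    assume "\<not> (\<exists>\<epsilon> a. (\<epsilon> = 1 \<or> \<epsilon> = - 1) \<and> x *v a = \<epsilon> *s a \<and> a \<noteq> 0)"
    then have "x *v V w + 1 *s V w = 0" "x *v V w + (- 1) *s V w = 0" using eigV by blast+
    then have "V w = 0" by (simp add: vec_eq_iff)
    then show False using w by (simp add: V_def)
  qed
  then obtain \<epsilon> a where \<epsilon>: "\<epsilon> = 1 \<or> \<epsilon> = - 1" and a: "x *v a = \<epsilon> *s a" "a \<noteq> 0" by blast
  have c'\<epsilon>: "c' = 2 - c * \<epsilon>" by (rule c'[OF a \<epsilon>])
  have c'0: "c' \<noteq> 0" and ne: "c - 2 * \<epsilon> \<noteq> 0" and ee: "\<epsilon> * \<epsilon> = 1"
    unfolding c'\<epsilon> using \<epsilon> c cs cs' by auto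
  \<comment> \<open>only one of the eigenvalues \<open>2\<close> and \<open>- 2\<close> of \<open>D\<close> occurs\<close>
  have xVe: "x *v V u = \<epsilon> *s V u" for u
  proof -
    define b where "b = x *v V u + (- \<epsilon>) *s V u"
    have e': "- \<epsilon> = 1 \<or> - \<epsilon> = - 1" using \<epsilon> by auto
    have xb: "x *v b = (- \<epsilon>) *s b" unfolding b_def by (rule eigV[OF e'])
    have "b = 0"
    proof (rule ccontr)
      assume "b \<noteq> 0"
      then have "2 - c * - \<epsilon> = 2 - c * \<epsilon>" using c'[OF xb _ e'] c'\<epsilon> by simp
      then show False using c \<epsilon> by auto
    qed
    then show ?thesis by (simp add: b_def vec_eq_iff)
  qed
  have DVe: "D (V u) = (2 * \<epsilon>) *s V u" for u unfolding DV xVe by (simp add: vec_eq_iff)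
  define pr where "pr = (\<lambda>g. (1 / (c - 2 * \<epsilon>)) *s (D g - (2 * \<epsilon>) *s g))"
  have Dpr: "D (pr g) = c *s pr g" for g
  proof -
    have "V (D g - (2 * \<epsilon>) *s g) = D (V g) - (2 * \<epsilon>) *s V g"
      by (simp add: V_def Dl vec_eq_iff algebra_simps)
    then have "V (pr g) = 0" unfolding pr_def Vl by (simp add: DVe)
    then show ?thesis by (simp add: V_def)
  qed
  obtain r :: cvec where r: "r \<in> Fl 3" "r \<noteq> 0" "om r k = 0" "om r (x *v k) = 0"
  proof -
    have "card {0, 1 :: nat} < card (UNIV :: 3 set)" by simp
    then have "\<exists>z. (\<exists>a\<in>(UNIV :: 3 set). z a \<noteq> 0) \<and>
      (\<forall>e\<in>{0, 1 :: nat}. (\<Sum>a\<in>UNIV. om (ev a) (if e = 0 then k else x *v k) * z a) = 0)"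
      by (intro homogeneous_system) auto
    then obtain z :: "3 \<Rightarrow> complex" where z: "\<exists>a. z a \<noteq> 0"
      "(\<Sum>a\<in>UNIV. om (ev a) k * z a) = 0" "(\<Sum>a\<in>UNIV. om (ev a) (x *v k) * z a) = 0" by auto
    define r :: cvec where "r = (\<Sum>a\<in>UNIV. z a *s ev a)"
    have rn: "r $ Inl b = z b" "r $ Inr b = 0" for b
      unfolding r_def by (simp_all add: sum_component axis_nth' if_distrib[of "\<lambda>x. _ * x"] cong: if_cong)
    show ?thesis
    proof (rule that[of r])
      have "r $ j = 0" if "3 < lv j" for j using that lv_le_3[of j] rn(2) by (cases j) auto
      then show "r \<in> Fl 3" by (simp add: Fl_def)
      show "r \<noteq> 0" using z(1) rn(1) by auto
      show "om r k = 0" "om r (x *v k) = 0"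
        using z(2,3) unfolding r_def om_sum_left om_scale_left by (simp_all add: mult.commute)
    qed
  qed
  define r' where "r' = pr r"
  have Dr': "D r' = c *s r'" unfolding r'_def by (rule Dpr)
  have r'0: "r' \<noteq> 0"
  proof
    assume "r' = 0"
    then have "D r = (2 * \<epsilon>) *s r" using ne by (simp add: r'_def pr_def vec_eq_iff)
    then have Vr: "V r = (2 * \<epsilon> - c) *s r" by (simp add: V_def vec_eq_iff algebra_simps)
    have "2 * \<epsilon> - c \<noteq> 0" using ne by auto
    then have "V ((1 / (2 * \<epsilon> - c)) *s r) = r" unfolding Vl Vr vector_smult_assoc by (simp add: vec_eq_iff)
    then have "x *v r = \<epsilon> *s r" using xVe by metis
    moreover obtain g where "g \<in> Fl 3" "om g (x *v r) \<noteq> 0" using nd[OF r(1,2)] by blast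
    moreover from this have "om g r = 0" using r(1) by (intro om_Fl[of _ 3 _ 3]) auto
    ultimately show False by (simp add: om_simps)
  qed
  have r'k: "om r' k = 0" "om r' (x *v k) = 0"
    using r(3,4) by (simp_all add: r'_def pr_def om_simps DD Dk Dxk)
  define P where "P = {f. D f = c *s f \<and> om k f = 0 \<and> om (x *v k) f = 0}"
  have r'P: "r' \<in> P" using Dr' r'k om_skew[of k r'] om_skew[of "x *v k" r'] by (simp add: P_def)
  have "\<exists>f\<in>P. om f (x *v f) \<noteq> 0"
  proof (rule ccontr)
    assume "\<not> (\<exists>f\<in>P. om f (x *v f) \<noteq> 0)"
    then have null: "om f (x *v f) = 0" if "f \<in> P" for f using that by blast
    have Padd: "f + g \<in> P" "f - g \<in> P" if "f \<in> P" "g \<in> P" for f g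
      using that by (simp_all add: P_def Dl om_simps vec_eq_iff algebra_simps)
    have Px: "x *v f \<in> P" if "f \<in> P" for f
    proof -
      have "om k (x *v f) = 0" using that unfolding oI[symmetric] Ik by (simp add: P_def om_simps)
      then show ?thesis using that by (simp add: P_def Dx oXX vec.scale)
    qed
    have PI: "adj x *v f \<in> P" if "f \<in> P" for f
    proof -
      have "om (x *v k) (adj x *v f) = 0" using that unfolding oX[symmetric] xxk by (simp add: P_def om_simps)
      moreover have "om k (adj x *v f) = 0" using that unfolding oX[symmetric] by (simp add: P_def)
      moreover have "D (adj x *v f) = adj x *v D f" by (simp add: D_def vec.add add.commute)
      ultimately show ?thesis using that by (simp add: P_def vec.scale)
    qed
    have anti: "om r' (x *v s - adj x *v s) = 0" if "s \<in> P" for s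
    proof -
      have "om r' (x *v s) + om s (x *v r') = 0"
        using null[OF Padd(1)[OF r'P that]] null[OF r'P] null[OF that] by (simp add: vec.add om_simps add.commute)
      moreover have "om s (x *v r') = - om r' (adj x *v s)" using om_skew[of r' "adj x *v s"] oI[of s r'] by simp
      ultimately show ?thesis by (simp add: om_simps)
    qed
    have orth: "om r' f = 0" if "f \<in> P" for f
    proof -
      define s where "s = x *v f - adj x *v f"
      have s: "s \<in> P" unfolding s_def using Padd(2) Px PI that by blast
      have "x *v s - adj x *v s = D (D f) - 4 *s f"
        by (simp add: s_def D_def vec.add vec.diff vec_eq_iff)
      also have "\<dots> = \<tau> *s f"
      proof -
        have Df: "D f = c *s f" using that by (simp add: P_def)
        show ?thesis unfolding Df Dl by (simp add: \<tau>_def power2_eq_square vec_eq_iff algebra_simps)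
      qed
      finally show ?thesis using anti[OF s] \<tau> by (simp add: om_simps)
    qed
    have "om r' g = 0" for g
    proof -
      define g1 where "g1 = pr g"
      define \<alpha> where "\<alpha> = - (om (x *v k) g1 / B)"
      define \<beta> where "\<beta> = om k g1 / B"
      define g2 where "g2 = g1 - \<alpha> *s k - \<beta> *s (x *v k)"
      have "D g1 = c *s g1" unfolding g1_def by (rule Dpr)
      then have "D g2 = c *s g2" unfolding g2_def Dl Dk Dxk by (simp add: vec_eq_iff algebra_simps)
      moreover have "om k g2 = 0" using B by (simp add: g2_def om_simps B_def[symmetric] \<beta>_def)
      moreover have "om (x *v k) g2 = 0" using B by (simp add: g2_def om_simps Bk \<alpha>_def)
      ultimately have "om r' g2 = 0" by (intro orth) (simp add: P_def)
      then have "om r' g1 = 0" using r'k by (simp add: g2_def om_simps)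
      then have "om r' (D g) - 2 * \<epsilon> * om r' g = 0" using ne by (simp add: g1_def pr_def om_simps)
      moreover have "om r' (D g) = c * om r' g" unfolding DD[symmetric] Dr' by (simp add: om_simps)
      ultimately have "(c - 2 * \<epsilon>) * om r' g = 0" by (simp add: algebra_simps)
      then show ?thesis using ne by simp
    qed
    then show False using om_eq_zero r'0 by blast
  qed
  then obtain f where f: "D f = c *s f" "om k f = 0" "om (x *v k) f = 0" "om f (x *v f) \<noteq> 0"
    unfolding P_def by blast
  have "om k (x *v f) + om k (adj x *v f) = 0"
    unfolding om_add_right[symmetric] f(1)[unfolded D_def] by (simp add: om_simps f(2))
  moreover have "om k (x *v f) = 0" unfolding oI[symmetric] Ik by (simp add: om_simps f)
  ultimately have "c' * (B * om f (x *v f)) = 0" using pl[OF f(2)] by (simp add: B_def)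
  then show False using c'0 B f(4) by simp
qed

lemma VV_relations:
  assumes A: "enc A \<in> VV"
  shows "(\<exists>c. \<forall>w. A *v w + adj A *v w = c *s w) \<or>
    (\<exists>c\<in>{0, 2, - 2}. \<forall>w. A *v (A *v w) - adj A *v (adj A *v w) = c *s (A *v w - adj A *v w))"
proof -
  obtain c where c: "\<forall>x\<in>cls A. \<forall>f. om f (x *v (x *v f)) = c * om f (x *v f)"
    using square_relation[OF A] by (elim exE)
  obtain c' where c': "\<forall>x\<in>cls A. \<forall>f g. om f g = 0 \<longrightarrow> (om f (x *v g) + om f (adj x *v g))\<^sup>2
    = c' * (om f (x *v f) * om g (x *v g) - om f (x *v g) * om g (x *v f))"
    using plane_relation[OF A] by (elim exE)
  show ?thesis
  proof (cases "c \<in> {0, 2, - 2}")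
    case True
    have "A *v (A *v w) - adj A *v (adj A *v w) = c *s (A *v w - adj A *v w)" for w
      using c cls_self[of A] by (intro square_relation_polarized) simp
    then show ?thesis using True by blast
  next
    case False
    obtain d where d: "d \<in> Bm" "w0 ** d \<in> cls A" using VV_cell_rep[OF A] by blast
    define x where "x = w0 ** d"
    have x: "x \<in> cls A" "x \<in> Sp"
      using d mult_Sp[OF w0_Sp Bm_Sp[OF d(1)]] by (simp_all add: x_def)
    have e1: "om (ev 1) (x *v ev 1) \<noteq> 0" unfolding x_def w0_upper[OF d(1)] using Bm_diag_nz[OF d(1)] by simp
    have tr: "x *v w + adj x *v w = c *s w" for w
    proof (rule scalar_trace[OF x(2)])
      show "om f (x *v (x *v f)) = c * om f (x *v f)" for f using c x(1) by blast
      show "(om f (x *v g) + om f (adj x *v g))\<^sup>2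
        = c' * (om f (x *v f) * om g (x *v g) - om f (x *v g) * om g (x *v f))" if "om f g = 0" for f g
        using c' x(1) that by blast
      show "\<exists>g\<in>Fl 3. om g (x *v r) \<noteq> 0" if "r \<in> Fl 3" "r \<noteq> 0" for r
        unfolding x_def by (rule Fl3_nondegenerate[OF d(1) that])
    qed (use e1 False in auto)
    have "A \<in> cls x" using cls_eq[OF x(1)] cls_self[of A] by simp
    then obtain g where g: "g \<in> Sp" "A = g ** x ** adj g" unfolding cls_def by blast
    have "A *v w + adj A *v w = c *s w" for w
    proof -
      have "A *v w + adj A *v w = g *v (x *v (adj g *v w) + adj x *v (adj g *v w))"
        by (simp add: g(2) adj_product matrix_vector_mul_assoc[symmetric] vec.add)
      also have "\<dots> = c *s w" unfolding tr vec.scale using g(1) by simp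
      finally show ?thesis .
    qed
    then show ?thesis by blast
  qed
qed

text \<open>A polynomial vanishing on the stratum and not at \<open>y2\<close>.\<close>

lemma y2_separated: "\<exists>F\<in>pf (coords 36). (\<forall>A. enc A \<in> VV \<longrightarrow> F (enc A) = 0) \<and> F (enc y2) \<noteq> 0"
proof -
  define tr where "tr = (\<lambda>A i. om (fv i) (A *v ev i) + om (fv i) (adj A *v ev i))"
  define sq where "sq = (\<lambda>c A. om (fv 1) (A *v (A *v ev 1)) - om (fv 1) (adj A *v (adj A *v ev 1))
    - c * (om (fv 1) (A *v ev 1) - om (fv 1) (adj A *v ev 1)))"
  define H where "H = (\<lambda>A. (tr A 1 - tr A 2) * (sq 0 A * (sq 2 A * sq (- 2) A)))"
  have "(\<lambda>p. H (dec p)) \<in> pf (coords 36)"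
    unfolding H_def tr_def sq_def by (intro pf_mult pf_diff pf_add pf_const mp_intros)
  moreover have "H A = 0" if "enc A \<in> VV" for A
    using VV_relations[OF that]
  proof (elim disjE exE bexE)
    fix c assume "\<forall>w. A *v w + adj A *v w = c *s w"
    then have "tr A i = - c" for i
      unfolding tr_def om_add_right[symmetric] by (simp add: om_simps om_basis)
    then show ?thesis by (simp add: H_def)
  next
    fix c assume c: "c \<in> {0, 2, - 2 :: complex}"
      and "\<forall>w. A *v (A *v w) - adj A *v (adj A *v w) = c *s (A *v w - adj A *v w)"
    then have "om (fv 1) (A *v (A *v ev 1) - adj A *v (adj A *v ev 1)) = om (fv 1) (c *s (A *v ev 1 - adj A *v ev 1))"
      by simp
    then have "sq c A = 0" by (simp add: sq_def om_simps right_diff_distrib)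
    then show ?thesis using c by (auto simp: H_def)
  qed
  moreover have "H y2 \<noteq> 0"
  proof -
    have y: "y2 *v ev 1 = (1 / 2) *s ev 1" "y2 *v ev 2 = ev 2"
      by (simp_all add: y2_def Hm_vec om_basis vec_eq_iff)
    have "adj y2 *v (y2 *v v) = v" for v using y2_Sp by simp
    from this[of "ev 1"] this[of "ev 2"] have a: "adj y2 *v ev 1 = 2 *s ev 1" "adj y2 *v ev 2 = ev 2"
      unfolding y vec.scale by (simp_all add: vec_eq_iff field_simps)
    show ?thesis by (simp add: H_def tr_def sq_def y a vec.scale om_simps om_basis)
  qed
  ultimately show ?thesis by (intro bexI[of _ "\<lambda>p. H (dec p)"]) simp_all
qed

theorem mainTheorem8:
  shows "\<exists>(K :: complex ring) (N :: nat) (G :: (nat \<Rightarrow> complex) monoid) (V :: (nat \<Rightarrow> complex) set).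
           algebraically_closed K \<and>
           connected_reductive K N G \<and>
           zero_or_good_char K N G \<and>
           V \<in> strata K N G \<and>
           (\<forall>C\<in>conj_classes G. C \<subseteq> V \<longrightarrow> spherical_class K N G C) \<and>
           \<not> (\<exists>\<S>\<subseteq>strata K N G. zariski K N closure_of V = \<Union>\<S>)"
proof -
  have enc: "\<exists>A\<in>Sp. v = enc A" if "v \<in> VV" for v
    using that unfolding VV_def stratum_of_def Let_def conj_classes_G cls_def by (auto simp: mult_Sp adj_Sp)
  have "VV \<subseteq> \<A> 36"
  proof
    fix v assume "v \<in> VV"
    from enc[OF this] show "v \<in> \<A> 36" using enc_affine by blast
  qed
  note closure = closure_zar[OF this]
  have "\<not> (\<exists>\<S>\<subseteq>strata CC 36 G. zar 36 closure_of VV = \<Union>\<S>)"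
  proof
    assume "\<exists>\<S>\<subseteq>strata CC 36 G. zar 36 closure_of VV = \<Union>\<S>"
    then obtain \<S> where S: "\<S> \<subseteq> strata CC 36 G" "zar 36 closure_of VV = \<Union>\<S>" by (elim exE conjE)
    have "enc yu \<in> zar 36 closure_of VV" unfolding closure using yu_closure by simp
    then have "enc yu \<in> \<Union>\<S>" unfolding S(2) .
    then obtain Y where Y: "enc yu \<in> Y" "Y \<in> \<S>" by (rule UnionE)
    have "enc y2 \<in> Y" by (rule strata_yu_y2[OF subsetD[OF S(1) Y(2)] Y(1)])
    with Y(2) have "enc y2 \<in> \<Union>\<S>" by (rule UnionI)
    then have "enc y2 \<in> zar 36 closure_of VV" unfolding S(2) .
    then have y2: "\<forall>f\<in>pf (coords 36). (\<forall>s\<in>VV. f s = 0) \<longrightarrow> f (enc y2) = 0"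
      unfolding closure by simp
    obtain F where F: "F \<in> pf (coords 36)" "\<forall>A. enc A \<in> VV \<longrightarrow> F (enc A) = 0" "F (enc y2) \<noteq> 0"
      using y2_separated by blast
    have "\<forall>s\<in>VV. F s = 0" using F(2) enc by blast
    then show False using bspec[OF y2 F(1)] F(3) by simp
  qed
  then have "algebraically_closed CC \<and> connected_reductive CC 36 G \<and> zero_or_good_char CC 36 G \<and>
      VV \<in> strata CC 36 G \<and> (\<forall>C\<in>conj_classes G. C \<subseteq> VV \<longrightarrow> spherical_class CC 36 G C) \<and>
      \<not> (\<exists>\<S>\<subseteq>strata CC 36 G. zar 36 closure_of VV = \<Union>\<S>)"
    by (intro conjI ballI impI algebraically_closed_CC connected_reductive_G zero_or_good_char_G VV_stratum VV_spherical)
  then show ?thesis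
    by (rule_tac exI[of _ CC], rule_tac exI[of _ 36], rule_tac exI[of _ G], rule_tac exI[of _ VV])
qed

end
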